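(* Let $D_0,D_1\in\mathcal{P}(r_0,M_1,\theta_0,M_0)$ with $d_H:=d_H(\partial D_0,\partial D_1)\le\delta_0r_0$, so that (see the context) $D_0$ and $D_1$ have the same number $N$ of vertices $\{V_i^{D_0}\}_{i=1}^N$, $\{V_i^{D_1}\}_{i=1}^N$, ordered correspondingly. There is a constant $C>0$, depending only on $M_0,M_1,\theta_0$, such that if in addition $d_H\le Cr_0$ then there exists a vector field $\mathcal{U}\in W^{1,\infty}(\mathbb{R}^3,\mathbb{R}^3)$ satisfying: (a) $\mathcal{U}(V_i^{D_0})=V_i^{D_1}-V_i^{D_0}$ for every $i=1,\dots,N$; (b) $\mathrm{supp}(\mathcal{U})\subset\overline{\mathcal{W}}$; (c) $\mathcal{U}$ is affine on each $T\in\mathcal{T}_0$; (d) $\|\mathcal{U}\|_\infty+r_0\|D\mathcal{U}\|_\infty\le\widetilde C\,d_H$, where $D\mathcal{U}$ is the Jacobian matrix of $\mathcal{U}$ and $\widetilde C$ is a constant depending only on $\theta_0$ and $M_1$.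
   Context: Constants $r_0>0$, $M_0\ge1$, $M_1>1$, $\theta_0\in(0,\pi/2)$ are given, and $\Omega\subset\mathbb{R}^3$ is a bounded domain with $\mathrm{diam}(\Omega)\le M_1r_0$. Lipschitz regularity: a portion $S$ of the boundary of a bounded domain $U\subset\mathbb{R}^3$ is of Lipschitz class with constants $r_0,M_0$ if for every $P\in S$ there is a rigid change of coordinates in which $P=0$ and $U\cap R=\{x\in R: x_3>g(x_1,x_2)\}$, where $R=[-r_0,r_0]^2\times[-2M_0r_0,2M_0r_0]$, $g(0)=0$, $\|g\|_{L^\infty}+r_0\,\mathrm{Lip}(g)\le M_0r_0$ (analogously in the plane). A polyhedron is a closed set $D\subset\mathbb{R}^3$ homeomorphic to a closed ball with $\partial D$ a finite union of faces (closed simply connected plane polygonal regions) with pairwise disjoint relative interiors; edges are nondegenerate segments that are intersections of two faces, vertices are nonempty intersections of two edges. The class $\mathcal{P}(r_0,M_1,\theta_0,M_0)$ consists of polyhedra $D\subset\Omega$ such that: $\mathrm{dist}(D,\partial\Omega)\ge r_0$; every dihedral angle at an edge and every internal angle of a face lies in $(\theta_0,\pi-\theta_0)\cup(\pi+\theta_0,2\pi-\theta_0)$; every edge has length $\ge r_0$; $\Omega\setminus D$ has Lipschitz boundary with constants $r_0,M_0$, and each face has Lipschitz boundary with constants $r_0,M_0$ in its plane. $d_H$ is the Hausdorff distance. Known fact fixing $\delta_0$: there are $\delta_0\in(0,1)$, $C_4>1$ depending only on $M_0,M_1,\theta_0$ such that $d_H(\partial D_0,\partial D_1)\le\delta_0r_0$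 implies that $D_0,D_1$ have the same number $N$ of vertices, which can be ordered so that $C_4^{-1}d_H\le|V_i^{D_0}-V_i^{D_1}|\le C_4d_H$, and to each edge or face of $D_0$ corresponds an edge or face of $D_1$ with corresponding vertices. $\mathcal{W}\subset\Omega$ is the tubular neighborhood of $D_0$ of width $r_0/4$, i.e. $\mathcal{W}=\{x:\mathrm{dist}(x,D_0)<r_0/4\}$. Let $\gamma=\min\{\theta_0/3,\ \pi/2-\arctan M_0\}$, $h_0=\frac{r_0}{2}\tan\gamma$. For a face $F$ of $D_0$ and an edge $\sigma$ of $F$ with midpoint $M$, let $n$ be the unit outer normal to $F$ at $M$ in the plane of $F$, $E=M-h_0n$, and $T$ the isosceles triangle with base $\sigma$ and third vertex $E$. $\mathcal{T}_0$ is the family of all such triangles over all faces $F$ and edges $\sigma$ of $F$. *)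

theory Defs
  imports "HOL-Analysis.Analysis" "HOL-Probability.Essential_Supremum"
begin

subsection \<open>Lipschitz boundaries\<close>

definition lip_const :: "'a::metric_space set \<Rightarrow> ('a \<Rightarrow> 'b::metric_space) \<Rightarrow> real" where
  "lip_const B g = Inf {L. L-lipschitz_on B g}"

text \<open>The second conjunct is needed separately: \<^const>\<open>Inf\<close> of the empty set is unspecified.\<close>

definition lipschitz_profile ::
    "real \<Rightarrow> real \<Rightarrow> 'a::real_normed_vector set \<Rightarrow> ('a \<Rightarrow> real) \<Rightarrow> bool" where
  "lipschitz_profile r0 M0 B g \<longleftrightarrow>
     g 0 = 0 \<and> (\<exists>L. L-lipschitz_on B g) \<and>
     (SUP x\<in>B. \<bar>g x\<bar>) + r0 * lip_const B g \<le> M0 * r0"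

text \<open>\<open>y \<mapsto> P + Q y\<close> is the rigid change of coordinates; \<open>y\<close> ranges over the cylinder \<open>R\<close>.\<close>

definition lipschitz_boundary3 :: "real \<Rightarrow> real \<Rightarrow> (real^3) set \<Rightarrow> bool" where
  "lipschitz_boundary3 r0 M0 U \<longleftrightarrow>
     (\<forall>P\<in>frontier U. \<exists>(Q :: real^3 \<Rightarrow> real^3) (g :: real^2 \<Rightarrow> real).
        orthogonal_transformation Q \<and>
        lipschitz_profile r0 M0 {z. \<bar>z$1\<bar> \<le> r0 \<and> \<bar>z$2\<bar> \<le> r0} g \<and>
        (\<forall>y. \<bar>y$1\<bar> \<le> r0 \<and> \<bar>y$2\<bar> \<le> r0 \<and> \<bar>y$3\<bar> \<le> 2 * M0 * r0 \<longrightarrow>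
             (P + Q y \<in> U \<longleftrightarrow> y$3 > g (vector [y$1, y$2]))))"

definition lipschitz_boundary2 :: "real \<Rightarrow> real \<Rightarrow> (real^2) set \<Rightarrow> bool" where
  "lipschitz_boundary2 r0 M0 U \<longleftrightarrow>
     (\<forall>P\<in>frontier U. \<exists>(Q :: real^2 \<Rightarrow> real^2) (g :: real \<Rightarrow> real).
        orthogonal_transformation Q \<and>
        lipschitz_profile r0 M0 {-r0..r0} g \<and>
        (\<forall>y. \<bar>y$1\<bar> \<le> r0 \<and> \<bar>y$2\<bar> \<le> 2 * M0 * r0 \<longrightarrow>
             (P + Q y \<in> U \<longleftrightarrow> y$2 > g (y$1))))"

text \<open>A face is a subset of a plane in space; its relative interior is transported to
  \<open>\<real>\<^sup>2\<close> by an isometric parametrization \<open>y \<mapsto> p + L y\<close> of that plane.\<close>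

definition face_lipschitz :: "real \<Rightarrow> real \<Rightarrow> (real^3) set \<Rightarrow> bool" where
  "face_lipschitz r0 M0 F \<longleftrightarrow>
     (\<exists>p (L :: real^2 \<Rightarrow> real^3). linear L \<and> (\<forall>y. norm (L y) = norm y) \<and>
        range (\<lambda>y. p + L y) = affine hull F \<and>
        lipschitz_boundary2 r0 M0 {y. p + L y \<in> rel_interior F})"

subsection \<open>Polyhedra\<close>

definition plane_polygonal_region :: "(real^3) set \<Rightarrow> bool" where
  "plane_polygonal_region F \<longleftrightarrow>
     aff_dim F = 2 \<and>
     (\<exists>\<P>. finite \<P> \<and> F = \<Union>\<P> \<and> (\<forall>P\<in>\<P>. polytope P \<and> aff_dim P = 2)) \<and>
     connected (rel_interior F)"

text \<open>A polyhedron is given together with its family of faces \<open>\<F>\<close>, since its edges and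
  vertices are determined by the faces. It need not be convex, so this is unrelated to the
  library constant \<^const>\<open>polyhedron\<close>.\<close>

definition is_polyhedron :: "(real^3) set \<Rightarrow> (real^3) set set \<Rightarrow> bool" where
  "is_polyhedron D \<F> \<longleftrightarrow>
     closed D \<and> D homeomorphic (cball 0 1 :: (real^3) set) \<and>
     finite \<F> \<and> frontier D = \<Union>\<F> \<and>
     (\<forall>F\<in>\<F>. plane_polygonal_region F \<and> simply_connected F) \<and>
     pairwise (\<lambda>F G. rel_interior F \<inter> rel_interior G = {}) \<F>"

definition nondegenerate_segment :: "'a::real_vector set \<Rightarrow> bool" where
  "nondegenerate_segment \<sigma> \<longleftrightarrow> (\<exists>a b. a \<noteq> b \<and> \<sigma> = closed_segment a b)"

text \<open>Two faces of a nonconvex polyhedron may meet in several segments (an edge of a cube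
  interrupted by a notch), each of which is an edge. Hence edges are the maximal
  nondegenerate segments of an intersection of two faces; if the intersection is a
  segment, that segment is the only one.\<close>

definition face_edges :: "(real^3) set set \<Rightarrow> (real^3) set \<Rightarrow> (real^3) set set" where
  "face_edges \<F> F = {\<sigma>. \<exists>G\<in>\<F>. G \<noteq> F \<and> nondegenerate_segment \<sigma> \<and> \<sigma> \<subseteq> F \<inter> G \<and>
     (\<forall>\<tau>. nondegenerate_segment \<tau> \<and> \<sigma> \<subseteq> \<tau> \<and> \<tau> \<subseteq> F \<inter> G \<longrightarrow> \<tau> = \<sigma>)}"

definition edges :: "(real^3) set set \<Rightarrow> (real^3) set set" where
  "edges \<F> = (\<Union>F\<in>\<F>. face_edges \<F> F)"

definition vertices :: "(real^3) set set \<Rightarrow> (real^3) set" where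
  "vertices \<F> = {v. \<exists>\<sigma>\<in>edges \<F>. \<exists>\<tau>\<in>edges \<F>. \<sigma> \<noteq> \<tau> \<and> \<sigma> \<inter> \<tau> = {v}}"

definition orthonormal_pair :: "'a::real_inner \<Rightarrow> 'a \<Rightarrow> bool" where
  "orthonormal_pair u w \<longleftrightarrow> norm u = 1 \<and> norm w = 1 \<and> u \<bullet> w = 0"

text \<open>Angles are read off from the germ of the set, so that reflex angles are covered:
  near \<open>v\<close> the face is a plane sector of opening \<open>\<alpha>\<close>, and near each inner point of an edge
  the solid \<open>D\<close> is a wedge of opening \<open>\<alpha>\<close> whose ridge is the line of the edge.\<close>

definition internal_angle :: "(real^3) set \<Rightarrow> real^3 \<Rightarrow> real \<Rightarrow> bool" where
  "internal_angle F v \<alpha> \<longleftrightarrow> 0 < \<alpha> \<and> \<alpha> < 2 * pi \<and>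
     (\<exists>u w. orthonormal_pair u w \<and>
        (\<exists>\<epsilon>>0. F \<inter> ball v \<epsilon> =
           {v + t *\<^sub>R (cos \<phi> *\<^sub>R u + sin \<phi> *\<^sub>R w) |t \<phi>. 0 \<le> t \<and> 0 \<le> \<phi> \<and> \<phi> \<le> \<alpha>} \<inter> ball v \<epsilon>))"

definition dihedral_angle :: "(real^3) set \<Rightarrow> (real^3) set \<Rightarrow> real \<Rightarrow> bool" where
  "dihedral_angle D \<sigma> \<alpha> \<longleftrightarrow> 0 < \<alpha> \<and> \<alpha> < 2 * pi \<and>
     (\<exists>a b u w. a \<noteq> b \<and> \<sigma> = closed_segment a b \<and> orthonormal_pair u w \<and>
        u \<bullet> (b - a) = 0 \<and> w \<bullet> (b - a) = 0 \<and>
        (\<forall>p\<in>open_segment a b. \<exists>\<epsilon>>0. D \<inter> ball p \<epsilon> =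
           {p + s *\<^sub>R (b - a) + t *\<^sub>R (cos \<phi> *\<^sub>R u + sin \<phi> *\<^sub>R w) |s t \<phi>.
              0 \<le> t \<and> 0 \<le> \<phi> \<and> \<phi> \<le> \<alpha>} \<inter> ball p \<epsilon>))"

definition admissible_angles :: "real \<Rightarrow> real set" where
  "admissible_angles \<theta>0 = {\<theta>0<..<pi - \<theta>0} \<union> {pi + \<theta>0<..<2 * pi - \<theta>0}"

definition polyhedral_class ::
    "(real^3) set \<Rightarrow> real \<Rightarrow> real \<Rightarrow> real \<Rightarrow> real \<Rightarrow> ((real^3) set \<times> (real^3) set set) set" where
  "polyhedral_class \<Omega> r0 M1 \<theta>0 M0 = {(D, \<F>).
     is_polyhedron D \<F> \<and> D \<subseteq> \<Omega> \<and> setdist D (frontier \<Omega>) \<ge> r0 \<and>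
     (\<forall>\<sigma>\<in>edges \<F>. \<exists>\<alpha>\<in>admissible_angles \<theta>0. dihedral_angle D \<sigma> \<alpha>) \<and>
     (\<forall>F\<in>\<F>. \<forall>v\<in>vertices \<F> \<inter> F. \<exists>\<alpha>\<in>admissible_angles \<theta>0. internal_angle F v \<alpha>) \<and>
     (\<forall>\<sigma>\<in>edges \<F>. diameter \<sigma> \<ge> r0) \<and>
     lipschitz_boundary3 r0 M0 (\<Omega> - D) \<and>
     (\<forall>F\<in>\<F>. face_lipschitz r0 M0 F)}"

text \<open>\<open>M1\<close> enters only through the ambient domain.\<close>

definition ambient_domain :: "real \<Rightarrow> real \<Rightarrow> (real^3) set \<Rightarrow> bool" where
  "ambient_domain r0 M1 \<Omega> \<longleftrightarrow>
     open \<Omega> \<and> connected \<Omega> \<and> \<Omega> \<noteq> {} \<and> bounded \<Omega> \<and> diameter \<Omega> \<le> M1 * r0"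

subsection \<open>Comparison of two polyhedra\<close>

definition hausdorff_dist :: "'a::metric_space set \<Rightarrow> 'a set \<Rightarrow> real" where
  "hausdorff_dist A B = max (SUP x\<in>A. infdist x B) (SUP y\<in>B. infdist y A)"

text \<open>The ordering of the vertices that stability under small Hausdorff distance \<open>dH\<close> provides.
  The lower bound is on the largest vertex displacement: it cannot hold for every
  vertex, since a single vertex may be moved while the others stay fixed.\<close>

definition vertex_correspondence ::
    "real \<Rightarrow> real \<Rightarrow> (real^3) set set \<Rightarrow> (real^3) set set \<Rightarrow>
     nat \<Rightarrow> (nat \<Rightarrow> real^3) \<Rightarrow> (nat \<Rightarrow> real^3) \<Rightarrow> bool" where
  "vertex_correspondence C4 dH \<F>0 \<F>1 N V0 V1 \<longleftrightarrow>
     bij_betw V0 {1..N} (vertices \<F>0) \<and> bij_betw V1 {1..N} (vertices \<F>1) \<and>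
     (\<forall>i\<in>{1..N}. dist (V0 i) (V1 i) \<le> C4 * dH) \<and>
     (\<exists>i\<in>{1..N}. dH / C4 \<le> dist (V0 i) (V1 i)) \<and>
     (\<forall>\<sigma>\<in>edges \<F>0. \<exists>\<tau>\<in>edges \<F>1. \<forall>i\<in>{1..N}. V0 i \<in> \<sigma> \<longleftrightarrow> V1 i \<in> \<tau>) \<and>
     (\<forall>F\<in>\<F>0. \<exists>G\<in>\<F>1. \<forall>i\<in>{1..N}. V0 i \<in> F \<longleftrightarrow> V1 i \<in> G)"

subsection \<open>The tubular neighbourhood and the triangles\<close>

definition tube :: "real \<Rightarrow> (real^3) set \<Rightarrow> (real^3) set" where
  "tube r0 D = {x. infdist x D < r0 / 4}"

definition tri_height :: "real \<Rightarrow> real \<Rightarrow> real \<Rightarrow> real" where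
  "tri_height r0 \<theta>0 M0 = r0 / 2 * tan (min (\<theta>0 / 3) (pi / 2 - arctan M0))"

definition outer_normal :: "(real^3) set \<Rightarrow> real^3 \<Rightarrow> real^3 \<Rightarrow> real^3 \<Rightarrow> bool" where
  "outer_normal F a b n \<longleftrightarrow>
     norm n = 1 \<and> n \<bullet> (b - a) = 0 \<and> midpoint a b + n \<in> affine hull F \<and>
     (\<forall>\<^sub>F t in at_right 0.
        midpoint a b + t *\<^sub>R n \<notin> F \<and> midpoint a b - t *\<^sub>R n \<in> F)"

definition edge_triangles ::
    "real \<Rightarrow> real \<Rightarrow> real \<Rightarrow> (real^3) set set \<Rightarrow> (real^3) set set" where
  "edge_triangles r0 \<theta>0 M0 \<F> =
     {convex hull {a, b, midpoint a b - tri_height r0 \<theta>0 M0 *\<^sub>R n} |a b n.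
        \<exists>F\<in>\<F>. closed_segment a b \<in> face_edges \<F> F \<and> outer_normal F a b n}"

definition affine_map_on :: "'a::real_vector set \<Rightarrow> ('a \<Rightarrow> 'b::real_vector) \<Rightarrow> bool" where
  "affine_map_on T U \<longleftrightarrow> (\<exists>A c. linear A \<and> (\<forall>x\<in>T. U x = A x + c))"

subsection \<open>The Sobolev space of essentially bounded fields\<close>

definition pdiff :: "3 \<Rightarrow> (real^3 \<Rightarrow> real) \<Rightarrow> real^3 \<Rightarrow> real" where
  "pdiff j f x = frechet_derivative f (at x) (axis j 1)"

primrec C_k :: "nat \<Rightarrow> (real^3 \<Rightarrow> real) \<Rightarrow> bool" where
  "C_k 0 f \<longleftrightarrow> continuous_on UNIV f"
| "C_k (Suc k) f \<longleftrightarrow> (\<forall>x. f differentiable (at x)) \<and> (\<forall>j. C_k k (pdiff j f))"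

definition test_function :: "(real^3 \<Rightarrow> real) \<Rightarrow> bool" where
  "test_function f \<longleftrightarrow> (\<forall>k. C_k k f) \<and> compact (closure {x. f x \<noteq> 0})"

definition locally_integrable :: "(real^3 \<Rightarrow> 'a::euclidean_space) \<Rightarrow> bool" where
  "locally_integrable f \<longleftrightarrow>
     f \<in> borel_measurable lebesgue \<and> (\<forall>K. compact K \<longrightarrow> set_integrable lebesgue K f)"

definition weak_jacobian :: "(real^3 \<Rightarrow> real^3) \<Rightarrow> (real^3 \<Rightarrow> real^3^3) \<Rightarrow> bool" where
  "weak_jacobian U J \<longleftrightarrow>
     locally_integrable U \<and> locally_integrable J \<and>
     (\<forall>f. test_function f \<longrightarrow> (\<forall>i j.
        (LINT x|lebesgue. U x $ i * pdiff j f x) = - (LINT x|lebesgue. J x $ i $ j * f x)))"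

definition sup_norm :: "(real^3 \<Rightarrow> 'a::real_normed_vector) \<Rightarrow> ereal" where
  "sup_norm f = esssup lebesgue (\<lambda>x. ereal (norm (f x)))"

text \<open>Elements are functions rather than classes modulo null sets; where point values
  matter, the continuous representative has to be asked for in addition.\<close>

definition W1_inf :: "(real^3 \<Rightarrow> real^3) set" where
  "W1_inf = {U. U \<in> borel_measurable lebesgue \<and> sup_norm U < \<infinity> \<and>
     (\<exists>J. weak_jacobian U J \<and> sup_norm J < \<infinity>)}"

end

theory Submission
  imports Defs
begin

text \<open>
  A vertex displacement is interpolated linearly along each edge and constantly in the direction
  orthogonal to the edge within the face. On the union of the edge triangles this interpolation is
  Lipschitz: triangles at adjacent edges meet only at the vertex, at an angle bounded below by the
  choice of \<open>\<gamma>\<close>, triangles at other edges of a face are separated, and points of different faces are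
  joined by a Lipschitz path inside the boundary. A McShane extension, cut off near the triangles
  and built from affine functions and distances to the triangles only, is differentiable almost
  everywhere. Thus its weak Jacobian is the limit of difference quotients, and no Rademacher theorem
  is needed.

  Two observations make \<open>Ct\<close> independent of \<open>M0\<close>. A boundary chart reaches height \<open>2 * M0 * r0\<close> inside
  \<open>\<Omega>\<close>, so the class is empty unless \<open>2 * M0 \<le> M1\<close>. And since both boundaries are cones near their
  vertices, comparing them at a vertex and at the midpoint of a moved segment bounds the distance of
  the moved vertex from each face plane by \<open>3 * dH\<close>; three such planes at the vertex, with angles
  controlled by \<open>\<theta>0\<close>, give the bound \<open>27 / (sin \<theta>0)\<^sup>2 * dH\<close> for its displacement.
\<close>

subsection \<open>Almost everywhere differentiable functions\<close>

text \<open>The order of the quantifiers shapes the proof: \<open>Ct\<close> is fixed before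
  \<open>M0\<close>, while the comparison constant \<open>C4\<close> depends on \<open>M0\<close>.
  So the displacement bound contained in the vertex correspondence can only fix the threshold
  \<open>C\<close>; below it the geometry at a vertex has to yield a bound of its own. The other
  obstacle is that faces need not be convex: nearby points cannot be joined by a segment inside a
  face, and a distance in space says nothing at first about the distance along the surface. The
  charts supply both: vertical projection in a face chart compares two edges of one face, and
  lifting segments in a boundary chart connects different faces. The two terms of \<gamma> have
  separate tasks. \<theta>0 / 3 keeps triangles at adjacent edges apart;
  \<open>pi / 2 - arctan M0\<close> makes the sides of a triangle no steeper than
  \<open>1 / M0\<close>, so that it stays where the Lipschitz chart guarantees points of the
  face.\<close>

lemma negligible_level_set_nonzero_derivative:
  fixes h :: "real^'n::{finite,wellorder} \<Rightarrow> real"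
  assumes zero: "\<And>x. x \<in> S \<Longrightarrow> h x = 0"
    and deriv: "\<And>x. x \<in> S \<Longrightarrow> (h has_derivative h' x) (at x)"
    and nonzero: "\<And>x. x \<in> S \<Longrightarrow> \<exists>v. h' x v \<noteq> 0"
  shows "negligible S"
proof -
  have "\<exists>v. h' x v = 1" if x: "x \<in> S" for x
  proof -
    obtain v where v: "h' x v \<noteq> 0" using nonzero[OF x] by blast
    have "h' x ((1 / h' x v) *\<^sub>R v) = 1"
      using has_derivative_bounded_linear[OF deriv[OF x]] v
      by (simp add: bounded_linear.linear linear_scale)
    then show ?thesis by blast
  qed
  then obtain v where v: "\<And>x. x \<in> S \<Longrightarrow> h' x (v x) = 1" by metis
  \<comment> \<open>On \<open>S\<close>, where \<open>h\<close> vanishes,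
    \<open>y - h y *\<^sub>R v x\<close> is the identity, so the identity on \<open>S\<close> also
    has the derivative \<open>f' x\<close>, which kills \<open>v x\<close>. Sard's theorem for rank
    deficient derivatives then applies to the identity itself, with image \<open>S\<close>.\<close>
  define f' where "f' = (\<lambda>x y. y - h' x y *\<^sub>R v x)"
  have der: "((\<lambda>x. x) has_derivative f' x) (at x within S)" if x: "x \<in> S" for x
  proof -
    have "((\<lambda>y. y - h y *\<^sub>R v x) has_derivative f' x) (at x within S)"
      unfolding f'_def
      by (auto intro!: derivative_eq_intros has_derivative_at_withinI[OF deriv[OF x]])
    then show ?thesis
      by (rule has_derivative_transform[rotated 2]) (auto simp: x zero)
  qed
  have rk: "rank (matrix (f' x)) < CARD('n)" if x: "x \<in> S" for x
  proof -
    have lin: "linear (f' x)"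
      by (rule bounded_linear.linear[OF has_derivative_bounded_linear[OF der[OF x]]])
    have "f' x (v x) = 0" unfolding f'_def using v[OF x] by simp
    moreover have "linear (h' x)"
      by (rule bounded_linear.linear[OF has_derivative_bounded_linear[OF deriv[OF x]]])
    then have "v x \<noteq> 0" using v[OF x] linear_0[of "h' x"] by auto
    ultimately have "\<not> inj (f' x)"
      using linear_injective_0[OF lin] by blast
    then have "\<not> inj ((*v) (matrix (f' x)))"
      using lin by (simp add: matrix_vector_mul(1)[symmetric])
    then show ?thesis by (simp add: less_rank_noninjective)
  qed
  have "negligible ((\<lambda>x. x) ` S)"
    by (rule baby_Sard[OF order_refl der rk])
  then show ?thesis by simp
qed

lemma differentiable_eventually_eq:
  assumes g: "g differentiable (at x)" and eq: "\<forall>\<^sub>F y in nhds x. f y = g y"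
  shows "f differentiable (at x)"
proof -
  obtain D where D: "(g has_derivative D) (at x)" using g by (auto simp: differentiable_def)
  have "\<forall>\<^sub>F y in at x. g y = f y"
    using eq by (auto simp: eventually_at_filter elim: eventually_mono)
  moreover have "g x = f x" using eventually_nhds_x_imp_x[OF eq] by simp
  ultimately have "(f has_derivative D) (at x)"
    using has_derivative_transform_eventually[OF D] by blast
  then show ?thesis by (auto simp: differentiable_def)
qed

text \<open>Continuity is part of the notion: it makes the sets where one function exceeds another
  open, and the limits of difference quotients measurable.\<close>

definition ae_differentiable :: "(real^'n::{finite,wellorder} \<Rightarrow> real) \<Rightarrow> bool" where
  "ae_differentiable f \<longleftrightarrow> continuous_on UNIV f \<and> negligible {x. \<not> f differentiable (at x)}"

text \<open>Off the set \<open>f = g\<close> the maximum is locally one of the two functions. Where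
  both agree to first order, the error of the maximum is at most the sum of the two errors. The
  remaining points are zeros of \<open>f - g\<close> with nonzero derivative, a null set.\<close>

lemma ae_differentiable_max:
  assumes f: "ae_differentiable f" and g: "ae_differentiable g"
  shows "ae_differentiable (\<lambda>x. max (f x) (g x))"
proof -
  let ?Nf = "{x. \<not> f differentiable (at x)}" and ?Ng = "{x. \<not> g differentiable (at x)}"
  have cf: "continuous_on UNIV f" and cg: "continuous_on UNIV g"
    using f g by (auto simp: ae_differentiable_def)
  define S where "S = {x. f x = g x \<and> f differentiable (at x) \<and> g differentiable (at x) \<and>
     frechet_derivative f (at x) \<noteq> frechet_derivative g (at x)}"
  have S: "negligible S"
  proof (rule negligible_level_set_nonzero_derivative)
    fix x assume x: "x \<in> S"
    then show "f x - g x = 0" by (simp add: S_def)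
    show "((\<lambda>x. f x - g x) has_derivative
      (\<lambda>x v. frechet_derivative f (at x) v - frechet_derivative g (at x) v) x) (at x)"
      using x by (auto simp: S_def frechet_derivative_works intro!: derivative_intros)
    show "\<exists>v. frechet_derivative f (at x) v - frechet_derivative g (at x) v \<noteq> 0"
      using x by (auto simp: S_def fun_eq_iff)
  qed
  have "(\<lambda>x. max (f x) (g x)) differentiable (at x)"
    if x: "x \<notin> ?Nf" "x \<notin> ?Ng" "x \<notin> S" for x
  proof -
    have fx: "(f has_derivative frechet_derivative f (at x)) (at x)"
      and gx: "(g has_derivative frechet_derivative g (at x)) (at x)"
      using x by (auto simp: frechet_derivative_works)
    consider "f x < g x" | "g x < f x" | "f x = g x" by linarith
    then show ?thesis
    proof cases
      case 1
      then have "\<forall>\<^sub>F y in nhds x. f y < g y"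
        using cf cg by (intro eventually_nhds_in_open[of "{y. f y < g y}", simplified] open_Collect_less) auto
      then have ev: "\<forall>\<^sub>F y in nhds x. max (f y) (g y) = g y"
        by eventually_elim simp
      show ?thesis
        by (rule differentiable_eventually_eq[OF _ ev]) (use x in simp)
    next
      case 2
      then have "\<forall>\<^sub>F y in nhds x. g y < f y"
        using cf cg by (intro eventually_nhds_in_open[of "{y. g y < f y}", simplified] open_Collect_less) auto
      then have ev: "\<forall>\<^sub>F y in nhds x. max (f y) (g y) = f y"
        by eventually_elim simp
      show ?thesis
        by (rule differentiable_eventually_eq[OF _ ev]) (use x in simp)
    next
      case 3
      then have eq: "frechet_derivative f (at x) = frechet_derivative g (at x)"
        using x by (auto simp: S_def)
      define D where "D = frechet_derivative f (at x)"
      have fl: "((\<lambda>y. norm (f y - f x - D (y - x)) / norm (y - x)) \<longlongrightarrow> 0) (at x)"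
        and gl: "((\<lambda>y. norm (g y - f x - D (y - x)) / norm (y - x)) \<longlongrightarrow> 0) (at x)"
        using fx gx eq 3 unfolding D_def has_derivative_iff_norm by simp_all
      have "((\<lambda>y. norm (max (f y) (g y) - f x - D (y - x)) / norm (y - x)) \<longlongrightarrow> 0) (at x)"
      proof (rule tendsto_sandwich[OF _ _ tendsto_const])
        show "((\<lambda>y. norm (f y - f x - D (y - x)) / norm (y - x)
            + norm (g y - f x - D (y - x)) / norm (y - x)) \<longlongrightarrow> 0) (at x)"
          using tendsto_add[OF fl gl] by simp
        show "\<forall>\<^sub>F y in at x. norm (max (f y) (g y) - f x - D (y - x)) / norm (y - x)
          \<le> norm (f y - f x - D (y - x)) / norm (y - x)
            + norm (g y - f x - D (y - x)) / norm (y - x)"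
          by (auto simp: max_def add_divide_distrib[symmetric] intro!: divide_right_mono always_eventually)
      qed (auto intro!: always_eventually)
      then have "((\<lambda>x. max (f x) (g x)) has_derivative D) (at x)"
        using fx 3 unfolding D_def has_derivative_iff_norm by simp
      then show ?thesis by (auto simp: differentiable_def)
    qed
  qed
  then have "{x. \<not> (\<lambda>x. max (f x) (g x)) differentiable (at x)} \<subseteq> ?Nf \<union> ?Ng \<union> S"
    by auto
  moreover have "negligible (?Nf \<union> ?Ng \<union> S)"
    using f g S by (simp add: ae_differentiable_def)
  ultimately have "negligible {x. \<not> (\<lambda>x. max (f x) (g x)) differentiable (at x)}"
    by (rule negligible_subset[rotated])
  then show ?thesis
    using cf cg by (simp add: ae_differentiable_def continuous_on_max)
qed

lemma ae_differentiable_uminus: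
  assumes "ae_differentiable f" shows "ae_differentiable (\<lambda>x. - f x)"
proof -
  have "(\<lambda>x. - f x) differentiable (at x)" if "f differentiable (at x)" for x
    using that by simp
  then have "{x. \<not> (\<lambda>x. - f x) differentiable (at x)} \<subseteq> {x. \<not> f differentiable (at x)}" by auto
  then have "negligible {x. \<not> (\<lambda>x. - f x) differentiable (at x)}"
    by (rule negligible_subset[rotated]) (use assms in \<open>simp add: ae_differentiable_def\<close>)
  then show ?thesis using assms by (simp add: ae_differentiable_def continuous_on_minus)
qed

lemma ae_differentiable_min:
  assumes "ae_differentiable f" "ae_differentiable g"
  shows "ae_differentiable (\<lambda>x. min (f x) (g x))"
proof -
  have "(\<lambda>x. min (f x) (g x)) = (\<lambda>x. - max (- f x) (- g x))" by (auto simp: fun_eq_iff)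
  then show ?thesis
    using assms by (auto intro!: ae_differentiable_uminus ae_differentiable_max)
qed

lemma ae_differentiable_add:
  assumes "ae_differentiable f" "ae_differentiable g"
  shows "ae_differentiable (\<lambda>x. f x + g x)"
proof -
  have "{x. \<not> (\<lambda>x. f x + g x) differentiable (at x)}
      \<subseteq> {x. \<not> f differentiable (at x)} \<union> {x. \<not> g differentiable (at x)}"
    by auto
  moreover have "negligible ({x. \<not> f differentiable (at x)} \<union> {x. \<not> g differentiable (at x)})"
    using assms by (simp add: ae_differentiable_def)
  ultimately have "negligible {x. \<not> (\<lambda>x. f x + g x) differentiable (at x)}"
    by (rule negligible_subset[rotated])
  then show ?thesis using assms by (simp add: ae_differentiable_def continuous_on_add)
qed

lemma ae_differentiable_cmult:
  assumes "ae_differentiable f"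
  shows "ae_differentiable (\<lambda>x. c * f x)"
proof -
  have "{x. \<not> (\<lambda>x. c * f x) differentiable (at x)} \<subseteq> {x. \<not> f differentiable (at x)}"
    by (auto intro!: differentiable_mult)
  then have "negligible {x. \<not> (\<lambda>x. c * f x) differentiable (at x)}"
    by (rule negligible_subset[rotated]) (use assms in \<open>simp add: ae_differentiable_def\<close>)
  then show ?thesis using assms by (simp add: ae_differentiable_def continuous_on_mult_left)
qed

lemma ae_differentiable_everywhere:
  assumes "\<And>x. f differentiable (at x)"
  shows "ae_differentiable f"
  using assms by (auto simp: ae_differentiable_def continuous_on_eq_continuous_at differentiable_imp_continuous_within)

lemma ae_differentiable_Min:
  assumes "finite I" "I \<noteq> {}" "\<And>i. i \<in> I \<Longrightarrow> ae_differentiable (f i)"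
  shows "ae_differentiable (\<lambda>x. Min ((\<lambda>i. f i x) ` I))"
  using assms
proof (induction I rule: finite_ne_induct)
  case (insert i I)
  then show ?case using ae_differentiable_min[of "f i" "\<lambda>x. Min ((\<lambda>i. f i x) ` I)"] by simp
qed simp

text \<open>With \<open>p\<close> the point of \<open>S\<close> nearest to \<open>x\<close>, the
  distance function is squeezed between the affine function given by the supporting half-space at
  \<open>p\<close> (\<open>low\<close>) and the distance to the single point \<open>p\<close>
  (\<open>up\<close>). Both touch it at \<open>x\<close> and have the derivative \<open>D\<close>
  there.\<close>

lemma infdist_convex_differentiable:
  fixes S :: "'a::euclidean_space set"
  assumes S: "convex S" "closed S" "S \<noteq> {}" and x: "x \<notin> S"
  shows "(\<lambda>y. infdist y S) differentiable (at x)"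
proof -
  define p where "p = closest_point S x"
  have p: "p \<in> S" using S by (simp add: p_def closest_point_in_set)
  have id: "infdist y S = norm (y - closest_point S y)" for y
    using S by (simp add: infdist_eq_setdist setdist_closest_point dist_norm)
  define v where "v = x - p"
  have v: "v \<noteq> 0" using p x by (auto simp: v_def)
  have ix: "infdist x S = norm v" by (simp add: id v_def p_def)
  define D where "D = (\<lambda>h. v \<bullet> h / norm v)"
  have nd: "(norm has_derivative D) (at v)"
    using has_derivative_norm[OF v] by (simp add: D_def sgn_div_norm inner_commute divide_inverse mult.commute)
  have "((\<lambda>y. norm (y - p)) has_derivative D) (at x)"
  proof -
    have "((norm \<circ> (\<lambda>y. y - p)) has_derivative (D \<circ> (\<lambda>y. y))) (at x)"
      by (rule diff_chain_at) (auto intro!: derivative_eq_intros nd[unfolded v_def])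
    then show ?thesis by (simp add: o_def)
  qed
  then have lim: "((\<lambda>y. norm (norm (y - p) - norm v - D (y - x)) / norm (y - x)) \<longlongrightarrow> 0) (at x)"
    and bl: "bounded_linear D"
    unfolding has_derivative_iff_norm v_def by simp_all
  have low: "infdist x S + D (y - x) \<le> infdist y S" for y
  proof -
    define q where "q = closest_point S y"
    have q: "q \<in> S" using S by (simp add: q_def closest_point_in_set)
    have "v \<bullet> (q - p) \<le> 0"
      using closest_point_dot[OF S(1,2) q, of x] by (simp add: v_def p_def)
    then have "v \<bullet> (y - q) \<ge> v \<bullet> (y - x) + v \<bullet> v"
      by (simp add: v_def inner_simps)
    moreover have "v \<bullet> (y - q) \<le> norm v * infdist y S"
      unfolding id q_def by (rule norm_cauchy_schwarz)
    moreover have "norm v * D (y - x) = v \<bullet> (y - x)" using v by (simp add: D_def)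
    ultimately have "norm v * (D (y - x) + norm v) \<le> norm v * infdist y S"
      by (simp add: distrib_left dot_square_norm power2_eq_square)
    then show ?thesis using v ix by simp
  qed
  have up: "infdist y S \<le> norm (y - p)" for y
    using infdist_le[OF p, of y] by (simp add: dist_norm)
  have "((\<lambda>y. norm (infdist y S - infdist x S - D (y - x)) / norm (y - x)) \<longlongrightarrow> 0) (at x)"
  proof (rule tendsto_sandwich[OF _ _ tendsto_const lim])
    have "norm (infdist y S - infdist x S - D (y - x)) \<le> norm (norm (y - p) - norm v - D (y - x))" for y
      using low[of y] up[of y] ix by simp
    then show "\<forall>\<^sub>F y in at x. norm (infdist y S - infdist x S - D (y - x)) / norm (y - x)
        \<le> norm (norm (y - p) - norm v - D (y - x)) / norm (y - x)"
      by (auto intro!: divide_right_mono always_eventually)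
  qed (auto intro!: always_eventually)
  then show ?thesis
    using bl by (auto simp: differentiable_def has_derivative_iff_norm)
qed

text \<open>Inside the set the distance vanishes and outside it is differentiable, so only the
  frontier is left, which is negligible by convexity.\<close>

lemma ae_differentiable_infdist:
  assumes S: "convex S" "closed S" "S \<noteq> {}"
  shows "ae_differentiable (\<lambda>x. infdist x S)"
proof -
  have "(\<lambda>x. infdist x S) differentiable (at x)" if "x \<notin> frontier S" for x
  proof (cases "x \<in> S")
    case True
    then have "x \<in> interior S" using that S closure_closed by (auto simp: frontier_def)
    then have "\<forall>\<^sub>F y in nhds x. y \<in> interior S"
      by (intro eventually_nhds_in_open) auto
    then have ev: "\<forall>\<^sub>F y in nhds x. infdist y S = 0"
      by eventually_elim (meson infdist_zero interior_subset subsetD)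
    show ?thesis by (rule differentiable_eventually_eq[OF _ ev]) simp
  next
    case False then show ?thesis using infdist_convex_differentiable[OF S] by blast
  qed
  then have "{x. \<not> (\<lambda>x. infdist x S) differentiable (at x)} \<subseteq> frontier S" by blast
  then have "negligible {x. \<not> (\<lambda>x. infdist x S) differentiable (at x)}"
    by (rule negligible_subset[OF negligible_convex_frontier[OF S(1)]])
  moreover have "continuous_on UNIV (\<lambda>x. infdist x S)"
    by (rule continuous_on_infdist) (rule continuous_on_id)
  ultimately show ?thesis by (simp add: ae_differentiable_def)
qed

subsection \<open>Weak Jacobians of Lipschitz fields\<close>

lemma integrable_continuous_bounded_support:
  fixes g :: "'a::euclidean_space \<Rightarrow> real"
  assumes "continuous_on UNIV g" "\<And>x. norm x > R \<Longrightarrow> g x = 0"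
  shows "integrable lborel g"
proof -
  have "integrable lborel (\<lambda>x. indicator (cball 0 R) x *\<^sub>R g x)"
    using assms(1) by (intro borel_integrable_compact) (auto intro: continuous_on_subset)
  moreover have "(\<lambda>x. indicator (cball 0 R) x *\<^sub>R g x) = g"
    using assms(2) by (auto simp: fun_eq_iff indicator_def not_le)
  ultimately show ?thesis by simp
qed

lemma lborel_integral_translate:
  fixes g :: "'a::euclidean_space \<Rightarrow> real"
  assumes g: "g \<in> borel_measurable borel"
  shows "(LBINT x. g (c + x)) = (LBINT x. g x)"
proof -
  have "(LBINT x. g x) = integral\<^sup>L (distr lborel borel ((+) c)) g"
    by (simp add: lborel_distr_plus)
  also have "\<dots> = (LBINT x. g (c + x))"
    using g by (intro integral_distr) auto
  finally show ?thesis by simp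
qed

definition difference_quotient :: "3 \<Rightarrow> (real^3 \<Rightarrow> real) \<Rightarrow> nat \<Rightarrow> real^3 \<Rightarrow> real" where
  "difference_quotient j u n x = (u (x + (1 / real (Suc n)) *\<^sub>R axis j 1) - u x) * real (Suc n)"

text \<open>Where the quotients diverge, \<open>lim\<close> has an arbitrary value. For functions
  that are differentiable almost everywhere these points form a null set, and the limit is Borel
  measurable all the same.\<close>

definition lim_quotient :: "3 \<Rightarrow> (real^3 \<Rightarrow> real) \<Rightarrow> real^3 \<Rightarrow> real" where
  "lim_quotient j u x = lim (\<lambda>n. difference_quotient j u n x)"

text \<open>The factor \<open>c\<close> serves two signs: \<open>c = 1\<close> for the field and
  \<open>c = -1\<close> for the test function, to which a change of variables transfers the opposite
  shift.\<close>

lemma difference_quotient_tendsto: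
  fixes u :: "'a::real_normed_vector \<Rightarrow> real"
  assumes "(u has_derivative D) (at x)"
  shows "(\<lambda>n. (u (x + (c / real (Suc n)) *\<^sub>R e) - u x) * real (Suc n)) \<longlonglongrightarrow> c * D e"
proof (cases "c = 0 \<or> e = 0")
  case True
  moreover have "D 0 = 0"
    using assms by (simp add: has_derivative_bounded_linear linear_simps)
  ultimately show ?thesis by auto
next
  case False
  have bl: "bounded_linear D" using assms has_derivative_bounded_linear by blast
  have D: "D (r *\<^sub>R e) = r * D e" for r using bl by (simp add: linear_simps)
  define y where "y = (\<lambda>n. x + (c / real (Suc n)) *\<^sub>R e)"
  have lim: "((\<lambda>z. (u z - u x - D (z - x)) / norm (z - x)) \<longlongrightarrow> 0) (at x)"
    using assms unfolding has_derivative_iff_norm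
    by (simp add: tendsto_norm_zero_iff[of "\<lambda>z. (u z - u x - D (z - x)) / norm (z - x)", symmetric] abs_divide)
  have "(\<lambda>n. c / real (Suc n)) \<longlonglongrightarrow> 0"
    using tendsto_mult_right_zero[OF LIMSEQ_inverse_real_of_nat, of c] by (simp add: divide_inverse)
  then have "y \<longlonglongrightarrow> x + 0 *\<^sub>R e" unfolding y_def by (intro tendsto_intros)
  then have "filterlim y (at x) sequentially"
    using False by (auto simp: filterlim_at y_def)
  then have "(\<lambda>n. (u (y n) - u x - D (y n - x)) / norm (y n - x)) \<longlonglongrightarrow> 0"
    by (rule filterlim_compose[OF lim])
  then have "(\<lambda>n. (u (y n) - u x - D (y n - x)) / norm (y n - x) * (\<bar>c\<bar> * norm e) + c * D e) \<longlonglongrightarrow> 0 * (\<bar>c\<bar> * norm e) + c * D e"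
    by (intro tendsto_intros)
  moreover have "(u (y n) - u x - D (y n - x)) / norm (y n - x) * (\<bar>c\<bar> * norm e) + c * D e
     = (u (x + (c / real (Suc n)) *\<^sub>R e) - u x) * real (Suc n)" for n
  proof -
    have "norm (y n - x) = \<bar>c\<bar> * norm e / real (Suc n)" by (simp add: y_def)
    moreover have "D (y n - x) = c * D e / real (Suc n)" by (simp add: y_def D)
    ultimately
    have "(u (y n) - u x - D (y n - x)) / norm (y n - x) * (\<bar>c\<bar> * norm e) + c * D e
       = (u (y n) - u x) * real (Suc n)"
    proof -
      have "(b - d / k) / (m / k) * m + d = b * k" if "k \<noteq> 0" "m \<noteq> 0" for b d k m :: real
        using that by (simp add: field_simps)
      from this[of "real (Suc n)" "\<bar>c\<bar> * norm e" "u (y n) - u x" "c * D e"] show ?thesis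
        using False \<open>norm (y n - x) = _\<close> \<open>D (y n - x) = _\<close> by simp
    qed
    then show ?thesis by (simp add: y_def)
  qed
  ultimately show ?thesis by simp
qed

lemma continuous_on_translate:
  fixes u :: "'a::real_normed_vector \<Rightarrow> 'b::topological_space"
  assumes "continuous_on UNIV u"
  shows "continuous_on UNIV (\<lambda>x. u (x + c))" "continuous_on UNIV (\<lambda>x. u (x - c))"
  by (rule continuous_on_compose2[OF assms]; simp add: continuous_on_add continuous_on_diff)+

lemma borel_measurable_lim_quotient [measurable]:
  assumes "continuous_on UNIV u"
  shows "lim_quotient j u \<in> borel_measurable borel"
proof -
  have "difference_quotient j u n \<in> borel_measurable borel" for n
    unfolding difference_quotient_def
    by (intro borel_measurable_continuous_onI continuous_on_mult_right continuous_on_diff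
        continuous_on_translate assms)
  then show ?thesis
    unfolding lim_quotient_def by (rule borel_measurable_lim_metric)
qed

lemma AE_lim_quotient:
  assumes u: "ae_differentiable u" and lip: "\<And>x y. \<bar>u x - u y\<bar> \<le> L * dist x y"
  shows "AE x in lborel. (\<lambda>n. difference_quotient j u n x) \<longlonglongrightarrow> lim_quotient j u x"
    and "\<And>n x. \<bar>difference_quotient j u n x\<bar> \<le> L"
    and "AE x in lborel. \<bar>lim_quotient j u x\<bar> \<le> L"
proof -
  have conv: "(\<lambda>n. difference_quotient j u n x) \<longlonglongrightarrow> lim_quotient j u x" if d: "u differentiable (at x)" for x
  proof -
    obtain D where "(u has_derivative D) (at x)" using d unfolding differentiable_def by blast
    from difference_quotient_tendsto[OF this, of 1 "axis j 1"]
    have "(\<lambda>n. difference_quotient j u n x) \<longlonglongrightarrow> D (axis j 1)"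
      by (simp add: difference_quotient_def[abs_def])
    then show ?thesis by (simp add: lim_quotient_def limI)
  qed
  have "{x. \<not> u differentiable (at x)} \<in> null_sets lebesgue"
    using u by (simp add: ae_differentiable_def negligible_iff_null_sets)
  then have "AE x in lebesgue. u differentiable (at x)"
    by (rule AE_I') auto
  then have ae: "AE x in lborel. u differentiable (at x)"
    by (simp add: AE_completion_iff)
  then show 1: "AE x in lborel. (\<lambda>n. difference_quotient j u n x) \<longlonglongrightarrow> lim_quotient j u x"
    by eventually_elim (rule conv)
  show 2: "\<bar>difference_quotient j u n x\<bar> \<le> L" for n x
  proof -
    have "\<bar>difference_quotient j u n x\<bar> \<le> L * dist (x + (1 / real (Suc n)) *\<^sub>R axis j 1) x * real (Suc n)"
      unfolding difference_quotient_def abs_mult by (intro mult_mono lip order_trans[OF abs_ge_zero lip]) auto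
    also have "\<dots> = L" by (simp add: dist_norm)
    finally show ?thesis .
  qed
  from 1 show "AE x in lborel. \<bar>lim_quotient j u x\<bar> \<le> L"
  proof eventually_elim
    case (elim x)
    show ?case
      by (rule Lim_bounded[OF tendsto_rabs[OF elim], of 0]) (use 2 in auto)
  qed
qed

lemma test_functionD:
  assumes "test_function f"
  shows "f differentiable (at x)" "continuous_on UNIV f" "continuous_on UNIV (pdiff j f)"
    "\<exists>R>0. \<forall>x. norm x > R \<longrightarrow> f x = 0"
proof -
  have C: "C_k (Suc 0) f" and K: "compact (closure {x. f x \<noteq> 0})"
    using assms unfolding test_function_def by blast+
  show d: "f differentiable (at x)" for x using C by simp
  show "continuous_on UNIV f"
    using d by (simp add: continuous_on_eq_continuous_at differentiable_imp_continuous_within)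
  show "continuous_on UNIV (pdiff j f)" using C by simp
  obtain R where "R > 0" "\<forall>x\<in>closure {x. f x \<noteq> 0}. norm x \<le> R"
    using compact_imp_bounded[OF K] bounded_pos by blast
  then show "\<exists>R>0. \<forall>x. norm x > R \<longrightarrow> f x = 0"
    by (metis (mono_tags, lifting) closure_subset linorder_not_le mem_Collect_eq subsetD)
qed

text \<open>For a fixed step the identity is exact: translation invariance of Lebesgue measure moves
  the shift from \<open>u\<close> to \<open>f\<close>. Dominated convergence then passes to the
  limit on both sides; the majorant comes from the Lipschitz bound on one side and from the mean
  value theorem on the other.\<close>

lemma lim_quotient_integration_by_parts:
  assumes u: "ae_differentiable u" and lip: "\<And>x y. \<bar>u x - u y\<bar> \<le> L * dist x y"
    and f: "test_function f"
  shows "(LBINT x. u x * pdiff j f x) = - (LBINT x. lim_quotient j u x * f x)"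
proof -
  have cu: "continuous_on UNIV u" using u by (simp add: ae_differentiable_def)
  note df = test_functionD(1)[OF f] and cf = test_functionD(2)[OF f] and cp = test_functionD(3)[OF f, of j]
  obtain R where R: "R > 0" "\<And>x. norm x > R \<Longrightarrow> f x = 0" using test_functionD(4)[OF f] by blast
  define e :: "real^3" where "e = axis j 1"
  have e: "norm e = 1" by (simp add: e_def)
  have L: "L \<ge> 0" using lip[of 0 e] e by (simp add: dist_norm)
  define h where "h = (\<lambda>n::nat. 1 / real (Suc n))"
  have h: "h n > 0" "h n \<le> 1" "h n * real (Suc n) = 1" for n by (auto simp: h_def)
  have [measurable]: "u \<in> borel_measurable borel" "f \<in> borel_measurable borel" "pdiff j f \<in> borel_measurable borel"
    using cu cf cp by (auto intro: borel_measurable_continuous_onI)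
  have [measurable]: "lim_quotient j u \<in> borel_measurable borel"
    by (rule borel_measurable_lim_quotient[OF cu])
  have [measurable]: "difference_quotient j u n \<in> borel_measurable borel" for n
    unfolding difference_quotient_def by measurable
  have if1: "integrable lborel f" by (rule integrable_continuous_bounded_support[OF cf R(2)])
  have lim1: "(\<lambda>n. LBINT x. difference_quotient j u n x * f x) \<longlonglongrightarrow> (LBINT x. lim_quotient j u x * f x)"
  proof (rule integral_dominated_convergence[where w = "\<lambda>x. L * \<bar>f x\<bar>"])
    show "AE x in lborel. (\<lambda>n. difference_quotient j u n x * f x) \<longlonglongrightarrow> lim_quotient j u x * f x"
      using AE_lim_quotient(1)[OF u lip, of j] by eventually_elim (intro tendsto_intros)
    show "AE x in lborel. norm (difference_quotient j u n x * f x) \<le> L * \<bar>f x\<bar>" for n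
      using AE_lim_quotient(2)[OF u lip, of j n] by (auto simp: abs_mult intro!: mult_right_mono)
  qed (use if1 in auto)
  \<comment> \<open>Room for two unit steps: the quotients of \<open>f\<close> may be nonzero up to
    radius \<open>R + 1\<close>, and the mean value theorem evaluates the derivative up to one step
    further out.\<close>
  obtain B where B: "B > 0" "\<And>x. norm x \<le> R + 2 \<Longrightarrow> \<bar>pdiff j f x\<bar> \<le> B"
  proof -
    have "bounded (pdiff j f ` cball 0 (R + 2))"
      by (intro compact_imp_bounded compact_continuous_image continuous_on_subset[OF cp]) auto
    then show ?thesis using that unfolding bounded_pos by auto
  qed
  have mvt: "\<bar>f (x - h n *\<^sub>R e) - f x\<bar> \<le> B * h n" if x: "norm x \<le> R + 1" for x n
  proof -
    have der: "((\<lambda>t. f (x - t *\<^sub>R e)) has_derivative (\<lambda>t. - t * pdiff j f (x - s *\<^sub>R e))) (at s within {0..h n})" for s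
    proof -
      have fd: "(f has_derivative frechet_derivative f (at (x - s *\<^sub>R e))) (at (x - s *\<^sub>R e))"
        using df frechet_derivative_works by blast
      have "((\<lambda>t. f (x - t *\<^sub>R e)) has_derivative (\<lambda>t. frechet_derivative f (at (x - s *\<^sub>R e)) (- (t *\<^sub>R e)))) (at s within {0..h n})"
        by (rule has_derivative_compose[where f = "\<lambda>t. x - t *\<^sub>R e" and g = f, OF _ fd]) (auto intro!: derivative_eq_intros)
      moreover have "frechet_derivative f (at (x - s *\<^sub>R e)) (- (t *\<^sub>R e)) = - t * pdiff j f (x - s *\<^sub>R e)" for t
        using linear_frechet_derivative[OF df, of "x - s *\<^sub>R e"]
        by (simp add: pdiff_def e_def linear_neg linear_scale)
      ultimately show ?thesis by simp
    qed
    have "\<exists>s\<in>{0<..<h n}. f (x - h n *\<^sub>R e) - f (x - 0 *\<^sub>R e) = - (h n - 0) * pdiff j f (x - s *\<^sub>R e)"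
      using mvt_simple[of 0 "h n" "\<lambda>t. f (x - t *\<^sub>R e)" "\<lambda>s t. - t * pdiff j f (x - s *\<^sub>R e)"] h[of n] der
      by auto
    then obtain s where s: "0 < s" "s < h n" "f (x - h n *\<^sub>R e) - f x = - h n * pdiff j f (x - s *\<^sub>R e)"
      by auto
    have "norm (x - s *\<^sub>R e) \<le> R + 2"
      using norm_triangle_ineq4[of x "s *\<^sub>R e"] x s h[of n] e by simp
    then show ?thesis using B(2) s h[of n] by (simp add: abs_mult mult.commute)
  qed
  define q where "q = (\<lambda>n x. (f (x - h n *\<^sub>R e) - f x) * real (Suc n))"
  have [measurable]: "q n \<in> borel_measurable borel" for n unfolding q_def by measurable
  have qb: "\<bar>u x * q n x\<bar> \<le> indicator (cball 0 (R + 1)) x *\<^sub>R (\<bar>u x\<bar> * B)" for n x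
  proof (cases "norm x \<le> R + 1")
    case True
    have "\<bar>q n x\<bar> \<le> B * h n * real (Suc n)"
      unfolding q_def abs_mult by (intro mult_mono mvt[OF True]) (use B h[of n] in auto)
    also have "\<dots> = B" using h(3)[of n] by (simp add: mult.assoc)
    finally show ?thesis using True by (simp add: abs_mult mult_left_mono)
  next
    case False
    have "norm (x - h n *\<^sub>R e) \<ge> norm x - norm (h n *\<^sub>R e)" by (rule norm_triangle_ineq2)
    then have "norm (x - h n *\<^sub>R e) > R" using False h[of n] e by simp
    then show ?thesis using False R by (simp add: q_def)
  qed
  have lim2: "(\<lambda>n. LBINT x. u x * q n x) \<longlonglongrightarrow> (LBINT x. u x * (- pdiff j f x))"
  proof (rule integral_dominated_convergence[where w = "\<lambda>x. indicator (cball 0 (R + 1)) x *\<^sub>R (\<bar>u x\<bar> * B)"])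
    show "AE x in lborel. (\<lambda>n. u x * q n x) \<longlonglongrightarrow> u x * (- pdiff j f x)"
    proof (intro AE_I2 tendsto_intros)
      fix x
      have "(f has_derivative frechet_derivative f (at x)) (at x)" using df frechet_derivative_works by blast
      from difference_quotient_tendsto[OF this, of "-1" e]
      show "(\<lambda>n. q n x) \<longlonglongrightarrow> - pdiff j f x" by (simp add: q_def h_def pdiff_def e_def)
    qed
    show "AE x in lborel. norm (u x * q n x) \<le> indicator (cball 0 (R + 1)) x *\<^sub>R (\<bar>u x\<bar> * B)" for n
      using qb by simp
    show "integrable lborel (\<lambda>x. indicator (cball 0 (R + 1)) x *\<^sub>R (\<bar>u x\<bar> * B))"
      by (intro borel_integrable_compact continuous_on_mult_right continuous_on_rabs
          continuous_on_subset[OF cu]) auto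
  qed auto
  have "(LBINT x. difference_quotient j u n x * f x) = (LBINT x. u x * q n x)" for n
  proof -
    have i1: "integrable lborel (\<lambda>x. u (x + h n *\<^sub>R e) * f x)"
      by (rule integrable_continuous_bounded_support[of _ R])
        (simp_all add: continuous_on_mult continuous_on_translate cf cu R(2))
    have i2: "integrable lborel (\<lambda>x. u x * f x)"
      by (rule integrable_continuous_bounded_support[of _ R])
        (simp_all add: continuous_on_mult cf cu R(2))
    have i3: "integrable lborel (\<lambda>x. u x * f (x - h n *\<^sub>R e))"
    proof (rule integrable_continuous_bounded_support[of _ "R + 1"])
      show "continuous_on UNIV (\<lambda>x. u x * f (x - h n *\<^sub>R e))"
        by (intro continuous_on_mult continuous_on_translate cf cu)
      fix x :: "real^3" assume "norm x > R + 1"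
      then have "norm (x - h n *\<^sub>R e) > R" using norm_triangle_ineq2[of x "h n *\<^sub>R e"] h[of n] e by simp
      then show "u x * f (x - h n *\<^sub>R e) = 0" using R by simp
    qed
    have "(LBINT x. u (x + h n *\<^sub>R e) * f x) = (LBINT x. u (h n *\<^sub>R e + x) * f ((h n *\<^sub>R e + x) - h n *\<^sub>R e))"
      by (simp add: add.commute)
    also have "\<dots> = (LBINT x. u x * f (x - h n *\<^sub>R e))"
      by (rule lborel_integral_translate[of "\<lambda>x. u x * f (x - h n *\<^sub>R e)"]) measurable
    finally have t: "(LBINT x. u (x + h n *\<^sub>R e) * f x) = (LBINT x. u x * f (x - h n *\<^sub>R e))" .
    have "(LBINT x. difference_quotient j u n x * f x)
        = (LBINT x. (u (x + h n *\<^sub>R e) * f x - u x * f x) * real (Suc n))"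
      by (simp add: difference_quotient_def h_def e_def algebra_simps)
    also have "\<dots> = ((LBINT x. u (x + h n *\<^sub>R e) * f x) - (LBINT x. u x * f x)) * real (Suc n)"
      using i1 i2 by simp
    also have "\<dots> = (LBINT x. (u x * f (x - h n *\<^sub>R e) - u x * f x) * real (Suc n))"
      using i3 i2 t by simp
    also have "\<dots> = (LBINT x. u x * q n x)"
      by (simp add: q_def algebra_simps)
    finally show ?thesis .
  qed
  with lim1 lim2 have "(LBINT x. lim_quotient j u x * f x) = (LBINT x. u x * (- pdiff j f x))"
    using LIMSEQ_unique by auto
  then show ?thesis by simp
qed

lemma integral_lebesgue_eq_lborel:
  fixes f :: "'a::euclidean_space \<Rightarrow> real"
  assumes "f \<in> borel_measurable borel"
  shows "(LINT x|lebesgue. f x) = (LBINT x. f x)"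
  using assms by (intro integral_completion) simp

lemma borel_measurable_vecI:
  fixes f :: "'b \<Rightarrow> 'a::euclidean_space ^ 'n"
  assumes "\<And>i. (\<lambda>x. f x $ i) \<in> borel_measurable M"
  shows "f \<in> borel_measurable M"
proof (subst borel_measurable_euclidean_space, intro ballI)
  fix b :: "'a ^ 'n" assume "b \<in> Basis"
  then obtain i u where b: "b = axis i u" "u \<in> Basis" by (auto simp: Basis_vec_def)
  then show "(\<lambda>x. f x \<bullet> b) \<in> borel_measurable M"
    using assms[of i] by (simp add: inner_axis borel_measurable_inner)
qed

lemma locally_integrable_AE_bounded:
  fixes f :: "real^3 \<Rightarrow> 'a::euclidean_space"
  assumes f: "f \<in> borel_measurable borel" and b: "AE x in lborel. norm (f x) \<le> B"
  shows "locally_integrable f"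
  unfolding locally_integrable_def
proof (intro conjI allI impI)
  show fl: "f \<in> borel_measurable lebesgue" using f by (simp add: measurable_completion)
  fix K :: "(real^3) set" assume K: "compact K"
  then have Ks: "K \<in> sets lebesgue" by (simp add: lmeasurable_compact fmeasurableD)
  have "AE x in lebesgue. norm (f x) \<le> B" using b by (simp add: AE_completion)
  then have "AE x in lebesgue. x \<in> K \<longrightarrow> norm (indicator K x *\<^sub>R f x) \<le> B"
    by eventually_elim (simp add: indicator_def)
  then show "set_integrable lebesgue K f"
    unfolding set_integrable_def using fl Ks K
    by (intro integrableI_bounded_set[where A = K and B = B])
      (use fmeasurableD2[OF lmeasurable_compact[OF K]] in
        \<open>auto simp: less_top[symmetric] intro!: borel_measurable_scaleR\<close>)
qed

lemma esssup_norm_le: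
  fixes f :: "real^3 \<Rightarrow> 'a::euclidean_space"
  assumes f: "f \<in> borel_measurable borel" and b: "AE x in lborel. norm (f x) \<le> B"
  shows "sup_norm f \<le> ereal B"
  unfolding sup_norm_def
proof (rule esssup_I)
  show "(\<lambda>x. ereal (norm (f x))) \<in> borel_measurable lebesgue"
    using f by (simp add: measurable_completion)
  show "AE x in lebesgue. ereal (norm (f x)) \<le> ereal B" using b by (simp add: AE_completion)
qed

text \<open>The weak Jacobian consists of the limits of difference quotients. The factors 3 and 9
  count the components of the field and the entries of the Jacobian, since norms are estimated by
  sums of absolute values.\<close>

lemma lipschitz_field_weak_jacobian:
  fixes U :: "real^3 \<Rightarrow> real^3"
  assumes ae: "\<And>i. ae_differentiable (\<lambda>x. U x $ i)"
    and lip: "\<And>i x y. \<bar>U x $ i - U y $ i\<bar> \<le> L * dist x y"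
    and bound: "\<And>i x. \<bar>U x $ i\<bar> \<le> M"
  shows "U \<in> W1_inf \<and> (\<exists>J. weak_jacobian U J \<and> sup_norm U + ereal r * sup_norm J \<le> ereal (3 * M + \<bar>r\<bar> * (9 * L)))"
proof -
  define J where "J = (\<lambda>x. \<chi> i j. lim_quotient j (\<lambda>x. U x $ i) x)"
  have cU: "continuous_on UNIV (\<lambda>x. U x $ i)" for i using ae by (simp add: ae_differentiable_def)
  have mUi: "(\<lambda>x. U x $ i) \<in> borel_measurable borel" for i
    by (rule borel_measurable_continuous_onI[OF cU])
  have mU: "U \<in> borel_measurable borel" by (rule borel_measurable_vecI[OF mUi])
  have mJi: "lim_quotient j (\<lambda>x. U x $ i) \<in> borel_measurable borel" for i j
    by (rule borel_measurable_lim_quotient[OF cU])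
  have mJ: "J \<in> borel_measurable borel"
    by (intro borel_measurable_vecI) (simp add: J_def mJi)
  have bU: "norm (U x) \<le> 3 * M" for x
  proof -
    have "norm (U x) \<le> (\<Sum>i\<in>UNIV. \<bar>U x $ i\<bar>)" by (rule norm_le_l1_cart)
    also have "\<dots> \<le> (\<Sum>i\<in>(UNIV::3 set). M)" by (intro sum_mono bound)
    finally show ?thesis by simp
  qed
  have "AE x in lborel. \<forall>i j. \<bar>J x $ i $ j\<bar> \<le> L"
    using AE_lim_quotient(3)[OF ae lip] by (simp add: J_def AE_all_countable)
  then have bJ: "AE x in lborel. norm (J x) \<le> 9 * L"
  proof eventually_elim
    case (elim x)
    have "norm (J x) \<le> (\<Sum>i\<in>UNIV. norm (J x $ i))" unfolding norm_vec_def by (rule L2_set_le_sum) simp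
    also have "\<dots> \<le> (\<Sum>i\<in>(UNIV::3 set). \<Sum>j\<in>UNIV. \<bar>J x $ i $ j\<bar>)"
      by (intro sum_mono norm_le_l1_cart)
    also have "\<dots> \<le> (\<Sum>i\<in>(UNIV::3 set). \<Sum>j\<in>(UNIV::3 set). L)"
      by (intro sum_mono) (use elim in auto)
    finally show ?case by simp
  qed
  have sU: "sup_norm U \<le> ereal (3 * M)" by (rule esssup_norm_le[OF mU]) (use bU in simp)
  have sJ: "sup_norm J \<le> ereal (9 * L)" by (rule esssup_norm_le[OF mJ bJ])
  \<comment> \<open>Allows \<open>r\<close> to be replaced by \<open>\<bar>r\<bar>\<close> in front
    of \<open>sup_norm J\<close>: the product is monotone only for a nonnegative second
    factor.\<close>
  have sJ0: "0 \<le> sup_norm J"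
  proof -
    have "esssup lebesgue (\<lambda>x::real^3. 0::ereal) \<le> sup_norm J"
      unfolding sup_norm_def by (rule esssup_mono) (use mJ in \<open>simp_all add: measurable_completion\<close>)
    then show ?thesis by (simp add: esssup_const emeasure_lborel_UNIV)
  qed
  have wj: "weak_jacobian U J"
    unfolding weak_jacobian_def
  proof (intro conjI allI impI)
    show "locally_integrable U" by (rule locally_integrable_AE_bounded[OF mU]) (use bU in auto)
    show "locally_integrable J" by (rule locally_integrable_AE_bounded[OF mJ bJ])
    fix f :: "real^3 \<Rightarrow> real" and i j :: 3 assume f: "test_function f"
    have "f \<in> borel_measurable borel" "pdiff j f \<in> borel_measurable borel"
      using test_functionD(2,3)[OF f] by (auto intro: borel_measurable_continuous_onI)
    then have "(LINT x|lebesgue. U x $ i * pdiff j f x) = (LBINT x. U x $ i * pdiff j f x)"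
      "(LINT x|lebesgue. J x $ i $ j * f x) = (LBINT x. J x $ i $ j * f x)"
      using mUi mJi by (auto intro!: integral_lebesgue_eq_lborel simp: J_def)
    then show "(LINT x|lebesgue. U x $ i * pdiff j f x) = - (LINT x|lebesgue. J x $ i $ j * f x)"
      using lim_quotient_integration_by_parts[OF ae lip f, of i j] by (simp add: J_def)
  qed
  have "ereal r * sup_norm J \<le> ereal \<bar>r\<bar> * ereal (9 * L)"
    using sJ sJ0 by (intro order_trans[OF ereal_mult_right_mono[of "ereal r" "ereal \<bar>r\<bar>"] ereal_mult_left_mono]) auto
  then have "sup_norm U + ereal r * sup_norm J \<le> ereal (3 * M) + ereal \<bar>r\<bar> * ereal (9 * L)"
    using sU by (intro add_mono)
  moreover have "U \<in> W1_inf"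
    unfolding W1_inf_def using mU wj sU sJ
    by (auto simp: measurable_completion intro!: exI[of _ J] le_less_trans[OF sU] le_less_trans[OF sJ])
  ultimately show ?thesis using wj by auto
qed

subsection \<open>Lipschitz extension\<close>

lemma lipschitz_max_min:
  fixes a b c d :: real
  assumes "\<bar>a - b\<bar> \<le> e" "\<bar>c - d\<bar> \<le> e"
  shows "\<bar>max a c - max b d\<bar> \<le> e" "\<bar>min a c - min b d\<bar> \<le> e"
  using assms by (auto simp: max_def min_def)

text \<open>A McShane extension whose ingredients, affine functions and distances to convex sets, are
  differentiable almost everywhere; the final truncation cuts it off away from the sets.\<close>

lemma piecewise_affine_extension:
  fixes T :: "'i \<Rightarrow> (real^'n::{finite,wellorder}) set" and a :: "'i \<Rightarrow> real^'n::{finite,wellorder} \<Rightarrow> real"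
  assumes fin: "finite I"
    and T: "\<And>i. i \<in> I \<Longrightarrow> convex (T i) \<and> compact (T i) \<and> T i \<noteq> {}"
    and diff: "\<And>i x. i \<in> I \<Longrightarrow> a i differentiable (at x)"
    and lip: "\<And>i x y. i \<in> I \<Longrightarrow> \<bar>a i x - a i y\<bar> \<le> L * dist x y"
    and cross: "\<And>i j x y. i \<in> I \<Longrightarrow> j \<in> I \<Longrightarrow> x \<in> T i \<Longrightarrow> y \<in> T j \<Longrightarrow> \<bar>a i x - a j y\<bar> \<le> L * dist x y"
    and bnd: "\<And>i x. i \<in> I \<Longrightarrow> x \<in> T i \<Longrightarrow> \<bar>a i x\<bar> \<le> M"
    and nonneg: "0 \<le> M" "0 \<le> L" and \<rho>: "0 < \<rho>" "M / \<rho> \<le> 3 * L"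
  obtains u where "ae_differentiable u" "\<And>x y. \<bar>u x - u y\<bar> \<le> 3 * L * dist x y" "\<And>x. \<bar>u x\<bar> \<le> M"
    "\<And>i x. i \<in> I \<Longrightarrow> x \<in> T i \<Longrightarrow> u x = a i x"
    "\<And>x. u x \<noteq> 0 \<Longrightarrow> \<exists>i\<in>I. infdist x (T i) < \<rho>"
proof (cases "I = {}")
  case True
  show thesis
    by (rule that[of "\<lambda>_. 0"]) (use True nonneg in \<open>auto intro: ae_differentiable_everywhere\<close>)
next
  case False
  define d where "d = (\<lambda>i x. infdist x (T i))"
  \<comment> \<open>For \<open>x\<close> in \<open>T i\<close> and the point \<open>y\<close> of
    \<open>T j\<close> nearest to \<open>x\<close>, one \<open>L * dist x y\<close> pays for passing
    from \<open>a i x\<close> to \<open>a j y\<close> and another for passing from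
    \<open>a j y\<close> to \<open>a j x\<close>. With the penalty \<open>2 * L\<close> no other
    term is below \<open>a i x\<close>, so the minimum is \<open>a i x\<close>.\<close>
  define v where "v = (\<lambda>x. Min ((\<lambda>i. a i x + 2 * L * d i x) ` I))"
  define D where "D = (\<lambda>x. Min ((\<lambda>i. d i x) ` I))"
  \<comment> \<open>The barrier equals \<open>M\<close> on the sets and decreases with slope
    \<open>M / \<rho>\<close> to 0 at distance \<rho>; the hypothesis on \<open>M / \<rho>\<close>
    makes it as Lipschitz as \<open>v\<close>. Clamping \<open>v\<close> between
    \<open>- cut\<close> and \<open>cut\<close> changes nothing on the sets because of the bound
    \<open>M\<close> there.\<close>
  define cut where "cut = (\<lambda>x. max 0 (M + - (M / \<rho>) * D x))"
  define u where "u = (\<lambda>x. max (- cut x) (min (v x) (cut x)))"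
  have d0: "0 \<le> d i x" for i x by (simp add: d_def infdist_nonneg)
  have dl: "\<bar>d i x - d i y\<bar> \<le> dist x y" for i x y by (simp add: d_def infdist_triangle_abs)
  have dae: "ae_differentiable (d i)" if "i \<in> I" for i
    unfolding d_def using T[OF that] by (intro ae_differentiable_infdist) (auto simp: compact_imp_closed)
  have vae: "ae_differentiable v" unfolding v_def
    by (intro ae_differentiable_Min fin False ae_differentiable_add ae_differentiable_cmult dae
        ae_differentiable_everywhere diff)
  have "ae_differentiable D" unfolding D_def
    using ae_differentiable_Min[OF fin False, of d] dae by simp
  then have cutae: "ae_differentiable cut" unfolding cut_def
    by (intro ae_differentiable_max ae_differentiable_add ae_differentiable_cmult)
      (auto intro: ae_differentiable_everywhere)
  have Min_lip: "\<bar>Min ((\<lambda>i. f i x) ` I) - Min ((\<lambda>i. f i y) ` I)\<bar> \<le> c"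
    if f: "\<And>i. i \<in> I \<Longrightarrow> \<bar>f i x - f i y\<bar> \<le> c" for f :: "'i \<Rightarrow> real^'n::{finite,wellorder} \<Rightarrow> real" and x y c
  proof -
    have *: "Min ((\<lambda>i. f i x) ` I) - c \<le> Min ((\<lambda>i. f i y) ` I)"
      if f: "\<And>i. i \<in> I \<Longrightarrow> \<bar>f i x - f i y\<bar> \<le> c" for x y
    proof (rule Min.boundedI)
      fix z assume "z \<in> (\<lambda>i. f i y) ` I"
      then obtain i where i: "i \<in> I" "z = f i y" by auto
      have "Min ((\<lambda>i. f i x) ` I) \<le> f i x" using fin i by simp
      then show "Min ((\<lambda>i. f i x) ` I) - c \<le> z" using f[OF i(1)] i by linarith
    qed (use fin False in auto)
    have "Min ((\<lambda>i. f i y) ` I) - c \<le> Min ((\<lambda>i. f i x) ` I)"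
      by (rule *) (use f in \<open>auto simp: abs_minus_commute\<close>)
    with *[OF f] show ?thesis by linarith
  qed
  have vl: "\<bar>v x - v y\<bar> \<le> 3 * L * dist x y" for x y
    unfolding v_def
  proof (rule Min_lip)
    fix i assume i: "i \<in> I"
    have "\<bar>a i x + 2 * L * d i x - (a i y + 2 * L * d i y)\<bar> \<le> \<bar>a i x - a i y\<bar> + 2 * L * \<bar>d i x - d i y\<bar>"
    proof -
      have "a i x + 2 * L * d i x - (a i y + 2 * L * d i y) = (a i x - a i y) + 2 * L * (d i x - d i y)"
        by (simp add: algebra_simps)
      then show ?thesis
        using abs_triangle_ineq[of "a i x - a i y" "2 * L * (d i x - d i y)"] nonneg by (simp add: abs_mult)
    qed
    also have "\<dots> \<le> L * dist x y + 2 * L * dist x y"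
      using nonneg by (intro add_mono lip i mult_left_mono dl) auto
    finally show "\<bar>a i x + 2 * L * d i x - (a i y + 2 * L * d i y)\<bar> \<le> 3 * L * dist x y" by simp
  qed
  have Dl: "\<bar>D x - D y\<bar> \<le> dist x y" for x y unfolding D_def by (rule Min_lip) (rule dl)
  have cutl: "\<bar>cut x - cut y\<bar> \<le> 3 * L * dist x y" for x y
    unfolding cut_def
  proof (rule lipschitz_max_min(1))
    have "\<bar>M + - (M / \<rho>) * D x - (M + - (M / \<rho>) * D y)\<bar> = M / \<rho> * \<bar>D x - D y\<bar>"
    proof -
      have "M + - (M / \<rho>) * D x - (M + - (M / \<rho>) * D y) = - (M / \<rho> * (D x - D y))"
        by (simp add: right_diff_distrib)
      then show ?thesis using nonneg \<rho> by (simp add: abs_mult)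
    qed
    also have "\<dots> \<le> 3 * L * dist x y"
      using \<rho> Dl nonneg by (intro mult_mono) auto
    finally show "\<bar>M + - (M / \<rho>) * D x - (M + - (M / \<rho>) * D y)\<bar> \<le> 3 * L * dist x y" .
  qed (use nonneg in simp)
  have D0: "0 \<le> D x" for x unfolding D_def using fin False d0 by (subst Min_ge_iff) auto
  have cutb: "0 \<le> cut x" "cut x \<le> M" for x
    using D0[of x] nonneg \<rho> by (auto simp: cut_def)
  show thesis
  proof (rule that)
    show "ae_differentiable u" unfolding u_def
      by (intro ae_differentiable_max ae_differentiable_min ae_differentiable_uminus vae cutae)
    show "\<bar>u x - u y\<bar> \<le> 3 * L * dist x y" for x y
      unfolding u_def
      by (intro lipschitz_max_min vl cutl) (use cutl[of x y] in \<open>simp add: abs_minus_commute\<close>)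
    show "\<bar>u x\<bar> \<le> M" for x using cutb[of x] by (auto simp: u_def)
    show "\<exists>i\<in>I. infdist x (T i) < \<rho>" if "u x \<noteq> 0" for x
    proof -
      have "cut x \<noteq> 0" using that by (auto simp: u_def)
      then have "M / \<rho> * D x < M" by (auto simp: cut_def max_def split: if_splits)
      moreover have "M > 0" using nonneg \<open>cut x \<noteq> 0\<close> cutb[of x] by linarith
      ultimately have "D x < \<rho>" using \<rho> by (simp add: field_simps)
      moreover have "D x \<in> (\<lambda>i. d i x) ` I" unfolding D_def using fin False by (intro Min_in) auto
      ultimately show ?thesis by (auto simp: d_def)
    qed
    fix i x assume i: "i \<in> I" and x: "x \<in> T i"
    have "d i x = 0" using x by (simp add: d_def)
    have "D x = 0"
    proof (rule antisym[OF _ D0])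
      show "D x \<le> 0" unfolding D_def \<open>d i x = 0\<close>[symmetric] using fin i by (intro Min_le) auto
    qed
    then have cut: "cut x = M" using nonneg by (simp add: cut_def)
    have "v x = a i x" unfolding v_def
    proof (rule Min_eqI)
      show "finite ((\<lambda>i. a i x + 2 * L * d i x) ` I)" using fin by simp
      show "a i x \<in> (\<lambda>i. a i x + 2 * L * d i x) ` I" using i \<open>d i x = 0\<close> by force
      fix z assume "z \<in> (\<lambda>i. a i x + 2 * L * d i x) ` I"
      then obtain j where j: "j \<in> I" "z = a j x + 2 * L * d j x" by auto
      obtain y where y: "y \<in> T j" "d j x = dist x y"
        unfolding d_def using T[OF j(1)] infdist_attains_inf[of "T j" x] by (auto simp: compact_imp_closed)
      show "a i x \<le> z"
        using cross[OF i j(1) x y(1)] lip[OF j(1), of x y] j y by (simp add: abs_le_iff)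
    qed
    then show "u x = a i x" using bnd[OF i x] by (auto simp: u_def cut)
  qed
qed

subsection \<open>Boundary charts\<close>

text \<open>\<open>lip_const\<close> is an infimum; dividing by the distance shows that it is again
  a Lipschitz constant. It is at most \<open>M0\<close> because the supremum in the profile, finite
  by the Lipschitz property on a bounded set, is at least
  \<open>\<bar>g 0\<bar> = 0\<close>.\<close>

lemma lipschitz_profile_bound:
  fixes B :: "'a::real_normed_vector set"
  assumes g: "lipschitz_profile r0 M0 B g" and B: "bounded B" "0 \<in> B" and r0: "r0 > 0"
    and xy: "x \<in> B" "y \<in> B"
  shows "\<bar>g x - g y\<bar> \<le> M0 * dist x y"
proof -
  obtain L where L: "L-lipschitz_on B g" and g0: "g 0 = 0"
    and sup: "(SUP x\<in>B. \<bar>g x\<bar>) + r0 * lip_const B g \<le> M0 * r0"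
    using g unfolding lipschitz_profile_def by blast
  obtain b where b: "\<And>x. x \<in> B \<Longrightarrow> norm x \<le> b" using B(1) by (auto simp: bounded_iff)
  have L0: "0 \<le> L" using L by (simp add: lipschitz_on_def)
  have "\<bar>g x\<bar> \<le> L * b" if "x \<in> B" for x
  proof -
    have "\<bar>g x\<bar> \<le> L * norm x"
      using lipschitz_onD[OF L that B(2)] g0 by (simp add: dist_norm)
    also have "\<dots> \<le> L * b" using b[OF that] L0 by (rule mult_left_mono)
    finally show ?thesis .
  qed
  then have "bdd_above ((\<lambda>x. \<bar>g x\<bar>) ` B)" by (rule bdd_aboveI2)
  then have "0 \<le> (SUP x\<in>B. \<bar>g x\<bar>)"
    using cSUP_upper[OF B(2), of "\<lambda>x. \<bar>g x\<bar>"] g0 by simp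
  with sup have "r0 * lip_const B g \<le> M0 * r0" by linarith
  then have l: "lip_const B g \<le> M0" using r0 by (simp add: mult.commute)
  have "\<bar>g x - g y\<bar> \<le> lip_const B g * dist x y"
  proof (cases "x = y")
    case False
    have "\<bar>g x - g y\<bar> / dist x y \<le> lip_const B g" unfolding lip_const_def
    proof (rule cInf_greatest)
      show "{L. L-lipschitz_on B g} \<noteq> {}" using L by auto
      fix L' assume "L' \<in> {L. L-lipschitz_on B g}"
      then have "\<bar>g x - g y\<bar> \<le> L' * dist x y"
        using lipschitz_onD[of L' B g x y] xy by (simp add: dist_real_def)
      then show "\<bar>g x - g y\<bar> / dist x y \<le> L'" using False by (simp add: divide_le_eq)
    qed
    then show ?thesis using False by (simp add: divide_le_eq)
  qed simp
  also have "\<dots> \<le> M0 * dist x y" using l by (rule mult_right_mono) simp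
  finally show ?thesis .
qed

lemma norm_vec2: "norm (v :: real^2) = sqrt ((v$1)\<^sup>2 + (v$2)\<^sup>2)"
  by (simp add: norm_vec_def L2_set_def sum_2)

lemma norm_vec3: "norm (v :: real^3) = sqrt ((v$1)\<^sup>2 + (v$2)\<^sup>2 + (v$3)\<^sup>2)"
  by (simp add: norm_vec_def L2_set_def sum_3)

text \<open>In a chart centred at a point of the boundary the surface is the graph of a function over
  the plane orthogonal to \<open>\<nu>\<close>; the two properties below are all that is used of it.\<close>

definition graph_direction :: "(real^3) set \<Rightarrow> real \<Rightarrow> real \<Rightarrow> real \<Rightarrow> real^3 \<Rightarrow> real^3 \<Rightarrow> bool" where
  "graph_direction S r s M P \<nu> \<longleftrightarrow> norm \<nu> = 1 \<and>
     (\<forall>x\<in>S \<inter> ball P r. \<forall>z\<in>S \<inter> ball P r.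
        \<bar>(x - z) \<bullet> \<nu>\<bar> \<le> M * norm ((x - z) - ((x - z) \<bullet> \<nu>) *\<^sub>R \<nu>)) \<and>
     (\<forall>h. h \<bullet> \<nu> = 0 \<and> norm h < s \<longrightarrow> (\<exists>c. \<bar>c\<bar> \<le> M * norm h \<and> P + h + c *\<^sub>R \<nu> \<in> S))"

text \<open>Within the chart the boundary is exactly the graph: a point strictly below it has a
  neighbourhood in \<open>D\<close>, and a point on it can be moved upwards out of \<open>D\<close>.
  A base point \<open>h\<close> is lifted by at most \<open>M0 * norm h\<close>, so
  \<open>norm h < r0 / K\<close> keeps the lifted point in the ball where the chart is
  known.\<close>

lemma subgraph_graph_direction:
  fixes D :: "(real^3) set" and Q :: "real^3 \<Rightarrow> real^3"
  assumes D: "closed D" and r0: "r0 > 0" and M0: "M0 \<ge> 1" and K: "1 + M0 \<le> K" "K > 0"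
    and Q: "orthogonal_transformation Q"
    and g: "lipschitz_profile r0 M0 {z::real^2. \<bar>z$1\<bar> \<le> r0 \<and> \<bar>z$2\<bar> \<le> r0} g"
    and chart: "\<And>y. norm y < r0 \<Longrightarrow> P + Q y \<in> D \<longleftrightarrow> y$3 \<le> g (vector [y$1, y$2])"
  shows "graph_direction (frontier D) r0 (r0 / K) M0 P (Q (axis 3 1))"
proof -
  let ?B = "{z::real^2. \<bar>z$1\<bar> \<le> r0 \<and> \<bar>z$2\<bar> \<le> r0}"
  define p where "p = (\<lambda>y::real^3. vector [y$1, y$2] :: real^2)"
  define e :: "real^3" where "e = axis 3 1"
  have linQ: "linear Q" using Q by (simp add: orthogonal_transformation_def)
  have pB: "p y \<in> ?B" if "norm y < r0" for y :: "real^3"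
    using component_le_norm_cart[of y 1] component_le_norm_cart[of y 2] that by (simp add: p_def vector_2)
  have bB: "bounded ?B"
  proof (rule boundedI)
    fix z :: "real^2" assume "z \<in> ?B"
    then show "norm z \<le> 2 * r0" using norm_le_l1_cart[of z] by (simp add: sum_2)
  qed
  have gl: "\<bar>g x - g y\<bar> \<le> M0 * dist x y" if "x \<in> ?B" "y \<in> ?B" for x y
    using lipschitz_profile_bound[OF g bB _ r0 that] r0 by simp
  have g0: "g 0 = 0" using g by (simp add: lipschitz_profile_def)
  have dp: "dist (p y) (p z) = norm ((y - z) - ((y - z)$3) *\<^sub>R e)" for y z
    by (simp add: dist_norm norm_vec2 norm_vec3 p_def e_def vector_2 axis_def)
  have Qn: "norm (Q y) = norm y" for y using Q by (rule orthogonal_transformation_norm)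
  have fr: "P + Q y \<in> frontier D \<longleftrightarrow> y$3 = g (p y)" if y: "norm y < r0" for y
  proof
    assume f: "P + Q y \<in> frontier D"
    then have "P + Q y \<in> D" using D frontier_subset_closed by blast
    then have le: "y$3 \<le> g (p y)" using chart[OF y] by (simp add: p_def)
    show "y$3 = g (p y)"
    proof (rule ccontr)
      assume "y$3 \<noteq> g (p y)"
      \<comment> \<open>Passing from \<open>y\<close> to \<open>z\<close> changes the height by at
        most \<open>norm (y - z)\<close> and the profile by at most \<open>M0\<close> times the
        shift of the base point, for which the crude bound by twice the norm is used; hence
        \<open>1 + 2 * M0\<close>.\<close>
      define \<delta> where "\<delta> = (g (p y) - y$3) / (1 + 2 * M0)"
      have \<delta>: "\<delta> > 0" using le \<open>y$3 \<noteq> g (p y)\<close> M0 by (simp add: \<delta>_def)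
      have "ball (P + Q y) (min \<delta> (r0 - norm y)) \<subseteq> D"
      proof
        fix x assume x: "x \<in> ball (P + Q y) (min \<delta> (r0 - norm y))"
        obtain z where z: "x = P + Q z"
          using orthogonal_transformation_surj[OF Q] by (metis add.commute diff_add_cancel surj_def)
        have "dist (P + Q y) x = norm (y - z)"
          using Qn[of "y - z"] linQ by (simp add: z dist_norm linear_diff)
        then have d: "norm (y - z) < \<delta>" "norm (y - z) < r0 - norm y" using x by auto
        have zn: "norm z < r0" using d norm_triangle_ineq2[of z y] by (simp add: norm_minus_commute)
        have "\<bar>(y - z)$3\<bar> \<le> norm (y - z)" by (rule component_le_norm_cart)
        moreover have "dist (p y) (p z) \<le> 2 * norm (y - z)"
          unfolding dp using norm_triangle_ineq4[of "y - z" "((y - z)$3) *\<^sub>R e"] calculation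
          by (simp add: e_def)
        then have "M0 * dist (p y) (p z) \<le> M0 * (2 * norm (y - z))"
          using M0 by (intro mult_left_mono) simp_all
        then have "\<bar>g (p y) - g (p z)\<bar> \<le> M0 * (2 * norm (y - z))"
          using gl[OF pB[OF y] pB[OF zn]] by linarith
        ultimately have "g (p z) - z$3 \<ge> g (p y) - y$3 - (1 + 2 * M0) * norm (y - z)"
          by (simp add: distrib_right abs_le_iff)
        moreover have "(1 + 2 * M0) * norm (y - z) \<le> (1 + 2 * M0) * \<delta>"
          using d M0 by (intro mult_left_mono) simp_all
        moreover have "(1 + 2 * M0) * \<delta> = g (p y) - y$3" using M0 by (simp add: \<delta>_def)
        ultimately show "x \<in> D" using chart[OF zn] by (simp add: z p_def)
      qed
      moreover have "P + Q y \<in> ball (P + Q y) (min \<delta> (r0 - norm y))" using \<delta> y by simp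
      ultimately have "P + Q y \<in> interior D" by (meson interior_maximal open_ball subsetD)
      then show False using f by (simp add: frontier_def)
    qed
  next
    assume eq: "y$3 = g (p y)"
    then have inD: "P + Q y \<in> D" using chart[OF y] by (simp add: p_def)
    have "P + Q y \<notin> interior D"
    proof
      assume "P + Q y \<in> interior D"
      then obtain \<epsilon> where \<epsilon>: "\<epsilon> > 0" "ball (P + Q y) \<epsilon> \<subseteq> D" by (auto simp: mem_interior)
      define t where "t = min (\<epsilon> / 2) ((r0 - norm y) / 2)"
      have t: "t > 0" "t < \<epsilon>" "t < r0 - norm y" using \<epsilon> y by (auto simp: t_def min_def)
      have e1: "norm e = 1" by (simp add: e_def)
      have "P + Q (y + t *\<^sub>R e) \<in> ball (P + Q y) \<epsilon>"
        using t e1 Qn[of e] linQ by (simp add: dist_norm linear_add linear_scale)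
      then have "P + Q (y + t *\<^sub>R e) \<in> D" using \<epsilon> by blast
      moreover have "norm (y + t *\<^sub>R e) < r0" using norm_triangle_ineq[of y "t *\<^sub>R e"] t e1 by simp
      moreover have "p (y + t *\<^sub>R e) = p y" by (simp add: p_def e_def axis_def)
      moreover have "(y + t *\<^sub>R e)$3 = y$3 + t" by (simp add: e_def)
      ultimately show False using chart[of "y + t *\<^sub>R e"] eq t by (simp add: p_def)
    qed
    then show "P + Q y \<in> frontier D" using inD D by (simp add: frontier_def)
  qed
  define \<nu> where "\<nu> = Q e"
  have n1: "norm \<nu> = 1" using Qn[of e] by (simp add: \<nu>_def e_def)
  have in3: "Q y \<bullet> \<nu> = y$3" for y
    using Q by (simp add: \<nu>_def orthogonal_transformation_def e_def inner_axis)
  have slope: "\<bar>(x - z) \<bullet> \<nu>\<bar> \<le> M0 * norm ((x - z) - ((x - z) \<bullet> \<nu>) *\<^sub>R \<nu>)"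
    if x: "x \<in> frontier D \<inter> ball P r0" and z: "z \<in> frontier D \<inter> ball P r0" for x z
  proof -
    obtain a where a: "x = P + Q a"
      using orthogonal_transformation_surj[OF Q] by (metis add.commute diff_add_cancel surj_def)
    obtain b where b: "z = P + Q b"
      using orthogonal_transformation_surj[OF Q] by (metis add.commute diff_add_cancel surj_def)
    have an: "norm a < r0" and bn: "norm b < r0" using x z a b Qn by (auto simp: dist_norm)
    have xz: "x - z = Q (a - b)" using a b linQ by (simp add: linear_diff)
    have "norm ((x - z) - ((x - z) \<bullet> \<nu>) *\<^sub>R \<nu>) = norm (Q ((a - b) - ((a - b)$3) *\<^sub>R e))"
      unfolding xz in3 by (simp add: \<nu>_def linear_diff[OF linQ] linear_scale[OF linQ])
    also have "\<dots> = dist (p a) (p b)" by (simp only: Qn dp)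
    finally have eq: "norm ((x - z) - ((x - z) \<bullet> \<nu>) *\<^sub>R \<nu>) = dist (p a) (p b)" .
    have "a$3 = g (p a)" "b$3 = g (p b)" using fr an bn x z a b by auto
    then have "(x - z) \<bullet> \<nu> = g (p a) - g (p b)" unfolding xz in3 by simp
    then show ?thesis using eq gl[OF pB[OF an] pB[OF bn]] by simp
  qed
  have lift: "\<exists>c. \<bar>c\<bar> \<le> M0 * norm h \<and> P + h + c *\<^sub>R \<nu> \<in> frontier D"
    if h: "h \<bullet> \<nu> = 0" "norm h < r0 / K" for h
  proof -
    obtain a where a: "h = Q a" using orthogonal_transformation_surj[OF Q] by (metis surj_def)
    have a3: "a$3 = 0" using h a in3 by simp
    have na: "norm a = norm h" using a Qn by simp
    have hK: "norm h * K < r0" using h K by (simp add: less_divide_eq)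
    have hM: "(1 + M0) * norm h < r0"
      using hK mult_right_mono[OF K(1), of "norm h"] by (simp add: mult.commute)
    have M0h: "0 \<le> M0 * norm h" using M0 by simp
    have an: "norm a < r0" using hM M0h na by (simp add: algebra_simps)
    define c where "c = g (p a)"
    have "\<bar>c\<bar> \<le> M0 * dist (p a) 0"
      using gl[OF pB[OF an], of 0] g0 r0 by (simp add: c_def)
    also have "dist (p a) 0 = norm a" by (simp add: norm_vec2 norm_vec3 p_def a3 vector_2)
    finally have c: "\<bar>c\<bar> \<le> M0 * norm h" using na by simp
    have "norm (a + c *\<^sub>R e) \<le> norm a + \<bar>c\<bar>"
      using norm_triangle_ineq[of a "c *\<^sub>R e"] by (simp add: e_def)
    then have "norm (a + c *\<^sub>R e) < r0" using c na hM by (simp add: algebra_simps)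
    moreover have "p (a + c *\<^sub>R e) = p a" by (simp add: p_def e_def axis_def)
    moreover have "(a + c *\<^sub>R e)$3 = c" by (simp add: e_def a3)
    ultimately have "P + Q (a + c *\<^sub>R e) \<in> frontier D" using fr by (simp add: c_def)
    moreover have "P + Q (a + c *\<^sub>R e) = P + h + c *\<^sub>R \<nu>"
      using linQ by (simp add: a \<nu>_def linear_add linear_scale)
    ultimately show ?thesis using c by auto
  qed
  show ?thesis
    unfolding graph_direction_def using n1 slope lift by (auto simp: \<nu>_def e_def)
qed

text \<open>Each polytope of the decomposition spans the same plane as \<open>F\<close>, so its
  relative interior lies in \<open>rel_interior F\<close>; and a convex closed set is the closure of
  its relative interior.\<close>

lemma plane_polygonal_region_closure:
  assumes "plane_polygonal_region F"
  shows "closed F" "bounded F" "closure (rel_interior F) = F"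
    and "\<exists>\<P>. finite \<P> \<and> F = \<Union>\<P> \<and> (\<forall>P\<in>\<P>. convex P \<and> closed P)"
proof -
  obtain \<P> where \<P>: "finite \<P>" "F = \<Union>\<P>" "\<And>P. P \<in> \<P> \<Longrightarrow> polytope P" "\<And>P. P \<in> \<P> \<Longrightarrow> aff_dim P = 2"
    and F2: "aff_dim F = 2"
    using assms unfolding plane_polygonal_region_def by blast
  show c: "closed F" using \<P> by (auto intro: closed_Union polytope_imp_closed)
  show "bounded F" using \<P> by (auto intro: bounded_Union polytope_imp_bounded)
  show "closure (rel_interior F) = F"
  proof
    show "closure (rel_interior F) \<subseteq> F" using c rel_interior_subset closure_minimal by blast
    show "F \<subseteq> closure (rel_interior F)"
    proof
      fix x assume "x \<in> F"
      then obtain P where P: "P \<in> \<P>" "x \<in> P" using \<P> by blast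
      have PF: "P \<subseteq> F" using P \<P> by blast
      have "affine hull P = affine hull F" using aff_dim_eq_full_gen[OF PF] \<P>(4)[OF P(1)] F2 by simp
      then have "rel_interior P \<subseteq> rel_interior F" by (rule subset_rel_interior[OF PF])
      moreover have "x \<in> closure (rel_interior P)"
        using convex_closure_rel_interior[OF polytope_imp_convex[OF \<P>(3)[OF P(1)]]] P(2) closure_subset by blast
      ultimately show "x \<in> closure (rel_interior F)" using closure_mono by blast
    qed
  qed
  show "\<exists>\<P>. finite \<P> \<and> F = \<Union>\<P> \<and> (\<forall>P\<in>\<P>. convex P \<and> closed P)"
    using \<P> by (auto intro!: exI[of _ \<P>] polytope_imp_convex polytope_imp_closed)
qed

text \<open>\<open>a\<close> and \<open>b\<close> are coordinates in the plane of \<open>F\<close>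
  with origin \<open>P\<close>. The closed epigraph describes \<open>F\<close> only on the open
  rectangle, because its points have to be approached within the chart.\<close>

definition face_chart :: "(real^3) set \<Rightarrow> real \<Rightarrow> real \<Rightarrow> real^3 \<Rightarrow> real^3 \<Rightarrow> real^3 \<Rightarrow> (real \<Rightarrow> real) \<Rightarrow> bool" where
  "face_chart F r M P E1 E2 g \<longleftrightarrow> orthonormal_pair E1 E2 \<and>
     (\<forall>x. x \<in> affine hull F \<longleftrightarrow> (\<exists>a b. x = P + a *\<^sub>R E1 + b *\<^sub>R E2)) \<and> g 0 = 0 \<and>
     (\<forall>a b. \<bar>a\<bar> \<le> r \<and> \<bar>b\<bar> \<le> r \<longrightarrow> \<bar>g a - g b\<bar> \<le> M * \<bar>a - b\<bar>) \<and>
     (\<forall>a b. \<bar>a\<bar> \<le> r \<and> \<bar>b\<bar> \<le> 2 * M * r \<longrightarrow> (P + a *\<^sub>R E1 + b *\<^sub>R E2 \<in> rel_interior F \<longleftrightarrow> g a < b)) \<and>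
     (\<forall>a b. \<bar>a\<bar> < r \<and> \<bar>b\<bar> < 2 * M * r \<longrightarrow> (P + a *\<^sub>R E1 + b *\<^sub>R E2 \<in> F \<longleftrightarrow> g a \<le> b))"

text \<open>The hypothesis describes only the relative interior. Since \<open>F\<close> is its
  closure, passing to limits turns the strict inequality into the weak one; the Lipschitz bound of
  \<open>g\<close> excludes limits strictly below the graph.\<close>

lemma face_lipschitz_chart:
  assumes F: "plane_polygonal_region F" and lip: "face_lipschitz r0 M0 F" and r0: "r0 > 0" and M0: "M0 \<ge> 1"
    and P: "P \<in> rel_frontier F"
  shows "\<exists>E1 E2 g. face_chart F r0 M0 P E1 E2 g"
proof -
  note cl = plane_polygonal_region_closure[OF F]
  obtain p and L :: "real^2 \<Rightarrow> real^3" where L: "linear L" "\<And>y. norm (L y) = norm y"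
    and rng: "range (\<lambda>y. p + L y) = affine hull F"
    and bd: "lipschitz_boundary2 r0 M0 {y. p + L y \<in> rel_interior F}"
    using lip unfolding face_lipschitz_def by blast
  let ?U = "{y. p + L y \<in> rel_interior F}"
  have PF: "P \<in> F" "P \<notin> rel_interior F" using P cl(1) by (auto simp: rel_frontier_def)
  then obtain y0 where y0: "P = p + L y0" using rng hull_subset[of F affine] by blast
  have ds: "dist (p + L y) (p + L z) = dist y z" for y z
    using L(2)[of "y - z"] by (simp add: dist_norm linear_diff[OF L(1)])
  have "y0 \<in> closure ?U"
    unfolding closure_approachable
  proof (intro allI impI)
    fix e :: real assume "e > 0"
    then obtain x where x: "x \<in> rel_interior F" "dist x P < e"
      using PF(1) cl(3) closure_approachable by blast
    then obtain y where y: "x = p + L y" using rng rel_interior_subset hull_subset[of F affine] by blast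
    show "\<exists>y\<in>?U. dist y y0 < e" using x y ds y0 by auto
  qed
  moreover have "y0 \<notin> interior ?U" using interior_subset PF y0 by blast
  ultimately have "y0 \<in> frontier ?U" by (simp add: frontier_def)
  then obtain Q :: "real^2 \<Rightarrow> real^2" and g :: "real \<Rightarrow> real" where Q: "orthogonal_transformation Q"
    and g: "lipschitz_profile r0 M0 {-r0..r0} g"
    and ch: "\<And>y. \<bar>y$1\<bar> \<le> r0 \<Longrightarrow> \<bar>y$2\<bar> \<le> 2 * M0 * r0 \<Longrightarrow> y0 + Q y \<in> ?U \<longleftrightarrow> y$2 > g (y$1)"
    using bd unfolding lipschitz_boundary2_def by metis
  define E1 where "E1 = L (Q (axis 1 1))"
  define E2 where "E2 = L (Q (axis 2 1))"
  have linQ: "linear Q" using Q by (simp add: orthogonal_transformation_def)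
  have y2: "y = y$1 *\<^sub>R axis 1 1 + y$2 *\<^sub>R axis 2 1" for y :: "real^2"
    by (simp add: vec_eq_iff forall_2 axis_def)
  have pt: "p + L (y0 + Q y) = P + y$1 *\<^sub>R E1 + y$2 *\<^sub>R E2" for y
  proof -
    have "Q y = y$1 *\<^sub>R Q (axis 1 1) + y$2 *\<^sub>R Q (axis 2 1)"
      using arg_cong[OF y2[of y], of Q] by (simp add: linear_add[OF linQ] linear_scale[OF linQ])
    then show ?thesis by (simp add: y0 E1_def E2_def linear_add[OF L(1)] linear_scale[OF L(1)])
  qed
  have vecy: "(vector [a, b] :: real^2) $ 1 = a" "(vector [a, b] :: real^2) $ 2 = b" for a b :: real
    by (simp_all add: vector_2)
  have ort: "orthonormal_pair E1 E2"
  proof -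
    have nL: "norm (L (Q y)) = norm y" for y using L(2) orthogonal_transformation_norm[OF Q] by simp
    have "norm E1 = 1" "norm E2 = 1" by (simp_all add: E1_def E2_def nL)
    moreover have "norm (E1 + E2) = norm (axis 1 1 + axis 2 1 :: real^2)"
      using nL[of "axis 1 1 + axis 2 1"] by (simp add: E1_def E2_def linear_add[OF linQ] linear_add[OF L(1)])
    then have "norm (E1 + E2) = sqrt 2" by (simp add: norm_vec2 axis_def)
    then have "(E1 + E2) \<bullet> (E1 + E2) = 2" by (simp add: dot_square_norm)
    moreover have "E1 \<bullet> E1 = 1" "E2 \<bullet> E2 = 1" using \<open>norm E1 = 1\<close> \<open>norm E2 = 1\<close> by (simp_all add: dot_square_norm)
    ultimately show ?thesis by (simp add: orthonormal_pair_def inner_simps inner_commute)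
  qed
  have hull: "x \<in> affine hull F \<longleftrightarrow> (\<exists>a b. x = P + a *\<^sub>R E1 + b *\<^sub>R E2)" for x
  proof
    assume "x \<in> affine hull F"
    then obtain z where z: "x = p + L z" using rng by blast
    obtain y where "z - y0 = Q y" using orthogonal_transformation_surj[OF Q] by (metis surj_def)
    then have "x = p + L (y0 + Q y)" using z by (metis add.commute diff_add_cancel)
    then show "\<exists>a b. x = P + a *\<^sub>R E1 + b *\<^sub>R E2" using pt by blast
  next
    assume "\<exists>a b. x = P + a *\<^sub>R E1 + b *\<^sub>R E2"
    then obtain a b where "x = p + L (y0 + Q (vector [a, b]))" using pt vecy by metis
    then show "x \<in> affine hull F" using rng by blast
  qed
  have gl: "\<bar>g a - g b\<bar> \<le> M0 * \<bar>a - b\<bar>" if "\<bar>a\<bar> \<le> r0" "\<bar>b\<bar> \<le> r0" for a b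
    using lipschitz_profile_bound[OF g, of a b] that r0 by (simp add: dist_real_def abs_le_iff)
  have g0: "g 0 = 0" using g by (simp add: lipschitz_profile_def)
  have ri: "P + a *\<^sub>R E1 + b *\<^sub>R E2 \<in> rel_interior F \<longleftrightarrow> g a < b" if "\<bar>a\<bar> \<le> r0" "\<bar>b\<bar> \<le> 2 * M0 * r0" for a b
    using ch[of "vector [a, b]"] pt[of "vector [a, b]"] that vecy by simp
  have inF: "P + a *\<^sub>R E1 + b *\<^sub>R E2 \<in> F \<longleftrightarrow> g a \<le> b" if ab: "\<bar>a\<bar> < r0" "\<bar>b\<bar> < 2 * M0 * r0" for a b
  proof
    assume x: "P + a *\<^sub>R E1 + b *\<^sub>R E2 \<in> F"
    show "g a \<le> b"
    proof (rule ccontr)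
      assume "\<not> g a \<le> b"
      \<comment> \<open>Within distance \<open>e\<close> neither coordinate leaves the rectangle,
        and \<open>g\<close> minus the second coordinate changes by less than
        \<open>(1 + M0) * e\<close>, too little to close the gap.\<close>
      define e where "e = Min {(g a - b) / (1 + M0), r0 - \<bar>a\<bar>, 2 * M0 * r0 - \<bar>b\<bar>}"
      have e: "e > 0" "e \<le> (g a - b) / (1 + M0)" "e \<le> r0 - \<bar>a\<bar>" "e \<le> 2 * M0 * r0 - \<bar>b\<bar>"
        using \<open>\<not> g a \<le> b\<close> ab M0 by (auto simp: e_def)
      obtain z where z: "z \<in> rel_interior F" "dist z (P + a *\<^sub>R E1 + b *\<^sub>R E2) < e"
        using x cl(3) closure_approachable e(1) by blast
      then obtain a' b' where z': "z = P + a' *\<^sub>R E1 + b' *\<^sub>R E2"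
        using hull rel_interior_subset hull_subset[of F affine] by blast
      have "z - (P + a *\<^sub>R E1 + b *\<^sub>R E2) = (a' - a) *\<^sub>R E1 + (b' - b) *\<^sub>R E2"
        by (simp add: z' algebra_simps)
      then have n: "norm ((a' - a) *\<^sub>R E1 + (b' - b) *\<^sub>R E2) < e" using z by (simp add: dist_norm)
      have "\<bar>((a' - a) *\<^sub>R E1 + (b' - b) *\<^sub>R E2) \<bullet> E1\<bar> \<le> norm ((a' - a) *\<^sub>R E1 + (b' - b) *\<^sub>R E2)"
        "\<bar>((a' - a) *\<^sub>R E1 + (b' - b) *\<^sub>R E2) \<bullet> E2\<bar> \<le> norm ((a' - a) *\<^sub>R E1 + (b' - b) *\<^sub>R E2)"
        using ort Cauchy_Schwarz_ineq2[of _ E1] Cauchy_Schwarz_ineq2[of _ E2] by (simp_all add: orthonormal_pair_def)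
      moreover have "E1 \<bullet> E1 = 1" "E2 \<bullet> E2 = 1" "E1 \<bullet> E2 = 0" "E2 \<bullet> E1 = 0"
        using ort by (simp_all add: orthonormal_pair_def dot_square_norm inner_commute)
      ultimately have d: "\<bar>a' - a\<bar> < e" "\<bar>b' - b\<bar> < e" using n by (simp_all add: inner_simps)
      then have ab': "\<bar>a'\<bar> \<le> r0" "\<bar>b'\<bar> \<le> 2 * M0 * r0" using e by linarith+
      have "g a' < b'" using ri[OF ab'] z z' by simp
      moreover have "\<bar>g a' - g a\<bar> \<le> M0 * \<bar>a' - a\<bar>" using gl ab' ab by simp
      moreover have "M0 * \<bar>a' - a\<bar> \<le> M0 * e" using d M0 by (intro mult_left_mono) auto
      moreover have "(1 + M0) * e \<le> g a - b" using e(2) M0 by (simp add: field_simps)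
      ultimately show False using d by (simp add: distrib_right)
    qed
  next
    assume gb: "g a \<le> b"
    show "P + a *\<^sub>R E1 + b *\<^sub>R E2 \<in> F"
    proof -
      have "P + a *\<^sub>R E1 + b *\<^sub>R E2 \<in> closure (rel_interior F)"
        unfolding closure_approachable
      proof (intro allI impI)
        fix e :: real assume "e > 0"
        define t where "t = min (e / 2) (2 * M0 * r0 - \<bar>b\<bar>)"
        have t: "0 < t" "t < e" "t \<le> 2 * M0 * r0 - \<bar>b\<bar>" using \<open>e > 0\<close> ab by (auto simp: t_def)
        have "P + a *\<^sub>R E1 + (b + t) *\<^sub>R E2 \<in> rel_interior F"
          using ri[of a "b + t"] t ab gb by linarith
        moreover have "dist (P + a *\<^sub>R E1 + (b + t) *\<^sub>R E2) (P + a *\<^sub>R E1 + b *\<^sub>R E2) = t"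
          using ort t by (simp add: dist_norm orthonormal_pair_def scaleR_add_left)
        ultimately show "\<exists>y\<in>rel_interior F. dist y (P + a *\<^sub>R E1 + b *\<^sub>R E2) < e" using t by metis
      qed
      then show ?thesis using cl by simp
    qed
  qed
  show ?thesis
    unfolding face_chart_def using ort hull g0 gl ri inF by blast
qed

lemma norm_orthogonal_part_le:
  fixes v \<nu> :: "'a::real_inner"
  assumes "norm \<nu> = 1"
  shows "norm (v - (v \<bullet> \<nu>) *\<^sub>R \<nu>) \<le> norm v" "norm v \<le> norm (v - (v \<bullet> \<nu>) *\<^sub>R \<nu>) + \<bar>v \<bullet> \<nu>\<bar>"
proof -
  have "\<nu> \<bullet> \<nu> = 1" using assms by (simp add: dot_square_norm)
  then have "(norm (v - (v \<bullet> \<nu>) *\<^sub>R \<nu>))\<^sup>2 = (norm v)\<^sup>2 - (v \<bullet> \<nu>)\<^sup>2"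
    unfolding power2_norm_eq_inner by (simp add: inner_simps power2_eq_square inner_commute)
  then have "(norm (v - (v \<bullet> \<nu>) *\<^sub>R \<nu>))\<^sup>2 \<le> (norm v)\<^sup>2" by simp
  then show "norm (v - (v \<bullet> \<nu>) *\<^sub>R \<nu>) \<le> norm v" by (rule power2_le_imp_le) simp
  show "norm v \<le> norm (v - (v \<bullet> \<nu>) *\<^sub>R \<nu>) + \<bar>v \<bullet> \<nu>\<bar>"
    using norm_triangle_ineq[of "v - (v \<bullet> \<nu>) *\<^sub>R \<nu>" "(v \<bullet> \<nu>) *\<^sub>R \<nu>"] assms by simp
qed

text \<open>\<open>K\<close> is any bound of \<open>1 + M0\<close>. Estimates are expressed through \<open>K\<close>, as \<open>M0\<close> will in turn be bounded
  by \<open>M1\<close>.\<close>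

locale poly_setting =
  fixes \<Omega> D :: "(real^3) set" and \<F> :: "(real^3) set set" and r0 M1 \<theta>0 M0 K :: real
  assumes r0: "r0 > 0" and M0: "M0 \<ge> 1" and K: "1 + M0 \<le> K" and \<theta>0: "0 < \<theta>0" "\<theta>0 < pi / 2"
    and dom: "ambient_domain r0 M1 \<Omega>"
    and cls: "(D, \<F>) \<in> polyhedral_class \<Omega> r0 M1 \<theta>0 M0"
begin

section \<open>Membership in the class and the local shape of the boundary\<close>

lemma K2: "K \<ge> 2" "K > 0" "M0 < K" using K M0 by auto

lemma poly: "closed D" "D homeomorphic (cball 0 1 :: (real^3) set)" "finite \<F>" "frontier D = \<Union>\<F>"
    "\<And>F. F \<in> \<F> \<Longrightarrow> plane_polygonal_region F" "D \<subseteq> \<Omega>" "setdist D (frontier \<Omega>) \<ge> r0"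
    "\<And>F G. F \<in> \<F> \<Longrightarrow> G \<in> \<F> \<Longrightarrow> F \<noteq> G \<Longrightarrow> rel_interior F \<inter> rel_interior G = {}"
    "\<And>F. F \<in> \<F> \<Longrightarrow> face_lipschitz r0 M0 F" "lipschitz_boundary3 r0 M0 (\<Omega> - D)"
    "\<And>\<sigma>. \<sigma> \<in> edges \<F> \<Longrightarrow> \<exists>\<alpha>\<in>admissible_angles \<theta>0. dihedral_angle D \<sigma> \<alpha>"
    "\<And>F v. F \<in> \<F> \<Longrightarrow> v \<in> vertices \<F> \<Longrightarrow> v \<in> F \<Longrightarrow> \<exists>\<alpha>\<in>admissible_angles \<theta>0. internal_angle F v \<alpha>"
    "\<And>\<sigma>. \<sigma> \<in> edges \<F> \<Longrightarrow> diameter \<sigma> \<ge> r0"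
  using cls by (auto simp: polyhedral_class_def is_polyhedron_def pairwise_def)

lemmas face_closed = plane_polygonal_region_closure(1)[OF poly(5)]
  and face_bounded = plane_polygonal_region_closure(2)[OF poly(5)]
  and face_closure = plane_polygonal_region_closure(3)[OF poly(5)]
  and face_pieces = plane_polygonal_region_closure(4)[OF poly(5)]

lemma face_frontier: "F \<in> \<F> \<Longrightarrow> rel_frontier F = F - rel_interior F"
  using face_closed by (simp add: rel_frontier_def)

lemma face_subset: "F \<in> \<F> \<Longrightarrow> F \<subseteq> frontier D" "F \<in> \<F> \<Longrightarrow> F \<subseteq> D"
  using poly(1,4) frontier_subset_closed by blast+

lemma compact_frontier_D: "compact (frontier D)"
  using dom poly(6) bounded_subset compact_frontier_bounded unfolding ambient_domain_def by blast

lemma face_chart_exists: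
  assumes "F \<in> \<F>" "P \<in> rel_frontier F"
  obtains E1 E2 g where "face_chart F r0 M0 P E1 E2 g"
  using face_lipschitz_chart[OF poly(5)[OF assms(1)] poly(9)[OF assms(1)] r0 M0 assms(2)] by blast

text \<open>A ball of radius \<open>r0\<close> about a point of \<open>D\<close> that left \<Omega>
  would by connectedness meet the boundary of \<Omega>. Hence near \<open>D\<close> the charts of
  \<open>\<Omega> - D\<close> are charts of \<open>D\<close>.\<close>

lemma frontier_D_complement:
  assumes P: "P \<in> frontier D"
  shows "ball P r0 \<subseteq> \<Omega>" "P \<in> frontier (\<Omega> - D)"
proof -
  have PD: "P \<in> D" using P poly(1) frontier_subset_closed by blast
  show ball: "ball P r0 \<subseteq> \<Omega>"
  proof (rule ccontr)
    assume "\<not> ball P r0 \<subseteq> \<Omega>"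
    moreover have "P \<in> ball P r0 \<inter> \<Omega>" using r0 PD poly(6) by auto
    ultimately have "ball P r0 \<inter> frontier \<Omega> \<noteq> {}"
      using connected_Int_frontier[OF connected_ball[of P r0], of \<Omega>] by blast
    then obtain z where z: "dist P z < r0" "z \<in> frontier \<Omega>" by auto
    then have "setdist D (frontier \<Omega>) \<le> dist P z" using PD by (intro setdist_le_dist)
    then show False using z poly(7) by linarith
  qed
  have "P \<in> closure (\<Omega> - D)" unfolding closure_approachable
  proof (intro allI impI)
    fix e :: real assume e: "e > 0"
    have "P \<in> closure (- D)" using P by (simp add: frontier_closures)
    then obtain y where "y \<in> - D" "dist y P < min e r0"
      unfolding closure_approachable using e r0 by (metis min_less_iff_conj)
    moreover from this have "y \<in> \<Omega>" using ball by (auto simp: dist_commute)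
    ultimately show "\<exists>y\<in>\<Omega> - D. dist y P < e" by auto
  qed
  then show "P \<in> frontier (\<Omega> - D)" using PD interior_subset by (auto simp: frontier_def)
qed

lemma graph_direction_exists:
  assumes P: "P \<in> frontier D"
  obtains \<nu> where "graph_direction (frontier D) r0 (r0 / K) M0 P \<nu>"
proof -
  note ball = frontier_D_complement(1)[OF P]
  obtain Q :: "real^3 \<Rightarrow> real^3" and g where Q: "orthogonal_transformation Q"
    and g: "lipschitz_profile r0 M0 {z::real^2. \<bar>z$1\<bar> \<le> r0 \<and> \<bar>z$2\<bar> \<le> r0} g"
    and ch: "\<forall>y. \<bar>y$1\<bar> \<le> r0 \<and> \<bar>y$2\<bar> \<le> r0 \<and> \<bar>y$3\<bar> \<le> 2 * M0 * r0 \<longrightarrow>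
      (P + Q y \<in> \<Omega> - D \<longleftrightarrow> y$3 > g (vector [y$1, y$2]))"
    using bspec[OF poly(10)[unfolded lipschitz_boundary3_def] frontier_D_complement(2)[OF P]] by blast
  have chart: "P + Q y \<in> D \<longleftrightarrow> y$3 \<le> g (vector [y$1, y$2])" if y: "norm y < r0" for y
  proof -
    \<comment> \<open>The ball of radius \<open>r0\<close> lies in the chart cylinder, whose half
      height \<open>2 * M0 * r0\<close> is at least \<open>r0\<close>, and it lies in \<Omega>; so
      belonging to \<open>\<Omega> - D\<close> means not belonging to \<open>D\<close>.\<close>
    have "r0 \<le> 2 * M0 * r0" using M0 r0 by simp
    then have "P + Q y \<in> \<Omega> - D \<longleftrightarrow> y$3 > g (vector [y$1, y$2])"
      using component_le_norm_cart[of y 1] component_le_norm_cart[of y 2] component_le_norm_cart[of y 3] y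
      by (intro ch[rule_format] conjI) linarith+
    moreover have "P + Q y \<in> \<Omega>"
      using y ball orthogonal_transformation_norm[OF Q] by (auto simp: dist_norm subset_iff)
    ultimately show ?thesis by auto
  qed
  show thesis
    by (rule that[OF subgraph_graph_direction[OF poly(1) r0 M0 K K2(2) Q g chart]])
qed

text \<open>The plane of a flat disc in the boundary is transversal to \<nu>, since a graph contains
  no vertical segment. Sliding a boundary point \<open>x\<close> along \<nu> into the plane ends in
  the disc if \<open>x\<close> is near enough, and a vertical line carries only one boundary point,
  so \<open>x\<close> was in the plane already.\<close>

lemma frontier_flat:
  assumes P: "P \<in> frontier D" and N: "N \<noteq> 0" and s: "s \<le> r0"
    and flat: "\<And>y. dist P y < s \<Longrightarrow> N \<bullet> (y - P) = 0 \<Longrightarrow> y \<in> frontier D"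
    and x: "x \<in> frontier D" "K * dist P x < s"
  shows "N \<bullet> (x - P) = 0"
proof -
  obtain \<nu> where "graph_direction (frontier D) r0 (r0 / K) M0 P \<nu>"
    using graph_direction_exists[OF P] .
  then have n1: "norm \<nu> = 1"
    and slope: "\<And>x z. x \<in> frontier D \<Longrightarrow> dist P x < r0 \<Longrightarrow> z \<in> frontier D \<Longrightarrow> dist P z < r0 \<Longrightarrow>
      \<bar>(x - z) \<bullet> \<nu>\<bar> \<le> M0 * norm ((x - z) - ((x - z) \<bullet> \<nu>) *\<^sub>R \<nu>)"
    unfolding graph_direction_def by auto
  have \<nu>\<nu>: "\<nu> \<bullet> \<nu> = 1" using n1 by (simp add: dot_square_norm)
  have "0 \<le> K * dist P x" using K2 by simp
  then have s0: "s > 0" using x by linarith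
  have N\<nu>: "N \<bullet> \<nu> \<noteq> 0"
  proof
    assume "N \<bullet> \<nu> = 0"
    then have "P + (s / 2) *\<^sub>R \<nu> \<in> frontier D" using s0 n1 by (intro flat) (auto simp: dist_norm)
    then have "\<bar>(P + (s / 2) *\<^sub>R \<nu> - P) \<bullet> \<nu>\<bar> \<le> M0 * norm ((P + (s / 2) *\<^sub>R \<nu> - P) - ((P + (s / 2) *\<^sub>R \<nu> - P) \<bullet> \<nu>) *\<^sub>R \<nu>)"
      using s0 s n1 P r0 by (intro slope) (auto simp: dist_norm)
    then show False using \<nu>\<nu> s0 by simp
  qed
  define c where "c = (N \<bullet> (x - P)) / (N \<bullet> \<nu>)"
  define w where "w = x - P - c *\<^sub>R \<nu>"
  have Nw: "N \<bullet> w = 0" using N\<nu> by (simp add: w_def c_def inner_simps)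
  define pw where "pw = w - (w \<bullet> \<nu>) *\<^sub>R \<nu>"
  have pw: "pw = (x - P) - ((x - P) \<bullet> \<nu>) *\<^sub>R \<nu>"
    using \<nu>\<nu> by (simp add: pw_def w_def inner_simps algebra_simps)
  have wle: "\<bar>w \<bullet> \<nu>\<bar> \<le> M0 * norm pw"
  proof -
    \<comment> \<open>\<open>w\<close> may be longer than the disc allows. The slope inequality is
      homogeneous, so it is read off from a short multiple of \<open>w\<close>; only with it does
      \<open>norm w < s\<close> follow.\<close>
    define t where "t = s / (2 * (norm w + 1))"
    have t0: "t > 0" using s0 by (simp add: t_def add_nonneg_pos)
    have "t * norm w < s"
    proof -
      have "t * norm w = s * (norm w / (2 * (norm w + 1)))" by (simp add: t_def)
      also have "\<dots> < s * 1" using s0 by (intro mult_strict_left_mono) (auto simp: divide_less_eq add_nonneg_pos intro: add_nonneg_pos less_le_trans)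
      finally show ?thesis by simp
    qed
    then have ts: "dist P (P + t *\<^sub>R w) < s" using t0 by (simp add: dist_norm)
    then have "P + t *\<^sub>R w \<in> frontier D" using Nw by (intro flat) auto
    then have "\<bar>(P + t *\<^sub>R w - P) \<bullet> \<nu>\<bar> \<le> M0 * norm ((P + t *\<^sub>R w - P) - ((P + t *\<^sub>R w - P) \<bullet> \<nu>) *\<^sub>R \<nu>)"
      using ts s P r0 by (intro slope) auto
    then have "t * \<bar>w \<bullet> \<nu>\<bar> \<le> M0 * norm (t *\<^sub>R pw)"
      using t0 by (simp add: pw_def abs_mult scaleR_diff_right)
    then have "t * \<bar>w \<bullet> \<nu>\<bar> \<le> t * (M0 * norm pw)" using t0 by (simp add: mult.left_commute)
    then show ?thesis using t0 by simp
  qed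
  have "norm w \<le> norm pw + \<bar>w \<bullet> \<nu>\<bar>" unfolding pw_def by (rule norm_orthogonal_part_le(2)[OF n1])
  also have "\<dots> \<le> (1 + M0) * norm pw" using wle by (simp add: distrib_right)
  also have "\<dots> \<le> K * dist P x"
    unfolding pw using norm_orthogonal_part_le(1)[OF n1, of "x - P"] K M0
    by (intro mult_mono) (auto simp: dist_norm norm_minus_commute)
  finally have ws: "norm w < s" using x(2) by simp
  have xs: "dist P x < s" using x(2) K2 mult_right_mono[of 1 K "dist P x"] by simp
  have "P + w \<in> frontier D" using ws Nw by (intro flat) (auto simp: dist_norm)
  then have "\<bar>(x - (P + w)) \<bullet> \<nu>\<bar> \<le> M0 * norm ((x - (P + w)) - ((x - (P + w)) \<bullet> \<nu>) *\<^sub>R \<nu>)"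
    using ws xs s x by (intro slope) (auto simp: dist_norm)
  moreover have "x - (P + w) = c *\<^sub>R \<nu>" by (simp add: w_def)
  ultimately have "c = 0" using \<nu>\<nu> by simp
  then show ?thesis using N\<nu> by (simp add: c_def)
qed

lemma face_normal:
  assumes "F \<in> \<F>" "x \<in> F"
  obtains N where "N \<noteq> 0" "\<And>y. y \<in> affine hull F \<longleftrightarrow> N \<bullet> (y - x) = 0"
proof -
  have "aff_dim F = int (DIM(real^3) - 1)" using poly(5)[OF assms(1)] by (simp add: plane_polygonal_region_def)
  then obtain N b where N: "N \<noteq> 0" "affine hull F = {x. N \<bullet> x = b}"
    using aff_dim_eq_hyperplane by blast
  have "N \<bullet> x = b" using assms(2) hull_subset[of F affine] N(2) by auto
  then show thesis using that[of N] N by (auto simp: inner_simps)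
qed

text \<open>About a relatively interior point the face fills a disc of its plane;
  \<open>frontier_flat\<close> confines the boundary to that plane, hence to the disc.\<close>

lemma frontier_near_rel_interior:
  assumes F: "F \<in> \<F>" and x: "x \<in> rel_interior F"
  obtains \<delta> where "\<delta> > 0" "frontier D \<inter> ball x \<delta> \<subseteq> rel_interior F"
proof -
  obtain \<epsilon> where \<epsilon>: "\<epsilon> > 0" "ball x \<epsilon> \<inter> affine hull F \<subseteq> F" and xF: "x \<in> F"
    using x by (auto simp: mem_rel_interior_ball)
  obtain N where N: "N \<noteq> 0" "\<And>y. y \<in> affine hull F \<longleftrightarrow> N \<bullet> (y - x) = 0" using face_normal[OF F xF] by blast
  define s where "s = min \<epsilon> r0"
  have s: "s > 0" "s \<le> \<epsilon>" "s \<le> r0" using \<epsilon> r0 by (auto simp: s_def)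
  show thesis
  proof (rule that)
    show "s / K > 0" using s K2 by simp
    show "frontier D \<inter> ball x (s / K) \<subseteq> rel_interior F"
    proof
      fix z assume z: "z \<in> frontier D \<inter> ball x (s / K)"
      then have zK: "K * dist x z < s" using K2 by (simp add: less_divide_eq mult.commute)
      have "N \<bullet> (z - x) = 0"
      proof (rule frontier_flat[OF _ N(1) s(3) _ _ zK])
        show "x \<in> frontier D" using xF face_subset[OF F] by blast
        show "z \<in> frontier D" using z by simp
        fix y assume "dist x y < s" "N \<bullet> (y - x) = 0"
        then have "y \<in> F" using \<epsilon>(2) N(2) s by (auto simp: subset_iff)
        then show "y \<in> frontier D" using face_subset[OF F] by blast
      qed
      then have zh: "z \<in> affine hull F" using N by simp
      have "dist x z < s" using zK K2 mult_right_mono[of 1 K "dist x z"] by simp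
      then have zd: "dist x z < \<epsilon>" using s by simp
      then have "z \<in> F" using zh \<epsilon> by auto
      moreover have "ball z (\<epsilon> - dist x z) \<inter> affine hull F \<subseteq> F"
      proof
        fix y assume y: "y \<in> ball z (\<epsilon> - dist x z) \<inter> affine hull F"
        then have "dist x y < \<epsilon>" using dist_triangle[of x y z] by simp
        then show "y \<in> F" using y \<epsilon> by auto
      qed
      ultimately show "z \<in> rel_interior F" unfolding mem_rel_interior_ball using zd by (auto intro!: exI[of _ "\<epsilon> - dist x z"])
    qed
  qed
qed

text \<open>A point of \<open>G\<close> is a limit of relatively interior points of
  \<open>G\<close>. If it were relatively interior to \<open>F\<close>, nearby boundary points would
  be so too, against the disjointness of the relative interiors.\<close>

lemma rel_interior_disjoint:
  assumes "F \<in> \<F>" "G \<in> \<F>" "F \<noteq> G"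
  shows "rel_interior F \<inter> G = {}"
proof (rule ccontr)
  assume "rel_interior F \<inter> G \<noteq> {}"
  then obtain x where x: "x \<in> rel_interior F" "x \<in> G" by blast
  obtain \<delta> where \<delta>: "\<delta> > 0" "frontier D \<inter> ball x \<delta> \<subseteq> rel_interior F"
    using frontier_near_rel_interior[OF assms(1) x(1)] .
  have "x \<in> closure (rel_interior G)" using x(2) face_closure[OF assms(2)] by simp
  then obtain y where y: "y \<in> rel_interior G" "dist y x < \<delta>" using \<delta>(1) closure_approachable by blast
  then have "y \<in> rel_interior F"
    using \<delta>(2) face_subset[OF assms(2)] rel_interior_subset[of G] by (auto simp: subset_iff dist_commute)
  then show False using poly(8)[OF assms] y by blast
qed

lemma face_Int_subset:
  assumes "F \<in> \<F>" "G \<in> \<F>" "F \<noteq> G"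
  shows "F \<inter> G \<subseteq> rel_frontier F" "F \<inter> G \<subseteq> rel_frontier G"
  using rel_interior_disjoint[OF assms] rel_interior_disjoint[OF assms(2,1)] assms by (auto simp: face_frontier)

end

lemma closure_finite_UN:
  "finite I \<Longrightarrow> closure (\<Union>i\<in>I. A i) = (\<Union>i\<in>I. closure (A i))"
  by (induction I rule: finite_induct) simp_all

lemma diameter_closed_segment_le: "diameter (closed_segment a b) \<le> dist a (b :: 'a::euclidean_space)"
proof (rule diameter_le)
  fix x y assume "x \<in> closed_segment a b" "y \<in> closed_segment a b"
  then obtain s t where st: "0 \<le> s" "s \<le> 1" "x = a + s *\<^sub>R (b - a)" "0 \<le> t" "t \<le> 1" "y = a + t *\<^sub>R (b - a)"
    by (auto simp: in_segment algebra_simps)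
  have "x - y = (s - t) *\<^sub>R (b - a)" unfolding st(3,6) by (simp add: algebra_simps)
  then have "norm (x - y) = \<bar>s - t\<bar> * norm (b - a)" by simp
  also have "\<dots> \<le> 1 * norm (b - a)" using st by (intro mult_right_mono) auto
  finally show "norm (x - y) \<le> dist a b" by (simp add: dist_norm norm_minus_commute)
qed simp

subsection \<open>Edges of a polyhedron\<close>

context poly_setting
begin

text \<open>The segment between the base points is lifted to the graph. Uniqueness over each base
  point makes the end of the lift equal to \<open>z\<close>, and the slope bound adds at most
  \<open>M0\<close> times the horizontal speed, hence the factor \<open>K\<close>. Such paths
  replace straight segments, which may leave the boundary.\<close>

lemma frontier_path:
  assumes x: "x \<in> frontier D" and z: "z \<in> frontier D" and xz: "dist x z < r0 / K"
  obtains \<gamma> where "(K * dist x z)-lipschitz_on {0..1::real} \<gamma>" "\<gamma> ` {0..1} \<subseteq> frontier D" "\<gamma> 0 = x" "\<gamma> 1 = z"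
proof -
  obtain \<nu> where "graph_direction (frontier D) r0 (r0 / K) M0 x \<nu>"
    using graph_direction_exists[OF x] .
  then have n1: "norm \<nu> = 1"
    and slope: "\<And>y z. y \<in> frontier D \<Longrightarrow> dist x y < r0 \<Longrightarrow> z \<in> frontier D \<Longrightarrow> dist x z < r0 \<Longrightarrow>
      \<bar>(y - z) \<bullet> \<nu>\<bar> \<le> M0 * norm ((y - z) - ((y - z) \<bullet> \<nu>) *\<^sub>R \<nu>)"
    and lift: "\<And>h. h \<bullet> \<nu> = 0 \<Longrightarrow> norm h < r0 / K \<Longrightarrow> \<exists>c. \<bar>c\<bar> \<le> M0 * norm h \<and> x + h + c *\<^sub>R \<nu> \<in> frontier D"
    unfolding graph_direction_def by auto
  have \<nu>\<nu>: "\<nu> \<bullet> \<nu> = 1" using n1 by (simp add: dot_square_norm)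
  define h where "h = (z - x) - ((z - x) \<bullet> \<nu>) *\<^sub>R \<nu>"
  have h\<nu>: "h \<bullet> \<nu> = 0" using \<nu>\<nu> by (simp add: h_def inner_simps)
  have hn: "norm h \<le> dist x z"
    unfolding h_def using norm_orthogonal_part_le(1)[OF n1, of "z - x"] by (simp add: dist_norm norm_minus_commute)
  have ex: "\<exists>c. \<bar>c\<bar> \<le> M0 * norm (t *\<^sub>R h) \<and> x + t *\<^sub>R h + c *\<^sub>R \<nu> \<in> frontier D" if "t \<in> {0..1}" for t
  proof (rule lift)
    show "(t *\<^sub>R h) \<bullet> \<nu> = 0" using h\<nu> by simp
    have "norm (t *\<^sub>R h) \<le> 1 * norm h" using that unfolding norm_scaleR by (intro mult_right_mono) auto
    then show "norm (t *\<^sub>R h) < r0 / K" using hn xz by simp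
  qed
  then obtain c where c: "\<And>t. t \<in> {0..1} \<Longrightarrow> \<bar>c t\<bar> \<le> M0 * norm (t *\<^sub>R h)"
    "\<And>t. t \<in> {0..1} \<Longrightarrow> x + t *\<^sub>R h + c t *\<^sub>R \<nu> \<in> frontier D" by metis
  define \<gamma> where "\<gamma> = (\<lambda>t. x + t *\<^sub>R h + c t *\<^sub>R \<nu>)"
  have fr: "\<gamma> t \<in> frontier D" if "t \<in> {0..1}" for t using c(2)[OF that] by (simp add: \<gamma>_def)
  have xzK: "K * dist x z < r0" using xz K2 by (simp add: less_divide_eq mult.commute)
  have nr: "dist x (\<gamma> t) < r0" if "t \<in> {0..1}" for t
  proof -
    have "dist x (\<gamma> t) \<le> norm (t *\<^sub>R h) + \<bar>c t\<bar>"
      using norm_triangle_ineq[of "t *\<^sub>R h" "c t *\<^sub>R \<nu>"] n1 dist_commute[of x "\<gamma> t"] by (simp add: \<gamma>_def dist_norm algebra_simps)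
    also have "\<dots> \<le> (1 + M0) * norm (t *\<^sub>R h)" using c(1)[OF that] by (simp add: distrib_right)
    also have "\<dots> \<le> K * dist x z"
    proof (intro mult_mono K)
      have "norm (t *\<^sub>R h) \<le> 1 * norm h" using that unfolding norm_scaleR by (intro mult_right_mono) auto
      then show "norm (t *\<^sub>R h) \<le> dist x z" using hn by simp
    qed (use K2 in auto)
    finally show ?thesis using xzK by simp
  qed
  show thesis
  proof (rule that[of \<gamma>])
    show "(K * dist x z)-lipschitz_on {0..1} \<gamma>"
    proof (rule lipschitz_onI)
      fix s t :: real assume st: "s \<in> {0..1}" "t \<in> {0..1}"
      have d: "\<gamma> s - \<gamma> t = (s - t) *\<^sub>R h + (c s - c t) *\<^sub>R \<nu>" by (simp add: \<gamma>_def algebra_simps)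
      have in\<nu>: "(\<gamma> s - \<gamma> t) \<bullet> \<nu> = c s - c t" unfolding d using h\<nu> \<nu>\<nu> by (simp add: inner_simps)
      have "\<bar>c s - c t\<bar> \<le> M0 * norm ((s - t) *\<^sub>R h)"
        using slope[OF fr[OF st(1)] nr[OF st(1)] fr[OF st(2)] nr[OF st(2)]] unfolding in\<nu> by (simp add: d)
      moreover have "norm (\<gamma> s - \<gamma> t) \<le> norm ((s - t) *\<^sub>R h) + \<bar>c s - c t\<bar>"
        unfolding d using norm_triangle_ineq[of "(s - t) *\<^sub>R h" "(c s - c t) *\<^sub>R \<nu>"] n1 by simp
      ultimately have "dist (\<gamma> s) (\<gamma> t) \<le> (1 + M0) * norm ((s - t) *\<^sub>R h)"
        by (simp add: dist_norm distrib_right)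
      also have "\<dots> \<le> K * (\<bar>s - t\<bar> * dist x z)"
        using K K2 hn by (intro mult_mono) (auto intro: mult_left_mono)
      finally show "dist (\<gamma> s) (\<gamma> t) \<le> K * dist x z * dist s t" by (simp add: dist_real_def mult_ac)
    qed (use K2 in simp)
    show "\<gamma> ` {0..1} \<subseteq> frontier D" using fr by auto
    show "\<gamma> 0 = x" using c(1)[of 0] by (simp add: \<gamma>_def)
    have "\<gamma> 1 - z = (c 1 - (z - x) \<bullet> \<nu>) *\<^sub>R \<nu>" by (simp add: \<gamma>_def h_def algebra_simps)
    moreover have "dist x z \<le> K * dist x z" using K2 mult_right_mono[of 1 K "dist x z"] by simp
    then have "\<bar>(\<gamma> 1 - z) \<bullet> \<nu>\<bar> \<le> M0 * norm ((\<gamma> 1 - z) - ((\<gamma> 1 - z) \<bullet> \<nu>) *\<^sub>R \<nu>)"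
      using xzK by (intro slope fr nr z) auto
    ultimately have "c 1 - (z - x) \<bullet> \<nu> = 0" using \<nu>\<nu> by simp
    then show "\<gamma> 1 = z" using \<open>\<gamma> 1 - z = _\<close> by simp
  qed
qed

text \<open>If the plane of \<open>F\<close> contained the graph direction, a small disc of
  \<open>F\<close> about a relatively interior point would contain a vertical segment, but a graph
  has one point on each vertical line. The interior point is taken within \<open>r0 / 2\<close> of
  \<open>P\<close> to stay in the chart.\<close>

lemma face_graph_transversal:
  assumes F: "F \<in> \<F>" and P: "P \<in> F" and \<nu>: "graph_direction (frontier D) r0 (r0 / K) M0 P \<nu>"
    and v: "P + c *\<^sub>R \<nu> \<in> affine hull F"
  shows "c = 0"
proof (rule ccontr)
  assume c: "c \<noteq> 0"
  have n1: "norm \<nu> = 1"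
    and slope: "\<And>y z. y \<in> frontier D \<Longrightarrow> dist P y < r0 \<Longrightarrow> z \<in> frontier D \<Longrightarrow> dist P z < r0 \<Longrightarrow>
      \<bar>(y - z) \<bullet> \<nu>\<bar> \<le> M0 * norm ((y - z) - ((y - z) \<bullet> \<nu>) *\<^sub>R \<nu>)"
    using \<nu> unfolding graph_direction_def by auto
  have \<nu>\<nu>: "\<nu> \<bullet> \<nu> = 1" using n1 by (simp add: dot_square_norm)
  obtain N where N: "N \<noteq> 0" "\<And>y. y \<in> affine hull F \<longleftrightarrow> N \<bullet> (y - P) = 0" using face_normal[OF F P] by blast
  then have N\<nu>: "N \<bullet> \<nu> = 0" using v c by simp
  have "P \<in> closure (rel_interior F)" using P face_closure[OF F] by simp
  then obtain y where y: "y \<in> rel_interior F" "dist y P < r0 / 2"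
    unfolding closure_approachable using r0 by (meson half_gt_zero)
  then obtain \<epsilon> where \<epsilon>: "\<epsilon> > 0" "ball y \<epsilon> \<inter> affine hull F \<subseteq> F" and yF: "y \<in> F"
    by (auto simp: mem_rel_interior_ball)
  define t where "t = min (\<epsilon> / 2) (r0 / 2)"
  have t: "t > 0" "t < \<epsilon>" "t \<le> r0 / 2" using \<epsilon> r0 by (auto simp: t_def)
  have "N \<bullet> (y - P) = 0" using N(2) yF hull_subset[of F affine] by blast
  then have "N \<bullet> (y + t *\<^sub>R \<nu> - P) = 0" using N\<nu> by (simp add: inner_simps)
  then have "y + t *\<^sub>R \<nu> \<in> F" using N(2) \<epsilon>(2) t n1 by (auto simp: dist_norm subset_iff)
  moreover have "dist P (y + t *\<^sub>R \<nu>) < r0"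
    using dist_triangle[of P "y + t *\<^sub>R \<nu>" y] y t n1 by (simp add: dist_norm norm_minus_commute)
  ultimately have "\<bar>(y + t *\<^sub>R \<nu> - y) \<bullet> \<nu>\<bar> \<le> M0 * norm ((y + t *\<^sub>R \<nu> - y) - ((y + t *\<^sub>R \<nu> - y) \<bullet> \<nu>) *\<^sub>R \<nu>)"
    using y yF face_subset[OF F] r0 by (intro slope) (auto simp: dist_commute)
  then show False using \<nu>\<nu> t by simp
qed

lemma chart_coords:
  assumes ch: "face_chart F r M P E1 E2 g"
  shows "y \<in> affine hull F \<Longrightarrow> y = P + ((y - P) \<bullet> E1) *\<^sub>R E1 + ((y - P) \<bullet> E2) *\<^sub>R E2"
    "(P + a *\<^sub>R E1 + b *\<^sub>R E2 - P) \<bullet> E1 = a" "(P + a *\<^sub>R E1 + b *\<^sub>R E2 - P) \<bullet> E2 = b"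
    "\<bar>v \<bullet> E1\<bar> \<le> norm v" "\<bar>v \<bullet> E2\<bar> \<le> norm v"
    "E1 \<bullet> E1 = 1" "E2 \<bullet> E2 = 1" "E1 \<bullet> E2 = 0" "E2 \<bullet> E1 = 0"
proof -
  have o: "norm E1 = 1" "norm E2 = 1" "E1 \<bullet> E2 = 0" using ch by (auto simp: face_chart_def orthonormal_pair_def)
  show oo: "E1 \<bullet> E1 = 1" "E2 \<bullet> E2 = 1" "E1 \<bullet> E2 = 0" "E2 \<bullet> E1 = 0"
    using o by (simp_all add: dot_square_norm inner_commute)
  show "\<bar>v \<bullet> E1\<bar> \<le> norm v" "\<bar>v \<bullet> E2\<bar> \<le> norm v"
    using Cauchy_Schwarz_ineq2[of v E1] Cauchy_Schwarz_ineq2[of v E2] o by simp_all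
  show 1: "(P + a *\<^sub>R E1 + b *\<^sub>R E2 - P) \<bullet> E1 = a" "(P + a *\<^sub>R E1 + b *\<^sub>R E2 - P) \<bullet> E2 = b" for a b
    using oo by (simp_all add: inner_simps)
  show "y = P + ((y - P) \<bullet> E1) *\<^sub>R E1 + ((y - P) \<bullet> E2) *\<^sub>R E2" if y: "y \<in> affine hull F"
  proof -
    obtain a b where "y = P + a *\<^sub>R E1 + b *\<^sub>R E2" using ch y by (auto simp: face_chart_def)
    then show ?thesis using 1[of a b] by simp
  qed
qed

text \<open>Otherwise the boundary of \<open>D\<close> near \<open>q\<close> lies in
  \<open>F\<close> alone. It is a graph over a full neighbourhood of base points, so some point of
  \<open>F\<close> lies over the base point of \<open>q - t *\<^sub>R E2\<close>. Being in the same
  plane, which is transversal to \<nu>, it is this very point, and the chart places that outside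
  \<open>F\<close>.\<close>

lemma rel_frontier_in_other_face:
  assumes F: "F \<in> \<F>" and q: "q \<in> rel_frontier F"
  shows "\<exists>G\<in>\<F>. G \<noteq> F \<and> q \<in> G"
proof (rule ccontr)
  assume none: "\<not> (\<exists>G\<in>\<F>. G \<noteq> F \<and> q \<in> G)"
  have qF: "q \<in> F" using q face_frontier[OF F] by simp
  then have qD: "q \<in> frontier D" using face_subset[OF F] by blast
  have "closed (\<Union>(\<F> - {F}))" using poly(3) face_closed by (intro closed_Union) auto
  then have "open (- \<Union>(\<F> - {F}))" by (simp add: open_Compl)
  moreover have "q \<in> - \<Union>(\<F> - {F})" using none by auto
  ultimately obtain \<delta> where \<delta>: "\<delta> > 0" "ball q \<delta> \<subseteq> - \<Union>(\<F> - {F})" using open_contains_ball by blast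
  have sub: "z \<in> F" if "z \<in> frontier D" "dist q z < \<delta>" for z
    using that \<delta> poly(4) by (auto simp: subset_iff)
  obtain \<nu> where \<nu>: "graph_direction (frontier D) r0 (r0 / K) M0 q \<nu>" using graph_direction_exists[OF qD] .
  then have n1: "norm \<nu> = 1"
    and lift: "\<And>h. h \<bullet> \<nu> = 0 \<Longrightarrow> norm h < r0 / K \<Longrightarrow> \<exists>c. \<bar>c\<bar> \<le> M0 * norm h \<and> q + h + c *\<^sub>R \<nu> \<in> frontier D"
    unfolding graph_direction_def by auto
  have \<nu>\<nu>: "\<nu> \<bullet> \<nu> = 1" using n1 by (simp add: dot_square_norm)
  obtain E1 E2 g where ch: "face_chart F r0 M0 q E1 E2 g" using face_chart_exists[OF F q] .
  then have g0: "g 0 = 0" and hull: "\<And>x. x \<in> affine hull F \<longleftrightarrow> (\<exists>a b. x = q + a *\<^sub>R E1 + b *\<^sub>R E2)"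
    and inF: "\<And>a b. \<bar>a\<bar> < r0 \<Longrightarrow> \<bar>b\<bar> < 2 * M0 * r0 \<Longrightarrow> q + a *\<^sub>R E1 + b *\<^sub>R E2 \<in> F \<longleftrightarrow> g a \<le> b"
    unfolding face_chart_def by auto
  \<comment> \<open>\<open>K * t < \<delta>\<close> keeps the lifted point where only
    \<open>F\<close> occurs, \<open>t < r0 / K\<close> makes the lift possible, and
    \<open>t < 2 * M0 * r0\<close> keeps \<open>- t\<close> in the range of the face chart.\<close>
  define t where "t = min (\<delta> / (2 * K)) (r0 / (2 * K))"
  have t: "t > 0" "K * t < \<delta>" "t < r0 / K" "t < 2 * M0 * r0"
  proof -
    show "t > 0" using \<delta> r0 K2 by (simp add: t_def)
    have "K * t \<le> K * (\<delta> / (2 * K))" using K2 by (intro mult_left_mono) (auto simp: t_def)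
    then show "K * t < \<delta>" using K2 \<delta> by simp
    have "t \<le> r0 / (2 * K)" by (simp add: t_def)
    also have "\<dots> < r0 / K" using r0 K2 by (simp add: field_simps)
    finally show "t < r0 / K" .
    also have "r0 / K \<le> r0" using r0 K2 by (simp add: field_simps)
    also have "r0 < 2 * M0 * r0" using r0 M0 by simp
    finally show "t < 2 * M0 * r0" .
  qed
  define h where "h = (- t *\<^sub>R E2) - ((- t *\<^sub>R E2) \<bullet> \<nu>) *\<^sub>R \<nu>"
  have h\<nu>: "h \<bullet> \<nu> = 0" using \<nu>\<nu> by (simp add: h_def inner_simps)
  have "norm (- t *\<^sub>R E2) = t" using ch t by (simp add: face_chart_def orthonormal_pair_def)
  then have hn: "norm h \<le> t" unfolding h_def using norm_orthogonal_part_le(1)[OF n1, of "- t *\<^sub>R E2"] by simp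
  then obtain c where c: "\<bar>c\<bar> \<le> M0 * norm h" "q + h + c *\<^sub>R \<nu> \<in> frontier D"
    using lift[OF h\<nu>] t by auto
  have "norm (h + c *\<^sub>R \<nu>) \<le> norm h + \<bar>c\<bar>" using norm_triangle_ineq[of h "c *\<^sub>R \<nu>"] n1 by simp
  also have "\<dots> \<le> (1 + M0) * norm h" using c by (simp add: distrib_right)
  also have "\<dots> \<le> K * t" using K hn K2 by (intro mult_mono) auto
  finally have "dist q (q + h + c *\<^sub>R \<nu>) < \<delta>" 
    using t norm_minus_cancel[of "h + c *\<^sub>R \<nu>"] by (simp add: dist_norm)
  then have zF: "q + h + c *\<^sub>R \<nu> \<in> F" using sub c by blast
  then obtain a b where ab: "q + h + c *\<^sub>R \<nu> = q + a *\<^sub>R E1 + b *\<^sub>R E2" using hull hull_subset[of F affine] by blast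
  have "q + (c - (- t *\<^sub>R E2) \<bullet> \<nu>) *\<^sub>R \<nu> = q + a *\<^sub>R E1 + (b + t) *\<^sub>R E2"
  proof -
    have "(c - (- t *\<^sub>R E2) \<bullet> \<nu>) *\<^sub>R \<nu> = (q + h + c *\<^sub>R \<nu>) - q + t *\<^sub>R E2" by (simp add: h_def algebra_simps)
    then show ?thesis unfolding ab by (simp add: algebra_simps)
  qed
  then have "q + (c - (- t *\<^sub>R E2) \<bullet> \<nu>) *\<^sub>R \<nu> \<in> affine hull F" using hull by blast
  then have "c - (- t *\<^sub>R E2) \<bullet> \<nu> = 0" by (rule face_graph_transversal[OF F qF \<nu>])
  then have "c = (- t *\<^sub>R E2) \<bullet> \<nu>" by simp
  then have "q + h + c *\<^sub>R \<nu> = q + 0 *\<^sub>R E1 + (- t) *\<^sub>R E2" by (simp add: h_def)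
  then have "q + 0 *\<^sub>R E1 + (- t) *\<^sub>R E2 \<in> F" using zF by (simp only:)
  then have "g 0 \<le> - t" using inF[of 0 "- t"] t r0 by simp
  then show False using g0 t by simp
qed

text \<open>Maximality is reached by taking the component containing \<open>x\<close> of the
  intersection of \<open>F \<inter> G\<close> with the line. It is compact and, being connected on a
  line, convex; hence it is a segment. Any larger segment in \<open>F \<inter> G\<close> lies on the
  same line and in the same component.\<close>

lemma segment_in_edge:
  assumes F: "F \<in> \<F>" and G: "G \<in> \<F>" "G \<noteq> F" and xq: "x \<noteq> q" and sub: "closed_segment x q \<subseteq> F \<inter> G"
  shows "\<exists>\<sigma>\<in>face_edges \<F> F. closed_segment x q \<subseteq> \<sigma>"
proof -
  define Y where "Y = connected_component_set (F \<inter> G \<inter> affine hull {x, q}) x"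
  have segs: "closed_segment x q \<subseteq> affine hull {x, q}"
    by (metis convex_hull_subset_affine_hull segment_convex_hull)
  have xX: "x \<in> F \<inter> G \<inter> affine hull {x, q}" using sub segs by auto
  have "compact (F \<inter> G \<inter> affine hull {x, q})"
    using face_closed[OF F] face_closed[OF G(1)] face_bounded[OF F] bounded_subset
    by (auto simp: compact_eq_bounded_closed intro!: closed_Int closed_affine_hull)
  then have cY: "compact Y" unfolding Y_def
    by (meson bounded_subset closed_connected_component compact_eq_bounded_closed connected_component_subset)
  have "Y \<subseteq> F \<inter> G \<inter> affine hull {x, q}" unfolding Y_def by (rule connected_component_subset)
  then have YX: "Y \<subseteq> F \<inter> G" and "Y \<subseteq> affine hull {x, q}" by auto
  then have col: "collinear Y" using collinear_affine_hull by blast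
  have sY: "closed_segment x q \<subseteq> Y" unfolding Y_def
    using sub segs by (intro connected_component_maximal) auto
  have "convex Y" using convex_connected_collinear[OF col] by (simp add: Y_def)
  then obtain a b where ab: "Y = closed_segment a b"
    using compact_convex_collinear_segment[OF _ cY _ col] sY by (metis ends_in_segment(1) empty_iff subsetD)
  have "a \<noteq> b" using sY xq ab by (metis closed_segment_idem ends_in_segment singletonD subsetD)
  then have nd: "nondegenerate_segment Y" unfolding nondegenerate_segment_def ab by blast
  have max: "\<tau> = Y" if \<tau>: "nondegenerate_segment \<tau>" "Y \<subseteq> \<tau>" "\<tau> \<subseteq> F \<inter> G" for \<tau>
  proof
    obtain c d where cd: "\<tau> = closed_segment c d" using \<tau>(1) by (auto simp: nondegenerate_segment_def)
    have "\<tau> \<subseteq> affine hull {x, q}"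
    proof
      fix y assume y: "y \<in> \<tau>"
      have "collinear \<tau>" unfolding cd by (rule collinear_closed_segment)
      moreover have "{x, q, y} \<subseteq> \<tau>" using y \<tau>(2) sY by auto
      ultimately have "collinear {x, q, y}" using collinear_subset by blast
      then show "y \<in> affine hull {x, q}" using collinear_3_affine_hull[OF xq] by simp
    qed
    then show "\<tau> \<subseteq> Y" unfolding Y_def using \<tau> sY cd
      by (intro connected_component_maximal) auto
  qed (rule \<tau>(2))
  have "Y \<in> face_edges \<F> F"
    unfolding face_edges_def using G nd YX max by blast
  then show ?thesis using sY by blast
qed

text \<open>Faces are finite unions of closed convex sets, hence so is every
  \<open>F \<inter> G\<close>. If \<open>A\<close> accumulates at \<open>x\<close>, one of finitely
  many convex pieces contains \<open>x\<close> and another point of \<open>A\<close>, and with them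
  the segment in between. The choice of \<open>A\<close> prescribes the side of \<open>x\<close> on
  which the edge is found.\<close>

lemma edge_through_limit_point:
  assumes F: "F \<in> \<F>" and A: "A \<subseteq> rel_frontier F" and x: "x \<in> closure (A - {x})"
  shows "\<exists>q\<in>A - {x}. \<exists>\<sigma>\<in>face_edges \<F> F. x \<in> \<sigma> \<and> q \<in> \<sigma>"
proof -
  obtain \<P> where \<P>: "\<And>G. G \<in> \<F> \<Longrightarrow> finite (\<P> G) \<and> G = \<Union>(\<P> G) \<and> (\<forall>P\<in>\<P> G. convex P \<and> closed P)"
    using face_pieces by metis
  define \<C> where "\<C> = (\<Union>G\<in>\<F> - {F}. (\<lambda>(C, C'). C \<inter> C') ` (\<P> F \<times> \<P> G))"
  have fin: "finite \<C>" unfolding \<C>_def using \<P> F poly(3) by auto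
  have C: "convex C \<and> closed C \<and> (\<exists>G\<in>\<F>. G \<noteq> F \<and> C \<subseteq> F \<inter> G)" if "C \<in> \<C>" for C
  proof -
    obtain G P P' where G: "G \<in> \<F>" "G \<noteq> F" "P \<in> \<P> F" "P' \<in> \<P> G" "C = P \<inter> P'"
      using \<open>C \<in> \<C>\<close> by (auto simp: \<C>_def)
    have "P \<subseteq> F" "P' \<subseteq> G" using \<P>[OF F] \<P>[OF G(1)] G by blast+
    then show ?thesis using \<P>[OF F] \<P>[OF G(1)] G by (auto intro: convex_Int)
  qed
  have cover: "A - {x} \<subseteq> (\<Union>C\<in>\<C>. (A - {x}) \<inter> C)"
  proof
    fix q assume q: "q \<in> A - {x}"
    then have qr: "q \<in> rel_frontier F" using A by blast
    then have qF: "q \<in> F" using face_frontier[OF F] by simp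
    obtain G where G: "G \<in> \<F>" "G \<noteq> F" "q \<in> G" using rel_frontier_in_other_face[OF F qr] by blast
    obtain P where P: "P \<in> \<P> F" "q \<in> P" using \<P>[OF F] qF by blast
    obtain P' where P': "P' \<in> \<P> G" "q \<in> P'" using \<P>[OF G(1)] G by blast
    have "P \<inter> P' \<in> \<C>" unfolding \<C>_def using G P P' by (intro UN_I[of G]) auto
    then show "q \<in> (\<Union>C\<in>\<C>. (A - {x}) \<inter> C)" using q P P' by blast
  qed
  have "x \<in> closure (\<Union>C\<in>\<C>. (A - {x}) \<inter> C)" using x closure_mono[OF cover] by blast
  also have "\<dots> = (\<Union>C\<in>\<C>. closure ((A - {x}) \<inter> C))" by (rule closure_finite_UN[OF fin])
  finally obtain C0 where C0: "C0 \<in> \<C>" "x \<in> closure ((A - {x}) \<inter> C0)" by blast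
  then have "x \<in> C0" using C closure_minimal[of "(A - {x}) \<inter> C0" C0] by blast
  have "(A - {x}) \<inter> C0 \<noteq> {}"
  proof
    assume "(A - {x}) \<inter> C0 = {}"
    then show False using C0(2) by (simp only: closure_empty empty_iff)
  qed
  then obtain q where q: "q \<in> A - {x}" "q \<in> C0" by blast
  obtain G where G: "G \<in> \<F>" "G \<noteq> F" "C0 \<subseteq> F \<inter> G" using C[OF C0(1)] by blast
  have sub: "closed_segment x q \<subseteq> F \<inter> G"
    using closed_segment_subset[OF \<open>x \<in> C0\<close> q(2)] C[OF C0(1)] G(3) by blast
  have "x \<noteq> q" using q(1) by blast
  from segment_in_edge[OF F G(1,2) this sub]
  obtain \<sigma> where "\<sigma> \<in> face_edges \<F> F" "closed_segment x q \<subseteq> \<sigma>" by blast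
  moreover have "x \<in> closed_segment x q" "q \<in> closed_segment x q" by simp_all
  ultimately have "\<sigma> \<in> face_edges \<F> F \<and> x \<in> \<sigma> \<and> q \<in> \<sigma>" by (meson subsetD)
  then show ?thesis using q(1) by meson
qed

lemma face_edgeE:
  assumes F: "F \<in> \<F>" and \<sigma>: "\<sigma> \<in> face_edges \<F> F"
  obtains a b G where "G \<in> \<F>" "G \<noteq> F" "a \<noteq> b" "\<sigma> = closed_segment a b" "\<sigma> \<subseteq> F \<inter> G"
    "\<sigma> \<in> face_edges \<F> G" "r0 \<le> dist a b" "\<sigma> \<subseteq> rel_frontier F"
    "\<And>\<tau>. nondegenerate_segment \<tau> \<Longrightarrow> \<sigma> \<subseteq> \<tau> \<Longrightarrow> \<tau> \<subseteq> F \<inter> G \<Longrightarrow> \<tau> = \<sigma>"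
proof -
  obtain G where G: "G \<in> \<F>" "G \<noteq> F" "nondegenerate_segment \<sigma>" "\<sigma> \<subseteq> F \<inter> G"
    and max: "\<And>\<tau>. nondegenerate_segment \<tau> \<Longrightarrow> \<sigma> \<subseteq> \<tau> \<Longrightarrow> \<tau> \<subseteq> F \<inter> G \<Longrightarrow> \<tau> = \<sigma>"
    using \<sigma> unfolding face_edges_def by blast
  obtain a b where ab: "a \<noteq> b" "\<sigma> = closed_segment a b" using G(3) by (auto simp: nondegenerate_segment_def)
  have "\<sigma> \<in> edges \<F>" using F \<sigma> by (auto simp: edges_def)
  then have "r0 \<le> dist a b" using poly(13)[of \<sigma>] ab diameter_closed_segment_le[of a b] by simp
  moreover have "\<sigma> \<in> face_edges \<F> G"
    unfolding face_edges_def
  proof (intro CollectI bexI[of _ F] conjI allI impI)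
    show "\<tau> = \<sigma>" if "nondegenerate_segment \<tau> \<and> \<sigma> \<subseteq> \<tau> \<and> \<tau> \<subseteq> G \<inter> F" for \<tau>
      using that max[of \<tau>] by blast
  qed (use F G in auto)
  ultimately show thesis using that[of G a b] G ab max face_Int_subset(1)[OF F G(1)] by blast
qed

end

lemma orthonormal3_expand:
  fixes x :: "real^3"
  assumes n: "norm u = 1" "norm v = 1" "norm w = 1" and o: "u \<bullet> v = 0" "u \<bullet> w = 0" "v \<bullet> w = 0"
  shows "x = (x \<bullet> u) *\<^sub>R u + (x \<bullet> v) *\<^sub>R v + (x \<bullet> w) *\<^sub>R w"
proof -
  have s: "u \<bullet> u = 1" "v \<bullet> v = 1" "w \<bullet> w = 1" "v \<bullet> u = 0" "w \<bullet> u = 0" "w \<bullet> v = 0"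
    using n o by (simp_all add: dot_square_norm inner_commute)
  have ne: "u \<noteq> v" "u \<noteq> w" "v \<noteq> w" using s o by auto
  have "pairwise orthogonal {u, v, w}" using o s by (auto simp: pairwise_def orthogonal_def)
  moreover have "0 \<notin> {u, v, w}" using n by auto
  ultimately have "independent {u, v, w}" by (rule pairwise_orthogonal_independent)
  moreover have "card {u, v, w} = DIM(real^3)" using ne by simp
  ultimately have sp: "span {u, v, w} = UNIV"
    by (simp add: dim_eq_full[symmetric] dim_eq_card_independent)
  define y where "y = x - ((x \<bullet> u) *\<^sub>R u + (x \<bullet> v) *\<^sub>R v + (x \<bullet> w) *\<^sub>R w)"
  have "y \<bullet> u = 0" "y \<bullet> v = 0" "y \<bullet> w = 0" using s o by (simp_all add: y_def inner_simps)
  then have "orthogonal y z" if "z \<in> {u, v, w}" for z using that by (auto simp: orthogonal_def)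
  then have "orthogonal y y" using orthogonal_to_span[of y "{u, v, w}" y] sp by blast
  then have "y = 0" by (simp add: orthogonal_self)
  then show ?thesis by (simp add: y_def)
qed

section \<open>One-sided neighbourhoods of edges within a face\<close>

context poly_setting
begin

lemma face_plane_expand:
  assumes F: "F \<in> \<F>" and p: "p \<in> affine hull F"
    and n: "norm e = 1" "norm m = 1" "e \<bullet> m = 0"
    and pe: "p + c *\<^sub>R e \<in> affine hull F" "c \<noteq> 0" and pm: "q + d *\<^sub>R m \<in> affine hull F" "q \<in> affine hull F" "d \<noteq> 0"
    and y: "y \<in> affine hull F" "z \<in> affine hull F"
  shows "y - z = ((y - z) \<bullet> e) *\<^sub>R e + ((y - z) \<bullet> m) *\<^sub>R m"
    and "z + s *\<^sub>R e + t *\<^sub>R m \<in> affine hull F"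
proof -
  have "F \<noteq> {}" using p by auto
  then obtain x where x: "x \<in> F" by blast
  obtain N where N: "N \<noteq> 0" "\<And>y. y \<in> affine hull F \<longleftrightarrow> N \<bullet> (y - x) = 0" using face_normal[OF F x] by blast
  have d: "N \<bullet> (y - z) = 0" if "y \<in> affine hull F" "z \<in> affine hull F" for y z
    using that N(2)[of y] N(2)[of z] by (simp add: inner_simps)
  have Ne: "N \<bullet> e = 0" using d[OF pe(1) p] pe(2) by simp
  have Nm: "N \<bullet> m = 0" using d[OF pm(1,2)] pm(3) by simp
  define w where "w = (1 / norm N) *\<^sub>R N"
  have "norm w = 1" "e \<bullet> w = 0" "m \<bullet> w = 0" using N(1) Ne Nm by (simp_all add: w_def inner_commute)
  moreover have "(y - z) \<bullet> w = 0" using d[OF y] by (simp add: w_def inner_commute)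
  ultimately show "y - z = ((y - z) \<bullet> e) *\<^sub>R e + ((y - z) \<bullet> m) *\<^sub>R m"
    using orthonormal3_expand[of e m w "y - z"] n by simp
  show "z + s *\<^sub>R e + t *\<^sub>R m \<in> affine hull F"
    using N(2) y(2) Ne Nm by (simp add: inner_simps)
qed

lemma chart_frontier:
  assumes F: "F \<in> \<F>" and ch: "face_chart F r0 M0 P E1 E2 g"
  shows "y \<in> rel_frontier F \<Longrightarrow> \<bar>(y - P) \<bullet> E1\<bar> < r0 \<Longrightarrow> \<bar>(y - P) \<bullet> E2\<bar> < 2 * M0 * r0 \<Longrightarrow>
      g ((y - P) \<bullet> E1) = (y - P) \<bullet> E2"
    and "\<bar>a\<bar> < r0 \<Longrightarrow> P + a *\<^sub>R E1 + g a *\<^sub>R E2 \<in> rel_frontier F"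
    and "\<bar>a\<bar> \<le> r0 \<Longrightarrow> \<bar>g a\<bar> \<le> M0 * \<bar>a\<bar>"
proof -
  have g0: "g 0 = 0" and gl: "\<And>a b. \<bar>a\<bar> \<le> r0 \<Longrightarrow> \<bar>b\<bar> \<le> r0 \<Longrightarrow> \<bar>g a - g b\<bar> \<le> M0 * \<bar>a - b\<bar>"
    and ri: "\<And>a b. \<bar>a\<bar> \<le> r0 \<Longrightarrow> \<bar>b\<bar> \<le> 2 * M0 * r0 \<Longrightarrow> P + a *\<^sub>R E1 + b *\<^sub>R E2 \<in> rel_interior F \<longleftrightarrow> g a < b"
    and inF: "\<And>a b. \<bar>a\<bar> < r0 \<Longrightarrow> \<bar>b\<bar> < 2 * M0 * r0 \<Longrightarrow> P + a *\<^sub>R E1 + b *\<^sub>R E2 \<in> F \<longleftrightarrow> g a \<le> b"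
    using ch unfolding face_chart_def by auto
  show "g ((y - P) \<bullet> E1) = (y - P) \<bullet> E2"
    if y: "y \<in> rel_frontier F" "\<bar>(y - P) \<bullet> E1\<bar> < r0" "\<bar>(y - P) \<bullet> E2\<bar> < 2 * M0 * r0"
  proof -
    have yF: "y \<in> F" "y \<notin> rel_interior F" using y(1) face_frontier[OF F] by auto
    then have "y \<in> affine hull F" using hull_subset[of F affine] by blast
    then have "y = P + ((y - P) \<bullet> E1) *\<^sub>R E1 + ((y - P) \<bullet> E2) *\<^sub>R E2" by (rule chart_coords(1)[OF ch])
    then show ?thesis using ri[of "(y - P) \<bullet> E1" "(y - P) \<bullet> E2"] inF[of "(y - P) \<bullet> E1" "(y - P) \<bullet> E2"] yF y(2,3) by simp
  qed
  show 1: "\<bar>g a\<bar> \<le> M0 * \<bar>a\<bar>" if "\<bar>a\<bar> \<le> r0" for a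
    using gl[OF that, of 0] g0 r0 by simp
  show "P + a *\<^sub>R E1 + g a *\<^sub>R E2 \<in> rel_frontier F" if a: "\<bar>a\<bar> < r0" for a
  proof -
    have "\<bar>g a\<bar> \<le> M0 * \<bar>a\<bar>" using a 1 by simp
    also have "\<dots> < M0 * r0" using a M0 by simp
    also have "\<dots> < 2 * M0 * r0" using M0 r0 by simp
    finally show ?thesis using ri[of a "g a"] inF[of a "g a"] a face_frontier[OF F] by simp
  qed
qed

text \<open>Both end points of a short initial piece of the segment lie on the graph of
  \<open>g\<close>, so its slope in the chart is bounded by the Lipschitz constant. The piece is
  shortened because the segment may leave the chart.\<close>

lemma chart_slope:
  assumes F: "F \<in> \<F>" and ch: "face_chart F r0 M0 P E1 E2 g"
    and p: "\<bar>(p - P) \<bullet> E1\<bar> < r0" "\<bar>(p - P) \<bullet> E2\<bar> < 2 * M0 * r0"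
    and s: "0 < s" and seg: "\<And>t. 0 \<le> t \<Longrightarrow> t \<le> s \<Longrightarrow> p + t *\<^sub>R e \<in> rel_frontier F"
  shows "\<bar>e \<bullet> E2\<bar> \<le> M0 * \<bar>e \<bullet> E1\<bar>" and "e = (e \<bullet> E1) *\<^sub>R E1 + (e \<bullet> E2) *\<^sub>R E2"
proof -
  have gl: "\<And>a b. \<bar>a\<bar> \<le> r0 \<Longrightarrow> \<bar>b\<bar> \<le> r0 \<Longrightarrow> \<bar>g a - g b\<bar> \<le> M0 * \<bar>a - b\<bar>"
    using ch unfolding face_chart_def by auto
  define t where "t = Min {s, (r0 - \<bar>(p - P) \<bullet> E1\<bar>) / (2 * (1 + norm e)), (2 * M0 * r0 - \<bar>(p - P) \<bullet> E2\<bar>) / (2 * (1 + norm e))}"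
  have e0: "0 < 2 * (1 + norm e)" by (simp add: add_pos_nonneg)
  have t: "0 < t" "t \<le> s" using s p e0 by (auto simp: t_def)
  have "t \<le> (r0 - \<bar>(p - P) \<bullet> E1\<bar>) / (2 * (1 + norm e))" "t \<le> (2 * M0 * r0 - \<bar>(p - P) \<bullet> E2\<bar>) / (2 * (1 + norm e))"
    unfolding t_def by simp_all
  then have t': "t * (2 * (1 + norm e)) \<le> r0 - \<bar>(p - P) \<bullet> E1\<bar>" "t * (2 * (1 + norm e)) \<le> 2 * M0 * r0 - \<bar>(p - P) \<bullet> E2\<bar>"
    unfolding pos_le_divide_eq[OF e0] .
  have te: "t * norm e < t * (2 * (1 + norm e))"
    using t(1) add_nonneg_pos[of "norm e" 2] by simp
  define q where "q = p + t *\<^sub>R e"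
  have q: "(q - P) \<bullet> E1 = (p - P) \<bullet> E1 + t * (e \<bullet> E1)" "(q - P) \<bullet> E2 = (p - P) \<bullet> E2 + t * (e \<bullet> E2)"
    by (simp_all add: q_def inner_simps)
  have "\<bar>t * (e \<bullet> E1)\<bar> \<le> t * norm e" "\<bar>t * (e \<bullet> E2)\<bar> \<le> t * norm e"
    using chart_coords(4,5)[OF ch, of e] t by (simp_all add: abs_mult)
  then have qb: "\<bar>(q - P) \<bullet> E1\<bar> < r0" "\<bar>(q - P) \<bullet> E2\<bar> < 2 * M0 * r0" using t t' te q by linarith+
  have pr: "p \<in> rel_frontier F" "q \<in> rel_frontier F" using seg[of 0] seg[of t] s t by (simp_all add: q_def)
  have "g ((p - P) \<bullet> E1) = (p - P) \<bullet> E2" by (rule chart_frontier(1)[OF F ch pr(1) p])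
  moreover have "g ((q - P) \<bullet> E1) = (q - P) \<bullet> E2" by (rule chart_frontier(1)[OF F ch pr(2) qb])
  ultimately have "\<bar>t * (e \<bullet> E2)\<bar> \<le> M0 * \<bar>t * (e \<bullet> E1)\<bar>"
    using gl[of "(q - P) \<bullet> E1" "(p - P) \<bullet> E1"] qb p q by simp
  then have "t * \<bar>e \<bullet> E2\<bar> \<le> t * (M0 * \<bar>e \<bullet> E1\<bar>)" using t by (simp add: abs_mult mult.left_commute)
  then show "\<bar>e \<bullet> E2\<bar> \<le> M0 * \<bar>e \<bullet> E1\<bar>" using t by simp
  have "p \<in> affine hull F" "q \<in> affine hull F"
    using pr face_frontier[OF F] hull_subset[of F affine] by blast+
  then have "q - p = ((q - P) \<bullet> E1 - (p - P) \<bullet> E1) *\<^sub>R E1 + ((q - P) \<bullet> E2 - (p - P) \<bullet> E2) *\<^sub>R E2"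
  proof -
    define aq bq ap bp where "aq = (q - P) \<bullet> E1" "bq = (q - P) \<bullet> E2" "ap = (p - P) \<bullet> E1" "bp = (p - P) \<bullet> E2"
    have "q = P + aq *\<^sub>R E1 + bq *\<^sub>R E2" "p = P + ap *\<^sub>R E1 + bp *\<^sub>R E2"
      unfolding aq_bq_ap_bp_def using \<open>p \<in> affine hull F\<close> \<open>q \<in> affine hull F\<close> by (intro chart_coords(1)[OF ch]; simp)+
    then show ?thesis unfolding aq_bq_ap_bp_def[symmetric] by (simp add: algebra_simps)
  qed
  then have "t *\<^sub>R e = t *\<^sub>R ((e \<bullet> E1) *\<^sub>R E1 + (e \<bullet> E2) *\<^sub>R E2)"
    unfolding q by (simp add: q_def scaleR_add_right)
  then show "e = (e \<bullet> E1) *\<^sub>R E1 + (e \<bullet> E2) *\<^sub>R E2" using t by simp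
qed

text \<open>In spite of the name, the region is a triangle on either side of the line through
  \<open>p\<close>, of half base \<open>s\<close> and height \<open>s / M0\<close>. From its points
  the projection along the vertical of a chart, in which the line has slope at most
  \<open>M0\<close>, still hits the segment. \<open>m\<close> points into \<open>F\<close>.\<close>

definition half_disc :: "(real^3) set \<Rightarrow> real^3 \<Rightarrow> real^3 \<Rightarrow> real^3 \<Rightarrow> real \<Rightarrow> bool" where
  "half_disc F p e m s \<longleftrightarrow> norm m = 1 \<and> m \<bullet> e = 0 \<and>
     (\<forall>t h. 0 < h \<and> \<bar>t\<bar> + M0 * h \<le> s \<longrightarrow> p + t *\<^sub>R e + h *\<^sub>R m \<in> rel_interior F \<and> p + t *\<^sub>R e - h *\<^sub>R m \<notin> F)"

text \<open>Seen from a point at height \<open>h\<close>, the vertical of the chart meets the edge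
  line at most \<open>M0 * h\<close> away from the foot point, hence within the segment, where the
  values of \<open>g\<close> are known. So the chart decides whether the point belongs to
  \<open>F\<close>.\<close>

lemma half_disc_exists:
  assumes F: "F \<in> \<F>" and e: "norm e = 1" and s: "0 < s" "s \<le> r0 / 2"
    and seg: "\<And>t. \<bar>t\<bar> \<le> s \<Longrightarrow> p + t *\<^sub>R e \<in> rel_frontier F"
  shows "\<exists>m. half_disc F p e m s"
proof -
  have pF: "p \<in> rel_frontier F" using seg[of 0] s by simp
  obtain E1 E2 g where ch: "face_chart F r0 M0 p E1 E2 g" using face_chart_exists[OF F pF] .
  note co = chart_coords[OF ch]
  have ri: "\<And>a b. \<bar>a\<bar> \<le> r0 \<Longrightarrow> \<bar>b\<bar> \<le> 2 * M0 * r0 \<Longrightarrow> p + a *\<^sub>R E1 + b *\<^sub>R E2 \<in> rel_interior F \<longleftrightarrow> g a < b"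
    and inF: "\<And>a b. \<bar>a\<bar> < r0 \<Longrightarrow> \<bar>b\<bar> < 2 * M0 * r0 \<Longrightarrow> p + a *\<^sub>R E1 + b *\<^sub>R E2 \<in> F \<longleftrightarrow> g a \<le> b"
    using ch unfolding face_chart_def by auto
  define e1 where "e1 = e \<bullet> E1"
  define e2 where "e2 = e \<bullet> E2"
  have sl: "\<bar>e2\<bar> \<le> M0 * \<bar>e1\<bar>" "e = e1 *\<^sub>R E1 + e2 *\<^sub>R E2"
    unfolding e1_def e2_def using chart_slope[OF F ch, of p s e] s r0 M0 seg by auto
  have unit: "e1\<^sup>2 + e2\<^sup>2 = 1"
  proof -
    have "e \<bullet> e = 1" using e by (simp add: dot_square_norm)
    then show ?thesis unfolding sl(2) using co(6-9) by (simp add: inner_simps power2_eq_square)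
  qed
  have e1: "e1 \<noteq> 0"
  proof
    assume "e1 = 0"
    then have "e2 = 0" using sl(1) by simp
    with \<open>e1 = 0\<close> show False using unit by simp
  qed
  \<comment> \<open>\<open>e\<close> turned by a right angle, with the sign that makes the second
    component positive, so that \<open>m\<close> points above the graph.\<close>
  define m where "m = (- sgn e1 * e2) *\<^sub>R E1 + \<bar>e1\<bar> *\<^sub>R E2"
  have sg: "sgn e1 * e1 = \<bar>e1\<bar>" "sgn e1 * sgn e1 = 1" using e1 by (auto simp: sgn_if)
  have "m \<bullet> m = 1"
    using unit co(6-9) sg by (simp add: m_def inner_simps power2_eq_square algebra_simps)
  then have nm: "norm m = 1" by (simp add: norm_eq_1)
  have me: "m \<bullet> e = 0"
    unfolding m_def sl(2) using co(6-9) e1 by (simp add: inner_simps sgn_if)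
  have key: "p + t *\<^sub>R e + h *\<^sub>R m \<in> rel_interior F \<and> p + t *\<^sub>R e - h *\<^sub>R m \<notin> F"
    if h: "0 < h" "\<bar>t\<bar> + M0 * h \<le> s" for t h
  proof -
    have gen: "g (t * e1 - k * e2) = (t - k * e2 / e1) * e2 \<and> \<bar>t * e1 - k * e2\<bar> \<le> s"
      if k: "\<bar>k\<bar> = h" for k
    proof -
      \<comment> \<open>Parameter of the point of the edge line that has the same first chart
        coordinate. Both \<open>k = h\<close> and \<open>k = - h\<close> occur, for the two sides of
        the line.\<close>
      define u where "u = t - k * e2 / e1"
      have "\<bar>k * e2 / e1\<bar> = h * (\<bar>e2\<bar> / \<bar>e1\<bar>)" using k by (simp add: abs_mult abs_divide)
      also have "\<dots> \<le> h * M0" using h sl(1) e1 by (intro mult_left_mono) (auto simp: divide_le_eq)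
      finally have "\<bar>k * e2 / e1\<bar> \<le> M0 * h" by (simp only: mult.commute)
      then have "\<bar>t\<bar> + \<bar>k * e2 / e1\<bar> \<le> s" using h(2) by simp
      then have us: "\<bar>u\<bar> \<le> s" unfolding u_def by (rule order_trans[OF abs_triangle_ineq4])
      have ue1: "t * e1 - k * e2 = u * e1" using e1 by (simp add: u_def field_simps)
      have e1le: "\<bar>e1\<bar> \<le> 1" "\<bar>e2\<bar> \<le> 1" using co(4,5)[of e] e by (simp_all add: e1_def e2_def)
      have "\<bar>u * e1\<bar> \<le> \<bar>u\<bar> * 1" "\<bar>u * e2\<bar> \<le> \<bar>u\<bar> * 1"
        unfolding abs_mult using e1le by (intro mult_left_mono; simp)+
      then have ub: "\<bar>u * e1\<bar> \<le> s" "\<bar>u * e2\<bar> \<le> s" using us by simp_all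
      have in1: "(p + u *\<^sub>R e - p) \<bullet> E1 = u * e1" "(p + u *\<^sub>R e - p) \<bullet> E2 = u * e2"
        by (simp_all add: e1_def e2_def)
      have "s < r0" "r0 \<le> 2 * M0 * r0" using s r0 M0 by simp_all
      then have "g (u * e1) = u * e2"
        using chart_frontier(1)[OF F ch seg[OF us], unfolded in1] ub by linarith
      then show ?thesis using ub ue1 by (simp add: u_def)
    qed
    have sr: "s < r0" "r0 \<le> 2 * M0 * r0" using s r0 M0 by simp_all
    have hs: "h \<le> M0 * h" using h M0 by simp
    have e1le: "\<bar>e1\<bar> \<le> 1" "\<bar>e2\<bar> \<le> 1" using co(4,5)[of e] e by (simp_all add: e1_def e2_def)
    have te: "\<bar>t * e2\<bar> \<le> \<bar>t\<bar> * 1" "h * \<bar>e1\<bar> \<le> h * 1"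
      unfolding abs_mult using e1le h by (intro mult_left_mono; simp)+
    have "0 \<le> h * \<bar>e1\<bar>" using h by simp
    then have bb: "\<bar>t * e2 + h * \<bar>e1\<bar>\<bar> \<le> s" "\<bar>t * e2 - h * \<bar>e1\<bar>\<bar> \<le> s"
      using te h hs abs_triangle_ineq[of "t * e2" "h * \<bar>e1\<bar>"] abs_triangle_ineq4[of "t * e2" "h * \<bar>e1\<bar>"] by linarith+
    have pos: "0 < h * \<bar>e1\<bar>" using h e1 by simp
    have sq: "0 \<le> h * e2 * e2 / \<bar>e1\<bar>" using h by (simp add: mult.assoc)
    have pt1: "p + t *\<^sub>R e + h *\<^sub>R m = p + (t * e1 - (sgn e1 * h) * e2) *\<^sub>R E1 + (t * e2 + h * \<bar>e1\<bar>) *\<^sub>R E2"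
      unfolding m_def by (subst sl(2)) (simp add: algebra_simps)
    have pt2: "p + t *\<^sub>R e - h *\<^sub>R m = p + (t * e1 - (- sgn e1 * h) * e2) *\<^sub>R E1 + (t * e2 - h * \<bar>e1\<bar>) *\<^sub>R E2"
      unfolding m_def by (subst sl(2)) (simp add: algebra_simps)
    have a1: "\<bar>sgn e1 * h\<bar> = h" "\<bar>- sgn e1 * h\<bar> = h" using h e1 by (auto simp: abs_mult sgn_if)
    have q: "(sgn e1 * h) * e2 / e1 * e2 = h * e2 * e2 / \<bar>e1\<bar>" "(- sgn e1 * h) * e2 / e1 * e2 = - (h * e2 * e2 / \<bar>e1\<bar>)"
      using e1 by (auto simp: sgn_if abs_if)
    have "g (t * e1 - (sgn e1 * h) * e2) < t * e2 + h * \<bar>e1\<bar>"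
    proof -
      have "g (t * e1 - (sgn e1 * h) * e2) = t * e2 - h * e2 * e2 / \<bar>e1\<bar>"
        using conjunct1[OF gen[OF a1(1)]] unfolding left_diff_distrib[of t] q(1) .
      then show ?thesis using sq pos by linarith
    qed
    then have "p + t *\<^sub>R e + h *\<^sub>R m \<in> rel_interior F"
      unfolding pt1 using gen[OF a1(1)] bb sr by (subst ri) auto
    moreover have "g (t * e1 - (- sgn e1 * h) * e2) > t * e2 - h * \<bar>e1\<bar>"
    proof -
      have "g (t * e1 - (- sgn e1 * h) * e2) = t * e2 - - (h * e2 * e2 / \<bar>e1\<bar>)"
        using conjunct1[OF gen[OF a1(2)]] unfolding left_diff_distrib[of t] q(2) .
      then show ?thesis using sq pos by linarith
    qed
    then have "p + t *\<^sub>R e - h *\<^sub>R m \<notin> F"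
      unfolding pt2 using gen[OF a1(2)] bb sr by (subst inF) auto
    ultimately show ?thesis by simp
  qed
  show ?thesis unfolding half_disc_def using nm me key by blast
qed

lemma half_disc_expand:
  assumes F: "F \<in> \<F>" and hd: "half_disc F p e m s" and s: "0 < s" and e: "norm e = 1"
    and p: "p \<in> affine hull F" "p + c *\<^sub>R e \<in> affine hull F" "c \<noteq> 0"
    and y: "y \<in> affine hull F" "z \<in> affine hull F"
  shows "y - z = ((y - z) \<bullet> e) *\<^sub>R e + ((y - z) \<bullet> m) *\<^sub>R m"
    and "z + u *\<^sub>R e + v *\<^sub>R m \<in> affine hull F"
proof -
  have m: "norm m = 1" "e \<bullet> m = 0" using hd by (auto simp: half_disc_def inner_commute)
  have "p + 0 *\<^sub>R e + (s / M0) *\<^sub>R m \<in> rel_interior F"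
    using hd[unfolded half_disc_def, THEN conjunct2, THEN conjunct2, rule_format, of "s / M0" 0] s M0 by simp
  then have "p + (s / M0) *\<^sub>R m \<in> affine hull F"
    using rel_interior_subset[of F] hull_subset[of F affine] by auto
  moreover have "s / M0 \<noteq> 0" using s M0 by simp
  ultimately show "y - z = ((y - z) \<bullet> e) *\<^sub>R e + ((y - z) \<bullet> m) *\<^sub>R m"
    "z + u *\<^sub>R e + v *\<^sub>R m \<in> affine hull F"
    using face_plane_expand[OF F p(1) e m p(2,3) _ p(1) _ y] by blast+
qed

end

definition edir :: "'a::real_normed_vector \<Rightarrow> 'a \<Rightarrow> 'a" where
  "edir a b = (1 / dist a b) *\<^sub>R (b - a)"

lemma edir:
  assumes "a \<noteq> b"
  shows "norm (edir a b) = 1" "a + dist a b *\<^sub>R edir a b = b" "dist a b *\<^sub>R edir a b = b - a"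
    "edir b a = - edir a b"
proof -
  show "norm (edir a b) = 1" using assms by (simp add: edir_def dist_norm norm_minus_commute)
qed (use assms in \<open>simp_all add: edir_def dist_commute algebra_simps\<close>)

lemma closed_segment_edir:
  assumes "a \<noteq> b"
  shows "x \<in> closed_segment a b \<longleftrightarrow> (\<exists>t. 0 \<le> t \<and> t \<le> dist a b \<and> x = a + t *\<^sub>R edir a b)"
    and "x \<in> open_segment a b \<longleftrightarrow> (\<exists>t. 0 < t \<and> t < dist a b \<and> x = a + t *\<^sub>R edir a b)"
proof -
  have L: "dist a b > 0" using assms by simp
  have "x \<in> closed_segment a b \<longleftrightarrow> (\<exists>t. 0 \<le> t \<and> t \<le> dist a b \<and> x = a + t *\<^sub>R edir a b)" for x
  proof
    assume "x \<in> closed_segment a b"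
    then obtain u where "0 \<le> u" "u \<le> 1" "x = a + u *\<^sub>R (b - a)" by (auto simp: in_segment algebra_simps)
    then show "\<exists>t. 0 \<le> t \<and> t \<le> dist a b \<and> x = a + t *\<^sub>R edir a b"
      using L by (intro exI[of _ "u * dist a b"]) (simp add: edir_def mult_left_le_one_le)
  next
    assume "\<exists>t. 0 \<le> t \<and> t \<le> dist a b \<and> x = a + t *\<^sub>R edir a b"
    then obtain t where "0 \<le> t" "t \<le> dist a b" "x = a + t *\<^sub>R edir a b" by blast
    then show "x \<in> closed_segment a b"
      using L unfolding in_segment by (intro exI[of _ "t / dist a b"]) (simp add: edir_def algebra_simps)
  qed
  note cl = this
  then show "x \<in> closed_segment a b \<longleftrightarrow> (\<exists>t. 0 \<le> t \<and> t \<le> dist a b \<and> x = a + t *\<^sub>R edir a b)" .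
  have ne: "edir a b \<noteq> 0" using edir(1)[OF assms] by auto
  have "a + t *\<^sub>R edir a b = a \<longleftrightarrow> t = 0" "a + t *\<^sub>R edir a b = b \<longleftrightarrow> t = dist a b" for t
  proof -
    show "a + t *\<^sub>R edir a b = a \<longleftrightarrow> t = 0" using ne by simp
    have "a + t *\<^sub>R edir a b = b \<longleftrightarrow> t *\<^sub>R edir a b = dist a b *\<^sub>R edir a b"
      using edir(2)[OF assms] by (metis add_left_cancel)
    then show "a + t *\<^sub>R edir a b = b \<longleftrightarrow> t = dist a b" using ne by simp
  qed
  then show "x \<in> open_segment a b \<longleftrightarrow> (\<exists>t. 0 < t \<and> t < dist a b \<and> x = a + t *\<^sub>R edir a b)"
    unfolding open_segment_def using cl by (auto simp: less_le)
qed

section \<open>Inner normals along whole edges, and the incidence of edges and vertices\<close>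

context poly_setting
begin

text \<open>The bound \<open>r0 / 2\<close> keeps the half disc inside a face chart; the other two
  terms keep its base inside the edge.\<close>

definition edge_radius :: "real^3 \<Rightarrow> real^3 \<Rightarrow> real \<Rightarrow> real" where
  "edge_radius a b t = min (min t (dist a b - t)) (r0 / 2)"

definition edge_normal :: "(real^3) set \<Rightarrow> real^3 \<Rightarrow> real^3 \<Rightarrow> real^3 \<Rightarrow> bool" where
  "edge_normal F a b m \<longleftrightarrow>
     (\<forall>t. 0 < t \<and> t < dist a b \<longrightarrow> half_disc F (a + t *\<^sub>R edir a b) (edir a b) m (edge_radius a b t))"

lemma edge_sub_frontier:
  assumes F: "F \<in> \<F>" and \<sigma>: "closed_segment a b \<in> face_edges \<F> F"
  shows "a \<noteq> b" "r0 \<le> dist a b" "closed_segment a b \<subseteq> rel_frontier F"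
    "0 \<le> t \<Longrightarrow> t \<le> dist a b \<Longrightarrow> a + t *\<^sub>R edir a b \<in> rel_frontier F"
    "0 \<le> t \<Longrightarrow> t \<le> dist a b \<Longrightarrow> a + t *\<^sub>R edir a b \<in> F"
    "0 \<le> t \<Longrightarrow> t \<le> dist a b \<Longrightarrow> a + t *\<^sub>R edir a b \<in> affine hull F"
proof -
  obtain c d G where 1: "c \<noteq> d" "closed_segment a b = closed_segment c d" "r0 \<le> dist c d" "closed_segment a b \<subseteq> rel_frontier F"
    by (rule face_edgeE[OF F \<sigma>]) (rule that)
  have "{a, b} = {c, d}" using 1(2) by (simp add: closed_segment_eq)
  then show ab: "a \<noteq> b" "r0 \<le> dist a b" using 1 by (auto simp: doubleton_eq_iff dist_commute)
  show "closed_segment a b \<subseteq> rel_frontier F" by fact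
  show r: "a + t *\<^sub>R edir a b \<in> rel_frontier F" if "0 \<le> t" "t \<le> dist a b"
    using 1(4) closed_segment_edir(1)[OF ab(1)] that by blast
  show f: "a + t *\<^sub>R edir a b \<in> F" if "0 \<le> t" "t \<le> dist a b"
    using r[OF that] face_frontier[OF F] by simp
  show "a + t *\<^sub>R edir a b \<in> affine hull F" if "0 \<le> t" "t \<le> dist a b"
    using f[OF that] hull_subset[of F affine] by blast
qed

lemma edge_normal_unique:
  assumes F: "F \<in> \<F>" and e: "norm e = 1" and hd: "half_disc F p e m s" and s: "0 < s"
    and p: "p \<in> affine hull F" "p + c *\<^sub>R e \<in> affine hull F" "c \<noteq> 0"
    and m': "norm m' = 1" "m' \<bullet> e = 0" "q \<in> affine hull F" "q + k *\<^sub>R m' \<in> affine hull F" "k \<noteq> 0"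
  shows "m' = m \<or> m' = - m"
proof -
  have "k *\<^sub>R m' = (k * (m' \<bullet> m)) *\<^sub>R m"
    using half_disc_expand(1)[OF F hd s e p m'(4,3)] m'(2) by simp
  then have "k *\<^sub>R m' = k *\<^sub>R ((m' \<bullet> m) *\<^sub>R m)" by simp
  then have eq: "m' = (m' \<bullet> m) *\<^sub>R m" using m'(5) by (simp only: scaleR_cancel_left) simp
  have "norm m = 1" using hd by (simp add: half_disc_def)
  then have "\<bar>m' \<bullet> m\<bar> = 1" using arg_cong[OF eq, of norm] m'(1) by simp
  then have "m' \<bullet> m = 1 \<or> m' \<bullet> m = -1" by linarith
  then show ?thesis using eq by (metis scaleR_minus1_left scaleR_one)
qed

lemma half_discD:
  assumes "half_disc F p e m s"
  shows "norm m = 1" "m \<bullet> e = 0" "0 < h \<Longrightarrow> \<bar>t\<bar> + M0 * h \<le> s \<Longrightarrow> p + t *\<^sub>R e + h *\<^sub>R m \<in> rel_interior F"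
    "0 < h \<Longrightarrow> \<bar>t\<bar> + M0 * h \<le> s \<Longrightarrow> p + t *\<^sub>R e - h *\<^sub>R m \<notin> F"
  using assms by (auto simp: half_disc_def)

text \<open>At each inner point of the edge the normal is determined up to sign. For neighbouring
  points the half discs overlap, and opposite signs would put a common point both inside and outside
  \<open>F\<close>. Thus the sign is locally constant, and an interval is connected.\<close>

lemma edge_normal_exists:
  assumes F: "F \<in> \<F>" and \<sigma>: "closed_segment a b \<in> face_edges \<F> F"
  obtains m where "edge_normal F a b m"
proof -
  note es = edge_sub_frontier[OF F \<sigma>]
  define L where "L = dist a b"
  define e where "e = edir a b"
  have e: "norm e = 1" using edir(1)[OF es(1)] by (simp add: e_def)
  have L: "L > 0" using es(1) by (simp add: L_def)
  have rad: "edge_radius a b t > 0" "edge_radius a b t \<le> r0 / 2" "edge_radius a b t \<le> t" "edge_radius a b t \<le> L - t" if "0 < t" "t < L" for t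
  proof -
    show "edge_radius a b t > 0" using that r0 by (simp add: edge_radius_def L_def)
    show "edge_radius a b t \<le> r0 / 2" unfolding edge_radius_def by (rule min.cobounded2)
  qed (simp_all add: edge_radius_def L_def)
  have ex: "\<exists>m. half_disc F (a + t *\<^sub>R e) e m (edge_radius a b t)" if t: "0 < t" "t < L" for t
  proof (rule half_disc_exists[OF F e rad(1,2)[OF t]])
    fix u assume "\<bar>u\<bar> \<le> edge_radius a b t"
    then have "0 \<le> t + u" "t + u \<le> dist a b" using rad[OF t] by (auto simp: L_def)
    then show "a + t *\<^sub>R e + u *\<^sub>R e \<in> rel_frontier F"
      using es(4)[of "t + u"] by (simp add: e_def scaleR_add_left add.assoc)
  qed
  then obtain mm where mm: "\<And>t. 0 < t \<Longrightarrow> t < L \<Longrightarrow> half_disc F (a + t *\<^sub>R e) e (mm t) (edge_radius a b t)"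
    by metis
  have loc: "mm t' = mm t" if t: "0 < t" "t < L" and t': "0 < t'" "t' < L" and d: "\<bar>t' - t\<bar> \<le> edge_radius a b t / 2" for t t'
  proof -
    define h where "h = min (edge_radius a b t / 2) (edge_radius a b t') / M0"
    have h: "0 < h" "M0 * h \<le> edge_radius a b t / 2" "M0 * h \<le> edge_radius a b t'"
      using rad(1)[OF t] rad(1)[OF t'] M0 by (auto simp: h_def)
    have i1: "a + t *\<^sub>R e + (t' - t) *\<^sub>R e + h *\<^sub>R mm t \<in> rel_interior F"
      using h d by (intro half_discD(3)[OF mm[OF t]]) auto
    have i2: "a + t' *\<^sub>R e + 0 *\<^sub>R e - h *\<^sub>R mm t' \<notin> F"
      using h by (intro half_discD(4)[OF mm[OF t']]) auto
    have i3: "a + t' *\<^sub>R e + 0 *\<^sub>R e + h *\<^sub>R mm t' \<in> rel_interior F"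
      using h by (intro half_discD(3)[OF mm[OF t']]) auto
    have hull: "a + u *\<^sub>R e \<in> affine hull F" if "0 \<le> u" "u \<le> L" for u
      using es(6) that by (simp add: e_def L_def)
    have rh: "x \<in> affine hull F" if "x \<in> rel_interior F" for x
      using that rel_interior_subset hull_subset[of F affine] by blast
    have "mm t' = mm t \<or> mm t' = - mm t"
    proof (rule edge_normal_unique[OF F e mm[OF t] rad(1)[OF t] hull])
      show "a + t *\<^sub>R e + (- t) *\<^sub>R e \<in> affine hull F" using hull[of 0] L by simp
      show "a + t' *\<^sub>R e \<in> affine hull F" using hull t' by simp
      show "a + t' *\<^sub>R e + h *\<^sub>R mm t' \<in> affine hull F" using rh[OF i3] by simp
    qed (use t h half_discD(1,2)[OF mm[OF t']] in auto)
    moreover have "mm t' \<noteq> - mm t"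
    proof
      assume "mm t' = - mm t"
      then have "a + t *\<^sub>R e + (t' - t) *\<^sub>R e + h *\<^sub>R mm t = a + t' *\<^sub>R e + 0 *\<^sub>R e - h *\<^sub>R mm t'"
        by (simp add: algebra_simps)
      then have "a + t' *\<^sub>R e + 0 *\<^sub>R e - h *\<^sub>R mm t' \<in> rel_interior F" using i1 by (simp only:)
      then show False using i2 rel_interior_subset by blast
    qed
    ultimately show ?thesis by blast
  qed
  have const: "mm s = mm t" if s: "0 < s" "s < L" and t: "0 < t" "t < L" for s t
  proof (rule connected_local_const[of "{0<..<L}" s t mm])
    show "\<forall>u\<in>{0<..<L}. \<forall>\<^sub>F v in at u within {0<..<L}. mm u = mm v"
    proof
      fix u assume u: "u \<in> {0<..<L}"
      then have "edge_radius a b u / 2 > 0" using rad(1)[of u] by simp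
      then show "\<forall>\<^sub>F v in at u within {0<..<L}. mm u = mm v"
        unfolding eventually_at
      proof (intro exI conjI ballI impI)
        fix v assume "v \<in> {0<..<L}" "v \<noteq> u \<and> dist v u < edge_radius a b u / 2"
        then have "mm v = mm u" using u by (intro loc) (simp_all add: dist_real_def)
        then show "mm u = mm v" ..
      qed
    qed
  qed (use s t in auto)
  have "edge_normal F a b (mm (L / 2))"
    unfolding edge_normal_def
  proof (intro allI impI)
    fix t assume "0 < t \<and> t < dist a b"
    then have t: "0 < t" "t < L" by (auto simp: L_def)
    then have "mm t = mm (L / 2)" using L by (intro const) auto
    then show "half_disc F (a + t *\<^sub>R edir a b) (edir a b) (mm (L / 2)) (edge_radius a b t)"
      using mm[OF t] by (simp add: e_def)
  qed
  then show thesis using that by blast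
qed

lemma edge_normalD:
  assumes F: "F \<in> \<F>" and \<sigma>: "closed_segment a b \<in> face_edges \<F> F" and en: "edge_normal F a b m"
  shows "norm m = 1" "m \<bullet> edir a b = 0"
    "0 < t \<Longrightarrow> t < dist a b \<Longrightarrow> half_disc F (a + t *\<^sub>R edir a b) (edir a b) m (edge_radius a b t)"
    "0 < t \<Longrightarrow> t < dist a b \<Longrightarrow> 0 < edge_radius a b t"
    "0 < t \<Longrightarrow> t < dist a b \<Longrightarrow> 0 \<le> h \<Longrightarrow> \<bar>u\<bar> + M0 * h \<le> edge_radius a b t \<Longrightarrow>
       a + (t + u) *\<^sub>R edir a b + h *\<^sub>R m \<in> F"
    "y \<in> affine hull F \<Longrightarrow> z \<in> affine hull F \<Longrightarrow>
       y - z = ((y - z) \<bullet> edir a b) *\<^sub>R edir a b + ((y - z) \<bullet> m) *\<^sub>R m"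
    "z \<in> affine hull F \<Longrightarrow> z + u *\<^sub>R edir a b + v *\<^sub>R m \<in> affine hull F"
proof -
  note es = edge_sub_frontier[OF F \<sigma>]
  show hd: "half_disc F (a + t *\<^sub>R edir a b) (edir a b) m (edge_radius a b t)" if "0 < t" "t < dist a b" for t
    using en that by (simp add: edge_normal_def)
  show rp: "0 < edge_radius a b t" if "0 < t" "t < dist a b" for t using that r0 by (simp add: edge_radius_def)
  have L: "dist a b > 0" using es(1) by simp
  have h: "0 < dist a b / 2" "dist a b / 2 < dist a b" using L by simp_all
  show "norm m = 1" "m \<bullet> edir a b = 0" using half_discD(1,2)[OF hd[OF h]] by auto
  show "a + (t + u) *\<^sub>R edir a b + h *\<^sub>R m \<in> F"
    if t: "0 < t" "t < dist a b" and hu: "0 \<le> h" "\<bar>u\<bar> + M0 * h \<le> edge_radius a b t"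
  proof (cases "h = 0")
    case True
    then have "0 \<le> t + u" "t + u \<le> dist a b" using hu t by (auto simp: edge_radius_def)
    then show ?thesis using es(5)[of "t + u"] True by simp
  next
    case False
    then have "a + t *\<^sub>R edir a b + u *\<^sub>R edir a b + h *\<^sub>R m \<in> rel_interior F"
      using hu by (intro half_discD(3)[OF hd[OF t]]) auto
    then show ?thesis using rel_interior_subset by (auto simp: scaleR_add_left add.assoc)
  qed
  have hull: "a + (dist a b / 2) *\<^sub>R edir a b \<in> affine hull F" using es(6) L by simp
  have hull': "a + (dist a b / 2) *\<^sub>R edir a b + (- (dist a b / 2)) *\<^sub>R edir a b \<in> affine hull F"
    using es(6)[of 0] by simp
  have nz: "- (dist a b / 2) \<noteq> 0" using L by simp
  show "y - z = ((y - z) \<bullet> edir a b) *\<^sub>R edir a b + ((y - z) \<bullet> m) *\<^sub>R m"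
    if "y \<in> affine hull F" "z \<in> affine hull F"
    by (rule half_disc_expand(1)[OF F hd[OF h] rp[OF h] edir(1)[OF es(1)] hull hull' nz that])
  show "z + u *\<^sub>R edir a b + v *\<^sub>R m \<in> affine hull F" if "z \<in> affine hull F"
    by (rule half_disc_expand(2)[OF F hd[OF h] rp[OF h] edir(1)[OF es(1)] hull hull' nz that that])
qed

text \<open>The half discs leave only the edge line: points on the side of \<open>m\<close> are
  relatively interior, points on the other side are not in \<open>F\<close>.\<close>

lemma rel_frontier_near_edge:
  assumes F: "F \<in> \<F>" and \<sigma>: "closed_segment a b \<in> face_edges \<F> F" and v: "v \<in> open_segment a b"
  obtains \<delta> where "\<delta> > 0" "rel_frontier F \<inter> ball v \<delta> \<subseteq> closed_segment a b"
proof -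
  note es = edge_sub_frontier[OF F \<sigma>]
  obtain m where en: "edge_normal F a b m" using edge_normal_exists[OF F \<sigma>] .
  note ed = edge_normalD[OF F \<sigma> en]
  obtain t where t: "0 < t" "t < dist a b" "v = a + t *\<^sub>R edir a b"
    using v closed_segment_edir(2)[OF es(1)] by blast
  let ?s = "edge_radius a b t"
  have vh: "v \<in> affine hull F" using es(6) t by simp
  show thesis
  proof (rule that)
    show "?s / K > 0" using ed(4)[OF t(1,2)] K2 by simp
    show "rel_frontier F \<inter> ball v (?s / K) \<subseteq> closed_segment a b"
    proof
      fix y assume y: "y \<in> rel_frontier F \<inter> ball v (?s / K)"
      then have yF: "y \<in> F" "y \<notin> rel_interior F" using face_frontier[OF F] by auto
      define u where "u = (y - v) \<bullet> edir a b"
      define h where "h = (y - v) \<bullet> m"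
      have yv: "y = v + u *\<^sub>R edir a b + h *\<^sub>R m"
        using ed(6)[OF _ vh, of y] yF hull_subset[of F affine] by (auto simp: u_def h_def algebra_simps)
      have "\<bar>u\<bar> \<le> norm (y - v)" "\<bar>h\<bar> \<le> norm (y - v)"
        using Cauchy_Schwarz_ineq2[of "y - v" "edir a b"] Cauchy_Schwarz_ineq2[of "y - v" m] ed(1) edir(1)[OF es(1)]
        by (simp_all add: u_def h_def)
      then have "\<bar>u\<bar> + M0 * \<bar>h\<bar> \<le> norm (y - v) + M0 * norm (y - v)"
        using M0 by (intro add_mono mult_left_mono) auto
      also have "\<dots> = (1 + M0) * norm (y - v)" by (simp add: distrib_right)
      also have "\<dots> \<le> K * norm (y - v)" using K by (intro mult_right_mono) auto
      also have "\<dots> < ?s" using y K2 by (simp add: less_divide_eq dist_norm norm_minus_commute mult.commute)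
      finally have uh: "\<bar>u\<bar> + M0 * \<bar>h\<bar> \<le> ?s" by simp
      consider "h > 0" | "h < 0" | "h = 0" by linarith
      then show "y \<in> closed_segment a b"
      proof cases
        case 1
        then show ?thesis using half_discD(3)[OF ed(3)[OF t(1,2)], of h u] uh yF yv t(3) by simp
      next
        case 2
        then have "v + u *\<^sub>R edir a b - (- h) *\<^sub>R m \<notin> F"
          using half_discD(4)[OF ed(3)[OF t(1,2)], of "- h" u] uh t(3) by simp
        then show ?thesis using yF yv by simp
      next
        case 3
        then have "0 \<le> t + u" "t + u \<le> dist a b" using uh by (auto simp: edge_radius_def)
        then show ?thesis unfolding closed_segment_edir(1)[OF es(1)]
          using 3 yv t(3) by (intro exI[of _ "t + u"]) (simp add: scaleR_add_left)
      qed
    qed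
  qed
qed

lemma graph_direction_unique:
  assumes \<nu>: "graph_direction (frontier D) r0 s M0 P \<nu>"
    and "y \<in> frontier D" "dist P y < r0" "z \<in> frontier D" "dist P z < r0" "y - z = c *\<^sub>R \<nu>"
  shows "c = 0" "y = z"
proof -
  have n1: "norm \<nu> = 1" and sl: "\<forall>x\<in>frontier D \<inter> ball P r0. \<forall>z\<in>frontier D \<inter> ball P r0.
      \<bar>(x - z) \<bullet> \<nu>\<bar> \<le> M0 * norm ((x - z) - ((x - z) \<bullet> \<nu>) *\<^sub>R \<nu>)"
    using \<nu> unfolding graph_direction_def by blast+
  have "\<bar>(y - z) \<bullet> \<nu>\<bar> \<le> M0 * norm ((y - z) - ((y - z) \<bullet> \<nu>) *\<^sub>R \<nu>)"
    using sl[THEN bspec, of y, THEN bspec, of z] assms(2-5) by simp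
  moreover have "\<nu> \<bullet> \<nu> = 1" using n1 by (simp add: dot_square_norm)
  ultimately show "c = 0" using assms(6) by simp
  then show "y = z" using assms(6) by simp
qed

text \<open>In the oblique coordinates given by \<open>e\<close>, \<open>m\<close> and the graph
  direction \<nu>, the half-planes spanned by \<open>m\<close> and by \<open>n\<close> project along
  \<nu> to opposite sides of the edge line. Together they cover all base points near
  \<open>v\<close>, and a graph has only one point over each of them.\<close>

lemma frontier_near_edge:
  assumes F: "F \<in> \<F>" and G: "G \<in> \<F>" "G \<noteq> F"
    and \<sigma>F: "closed_segment a b \<in> face_edges \<F> F" and \<sigma>G: "closed_segment a b \<in> face_edges \<F> G"
    and v: "v \<in> open_segment a b"
  obtains \<delta> where "\<delta> > 0" "frontier D \<inter> ball v \<delta> \<subseteq> F \<union> G"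
proof -
  note es = edge_sub_frontier[OF F \<sigma>F]
  obtain m where en: "edge_normal F a b m" using edge_normal_exists[OF F \<sigma>F] .
  obtain n where enG: "edge_normal G a b n" using edge_normal_exists[OF G(1) \<sigma>G] .
  note ed = edge_normalD[OF F \<sigma>F en]
  note edG = edge_normalD[OF G(1) \<sigma>G enG]
  obtain t0 where t0: "0 < t0" "t0 < dist a b" "v = a + t0 *\<^sub>R edir a b"
    using v closed_segment_edir(2)[OF es(1)] by blast
  define e where "e = edir a b"
  define s where "s = edge_radius a b t0"
  have e1: "norm e = 1" using edir(1)[OF es(1)] by (simp add: e_def)
  have ee: "e \<bullet> e = 1" using e1 by (simp add: dot_square_norm)
  have s: "s > 0" "s \<le> r0 / 2"
    using ed(4)[OF t0(1,2)] min.cobounded2[of "min t0 (dist a b - t0)" "r0 / 2"] by (simp_all only: s_def edge_radius_def)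
  have hdF: "half_disc F v e m s" using ed(3)[OF t0(1,2)] by (simp add: t0(3) e_def s_def)
  have hdG: "half_disc G v e n s" using edG(3)[OF t0(1,2)] by (simp add: t0(3) e_def s_def)
  have inF: "v + t *\<^sub>R e + h *\<^sub>R m \<in> F" if "0 \<le> h" "\<bar>t\<bar> + M0 * h \<le> s" for t h
    using ed(5)[OF t0(1,2) that[unfolded s_def]] by (simp add: t0(3) e_def scaleR_add_left add.assoc)
  have inG: "v + t *\<^sub>R e + h *\<^sub>R n \<in> G" if "0 \<le> h" "\<bar>t\<bar> + M0 * h \<le> s" for t h
    using edG(5)[OF t0(1,2) that[unfolded s_def]] by (simp add: t0(3) e_def scaleR_add_left add.assoc)
  have vF: "v \<in> F" and vG: "v \<in> G" using inF[of 0 0] inG[of 0 0] s by auto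
  have vD: "v \<in> frontier D" using vF face_subset[OF F] by blast
  obtain \<nu> where \<nu>: "graph_direction (frontier D) r0 (r0 / K) M0 v \<nu>" using graph_direction_exists[OF vD] .
  obtain N where N: "N \<noteq> 0" "\<And>y. y \<in> affine hull F \<longleftrightarrow> N \<bullet> (y - v) = 0" using face_normal[OF F vF] by blast
  have N\<nu>: "N \<bullet> \<nu> \<noteq> 0"
  proof
    assume "N \<bullet> \<nu> = 0"
    then have "v + 1 *\<^sub>R \<nu> \<in> affine hull F" using N(2) by simp
    then show False using face_graph_transversal[OF F vF \<nu>, of 1] by simp
  qed
  have vh: "v \<in> affine hull F" using vF hull_subset[of F affine] by blast
  \<comment> \<open>\<open>x\<close> is slid along \<nu> into the plane of \<open>F\<close>; the
    bound is finite because that plane is transversal to \<nu>.\<close>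
  have dec: "\<exists>t h c. x = t *\<^sub>R e + h *\<^sub>R m + c *\<^sub>R \<nu> \<and> \<bar>t\<bar> \<le> (1 + norm N / \<bar>N \<bullet> \<nu>\<bar>) * norm x \<and> \<bar>h\<bar> \<le> (1 + norm N / \<bar>N \<bullet> \<nu>\<bar>) * norm x" for x
  proof -
    define c where "c = (N \<bullet> x) / (N \<bullet> \<nu>)"
    define w where "w = x - c *\<^sub>R \<nu>"
    have "N \<bullet> w = 0" using N\<nu> by (simp add: w_def c_def inner_simps)
    then have "v + w \<in> affine hull F" using N(2) by simp
    from ed(6)[OF this vh] have w: "w = (w \<bullet> e) *\<^sub>R e + (w \<bullet> m) *\<^sub>R m" by (simp add: e_def)
    have "\<bar>N \<bullet> x\<bar> \<le> norm N * norm x" by (rule Cauchy_Schwarz_ineq2)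
    then have "\<bar>c\<bar> \<le> norm N * norm x / \<bar>N \<bullet> \<nu>\<bar>" using N\<nu> by (simp add: c_def abs_divide divide_right_mono)
    moreover have "norm \<nu> = 1" using \<nu> by (simp add: graph_direction_def)
    ultimately have "norm w \<le> (1 + norm N / \<bar>N \<bullet> \<nu>\<bar>) * norm x"
      using norm_triangle_ineq4[of x "c *\<^sub>R \<nu>"] by (simp add: w_def distrib_right)
    moreover have "\<bar>w \<bullet> e\<bar> \<le> norm w" "\<bar>w \<bullet> m\<bar> \<le> norm w"
      using Cauchy_Schwarz_ineq2[of w e] Cauchy_Schwarz_ineq2[of w m] e1 ed(1) by simp_all
    moreover have "x = (w \<bullet> e) *\<^sub>R e + (w \<bullet> m) *\<^sub>R m + c *\<^sub>R \<nu>" using w by (simp add: w_def)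
    ultimately show ?thesis by (intro exI conjI) auto
  qed
  obtain t' h' c' where n: "n = t' *\<^sub>R e + h' *\<^sub>R m + c' *\<^sub>R \<nu>" using dec[of n] by blast
  \<comment> \<open>A scale at which both \<open>r *\<^sub>R n\<close> and its shadow along \<nu> in
    the plane of \<open>F\<close> satisfy the size conditions of the half discs.\<close>
  have small: "\<exists>r>0. \<bar>r * t'\<bar> + M0 * (r * \<bar>h'\<bar>) \<le> s \<and> M0 * r \<le> s"
  proof -
    define B where "B = \<bar>t'\<bar> + M0 * \<bar>h'\<bar> + M0"
    have B: "B > 0" using M0 by (simp add: B_def add_nonneg_pos)
    define r where "r = s / B"
    have r: "r > 0" "r * B = s" using s B by (simp_all add: r_def)
    have "r * \<bar>t'\<bar> + M0 * (r * \<bar>h'\<bar>) + M0 * r = s"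
      using r(2) unfolding B_def by (simp add: algebra_simps)
    moreover have "0 \<le> r * \<bar>t'\<bar>" "0 \<le> M0 * (r * \<bar>h'\<bar>)" "0 \<le> M0 * r" using r M0 by simp_all
    moreover have "\<bar>r * t'\<bar> = r * \<bar>t'\<bar>" using r by (simp add: abs_mult)
    ultimately have "\<bar>r * t'\<bar> + M0 * (r * \<bar>h'\<bar>) \<le> s \<and> M0 * r \<le> s" by linarith
    then show ?thesis using r by blast
  qed
  have near: "dist v (v + t *\<^sub>R e + h *\<^sub>R x) < r0" if "norm x = 1" "\<bar>t\<bar> + M0 * \<bar>h\<bar> \<le> s" for t h x
  proof -
    have "dist v (v + t *\<^sub>R e + h *\<^sub>R x) \<le> \<bar>t\<bar> + \<bar>h\<bar>"
      using norm_triangle_ineq[of "t *\<^sub>R e" "h *\<^sub>R x"] e1 that(1)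
      by (metis add.assoc add_diff_cancel_left' dist_commute dist_norm mult.right_neutral norm_scaleR)
    also have "\<bar>h\<bar> \<le> M0 * \<bar>h\<bar>" using M0 mult_right_mono[of 1 M0 "\<bar>h\<bar>"] by simp
    finally show ?thesis using that s r0 by linarith
  qed
  \<comment> \<open>\<open>h' = 0\<close> would place \<nu> in the plane of \<open>G\<close> or make
    \<open>n\<close> parallel to the edge. \<open>h' > 0\<close> would make the two half-planes
    project onto overlapping sets, so that the relative interiors of \<open>F\<close> and
    \<open>G\<close> would meet.\<close>
  have h'neg: "h' < 0"
  proof (rule ccontr)
    assume "\<not> h' < 0"
    then consider "h' = 0" | "h' > 0" by linarith
    then show False
    proof cases
      case 1
      then have "v + c' *\<^sub>R \<nu> = v + (- t') *\<^sub>R e + 1 *\<^sub>R n" using n by (simp add: algebra_simps)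
      also have "\<dots> \<in> affine hull G"
        using edG(7)[of v "- t'" 1] vG hull_subset[of G affine] by (auto simp: e_def)
      finally have "c' = 0" by (rule face_graph_transversal[OF G(1) vG \<nu>])
      then have "n = t' *\<^sub>R e" using n 1 by simp
      moreover from this have "t' = 0" using edG(2) ee by (simp add: e_def[symmetric])
      ultimately show False using edG(1) by simp
    next
      case 2
      obtain r where r: "r > 0" "\<bar>r * t'\<bar> + M0 * (r * \<bar>h'\<bar>) \<le> s" "M0 * r \<le> s" using small by blast
      have i1: "v + 0 *\<^sub>R e + r *\<^sub>R n \<in> rel_interior G" using r by (intro half_discD(3)[OF hdG]) auto
      have i2: "v + (r * t') *\<^sub>R e + (r * h') *\<^sub>R m \<in> rel_interior F" using r 2 by (intro half_discD(3)[OF hdF]) auto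
      have "v + 0 *\<^sub>R e + r *\<^sub>R n = v + (r * t') *\<^sub>R e + (r * h') *\<^sub>R m"
      proof (rule graph_direction_unique(2)[OF \<nu>])
        show "v + 0 *\<^sub>R e + r *\<^sub>R n \<in> frontier D" using i1 rel_interior_subset face_subset[OF G(1)] by blast
        show "v + (r * t') *\<^sub>R e + (r * h') *\<^sub>R m \<in> frontier D" using i2 rel_interior_subset face_subset[OF F] by blast
        show "dist v (v + 0 *\<^sub>R e + r *\<^sub>R n) < r0" using r edG(1) by (intro near) auto
        show "dist v (v + (r * t') *\<^sub>R e + (r * h') *\<^sub>R m) < r0" using r ed(1) by (intro near) (auto simp: abs_mult)
        show "v + 0 *\<^sub>R e + r *\<^sub>R n - (v + (r * t') *\<^sub>R e + (r * h') *\<^sub>R m) = (r * c') *\<^sub>R \<nu>"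
          by (subst n) (simp add: algebra_simps)
      qed
      then have "v + (r * t') *\<^sub>R e + (r * h') *\<^sub>R m \<in> rel_interior G" using i1 by (simp only:)
      then show False using i2 poly(8)[OF F G(1) G(2)[symmetric]] by blast
    qed
  qed
  define A where "A = 1 + norm N / \<bar>N \<bullet> \<nu>\<bar>"
  \<comment> \<open>Several demands on \<open>norm (z - v)\<close> at once: the first summand brings
    the coordinates into the half disc of \<open>F\<close>; the other two, which arise from the
    division by \<open>h'\<close>, serve that of \<open>G\<close>.\<close>
  define B where "B = A * (K + \<bar>t'\<bar> / \<bar>h'\<bar> + M0 / \<bar>h'\<bar>)"
  have A: "A \<ge> 1" by (simp add: A_def)
  have Bq: "K + \<bar>t'\<bar> / \<bar>h'\<bar> + M0 / \<bar>h'\<bar> > 0" using K2 M0 by (intro add_pos_nonneg) auto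
  have B: "B > 0" using A Bq by (simp add: B_def)
  show thesis
  proof (rule that)
    show "min r0 (s / B) > 0" using r0 s B by simp
    show "frontier D \<inter> ball v (min r0 (s / B)) \<subseteq> F \<union> G"
    proof
      fix z assume z: "z \<in> frontier D \<inter> ball v (min r0 (s / B))"
      obtain t h c where zv: "z - v = t *\<^sub>R e + h *\<^sub>R m + c *\<^sub>R \<nu>"
        and th: "\<bar>t\<bar> \<le> A * norm (z - v)" "\<bar>h\<bar> \<le> A * norm (z - v)"
        using dec[of "z - v"] unfolding A_def by blast
      have "norm (z - v) < s / B" using z by (simp add: dist_norm norm_minus_commute)
      then have zB: "B * norm (z - v) < s" using B by (simp add: less_divide_eq mult.commute)
      have sum: "A * norm (z - v) * K + \<bar>t'\<bar> * (A * norm (z - v) / \<bar>h'\<bar>) + M0 * (A * norm (z - v) / \<bar>h'\<bar>) < s"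
        using zB by (simp add: B_def algebra_simps)
      have nn: "0 \<le> A * norm (z - v)" using A by simp
      then have nn': "0 \<le> \<bar>t'\<bar> * (A * norm (z - v) / \<bar>h'\<bar>)" "0 \<le> M0 * (A * norm (z - v) / \<bar>h'\<bar>)" "0 \<le> A * norm (z - v) * K"
        using M0 K2 by simp_all
      have K1: "A * norm (z - v) * (1 + M0) \<le> A * norm (z - v) * K" using K nn by (rule mult_left_mono)
      show "z \<in> F \<union> G"
      proof (cases "h \<ge> 0")
        case True
        have "M0 * h \<le> M0 * (A * norm (z - v))" using th True M0 by (intro mult_left_mono) auto
        then have le: "\<bar>t\<bar> + M0 * \<bar>h\<bar> \<le> s" 
        proof -
          have "A * norm (z - v) + M0 * (A * norm (z - v)) \<le> A * norm (z - v) * K" using K1 by (simp add: algebra_simps)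
          moreover have "\<bar>h\<bar> = h" using True by simp
          ultimately show ?thesis using \<open>M0 * h \<le> _\<close> th(1) sum nn' by linarith
        qed
        have i: "v + t *\<^sub>R e + h *\<^sub>R m \<in> F" using le True by (intro inF) auto
        have "z = v + t *\<^sub>R e + h *\<^sub>R m"
        proof (rule graph_direction_unique(2)[OF \<nu>])
          show "v + t *\<^sub>R e + h *\<^sub>R m \<in> frontier D" using i face_subset[OF F] by blast
          show "dist v (v + t *\<^sub>R e + h *\<^sub>R m) < r0" using le ed(1) by (intro near)
          show "z - (v + t *\<^sub>R e + h *\<^sub>R m) = c *\<^sub>R \<nu>" using zv by (simp add: algebra_simps)
        qed (use z in auto)
        then show ?thesis using i by simp
      next
        case False
        \<comment> \<open>The multiple of \<open>n\<close> with the same \<open>m\<close>-coordinate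
          as \<open>z - v\<close>; what remains is a shift along the edge and one along
          \<nu>.\<close>
        define \<rho> where "\<rho> = h / h'"
        have \<rho>: "\<rho> > 0" "\<rho> * h' = h" using False h'neg by (simp_all add: \<rho>_def zero_less_divide_iff)
        have "\<rho> = \<bar>h\<bar> / \<bar>h'\<bar>" using False h'neg by (simp add: \<rho>_def)
        then have \<rho>le: "\<rho> \<le> A * norm (z - v) / \<bar>h'\<bar>" using th(2) by (simp add: divide_right_mono)
        have "\<bar>t - \<rho> * t'\<bar> \<le> \<bar>t\<bar> + \<bar>t'\<bar> * \<rho>"
          using abs_triangle_ineq4[of t "\<rho> * t'"] \<rho> by (simp add: abs_mult mult.commute)
        also have "\<bar>t'\<bar> * \<rho> \<le> \<bar>t'\<bar> * (A * norm (z - v) / \<bar>h'\<bar>)" using \<rho>le by (intro mult_left_mono) auto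
        finally have 1: "\<bar>t - \<rho> * t'\<bar> \<le> \<bar>t\<bar> + \<bar>t'\<bar> * (A * norm (z - v) / \<bar>h'\<bar>)" by simp
        have 2: "M0 * \<rho> \<le> M0 * (A * norm (z - v) / \<bar>h'\<bar>)" using \<rho>le M0 by (intro mult_left_mono) auto
        have 3: "A * norm (z - v) \<le> A * norm (z - v) * K" using nn K2 mult_left_mono[of 1 K "A * norm (z - v)"] by simp
        have le: "\<bar>t - \<rho> * t'\<bar> + M0 * \<bar>\<rho>\<bar> \<le> s" using 1 2 3 th(1) sum \<rho> by linarith
        have i: "v + (t - \<rho> * t') *\<^sub>R e + \<rho> *\<^sub>R n \<in> G" using le \<rho> by (intro inG) auto
        have "z = v + (t - \<rho> * t') *\<^sub>R e + \<rho> *\<^sub>R n"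
        proof (rule graph_direction_unique(2)[OF \<nu>])
          show "v + (t - \<rho> * t') *\<^sub>R e + \<rho> *\<^sub>R n \<in> frontier D" using i face_subset[OF G(1)] by blast
          show "dist v (v + (t - \<rho> * t') *\<^sub>R e + \<rho> *\<^sub>R n) < r0" using le edG(1) by (intro near)
          have "z = v + t *\<^sub>R e + (\<rho> * h') *\<^sub>R m + c *\<^sub>R \<nu>" using zv \<rho>(2) by (simp add: algebra_simps)
          then show "z - (v + (t - \<rho> * t') *\<^sub>R e + \<rho> *\<^sub>R n) = (c - \<rho> * c') *\<^sub>R \<nu>"
            unfolding n by (simp add: algebra_simps)
        qed (use z in auto)
        then show ?thesis using i by simp
      qed
    qed
  qed
qed

text \<open>Near \<open>v\<close> only \<open>F\<close> and \<open>G\<close> are present, so these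
  are the two faces of \<tau>, and \<tau> runs along the given edge near \<open>v\<close>. The union
  of two overlapping collinear segments is a segment in \<open>F \<inter> G\<close>, and maximality
  makes both equal to it.\<close>

lemma edges_through_open_segment:
  assumes F: "F \<in> \<F>" and \<sigma>: "closed_segment a b \<in> face_edges \<F> F" and v: "v \<in> open_segment a b"
    and \<tau>: "\<tau> \<in> edges \<F>" "v \<in> \<tau>"
  shows "\<tau> = closed_segment a b"
proof -
  obtain F' where F': "F' \<in> \<F>" "\<tau> \<in> face_edges \<F> F'" using \<tau>(1) by (auto simp: edges_def)
  obtain a' b' G where G: "G \<in> \<F>" "G \<noteq> F" "closed_segment a b \<in> face_edges \<F> G"
    and FG: "closed_segment a b \<subseteq> F \<inter> G"
    and max\<sigma>: "\<And>\<rho>. nondegenerate_segment \<rho> \<Longrightarrow> closed_segment a b \<subseteq> \<rho> \<Longrightarrow> \<rho> \<subseteq> F \<inter> G \<Longrightarrow> \<rho> = closed_segment a b"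
    by (rule face_edgeE[OF F \<sigma>]) (rule that)
  obtain c d G' where cd: "c \<noteq> d" "\<tau> = closed_segment c d" and G': "G' \<in> \<F>" "G' \<noteq> F'" "\<tau> \<subseteq> F' \<inter> G'"
    and max\<tau>: "\<And>\<rho>. nondegenerate_segment \<rho> \<Longrightarrow> \<tau> \<subseteq> \<rho> \<Longrightarrow> \<rho> \<subseteq> F' \<inter> G' \<Longrightarrow> \<rho> = \<tau>"
    by (rule face_edgeE[OF F'(1,2)]) (rule that)
  obtain \<delta> where \<delta>: "\<delta> > 0" "frontier D \<inter> ball v \<delta> \<subseteq> F \<union> G"
    using frontier_near_edge[OF F G(1,2) \<sigma> G(3) v] .
  have two: "H = F \<or> H = G" if H: "H \<in> \<F>" "v \<in> H" for H
  proof (rule ccontr)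
    assume ne: "\<not> (H = F \<or> H = G)"
    have "v \<in> closure (rel_interior H)" using H face_closure by blast
    then obtain y where y: "y \<in> rel_interior H" "dist y v < \<delta>" using \<delta>(1) closure_approachable by blast
    then have "y \<in> frontier D \<inter> ball v \<delta>"
      using face_subset(1)[OF H(1)] rel_interior_subset[of H] by (auto simp: dist_commute)
    then have "y \<in> F \<union> G" using \<delta>(2) by blast
    then show False using rel_interior_disjoint[OF H(1) F] rel_interior_disjoint[OF H(1) G(1)] ne y by auto
  qed
  have "F' = F \<or> F' = G" "G' = F \<or> G' = G" using two[OF F'(1)] two[OF G'(1)] G'(3) \<tau>(2) by blast+
  then have FG': "F' \<inter> G' = F \<inter> G" using G'(2) by blast
  obtain \<delta>' where \<delta>': "\<delta>' > 0" "rel_frontier F \<inter> ball v \<delta>' \<subseteq> closed_segment a b"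
    using rel_frontier_near_edge[OF F \<sigma> v] .
  \<comment> \<open>Provides a second point of \<tau> so close to \<open>v\<close> that it must lie
    on the edge: two common points put both segments on one line.\<close>
  have "v islimpt \<tau>"
    using connected_imp_perfect[of \<tau> v] \<tau>(2) cd by (metis connected_segment(1) ends_in_segment singletonD)
  then obtain q where q: "q \<in> \<tau>" "q \<noteq> v" "dist q v < \<delta>'" using \<delta>'(1) by (auto simp: islimpt_approachable)
  have "q \<in> rel_frontier F" using q(1) G'(3) FG' face_Int_subset(1)[OF F G(1)] G(2) by blast
  then have q\<sigma>: "q \<in> closed_segment a b" using \<delta>'(2) q(3) by (auto simp: subset_iff dist_commute)
  have v\<sigma>: "v \<in> closed_segment a b" using v by (simp add: open_segment_def)
  let ?S = "closed_segment a b \<union> \<tau>"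
  have line: "S \<subseteq> affine hull {v, q}" if S: "collinear S" "v \<in> S" "q \<in> S" for S
  proof
    fix y assume "y \<in> S"
    then have "collinear {v, q, y}" using S by (intro collinear_subset[OF S(1)]) auto
    then show "y \<in> affine hull {v, q}" using collinear_3_affine_hull[of v q y] q(2) by auto
  qed
  have "?S \<subseteq> affine hull {v, q}"
    using line[OF collinear_closed_segment v\<sigma> q\<sigma>] line[of \<tau>] collinear_closed_segment \<tau>(2) q(1) cd(2) by blast
  then have col: "collinear ?S" using collinear_affine_hull by blast
  have "connected ?S" using v\<sigma> \<tau>(2) cd(2) by (intro connected_Un) auto
  then have "convex ?S" using convex_connected_collinear[OF col] by simp
  moreover have "compact ?S" using cd(2) by (simp add: compact_Un)
  ultimately obtain c' d' where S: "?S = closed_segment c' d'"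
    using compact_convex_collinear_segment[OF _ _ _ col] v\<sigma> by blast
  have "c' \<noteq> d'"
  proof
    assume "c' = d'"
    then have "?S = {c'}" using S by simp
    moreover have "q \<in> ?S" "v \<in> ?S" using q v\<sigma> by blast+
    ultimately have "q = c'" "v = c'" by blast+
    then show False using q by simp
  qed
  then have nd: "nondegenerate_segment ?S" using S unfolding nondegenerate_segment_def by blast
  have sub: "?S \<subseteq> F \<inter> G" using FG G'(3) FG' by blast
  have "?S = closed_segment a b" by (rule max\<sigma>[OF nd _ sub]) blast
  moreover have "?S = \<tau>" by (rule max\<tau>[OF nd]) (use sub FG' in blast)+
  ultimately show ?thesis by simp
qed

lemma edgesI: "F \<in> \<F> \<Longrightarrow> \<sigma> \<in> face_edges \<F> F \<Longrightarrow> \<sigma> \<in> edges \<F>"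
  by (auto simp: edges_def)

lemma edges_Int:
  assumes F: "F \<in> \<F>" and \<sigma>: "closed_segment a b \<in> face_edges \<F> F"
    and \<tau>: "\<tau> \<in> edges \<F>" "\<tau> \<noteq> closed_segment a b" and x: "x \<in> closed_segment a b" "x \<in> \<tau>"
  shows "x = a \<or> x = b"
  using edges_through_open_segment[OF F \<sigma> _ \<tau>(1) x(2)] \<tau>(2) x(1) by (auto simp: open_segment_def)

text \<open>The chart at the end point \<open>a\<close> continues the relative boundary beyond the
  edge. The points of the graph on the side turned away from the edge accumulate at
  \<open>a\<close>, so one of them shares an edge with \<open>a\<close>; as \<open>a\<close> cannot
  be an inner point of that edge, it is an end point.\<close>

lemma edge_opposite_side:
  assumes F: "F \<in> \<F>" and \<sigma>: "closed_segment a b \<in> face_edges \<F> F" and ch: "face_chart F r0 M0 a E1 E2 g"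
  obtains c where "closed_segment a c \<in> face_edges \<F> F" "closed_segment a c \<noteq> closed_segment a b"
    "edir a b \<bullet> E1 \<noteq> 0" "(edir a c \<bullet> E1) * (edir a b \<bullet> E1) < 0" "closed_segment a b \<inter> closed_segment a c = {a}"
proof -
  note es = edge_sub_frontier[OF F \<sigma>]
  note co = chart_coords[OF ch]
  define e where "e = edir a b"
  have e1: "norm e = 1" using edir(1)[OF es(1)] by (simp add: e_def)
  have slope: "e \<bullet> E1 \<noteq> 0"
  proof
    assume 0: "e \<bullet> E1 = 0"
    have "\<bar>e \<bullet> E2\<bar> \<le> M0 * \<bar>e \<bullet> E1\<bar>" "e = (e \<bullet> E1) *\<^sub>R E1 + (e \<bullet> E2) *\<^sub>R E2"
      using chart_slope[OF F ch, of a "dist a b" e] es r0 M0 by (auto simp: e_def)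
    then have "e = 0" using 0 by simp
    then show False using e1 by simp
  qed
  define p where "p = (\<lambda>x. a + x *\<^sub>R E1 + g x *\<^sub>R E2)"
  have pE1: "(p x - a) \<bullet> E1 = x" for x unfolding p_def by (rule co(2))
  define A where "A = p ` {x. \<bar>x\<bar> < r0 \<and> x * (e \<bullet> E1) < 0}"
  have A: "A \<subseteq> rel_frontier F" unfolding A_def p_def using chart_frontier(2)[OF F ch] by auto
  have p0: "p 0 = a" using ch by (simp add: p_def face_chart_def)
  have "a \<in> closure (A - {a})"
    unfolding closure_approachable
  proof (intro allI impI)
    fix \<epsilon> :: real assume \<epsilon>: "\<epsilon> > 0"
    \<comment> \<open>The sign puts \<open>x\<close> on the side away from the edge;
      \<open>K * \<bar>x\<bar> < \<epsilon>\<close> controls the point of the graph over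
      \<open>x\<close>.\<close>
    define x where "x = - sgn (e \<bullet> E1) * min (r0 / 2) (\<epsilon> / (2 * K))"
    have mn: "min (r0 / 2) (\<epsilon> / (2 * K)) > 0" using r0 \<epsilon> K2 by simp
    have xa: "\<bar>x\<bar> = min (r0 / 2) (\<epsilon> / (2 * K))" using slope mn by (simp add: x_def abs_mult abs_sgn_eq)
    have xr: "\<bar>x\<bar> < r0" "x \<noteq> 0" using xa r0 mn by (auto simp: min_def)
    have xe: "x * (e \<bullet> E1) < 0"
    proof -
      have "x * (e \<bullet> E1) = - (min (r0 / 2) (\<epsilon> / (2 * K)) * (sgn (e \<bullet> E1) * (e \<bullet> E1)))" by (simp add: x_def)
      moreover have "sgn (e \<bullet> E1) * (e \<bullet> E1) > 0" using slope by (simp add: sgn_if)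
      ultimately show ?thesis using mn by simp
    qed
    have "p x \<noteq> a" using pE1[of x] xr(2) by auto
    moreover have "p x \<in> A" using xr xe by (auto simp: A_def)
    moreover have "dist (p x) a < \<epsilon>"
    proof -
      have "dist (p x) a \<le> \<bar>x\<bar> + \<bar>g x\<bar>"
        using norm_triangle_ineq[of "x *\<^sub>R E1" "g x *\<^sub>R E2"] ch
        by (simp add: p_def dist_norm face_chart_def orthonormal_pair_def add.assoc)
      also have "\<bar>g x\<bar> \<le> M0 * \<bar>x\<bar>" using chart_frontier(3)[OF F ch] xr by simp
      also have "\<bar>x\<bar> + M0 * \<bar>x\<bar> \<le> K * \<bar>x\<bar>" using K mult_right_mono[OF K, of "\<bar>x\<bar>"] by (simp add: distrib_right)
      also have "\<dots> \<le> K * (\<epsilon> / (2 * K))" using xa K2 by (intro mult_left_mono) auto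
      also have "\<dots> < \<epsilon>" using K2 \<epsilon> by simp
      finally show ?thesis by simp
    qed
    ultimately show "\<exists>y\<in>A - {a}. dist y a < \<epsilon>" by blast
  qed
  then obtain q \<tau> where q: "q \<in> A - {a}" and \<tau>: "\<tau> \<in> face_edges \<F> F" "a \<in> \<tau>" "q \<in> \<tau>"
    using edge_through_limit_point[OF F A] by blast
  obtain x where x: "q = p x" "x * (e \<bullet> E1) < 0" using q by (auto simp: A_def)
  have "q \<notin> closed_segment a b"
  proof
    assume "q \<in> closed_segment a b"
    then obtain t where t: "0 \<le> t" "q = a + t *\<^sub>R e" using closed_segment_edir(1)[OF es(1)] by (auto simp: e_def)
    then have "x = t * (e \<bullet> E1)" using pE1[of x] x by simp
    then have "x * (e \<bullet> E1) = t * (e \<bullet> E1)\<^sup>2" by (simp add: power2_eq_square)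
    moreover have "t * (e \<bullet> E1)\<^sup>2 \<ge> 0" using t by simp
    ultimately show False using x by simp
  qed
  then have ne: "\<tau> \<noteq> closed_segment a b" using \<tau> by blast
  obtain c d where cd: "c \<noteq> d" "\<tau> = closed_segment c d" using face_edgeE[OF F \<tau>(1)] by metis
  have "a = c \<or> a = d"
    using edges_Int[OF F, of c d "closed_segment a b" a] \<tau> cd ne edgesI[OF F \<sigma>] by auto
  then obtain c' where c': "\<tau> = closed_segment a c'" using cd by (auto simp: closed_segment_commute)
  have ac: "a \<noteq> c'" using edge_sub_frontier(1)[OF F] \<tau>(1) c' by blast
  show thesis
  proof (rule that)
    show "closed_segment a c' \<in> face_edges \<F> F" "closed_segment a c' \<noteq> closed_segment a b" using \<tau> c' ne by auto
    show "edir a b \<bullet> E1 \<noteq> 0" using slope by (simp add: e_def)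
    obtain t where t: "0 \<le> t" "q = a + t *\<^sub>R edir a c'" using closed_segment_edir(1)[OF ac] \<tau>(3) c' by auto
    then have "x = t * (edir a c' \<bullet> E1)" using pE1[of x] x by simp
    then have "t * ((edir a c' \<bullet> E1) * (e \<bullet> E1)) < 0" using x(2) by (simp add: mult.assoc)
    then show "(edir a c' \<bullet> E1) * (edir a b \<bullet> E1) < 0" using t(1) by (simp add: e_def mult_less_0_iff)
    \<comment> \<open>With a second common point \<open>y\<close> the midpoint of \<open>a\<close>
      and \<open>y\<close> would be common as well, but common points can only be \<open>a\<close>
      or \<open>b\<close>.\<close>
    show "closed_segment a b \<inter> closed_segment a c' = {a}"
    proof (rule ccontr)
      assume "closed_segment a b \<inter> closed_segment a c' \<noteq> {a}"
      then obtain y where y: "y \<in> closed_segment a b" "y \<in> closed_segment a c'" "y \<noteq> a" by auto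
      then have sub: "closed_segment a y \<subseteq> closed_segment a b" "closed_segment a y \<subseteq> closed_segment a c'"
        by (simp_all add: subset_closed_segment)
      have "midpoint a y \<in> closed_segment a y" by simp
      then have my: "midpoint a y \<in> closed_segment a b" "midpoint a y \<in> closed_segment a c'" using sub by blast+
      have 1: "midpoint a y = a \<or> midpoint a y = b"
        using edges_Int[OF F \<sigma>, of "closed_segment a c'" "midpoint a y"] my ne c' edgesI[OF F \<tau>(1)] by simp
      have 2: "y = a \<or> y = b"
        using edges_Int[OF F \<sigma>, of "closed_segment a c'" y] y ne c' edgesI[OF F \<tau>(1)] by simp
      have "midpoint a y = y" using 1 2 y(3) by (auto simp: midpoint_eq_endpoint)
      then show False using y(3) by (metis midpoint_eq_endpoint(2))
    qed
  qed
qed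

lemma endpoint_is_vertex:
  assumes F: "F \<in> \<F>" and \<sigma>: "closed_segment a b \<in> face_edges \<F> F"
  shows "a \<in> vertices \<F>" "b \<in> vertices \<F>"
proof -
  have *: "a \<in> vertices \<F>" if \<sigma>: "closed_segment a b \<in> face_edges \<F> F" for a b
  proof -
    have "a \<in> rel_frontier F" using edge_sub_frontier(3)[OF F \<sigma>] by auto
    then obtain E1 E2 g where ch: "face_chart F r0 M0 a E1 E2 g" using face_chart_exists[OF F] by blast
    obtain c where "closed_segment a c \<in> face_edges \<F> F" "closed_segment a c \<noteq> closed_segment a b"
      "closed_segment a b \<inter> closed_segment a c = {a}"
      by (rule edge_opposite_side[OF F \<sigma> ch]) (rule that)
    then show ?thesis unfolding vertices_def using edgesI[OF F] \<sigma> by blast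
  qed
  show "a \<in> vertices \<F>" by (rule *[OF \<sigma>])
  show "b \<in> vertices \<F>" by (rule *[of b a]) (use \<sigma> in \<open>simp add: closed_segment_commute\<close>)
qed

lemma rel_frontier_edge:
  assumes F: "F \<in> \<F>" and x: "x \<in> rel_frontier F"
  obtains \<sigma> where "\<sigma> \<in> face_edges \<F> F" "x \<in> \<sigma>"
proof -
  obtain E1 E2 g where ch: "face_chart F r0 M0 x E1 E2 g" using face_chart_exists[OF F x] .
  have "x \<in> closure (rel_frontier F - {x})"
    unfolding closure_approachable
  proof (intro allI impI)
    fix \<epsilon> :: real assume \<epsilon>: "\<epsilon> > 0"
    define u where "u = min (r0 / 2) (\<epsilon> / (2 * K))"
    have u: "0 < u" "u < r0" "u \<le> \<epsilon> / (2 * K)" using r0 \<epsilon> K2 by (auto simp: u_def)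
    define q where "q = x + u *\<^sub>R E1 + g u *\<^sub>R E2"
    have "q \<in> rel_frontier F" unfolding q_def using u by (intro chart_frontier(2)[OF F ch]) simp
    moreover have "(q - x) \<bullet> E1 = u" unfolding q_def by (rule chart_coords(2)[OF ch])
    then have "q \<noteq> x" using u by auto
    moreover have "dist q x < \<epsilon>"
    proof -
      have "dist q x \<le> \<bar>u\<bar> + \<bar>g u\<bar>"
        using norm_triangle_ineq[of "u *\<^sub>R E1" "g u *\<^sub>R E2"] ch
        by (simp add: q_def dist_norm face_chart_def orthonormal_pair_def add.assoc)
      also have "\<bar>g u\<bar> \<le> M0 * \<bar>u\<bar>" using chart_frontier(3)[OF F ch, of u] u by simp
      also have "\<bar>u\<bar> + M0 * \<bar>u\<bar> \<le> K * u" using u mult_right_mono[OF K, of u] by (simp add: distrib_right)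
      also have "\<dots> \<le> K * (\<epsilon> / (2 * K))" using u K2 by (intro mult_left_mono) auto
      also have "\<dots> < \<epsilon>" using K2 \<epsilon> by simp
      finally show ?thesis by simp
    qed
    ultimately show "\<exists>y\<in>rel_frontier F - {x}. dist y x < \<epsilon>" by blast
  qed
  then show thesis using edge_through_limit_point[OF F order_refl] that by blast
qed

text \<open>Two distinct edges pass through a vertex, so it is not an inner point of any edge; and
  it is not relatively interior to \<open>F\<close>, because an edge through it lies in two
  faces.\<close>

lemma vertex_is_endpoint:
  assumes F: "F \<in> \<F>" and v: "v \<in> vertices \<F>" "v \<in> F"
  obtains b where "closed_segment v b \<in> face_edges \<F> F"
proof -
  obtain \<sigma>1 \<tau>1 where 1: "\<sigma>1 \<in> edges \<F>" "\<tau>1 \<in> edges \<F>" "\<sigma>1 \<noteq> \<tau>1" "\<sigma>1 \<inter> \<tau>1 = {v}"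
    using v(1) unfolding vertices_def by blast
  have "v \<in> rel_frontier F"
  proof (rule ccontr)
    assume "v \<notin> rel_frontier F"
    then have vi: "v \<in> rel_interior F" using v(2) face_frontier[OF F] by simp
    obtain H where H: "H \<in> \<F>" "\<sigma>1 \<in> face_edges \<F> H" using 1(1) by (auto simp: edges_def)
    obtain H' where H': "H' \<in> \<F>" "H' \<noteq> H" "\<sigma>1 \<subseteq> H \<inter> H'" by (rule face_edgeE[OF H]) (rule that)
    have "v \<in> H" "v \<in> H'" using H' 1(4) by auto
    then show False using rel_interior_disjoint[OF F H(1)] rel_interior_disjoint[OF F H'(1)] vi H'(2) by auto
  qed
  then obtain \<sigma> where \<sigma>: "\<sigma> \<in> face_edges \<F> F" "v \<in> \<sigma>" by (rule rel_frontier_edge[OF F])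
  obtain a b where ab: "\<sigma> = closed_segment a b" by (rule face_edgeE[OF F \<sigma>(1)]) (rule that)
  have "v \<notin> open_segment a b"
  proof
    assume "v \<in> open_segment a b"
    then have "\<sigma>1 = closed_segment a b" "\<tau>1 = closed_segment a b"
      using edges_through_open_segment[OF F, of a b v] \<sigma> ab 1 by auto
    then show False using 1(3) by simp
  qed
  then have "v = a \<or> v = b" using \<sigma>(2) ab by (auto simp: open_segment_def)
  then show thesis using that[of b] that[of a] \<sigma> ab by (auto simp: closed_segment_commute)
qed

end

subsection \<open>Edge data and the triangles at the edges\<close>

text \<open>Defined on all of space and without reference to a face, so that it is the same function
  for both faces at the edge.\<close>

definition edge_interp :: "(real^3 \<Rightarrow> real) \<Rightarrow> real^3 \<Rightarrow> real^3 \<Rightarrow> real^3 \<Rightarrow> real" where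
  "edge_interp W a b x = W a + ((x - a) \<bullet> edir a b / dist a b) * (W b - W a)"

lemma edge_interp_point:
  assumes "a \<noteq> b" "m \<bullet> edir a b = 0"
  shows "edge_interp W a b (a + t *\<^sub>R edir a b + h *\<^sub>R m) = W a + (t / dist a b) * (W b - W a)"
proof -
  have "edir a b \<bullet> edir a b = 1" using edir(1)[OF assms(1)] by (simp add: dot_square_norm)
  then show ?thesis using assms(2) by (simp add: edge_interp_def inner_simps)
qed

lemma edge_interp_ends:
  assumes "a \<noteq> b"
  shows "edge_interp W a b a = W a" "edge_interp W a b b = W b"
proof -
  show "edge_interp W a b a = W a" by (simp add: edge_interp_def)
  show "edge_interp W a b b = W b"
    using edge_interp_point[OF assms, of 0 W "dist a b" 0] edir(2)[OF assms] assms by simp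
qed

lemma edge_interp_commute:
  assumes "a \<noteq> b"
  shows "edge_interp W a b = edge_interp W b a"
proof
  fix x
  have "(x - b) \<bullet> edir b a = (x - a) \<bullet> edir b a - (b - a) \<bullet> edir b a" by (simp add: inner_simps)
  also have "(b - a) \<bullet> edir b a = - dist a b"
  proof -
    have "(b - a) \<bullet> edir b a = - ((dist a b *\<^sub>R edir a b) \<bullet> edir a b)"
      using edir(3,4)[OF assms] by simp
    then show ?thesis using edir(1)[OF assms] by (simp add: dot_square_norm)
  qed
  finally have "(x - b) \<bullet> edir b a = dist a b - (x - a) \<bullet> edir a b" using edir(4)[OF assms] by simp
  then have "(x - b) \<bullet> edir b a / dist b a = 1 - (x - a) \<bullet> edir a b / dist a b"
    using assms by (simp add: dist_commute diff_divide_distrib)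
  moreover have "W a + s * (W b - W a) = W b + (1 - s) * (W a - W b)" for s
    by (simp add: algebra_simps)
  ultimately show "edge_interp W a b x = edge_interp W b a x"
    unfolding edge_interp_def by (simp only:)
qed

lemma edge_interp_lipschitz:
  assumes ab: "a \<noteq> b" and B: "\<bar>W b - W a\<bar> \<le> B" and r: "0 < r" "r \<le> dist a b"
  shows "\<bar>edge_interp W a b x - edge_interp W a b y\<bar> \<le> B / r * dist x y"
proof -
  have B0: "0 \<le> B" using B by linarith
  have "edge_interp W a b x - edge_interp W a b y = ((x - y) \<bullet> edir a b / dist a b) * (W b - W a)"
    by (simp add: edge_interp_def inner_simps diff_divide_distrib algebra_simps)
  then have "\<bar>edge_interp W a b x - edge_interp W a b y\<bar> = \<bar>(x - y) \<bullet> edir a b\<bar> / dist a b * \<bar>W b - W a\<bar>"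
    by (simp add: abs_mult)
  also have "\<dots> \<le> dist x y / r * B"
  proof (intro mult_mono frac_le)
    show "\<bar>(x - y) \<bullet> edir a b\<bar> \<le> dist x y"
      using Cauchy_Schwarz_ineq2[of "x - y" "edir a b"] edir(1)[OF ab] by (simp add: dist_norm)
  qed (use B r in auto)
  finally show ?thesis by (simp add: mult.commute)
qed

lemma affine_edge_interp: "\<exists>A. linear A \<and> (\<forall>x. edge_interp W a b x = A x + edge_interp W a b 0)"
proof (intro exI conjI allI)
  show "linear (\<lambda>x. (x \<bullet> edir a b / dist a b) * (W b - W a))"
    by (intro linearI) (simp_all add: inner_simps add_divide_distrib distrib_right)
  show "edge_interp W a b x = (x \<bullet> edir a b / dist a b) * (W b - W a) + edge_interp W a b 0" for x
    by (simp add: edge_interp_def inner_simps diff_divide_distrib algebra_simps)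
qed

context poly_setting
begin

text \<open>The angle \<gamma> of the triangles. Its first term is spent in
  \<open>adjacent_caps\<close>, its second in \<open>M0 * slope_bound \<le> 1\<close>.\<close>

definition base_angle :: real where "base_angle = min (\<theta>0 / 3) (pi / 2 - arctan M0)"

definition slope_bound :: real where "slope_bound = tan base_angle"

lemma tri_height_eq: "tri_height r0 \<theta>0 M0 = r0 / 2 * slope_bound"
  by (simp add: tri_height_def slope_bound_def base_angle_def)

lemma base_angle: "0 < base_angle" "base_angle \<le> \<theta>0 / 3" "base_angle < pi / 6"
proof -
  show "0 < base_angle" using \<theta>0 arctan_ubound[of M0] by (simp add: base_angle_def)
  show 1: "base_angle \<le> \<theta>0 / 3" unfolding base_angle_def by (rule min.cobounded1)
  show "base_angle < pi / 6" using 1 \<theta>0 by linarith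
qed

text \<open>The second bound is \<open>tan (pi / 2 - arctan M0) = 1 / M0\<close>. The third, from
  \<open>tan (pi / 6) = 1 / sqrt 3\<close>, limits the height of caps to \<open>3 / 10 * r0\<close>,
  so that two of them and a small gap fit into one chart.\<close>

lemma slope_bound: "0 < slope_bound" "M0 * slope_bound \<le> 1" "slope_bound < 3 / 5"
proof -
  show "0 < slope_bound" unfolding slope_bound_def using base_angle by (intro tan_gt_zero) auto
  have "slope_bound \<le> tan (pi / 2 - arctan M0)"
    unfolding slope_bound_def
  proof (rule tan_mono_le)
    show "- (pi / 2) < base_angle" using base_angle(1) pi_gt_zero by linarith
    show "base_angle \<le> pi / 2 - arctan M0" unfolding base_angle_def by (rule min.cobounded2)
    show "pi / 2 - arctan M0 < pi / 2" using M0 by simp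
  qed
  also have "\<dots> = 1 / M0" by (simp add: tan_cot tan_arctan inverse_eq_divide)
  finally show "M0 * slope_bound \<le> 1" using M0 by (simp add: field_simps)
  have "slope_bound < tan (pi / 6)"
    unfolding slope_bound_def using base_angle by (intro tan_monotone) auto
  also have "tan (pi / 6) = 1 / sqrt 3" by (rule tan_30)
  also have "1 / sqrt 3 < 3 / 5"
  proof -
    have "5 / 3 < sqrt (3::real)" by (rule real_less_rsqrt) (simp add: power2_eq_square)
    then show ?thesis by (simp add: field_simps)
  qed
  finally show "slope_bound < 3 / 5" .
qed

text \<open>A trapezoid containing the triangle, of the same height but with sides of slope
  \<open>slope_bound\<close> whatever the length of the edge. Linear inequalities in
  \<open>t\<close> and \<open>h\<close> thus replace barycentric coordinates.\<close>

definition cap :: "real^3 \<Rightarrow> real^3 \<Rightarrow> real^3 \<Rightarrow> (real^3) set" where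
  "cap a b m = {a + t *\<^sub>R edir a b + h *\<^sub>R m |t h. 0 \<le> t \<and> t \<le> dist a b \<and> 0 \<le> h \<and>
     h \<le> slope_bound * t \<and> h \<le> slope_bound * (dist a b - t) \<and> h \<le> slope_bound * (r0 / 2)}"

lemma capE:
  assumes "x \<in> cap a b m"
  obtains t h where "x = a + t *\<^sub>R edir a b + h *\<^sub>R m" "0 \<le> t" "t \<le> dist a b" "0 \<le> h"
    "h \<le> slope_bound * t" "h \<le> slope_bound * (dist a b - t)" "h \<le> slope_bound * (r0 / 2)"
    "M0 * h \<le> t" "M0 * h \<le> dist a b - t" "M0 * h \<le> r0 / 2" "h \<le> 3 / 10 * r0"
proof -
  obtain t h where th: "x = a + t *\<^sub>R edir a b + h *\<^sub>R m" "0 \<le> t" "t \<le> dist a b" "0 \<le> h"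
    "h \<le> slope_bound * t" "h \<le> slope_bound * (dist a b - t)" "h \<le> slope_bound * (r0 / 2)"
    using assms unfolding cap_def by blast
  have *: "M0 * h \<le> s" if "h \<le> slope_bound * s" "0 \<le> s" for s
  proof -
    have "M0 * h \<le> M0 * (slope_bound * s)" using that M0 by (intro mult_left_mono) auto
    also have "\<dots> = (M0 * slope_bound) * s" by simp
    also have "\<dots> \<le> 1 * s" using slope_bound that by (intro mult_right_mono) auto
    finally show ?thesis by simp
  qed
  have "slope_bound * (r0 / 2) \<le> 3 / 5 * (r0 / 2)" using slope_bound r0 by (intro mult_right_mono) auto
  then have "h \<le> 3 / 10 * r0" using th(7) by linarith
  then show thesis using that[OF th *[OF th(5,2)] *[OF th(6)] *[OF th(7)]] th r0 by simp
qed

lemma cap_commute: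
  assumes "a \<noteq> b"
  shows "cap a b m = cap b a m"
proof -
  have sub: "cap a b m \<subseteq> cap b a m" if "a \<noteq> b" for a b
  proof
    fix x assume "x \<in> cap a b m"
    then obtain t h where th: "x = a + t *\<^sub>R edir a b + h *\<^sub>R m" "0 \<le> t" "t \<le> dist a b" "0 \<le> h"
      "h \<le> slope_bound * t" "h \<le> slope_bound * (dist a b - t)" "h \<le> slope_bound * (r0 / 2)"
      unfolding cap_def by blast
    have "x = b + (dist a b - t) *\<^sub>R edir b a + h *\<^sub>R m"
      using edir(2)[OF that] unfolding th(1) edir(4)[OF that]
      by (simp add: algebra_simps)
    then show "x \<in> cap b a m"
      unfolding cap_def using th by (intro CollectI exI[of _ "dist a b - t"] exI[of _ h]) (simp add: dist_commute)
  qed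
  show ?thesis by (rule subset_antisym[OF sub[OF assms] sub[OF assms[symmetric]]])
qed

lemma edge_normal_commute:
  assumes "a \<noteq> b" and en: "edge_normal F a b m"
  shows "edge_normal F b a m"
  unfolding edge_normal_def
proof (intro allI impI)
  fix t assume t: "0 < t \<and> t < dist b a"
  have pt: "b + t *\<^sub>R edir b a = a + (dist a b - t) *\<^sub>R edir a b"
    using edir(2,4)[OF assms(1)] by (simp add: algebra_simps)
  have "half_disc F (a + (dist a b - t) *\<^sub>R edir a b) (edir a b) m (edge_radius a b (dist a b - t))"
    using en t by (simp add: edge_normal_def dist_commute)
  moreover have "edge_radius a b (dist a b - t) = edge_radius b a t"
    by (simp add: edge_radius_def dist_commute min.commute)
  ultimately have hd: "half_disc F (b + t *\<^sub>R edir b a) (edir a b) m (edge_radius b a t)" by (simp add: pt)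
  show "half_disc F (b + t *\<^sub>R edir b a) (edir b a) m (edge_radius b a t)"
    unfolding half_disc_def
  proof (intro conjI allI impI)
    show "norm m = 1" "m \<bullet> edir b a = 0" using half_discD(1,2)[OF hd] edir(4)[OF assms(1)] by auto
    fix u h assume "0 < h \<and> \<bar>u\<bar> + M0 * h \<le> edge_radius b a t"
    then have uh: "0 < h" "\<bar>- u\<bar> + M0 * h \<le> edge_radius b a t" by auto
    show "b + t *\<^sub>R edir b a + u *\<^sub>R edir b a + h *\<^sub>R m \<in> rel_interior F"
      "b + t *\<^sub>R edir b a + u *\<^sub>R edir b a - h *\<^sub>R m \<notin> F"
      using half_discD(3,4)[OF hd uh] edir(4)[OF assms(1)] by simp_all
  qed
qed

lemma cap_subset_face:
  assumes F: "F \<in> \<F>" and \<sigma>: "closed_segment a b \<in> face_edges \<F> F" and en: "edge_normal F a b m"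
  shows "cap a b m \<subseteq> F"
proof
  fix x assume "x \<in> cap a b m"
  then obtain t h where th: "x = a + t *\<^sub>R edir a b + h *\<^sub>R m" "0 \<le> t" "t \<le> dist a b" "0 \<le> h"
    "M0 * h \<le> t" "M0 * h \<le> dist a b - t" "M0 * h \<le> r0 / 2"
    by (rule capE) (rule that)
  show "x \<in> F"
  proof (cases "h = 0")
    case True
    then show ?thesis using edge_sub_frontier(5)[OF F \<sigma> th(2,3)] th(1) by simp
  next
    case False
    then have "M0 * h > 0" using th(4) M0 by simp
    then have "0 < t" "t < dist a b" using th by linarith+
    then show ?thesis
      using edge_normalD(5)[OF F \<sigma> en, of t h 0] th by (simp add: edge_radius_def)
  qed
qed

lemma segment_subset_cap: "a \<noteq> b \<Longrightarrow> closed_segment a b \<subseteq> cap a b m"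
proof
  fix x assume ab: "a \<noteq> b" and "x \<in> closed_segment a b"
  then obtain t where "0 \<le> t" "t \<le> dist a b" "x = a + t *\<^sub>R edir a b" using closed_segment_edir(1) by blast
  then show "x \<in> cap a b m" unfolding cap_def
    using slope_bound(1) r0 by (intro CollectI exI[of _ t] exI[of _ 0]) simp
qed

text \<open>Going vertically from a point of the cap one meets the edge at most
  \<open>M0 * h\<close> from the foot point, which the shape of the cap keeps within the edge. So
  points of caps are compared through points of the graph with the same first coordinate.\<close>

lemma chart_vertical_projection:
  assumes F: "F \<in> \<F>" and ch: "face_chart F r0 M0 P E1 E2 g"
    and \<sigma>: "closed_segment a b \<in> face_edges \<F> F" and en: "edge_normal F a b m"
    and th: "0 \<le> t" "t \<le> dist a b" "0 \<le> h" "M0 * h \<le> t" "M0 * h \<le> dist a b - t" "M0 * h \<le> r0 / 2"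
    and q: "q = a + t *\<^sub>R edir a b" "\<bar>(q - P) \<bullet> E1\<bar> < r0" "\<bar>(q - P) \<bullet> E2\<bar> < 2 * M0 * r0"
  shows "\<exists>y\<in>closed_segment a b. (y - P) \<bullet> E1 = (q + h *\<^sub>R m - P) \<bullet> E1 \<and> dist y q \<le> r0 / 2"
proof (cases "h = 0")
  case True
  have "q \<in> closed_segment a b" unfolding closed_segment_edir(1)[OF edge_sub_frontier(1)[OF F \<sigma>]]
    using q th by blast
  then show ?thesis using True r0 by (intro bexI[of _ q]) auto
next
  case False
  note es = edge_sub_frontier[OF F \<sigma>]
  note co = chart_coords[OF ch]
  have "M0 * h > 0" using False th(3) M0 by simp
  then have t: "0 < t" "t < dist a b" using th by linarith+
  define e where "e = edir a b"
  have e1: "norm e = 1" using edir(1)[OF es(1)] by (simp add: e_def)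
  have sl: "\<bar>e \<bullet> E2\<bar> \<le> M0 * \<bar>e \<bullet> E1\<bar>" and ee: "e = (e \<bullet> E1) *\<^sub>R E1 + (e \<bullet> E2) *\<^sub>R E2"
  proof -
    have "q + u *\<^sub>R e \<in> rel_frontier F" if "0 \<le> u" "u \<le> dist a b - t" for u
      using es(4)[of "t + u"] that t by (simp add: q(1) e_def scaleR_add_left add.assoc)
    then show "\<bar>e \<bullet> E2\<bar> \<le> M0 * \<bar>e \<bullet> E1\<bar>" "e = (e \<bullet> E1) *\<^sub>R E1 + (e \<bullet> E2) *\<^sub>R E2"
      using chart_slope[OF F ch q(2,3), of "dist a b - t" e] t by auto
  qed
  define c1 c2 where "c1 = e \<bullet> E1" "c2 = e \<bullet> E2"
  have ee': "e = c1 *\<^sub>R E1 + c2 *\<^sub>R E2" using ee by (simp add: c1_c2_def)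
  have "e \<bullet> e = 1" using e1 by (simp add: dot_square_norm)
  then have u1: "c1\<^sup>2 + c2\<^sup>2 = 1" unfolding ee' using co(6-9) by (simp add: inner_simps power2_eq_square)
  have c1: "c1 \<noteq> 0"
  proof
    assume "c1 = 0"
    then have "c2 = 0" using sl by (simp add: c1_c2_def)
    then show False using u1 \<open>c1 = 0\<close> by simp
  qed
  define m1 m2 where "m1 = m \<bullet> E1" "m2 = m \<bullet> E2"
  have mm: "m = m1 *\<^sub>R E1 + m2 *\<^sub>R E2"
  proof -
    have qF: "q \<in> affine hull F" using es(6) th q by simp
    have q'F: "q + h *\<^sub>R m \<in> affine hull F"
      using edge_normalD(7)[OF F \<sigma> en qF, of 0 h] by simp
    define aq bq where "aq = (q - P) \<bullet> E1" "bq = (q - P) \<bullet> E2"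
    have "q = P + aq *\<^sub>R E1 + bq *\<^sub>R E2" unfolding aq_bq_def by (rule co(1)[OF qF])
    moreover have "(q + h *\<^sub>R m - P) \<bullet> E1 = aq + h * m1" "(q + h *\<^sub>R m - P) \<bullet> E2 = bq + h * m2"
      by (simp_all add: aq_bq_def m1_m2_def inner_simps)
    then have "q + h *\<^sub>R m = P + (aq + h * m1) *\<^sub>R E1 + (bq + h * m2) *\<^sub>R E2"
      using co(1)[OF q'F] by simp
    ultimately have "h *\<^sub>R m = h *\<^sub>R (m1 *\<^sub>R E1 + m2 *\<^sub>R E2)" by (simp add: algebra_simps)
    then show ?thesis using False by simp
  qed
  have "m \<bullet> m = 1" using edge_normalD(1)[OF F \<sigma> en] by (simp add: dot_square_norm)
  then have u2: "m1\<^sup>2 + m2\<^sup>2 = 1" unfolding mm using co(6-9) by (simp add: inner_simps power2_eq_square)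
  have "m \<bullet> e = 0" using edge_normalD(2)[OF F \<sigma> en] by (simp add: e_def)
  then have "m1 * c1 + m2 * c2 = 0" unfolding mm ee' using co(6-9) by (simp add: inner_simps mult.commute)
  then have o: "m1 * c1 = - (m2 * c2)" by linarith
  have "m1\<^sup>2 = m1\<^sup>2 * (c1\<^sup>2 + c2\<^sup>2)" using u1 by simp
  also have "\<dots> = (m1 * c1)\<^sup>2 + m1\<^sup>2 * c2\<^sup>2" by (simp add: algebra_simps power_mult_distrib)
  also have "\<dots> = c2\<^sup>2 * (m1\<^sup>2 + m2\<^sup>2)" unfolding o by (simp add: algebra_simps power_mult_distrib)
  finally have "m1\<^sup>2 = c2\<^sup>2" using u2 by simp
  then have m1: "\<bar>m1\<bar> = \<bar>c2\<bar>" using abs_eq_iff power2_eq_iff by blast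
  \<comment> \<open>Displacement along the edge from the foot point to the vertical projection.
    Since \<open>e\<close> and \<open>m\<close> are orthonormal in a plane,
    \<open>\<bar>m1\<bar> = \<bar>c2\<bar>\<close>, so the slope of the edge bounds the displacement
    by \<open>M0 * h\<close>.\<close>
  define u where "u = h * m1 / c1"
  have "\<bar>u\<bar> = h * (\<bar>c2\<bar> / \<bar>c1\<bar>)" using th(3) m1 by (simp add: u_def abs_mult)
  also have "\<dots> \<le> h * M0" using th(3) sl c1 by (intro mult_left_mono) (auto simp: c1_c2_def divide_le_eq)
  finally have uM: "\<bar>u\<bar> \<le> M0 * h" by (simp add: mult.commute)
  define y where "y = a + (t + u) *\<^sub>R e"
  have yq: "y = q + u *\<^sub>R e" by (simp add: y_def q(1) e_def scaleR_add_left)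
  have "0 \<le> t + u" "t + u \<le> dist a b" using uM th by linarith+
  then have "y \<in> closed_segment a b"
    unfolding closed_segment_edir(1)[OF es(1)] y_def e_def by blast
  moreover have "(y - P) \<bullet> E1 = (q + h *\<^sub>R m - P) \<bullet> E1"
  proof -
    have "(y - P) \<bullet> E1 = (q - P) \<bullet> E1 + u * c1" by (simp add: yq inner_simps c1_c2_def)
    also have "u * c1 = h * m1" using c1 by (simp add: u_def)
    finally show ?thesis by (simp add: inner_simps m1_m2_def)
  qed
  moreover have "dist y q \<le> r0 / 2" using uM th(6) e1 by (simp add: yq dist_norm)
  ultimately show ?thesis by blast
qed

text \<open>Different edges meet only at common end points, and there both interpolations return the
  vertex value.\<close>

lemma edge_interp_agree:
  assumes F: "F \<in> \<F>" "closed_segment a b \<in> face_edges \<F> F" and G: "G \<in> \<F>" "closed_segment c d \<in> face_edges \<F> G"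
    and x: "x \<in> closed_segment a b" "x \<in> closed_segment c d"
  shows "edge_interp W a b x = edge_interp W c d x"
proof (cases "closed_segment a b = closed_segment c d")
  case True
  then have "{a, b} = {c, d}" by (simp add: closed_segment_eq)
  then have "(a = c \<and> b = d) \<or> (a = d \<and> b = c)" by (auto simp: doubleton_eq_iff)
  then show ?thesis using edge_interp_commute[OF edge_sub_frontier(1)[OF F]] by auto
next
  case False
  have "x = a \<or> x = b" by (rule edges_Int[OF F edgesI[OF G] _ x]) (use False in auto)
  moreover have "x = c \<or> x = d" by (rule edges_Int[OF G edgesI[OF F] _ x(2,1)]) (use False in auto)
  ultimately show ?thesis
    using edge_interp_ends[OF edge_sub_frontier(1)[OF F]] edge_interp_ends[OF edge_sub_frontier(1)[OF G]] by auto
qed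

end

text \<open>Finiteness of the vertices comes with their enumeration by \<open>{1..N}\<close>. As an
  edge is determined by its two end points, faces then have finitely many edges.\<close>

locale poly_setting_finite = poly_setting +
  assumes finite_vertices: "finite (vertices \<F>)"
begin

lemma finite_face_edges: "F \<in> \<F> \<Longrightarrow> finite (face_edges \<F> F)"
proof (rule finite_subset)
  assume F: "F \<in> \<F>"
  show "face_edges \<F> F \<subseteq> (\<lambda>(a, b). closed_segment a b) ` (vertices \<F> \<times> vertices \<F>)"
  proof
    fix \<sigma> assume \<sigma>: "\<sigma> \<in> face_edges \<F> F"
    obtain a b where ab: "\<sigma> = closed_segment a b" by (rule face_edgeE[OF F \<sigma>]) (rule that)
    have "a \<in> vertices \<F>" "b \<in> vertices \<F>" using endpoint_is_vertex[OF F \<sigma>[unfolded ab]] by auto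
    then show "\<sigma> \<in> (\<lambda>(a, b). closed_segment a b) ` (vertices \<F> \<times> vertices \<F>)" using ab by auto
  qed
  show "finite ((\<lambda>(a, b). closed_segment a b) ` (vertices \<F> \<times> vertices \<F>))" using finite_vertices by simp
qed

text \<open>Along the graph of \<open>g\<close> the interpolation is pieced together from finitely
  many edges, on each of which it has slope at most \<open>B / r0\<close>, since edges are at least
  \<open>r0\<close> long. Finitely many closed pieces preserve the constant; \<open>K\<close> bounds
  the length of the graph per unit of the first coordinate.\<close>

lemma chart_edge_interp_lipschitz:
  assumes F: "F \<in> \<F>" and ch: "face_chart F r0 M0 P E1 E2 g"
    and W: "\<And>v w. v \<in> vertices \<F> \<Longrightarrow> w \<in> vertices \<F> \<Longrightarrow> \<bar>W v - W w\<bar> \<le> B"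
    and \<sigma>: "closed_segment a b \<in> face_edges \<F> F" and \<tau>: "closed_segment c d \<in> face_edges \<F> F"
    and x: "x \<in> closed_segment a b" "\<bar>(x - P) \<bullet> E1\<bar> < r0" "\<bar>(x - P) \<bullet> E2\<bar> < 2 * M0 * r0"
    and z: "z \<in> closed_segment c d" "\<bar>(z - P) \<bullet> E1\<bar> < r0" "\<bar>(z - P) \<bullet> E2\<bar> < 2 * M0 * r0"
  shows "\<bar>edge_interp W a b x - edge_interp W c d z\<bar> \<le> B / r0 * K * \<bar>(x - P) \<bullet> E1 - (z - P) \<bullet> E1\<bar>"
proof -
  define p where "p = (\<lambda>t. P + t *\<^sub>R E1 + g t *\<^sub>R E2)"
  \<comment> \<open>The value does not depend on the edge that is picked, by
    \<open>edge_interp_agree\<close>.\<close>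
  define val where "val = (\<lambda>y. SOME r. \<exists>a b. closed_segment a b \<in> face_edges \<F> F \<and> y \<in> closed_segment a b \<and> r = edge_interp W a b y)"
  have val: "val y = edge_interp W a b y" if "closed_segment a b \<in> face_edges \<F> F" "y \<in> closed_segment a b" for a b y
    unfolding val_def using edge_interp_agree[OF F _ F] that by (intro some_equality) blast+
  have B0: "0 \<le> B"
    using W[OF endpoint_is_vertex(1)[OF F \<sigma>] endpoint_is_vertex(1)[OF F \<sigma>]] by simp
  have L0: "0 \<le> B / r0 * K" using B0 r0 K2 by simp
  have gl: "\<bar>g s - g t\<bar> \<le> M0 * \<bar>s - t\<bar>" if "\<bar>s\<bar> \<le> r0" "\<bar>t\<bar> \<le> r0" for s t
    using ch that unfolding face_chart_def by blast
  have o: "norm E1 = 1" "norm E2 = 1" using ch by (auto simp: face_chart_def orthonormal_pair_def)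
  have pl: "dist (p s) (p t) \<le> K * \<bar>s - t\<bar>" if "\<bar>s\<bar> \<le> r0" "\<bar>t\<bar> \<le> r0" for s t
  proof -
    have "p s - p t = (s - t) *\<^sub>R E1 + (g s - g t) *\<^sub>R E2" by (simp add: p_def algebra_simps)
    then have "dist (p s) (p t) \<le> \<bar>s - t\<bar> + \<bar>g s - g t\<bar>"
      using norm_triangle_ineq[of "(s - t) *\<^sub>R E1" "(g s - g t) *\<^sub>R E2"] o by (simp add: dist_norm)
    also have "\<dots> \<le> (1 + M0) * \<bar>s - t\<bar>" using gl[OF that] by (simp add: distrib_right)
    also have "\<dots> \<le> K * \<bar>s - t\<bar>" using K by (intro mult_right_mono) auto
    finally show ?thesis .
  qed
  have main: "\<bar>val (p s) - val (p t)\<bar> \<le> B / r0 * K * \<bar>s - t\<bar>" if st: "s \<le> t" "\<bar>s\<bar> < r0" "\<bar>t\<bar> < r0" for s t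
  proof -
    have ivl: "\<bar>u\<bar> < r0" if "u \<in> {s..t}" for u using that st by auto
    have pc: "continuous_on {s..t} p"
    proof -
      have "K-lipschitz_on {s..t} p"
        by (rule lipschitz_onI) (use pl ivl K2 in \<open>auto simp: dist_real_def less_imp_le\<close>)
      then show ?thesis by (rule lipschitz_on_continuous_on)
    qed
    have "(B / r0 * K)-lipschitz_on {s..t} (\<lambda>u. val (p u))"
    proof (rule lipschitz_on_closed_Union[where I = "face_edges \<F> F" and U = "\<lambda>\<sigma>. {u \<in> {s..t}. p u \<in> \<sigma>}"])
      show "finite (face_edges \<F> F)" by (rule finite_face_edges[OF F])
      show "0 \<le> B / r0 * K" by (rule L0)
      fix \<rho> assume \<rho>: "\<rho> \<in> face_edges \<F> F"
      obtain a' b' where ab': "\<rho> = closed_segment a' b'" by (rule face_edgeE[OF F \<rho>]) (rule that)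
      note \<rho>' = \<rho>[unfolded ab']
      show "closed {u \<in> {s..t}. p u \<in> \<rho>}"
        using continuous_closed_preimage[OF pc, of \<rho>] by (simp add: ab' vimage_def Int_def conj_commute)
      show "(B / r0 * K)-lipschitz_on {u \<in> {s..t}. p u \<in> \<rho>} (\<lambda>u. val (p u))"
      proof (rule lipschitz_onI)
        fix u v assume uv: "u \<in> {u \<in> {s..t}. p u \<in> \<rho>}" "v \<in> {u \<in> {s..t}. p u \<in> \<rho>}"
        have "dist (val (p u)) (val (p v)) = \<bar>edge_interp W a' b' (p u) - edge_interp W a' b' (p v)\<bar>"
          using val[OF \<rho>'] uv ab' by (simp add: dist_real_def)
        also have "\<dots> \<le> B / r0 * dist (p u) (p v)"
          using edge_sub_frontier(1,2)[OF F \<rho>'] W endpoint_is_vertex[OF F \<rho>'] r0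
          by (intro edge_interp_lipschitz) auto
        also have "\<dots> \<le> B / r0 * (K * \<bar>u - v\<bar>)"
          using ivl uv B0 r0 by (intro mult_left_mono pl) (auto simp: less_imp_le)
        finally show "dist (val (p u)) (val (p v)) \<le> B / r0 * K * dist u v" by (simp add: dist_real_def)
      qed (rule L0)
    next
      show "{s..t} \<subseteq> \<Union> ((\<lambda>\<sigma>. {u \<in> {s..t}. p u \<in> \<sigma>}) ` face_edges \<F> F)"
      proof
        fix u assume u: "u \<in> {s..t}"
        have "p u \<in> rel_frontier F" unfolding p_def using ivl[OF u] by (rule chart_frontier(2)[OF F ch])
        then obtain \<rho> where "\<rho> \<in> face_edges \<F> F" "p u \<in> \<rho>" by (rule rel_frontier_edge[OF F])
        then show "u \<in> \<Union> ((\<lambda>\<sigma>. {u \<in> {s..t}. p u \<in> \<sigma>}) ` face_edges \<F> F)" using u by auto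
      qed
    qed
    from lipschitz_onD[OF this, of s t] show ?thesis using st by (simp add: dist_real_def)
  qed
  have pt: "p ((y - P) \<bullet> E1) = y"
    if y: "y \<in> rel_frontier F" "\<bar>(y - P) \<bullet> E1\<bar> < r0" "\<bar>(y - P) \<bullet> E2\<bar> < 2 * M0 * r0" for y
  proof -
    have "y \<in> affine hull F" using y(1) face_frontier[OF F] hull_subset[of F affine] by blast
    then show ?thesis
      unfolding p_def chart_frontier(1)[OF F ch y] by (rule chart_coords(1)[OF ch, symmetric])
  qed
  have px: "p ((x - P) \<bullet> E1) = x" using edge_sub_frontier(3)[OF F \<sigma>] x by (intro pt) auto
  have pz: "p ((z - P) \<bullet> E1) = z" using edge_sub_frontier(3)[OF F \<tau>] z by (intro pt) auto
  have "\<bar>val x - val z\<bar> \<le> B / r0 * K * \<bar>(x - P) \<bullet> E1 - (z - P) \<bullet> E1\<bar>"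
  proof (cases "(x - P) \<bullet> E1 \<le> (z - P) \<bullet> E1")
    case True
    then show ?thesis using main[OF True x(2) z(2)] px pz by simp
  next
    case False
    then have "(z - P) \<bullet> E1 \<le> (x - P) \<bullet> E1" by simp
    from main[OF this z(2) x(2)] show ?thesis using px pz by (simp add: abs_minus_commute)
  qed
  then show ?thesis using val[OF \<sigma> x(1)] val[OF \<tau> z(1)] by simp
qed

text \<open>The preceding Lipschitz bound is applied to vertex data that are 1 at the ends of one
  edge and 0 elsewhere. The interpolation is 1 along the first edge and 0 along the second, so first
  chart coordinates on the two edges differ by at least \<open>r0 / K\<close>. Vertical projection
  carries this over to the caps.\<close>

lemma nonadjacent_caps:
  assumes F: "F \<in> \<F>"
    and \<sigma>: "closed_segment a b \<in> face_edges \<F> F" and m: "edge_normal F a b m"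
    and \<tau>: "closed_segment c d \<in> face_edges \<F> F" and n: "edge_normal F c d n"
    and disj: "{a, b} \<inter> {c, d} = {}" and x: "x \<in> cap a b m" and z: "z \<in> cap c d n"
  shows "r0 / (3 * K) \<le> dist x z"
proof (rule ccontr)
  assume "\<not> r0 / (3 * K) \<le> dist x z"
  then have xz: "dist x z < r0 / (3 * K)" by simp
  \<comment> \<open>With heights at most \<open>3 / 10 * r0\<close> the two foot points are then
    less than \<open>r0\<close> apart, so a single chart at \<open>p\<close> sees both edges; the
    factor 3 provides this slack.\<close>
  have "r0 / (3 * K) \<le> r0 / 6" using r0 K2 by (intro divide_left_mono) auto
  then have xz': "dist x z < r0 / 6" using xz by simp
  obtain t h where th: "x = a + t *\<^sub>R edir a b + h *\<^sub>R m" "0 \<le> t" "t \<le> dist a b" "0 \<le> h"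
    "M0 * h \<le> t" "M0 * h \<le> dist a b - t" "M0 * h \<le> r0 / 2" "h \<le> 3 / 10 * r0"
    using x by (rule capE) (rule that)
  obtain s k where sk: "z = c + s *\<^sub>R edir c d + k *\<^sub>R n" "0 \<le> s" "s \<le> dist c d" "0 \<le> k"
    "M0 * k \<le> s" "M0 * k \<le> dist c d - s" "M0 * k \<le> r0 / 2" "k \<le> 3 / 10 * r0"
    using z by (rule capE) (rule that)
  define p where "p = a + t *\<^sub>R edir a b"
  define q where "q = c + s *\<^sub>R edir c d"
  have nm: "norm m = 1" "norm n = 1" using edge_normalD(1)[OF F \<sigma> m] edge_normalD(1)[OF F \<tau> n] by auto
  have pr: "p \<in> rel_frontier F" using edge_sub_frontier(4)[OF F \<sigma> th(2,3)] by (simp add: p_def)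
  obtain E1 E2 g where ch: "face_chart F r0 M0 p E1 E2 g" using face_chart_exists[OF F pr] .
  note co = chart_coords(4,5)[OF ch]
  have xp: "x = p + h *\<^sub>R m" and zq: "z = q + k *\<^sub>R n" using th sk by (simp_all add: p_def q_def)
  have dxp: "dist x p \<le> 3 / 10 * r0" using th nm by (simp add: xp dist_norm)
  have dzq: "dist z q \<le> 3 / 10 * r0" using sk nm by (simp add: zq dist_norm)
  have "dist q p \<le> dist z q + dist x z + dist x p"
    using dist_triangle[of q p z] dist_triangle[of z p x] by (simp add: dist_commute)
  then have dqp: "norm (q - p) < r0" using dxp dzq xz' r0 unfolding dist_norm by linarith
  have r2: "r0 * 2 \<le> 2 * M0 * r0" using M0 r0 by simp
  obtain x' where x': "x' \<in> closed_segment a b" "(x' - p) \<bullet> E1 = (p + h *\<^sub>R m - p) \<bullet> E1" "dist x' p \<le> r0 / 2"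
    using chart_vertical_projection[OF F ch \<sigma> m th(2-7) p_def] r0 M0 by auto
 have qE: "\<bar>(q - p) \<bullet> E1\<bar> < r0" "\<bar>(q - p) \<bullet> E2\<bar> < 2 * M0 * r0" using co[of "q - p"] dqp r2 r0 by linarith+
  obtain z' where z': "z' \<in> closed_segment c d" "(z' - p) \<bullet> E1 = (q + k *\<^sub>R n - p) \<bullet> E1" "dist z' q \<le> r0 / 2"
    using chart_vertical_projection[OF F ch \<tau> n sk(2-7) q_def qE] by blast
  have x1: "\<bar>(x' - p) \<bullet> E1\<bar> < r0" "\<bar>(x' - p) \<bullet> E2\<bar> < 2 * M0 * r0"
    using co[of "x' - p"] x'(3) r0 r2 unfolding dist_norm by linarith+
  have "\<bar>(z' - p) \<bullet> E1\<bar> \<le> dist z p"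
    unfolding z'(2) using co(1)[of "z - p"] by (simp add: zq dist_norm)
  also have "\<dots> < r0" using dist_triangle[of z p x] xz' dxp r0 by (simp add: dist_commute)
  finally have z1: "\<bar>(z' - p) \<bullet> E1\<bar> < r0" .
  have "norm (z' - p) \<le> dist z' q + norm (q - p)" using dist_triangle[of z' p q] by (simp add: dist_norm)
  then have z2: "\<bar>(z' - p) \<bullet> E2\<bar> < 2 * M0 * r0"
    using co(2)[of "z' - p"] z'(3) dqp r0 r2 by linarith
  define W :: "real^3 \<Rightarrow> real" where "W = (\<lambda>v. if v = a \<or> v = b then 1 else 0)"
  have "\<bar>edge_interp W a b x' - edge_interp W c d z'\<bar> \<le> 1 / r0 * K * \<bar>(x' - p) \<bullet> E1 - (z' - p) \<bullet> E1\<bar>"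
    by (rule chart_edge_interp_lipschitz[OF F ch _ \<sigma> \<tau> x'(1) x1 z'(1) z1 z2]) (simp add: W_def)
  moreover have "edge_interp W a b x' = 1" by (simp add: edge_interp_def W_def)
  moreover have "edge_interp W c d z' = 0" using disj by (auto simp: edge_interp_def W_def)
  ultimately have "1 \<le> 1 / r0 * K * \<bar>(x' - p) \<bullet> E1 - (z' - p) \<bullet> E1\<bar>" by simp
  also have "(x' - p) \<bullet> E1 - (z' - p) \<bullet> E1 = (x - z) \<bullet> E1"
    unfolding x'(2) z'(2) xp zq by (simp add: inner_simps)
  also have "1 / r0 * K * \<bar>(x - z) \<bullet> E1\<bar> \<le> 1 / r0 * K * dist x z"
    using co(1)[of "x - z"] r0 K2 by (intro mult_left_mono) (auto simp: dist_norm)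
  also have "\<dots> < 1 / r0 * K * (r0 / (3 * K))" using xz r0 K2 by (intro mult_strict_left_mono) auto
  also have "\<dots> = 1 / 3" using r0 K2 by simp
  finally show False by simp
qed

end

subsection \<open>Angles within a face\<close>

definition polar :: "'a::real_inner \<Rightarrow> 'a \<Rightarrow> real \<Rightarrow> 'a" where
  "polar u w \<phi> = cos \<phi> *\<^sub>R u + sin \<phi> *\<^sub>R w"

lemma orthonormal_pairD:
  assumes "orthonormal_pair u w"
  shows "u \<bullet> u = 1" "w \<bullet> w = 1" "u \<bullet> w = 0" "w \<bullet> u = 0" "norm u = 1" "norm w = 1"
  using assms by (simp_all add: orthonormal_pair_def dot_square_norm inner_commute)

lemma polar_inner:
  assumes "orthonormal_pair u w"
  shows "polar u w \<phi> \<bullet> polar u w \<psi> = cos (\<phi> - \<psi>)"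
  using orthonormal_pairD[OF assms] by (simp add: polar_def inner_simps cos_diff mult.commute)

lemma norm_polar:
  assumes "orthonormal_pair u w"
  shows "norm (polar u w \<phi>) = 1"
  using polar_inner[OF assms, of \<phi> \<phi>] by (simp add: norm_eq_1)

lemma polar_coords:
  assumes "orthonormal_pair u w"
  shows "polar u w \<phi> \<bullet> u = cos \<phi>" "polar u w \<phi> \<bullet> w = sin \<phi>"
  using orthonormal_pairD[OF assms] by (simp_all add: polar_def inner_simps)

lemma polar_unique:
  assumes o: "orthonormal_pair u w" and eq: "polar u w \<phi> = polar u w \<psi>"
    and r: "0 \<le> \<phi>" "\<phi> < 2 * pi" "0 \<le> \<psi>" "\<psi> < 2 * pi"
  shows "\<phi> = \<psi>"
proof -
  have "sin \<phi> = sin \<psi> \<and> cos \<phi> = cos \<psi>" using polar_coords[OF o] eq by metis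
  then obtain n :: int where n: "\<phi> = \<psi> + 2 * pi * n" using sin_cos_eq_iff by blast
  have "2 * pi * (-1) < 2 * pi * real_of_int n" "2 * pi * real_of_int n < 2 * pi * 1" using n r by linarith+
  then have "-1 < real_of_int n" "real_of_int n < 1" by (simp_all only: mult_less_cancel_left_pos pi_gt_zero zero_less_mult_iff zero_less_numeral simp_thms)
  then have "n = 0" by linarith
  then show ?thesis using n by simp
qed

text \<open>The argument is taken of the quotient \<open>z / z0\<close>, which is near 1 and thus
  far from the cut of \<open>Arg\<close>; so angles beyond \<open>pi\<close> are covered without a
  separate case.\<close>

lemma polar_near:
  fixes t \<phi> \<alpha> :: real
  assumes "0 < \<phi>" "\<phi> < \<alpha>" "0 < t"
  obtains \<delta> where "\<delta> > 0" "\<And>x y. \<bar>x - t * cos \<phi>\<bar> < \<delta> \<Longrightarrow> \<bar>y - t * sin \<phi>\<bar> < \<delta> \<Longrightarrow>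
     \<exists>s \<psi>. 0 \<le> s \<and> 0 \<le> \<psi> \<and> \<psi> \<le> \<alpha> \<and> x = s * cos \<psi> \<and> y = s * sin \<psi>"
proof -
  define z0 where "z0 = rcis t \<phi>"
  have z0: "z0 \<noteq> 0" using assms(3) by (simp add: z0_def rcis_def)
  have "isCont (\<lambda>z. Arg (z / z0)) z0"
  proof (rule isCont_o2[where f = "\<lambda>z. z / z0" and g = Arg])
    show "isCont (\<lambda>z. z / z0) z0" using z0 by (intro continuous_intros) auto
    show "isCont Arg (z0 / z0)" using z0 by (intro continuous_at_Arg) auto
  qed
  moreover have "0 < min \<phi> (\<alpha> - \<phi>)" using assms by simp
  ultimately have "\<exists>d>0. \<forall>z. dist z z0 < d \<longrightarrow> dist (Arg (z / z0)) (Arg (z0 / z0)) < min \<phi> (\<alpha> - \<phi>)"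
    unfolding continuous_at_eps_delta by blast
  then obtain d where d: "d > 0" "\<And>z. dist z z0 < d \<Longrightarrow> dist (Arg (z / z0)) (Arg (z0 / z0)) < min \<phi> (\<alpha> - \<phi>)"
    by blast
  show thesis
  proof (rule that[of "d / 2"])
    show "d / 2 > 0" using d by simp
    fix x y assume xy: "\<bar>x - t * cos \<phi>\<bar> < d / 2" "\<bar>y - t * sin \<phi>\<bar> < d / 2"
    define z where "z = Complex x y"
    have "dist z z0 \<le> \<bar>Re (z - z0)\<bar> + \<bar>Im (z - z0)\<bar>" unfolding dist_norm by (rule cmod_le)
    also have "\<dots> < d" using xy by (simp add: z_def z0_def rcis_def)
    finally have a: "\<bar>Arg (z / z0)\<bar> < min \<phi> (\<alpha> - \<phi>)" using d(2)[of z] z0 by (simp add: dist_real_def)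
    have "z = z0 * (z / z0)" using z0 by simp
    also have "\<dots> = rcis t \<phi> * rcis (cmod (z / z0)) (Arg (z / z0))" by (simp only: z0_def[symmetric] rcis_cmod_Arg)
    also have "\<dots> = rcis (t * cmod (z / z0)) (\<phi> + Arg (z / z0))" by (rule rcis_mult)
    finally have z: "z = rcis (t * cmod (z / z0)) (\<phi> + Arg (z / z0))" .
    show "\<exists>s \<psi>. 0 \<le> s \<and> 0 \<le> \<psi> \<and> \<psi> \<le> \<alpha> \<and> x = s * cos \<psi> \<and> y = s * sin \<psi>"
    proof (intro exI conjI)
      show "0 \<le> t * cmod (z / z0)" using assms(3) by simp
      show "0 \<le> \<phi> + Arg (z / z0)" "\<phi> + Arg (z / z0) \<le> \<alpha>" using a by (auto simp: abs_less_iff)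
      show "x = t * cmod (z / z0) * cos (\<phi> + Arg (z / z0))" using arg_cong[OF z, of Re] by (simp add: z_def[symmetric] rcis_def) (simp add: z_def)
      show "y = t * cmod (z / z0) * sin (\<phi> + Arg (z / z0))" using arg_cong[OF z, of Im] by (simp add: z_def[symmetric] rcis_def) (simp add: z_def)
    qed
  qed
qed

text \<open>Completing the square in \<open>norm z\<close> in the law of cosines leaves
  \<open>(sin \<theta> * norm x)\<^sup>2\<close>, the squared distance of \<open>x\<close> from a
  line at the angle \<theta>.\<close>

lemma norm_diff_ge_angle:
  fixes x z :: "'a::real_inner"
  assumes "x \<bullet> z \<le> cos \<theta> * (norm x * norm z)" "0 \<le> \<theta>" "\<theta> \<le> pi"
  shows "sin \<theta> * norm x \<le> norm (x - z)"
proof -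
  have "(norm (x - z))\<^sup>2 = (norm x)\<^sup>2 + (norm z)\<^sup>2 - 2 * (x \<bullet> z)"
    by (simp add: power2_norm_eq_inner inner_simps inner_commute)
  also have "\<dots> \<ge> (norm x)\<^sup>2 + (norm z)\<^sup>2 - 2 * (cos \<theta> * (norm x * norm z))" using assms(1) by simp
  also have "(norm x)\<^sup>2 + (norm z)\<^sup>2 - 2 * (cos \<theta> * (norm x * norm z))
      = (norm z - cos \<theta> * norm x)\<^sup>2 + (norm x)\<^sup>2 * (1 - (cos \<theta>)\<^sup>2)"
    by (simp add: power2_eq_square algebra_simps)
  also have "1 - (cos \<theta>)\<^sup>2 = (sin \<theta>)\<^sup>2" by (simp add: sin_squared_eq)
  finally have "(norm z - cos \<theta> * norm x)\<^sup>2 + (norm x)\<^sup>2 * (sin \<theta>)\<^sup>2 \<le> (norm (x - z))\<^sup>2" .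
  moreover have "(sin \<theta> * norm x)\<^sup>2 = (norm x)\<^sup>2 * (sin \<theta>)\<^sup>2" by (simp add: power_mult_distrib)
  ultimately have "(sin \<theta> * norm x)\<^sup>2 \<le> (norm (x - z))\<^sup>2"
    using zero_le_power2[of "norm z - cos \<theta> * norm x"] by linarith
  then show ?thesis by (rule power2_le_imp_le) simp
qed

lemma cos_le_cos_off:
  assumes "0 \<le> c" "c \<le> pi" "c \<le> x" "x \<le> 2 * pi - c"
  shows "cos x \<le> cos c"
proof (cases "x \<le> pi")
  case True
  then show ?thesis using assms by (intro cos_monotone_0_pi_le) auto
next
  case False
  have "cos x = cos (2 * pi - x)" by (simp add: cos_diff)
  also have "\<dots> \<le> cos c" using assms False by (intro cos_monotone_0_pi_le) auto
  finally show ?thesis .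
qed

context poly_setting
begin

text \<open>A thin sector about the edge, of slope at most \<open>1 / M0\<close>, contains points
  whose side is decided by the half discs. They belong to \<open>F\<close>, so \<open>w\<close>
  points into \<open>F\<close> and is the inner normal.\<close>

lemma sector_normal:
  assumes F: "F \<in> \<F>" and \<sigma>: "closed_segment V b \<in> face_edges \<F> F" and m: "edge_normal F V b m"
    and w: "norm w = 1" "w \<bullet> edir V b = 0" and \<epsilon>: "\<epsilon> > 0" "\<beta>0 > 0"
    and sec: "\<And>s \<beta>. 0 \<le> s \<Longrightarrow> s < \<epsilon> \<Longrightarrow> 0 \<le> \<beta> \<Longrightarrow> \<beta> \<le> \<beta>0 \<Longrightarrow> V + s *\<^sub>R (cos \<beta> *\<^sub>R edir V b + sin \<beta> *\<^sub>R w) \<in> F"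
  shows "m = w"
proof -
  note es = edge_sub_frontier[OF F \<sigma>]
  note ed = edge_normalD[OF F \<sigma> m]
  define e where "e = edir V b"
  define L where "L = dist V b"
  have L: "L > 0" using es(1) by (simp add: L_def)
  define \<beta> where "\<beta> = min \<beta>0 (arctan (1 / M0))"
  have \<beta>: "0 < \<beta>" "\<beta> \<le> \<beta>0" "\<beta> \<le> arctan (1 / M0)" "\<beta> < pi / 2"
    using \<epsilon> M0 arctan_ubound[of "1 / M0"] by (auto simp: \<beta>_def min_less_iff_disj)
  have cb: "cos \<beta> > 0" "sin \<beta> > 0" using \<beta> by (auto intro!: cos_gt_zero_pi sin_gt_zero)
  have "tan \<beta> \<le> tan (arctan (1 / M0))"
    using \<beta> arctan_ubound[of "1 / M0"] by (intro tan_mono_le) auto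
  then have tb: "M0 * tan \<beta> \<le> 1" "tan \<beta> > 0" using M0 \<beta> by (auto simp: tan_arctan field_simps intro: tan_gt_zero)
  \<comment> \<open>\<open>r\<close> is at most half the length of the edge and at most
    \<open>r0 / 2\<close>, so \<open>edge_radius V b r = r\<close>. The last term keeps the point,
    at distance \<open>r / cos \<beta>\<close>, in the range \<epsilon> of the sector.\<close>
  define r where "r = min (min (L / 2) (r0 / 2)) (\<epsilon> / 2 * cos \<beta>)"
  have r: "r > 0" "r \<le> L / 2" "r \<le> r0 / 2" "r \<le> \<epsilon> / 2 * cos \<beta>" using L r0 \<epsilon> cb by (auto simp: r_def)
  have re: "r / cos \<beta> \<le> \<epsilon> / 2" using r(4) cb by (simp add: divide_le_eq)
  have rs: "0 \<le> r / cos \<beta>" using r cb by simp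
  have rs': "r / cos \<beta> < \<epsilon>" using re \<epsilon> by linarith
  have "V + (r / cos \<beta>) *\<^sub>R (cos \<beta> *\<^sub>R e + sin \<beta> *\<^sub>R w) \<in> F"
    unfolding e_def by (rule sec[OF rs rs']) (use \<beta> in simp_all)
  moreover have "(r / cos \<beta>) *\<^sub>R (cos \<beta> *\<^sub>R e + sin \<beta> *\<^sub>R w) = r *\<^sub>R e + (r * tan \<beta>) *\<^sub>R w"
    using cb by (simp add: tan_def scaleR_add_right)
  ultimately have pF: "V + r *\<^sub>R e + (r * tan \<beta>) *\<^sub>R w \<in> F" by (simp add: add.assoc)
  have rL: "0 < r" "r < dist V b" using r L by (auto simp: L_def)
  have "0 < r * tan \<beta>" using r tb by simp
  have hull: "V + r *\<^sub>R e \<in> affine hull F" using es(6) rL by (simp add: e_def)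
  have "w = m \<or> w = - m"
  proof (rule edge_normal_unique[OF F edir(1)[OF es(1)] ed(3)[OF rL] ed(4)[OF rL]])
    show "V + r *\<^sub>R edir V b \<in> affine hull F" using hull by (simp add: e_def)
    show "V + r *\<^sub>R edir V b + (- r) *\<^sub>R edir V b \<in> affine hull F" using es(6)[of 0] by simp
    show "V + r *\<^sub>R e \<in> affine hull F" by (rule hull)
    show "V + r *\<^sub>R e + (r * tan \<beta>) *\<^sub>R w \<in> affine hull F" using pF hull_subset[of F affine] by blast
  qed (use w r \<open>0 < r * tan \<beta>\<close> in auto)
  moreover have "w \<noteq> - m"
  proof
    assume wm: "w = - m"
    have "M0 * (r * tan \<beta>) = r * (M0 * tan \<beta>)" by simp
    also have "\<dots> \<le> r * 1" using tb r by (intro mult_left_mono) auto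
    also have "r * 1 = edge_radius V b r" using r by (simp add: edge_radius_def L_def)
    finally have "V + r *\<^sub>R edir V b + 0 *\<^sub>R edir V b - (r * tan \<beta>) *\<^sub>R m \<notin> F"
      using \<open>0 < r * tan \<beta>\<close> by (intro half_discD(4)[OF ed(3)[OF rL]]) auto
    then show False using pF wm by (simp add: e_def)
  qed
  ultimately show ?thesis by blast
qed

text \<open>A ray strictly inside the sector consists near \<open>V\<close> of relatively interior
  points, so an edge at \<open>V\<close> runs along one of the two bounding rays, and distinct edges
  cannot share one. The inner normals are the bounding directions turned by a right angle into the
  sector. Either edge may be the first one, hence the two cases.\<close>

lemma face_sector:
  assumes F: "F \<in> \<F>"
    and \<sigma>: "closed_segment V b \<in> face_edges \<F> F" and m: "edge_normal F V b m"
    and \<tau>: "closed_segment V c \<in> face_edges \<F> F" and n: "edge_normal F V c n"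
    and ne: "closed_segment V b \<noteq> closed_segment V c"
  obtains \<alpha> u w where "\<alpha> \<in> admissible_angles \<theta>0" "orthonormal_pair u w"
    "(edir V b = u \<and> m = w \<and> edir V c = polar u w \<alpha> \<and> n = polar u w (\<alpha> - pi / 2)) \<or>
     (edir V c = u \<and> n = w \<and> edir V b = polar u w \<alpha> \<and> m = polar u w (\<alpha> - pi / 2))"
proof -
  have VF: "V \<in> F" using edge_sub_frontier(5)[OF F \<sigma>, of 0] by simp
  obtain \<alpha> where \<alpha>: "\<alpha> \<in> admissible_angles \<theta>0" "internal_angle F V \<alpha>"
    using poly(12)[OF F endpoint_is_vertex(1)[OF F \<sigma>] VF] by blast
  then obtain u w \<epsilon> where \<alpha>r: "0 < \<alpha>" "\<alpha> < 2 * pi" and uw: "orthonormal_pair u w" and \<epsilon>: "\<epsilon> > 0"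
    and sec: "F \<inter> ball V \<epsilon> = {V + t *\<^sub>R polar u w \<phi> |t \<phi>. 0 \<le> t \<and> 0 \<le> \<phi> \<and> \<phi> \<le> \<alpha>} \<inter> ball V \<epsilon>"
    unfolding internal_angle_def polar_def by blast
  have np: "norm (polar u w \<phi>) = 1" for \<phi> by (rule norm_polar[OF uw])
  have mem: "V + t *\<^sub>R polar u w \<phi> \<in> F" if "0 \<le> t" "t < \<epsilon>" "0 \<le> \<phi>" "\<phi> \<le> \<alpha>" for t \<phi>
  proof -
    have "V + t *\<^sub>R polar u w \<phi> \<in> {V + t *\<^sub>R polar u w \<phi> |t \<phi>. 0 \<le> t \<and> 0 \<le> \<phi> \<and> \<phi> \<le> \<alpha>} \<inter> ball V \<epsilon>"
      using that np by (auto simp: dist_norm)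
    then show ?thesis using sec by blast
  qed
  obtain N where N: "N \<noteq> 0" "\<And>y. y \<in> affine hull F \<longleftrightarrow> N \<bullet> (y - V) = 0" using face_normal[OF F VF] by blast
  have Np: "N \<bullet> polar u w \<phi> = 0" if "0 \<le> \<phi>" "\<phi> \<le> \<alpha>" for \<phi>
  proof -
    have "V + (\<epsilon> / 2) *\<^sub>R polar u w \<phi> \<in> affine hull F"
      using mem[of "\<epsilon> / 2" \<phi>] that \<epsilon> hull_subset[of F affine] by auto
    then show ?thesis using N(2) \<epsilon> by simp
  qed
  have Nu: "N \<bullet> u = 0" using Np[of 0] \<alpha>r by (simp add: polar_def)
  have Nw: "N \<bullet> w = 0"
  proof -
    \<comment> \<open>An angle of the sector with positive sine; \<alpha> itself may exceed
      \<open>pi\<close>.\<close>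
    define \<beta> where "\<beta> = min \<alpha> (pi / 2)"
    have \<beta>: "0 < \<beta>" "\<beta> \<le> \<alpha>" "\<beta> < pi" using \<alpha>r by (auto simp: \<beta>_def min_less_iff_disj)
    then have "sin \<beta> > 0" by (intro sin_gt_zero)
    moreover have "N \<bullet> polar u w \<beta> = sin \<beta> * (N \<bullet> w)" using Nu by (simp add: polar_def inner_simps)
    ultimately show ?thesis using Np[of \<beta>] \<beta> by simp
  qed
  have expand: "y - V = ((y - V) \<bullet> u) *\<^sub>R u + ((y - V) \<bullet> w) *\<^sub>R w" if "y \<in> affine hull F" for y
  proof -
    define k where "k = (1 / norm N) *\<^sub>R N"
    have "norm k = 1" "u \<bullet> k = 0" "w \<bullet> k = 0" "(y - V) \<bullet> k = 0"
      using N that Nu Nw by (simp_all add: k_def inner_commute)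
    then show ?thesis using orthonormal3_expand[of u w k "y - V"] orthonormal_pairD[OF uw] by simp
  qed
  have dir: "edir V b' = polar u w 0 \<or> edir V b' = polar u w \<alpha>" if \<sigma>': "closed_segment V b' \<in> face_edges \<F> F" for b'
  proof -
    note es = edge_sub_frontier[OF F \<sigma>']
    define t where "t = min (\<epsilon> / 2) (dist V b' / 2)"
    have t: "0 < t" "t \<le> \<epsilon> / 2" "t < dist V b'" using \<epsilon> es(1) by (auto simp: t_def min_less_iff_disj)
    have e1: "norm (edir V b') = 1" by (rule edir(1)[OF es(1)])
    have yr: "V + t *\<^sub>R edir V b' \<in> rel_frontier F" using es(4) t by simp
    then have yF: "V + t *\<^sub>R edir V b' \<in> F" "V + t *\<^sub>R edir V b' \<notin> rel_interior F" using face_frontier[OF F] by auto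
    then have "V + t *\<^sub>R edir V b' \<in> F \<inter> ball V \<epsilon>" using t e1 \<epsilon> by (simp add: dist_norm)
    then obtain s \<phi> where s: "V + t *\<^sub>R edir V b' = V + s *\<^sub>R polar u w \<phi>" "0 \<le> s" "0 \<le> \<phi>" "\<phi> \<le> \<alpha>"
      unfolding sec by blast
    have "norm (t *\<^sub>R edir V b') = norm (s *\<^sub>R polar u w \<phi>)" using s(1) by simp
    then have "t = s" using np e1 s(2) t(1) by simp
    then have ep: "edir V b' = polar u w \<phi>" using s(1) t(1) by simp
    show ?thesis
    proof (rule ccontr)
      assume "\<not> (edir V b' = polar u w 0 \<or> edir V b' = polar u w \<alpha>)"
      then have \<phi>: "0 < \<phi>" "\<phi> < \<alpha>" using ep s(3,4) by (auto simp: less_le)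
      obtain \<delta> where \<delta>: "\<delta> > 0" "\<And>x y. \<bar>x - t * cos \<phi>\<bar> < \<delta> \<Longrightarrow> \<bar>y - t * sin \<phi>\<bar> < \<delta> \<Longrightarrow>
          \<exists>s \<psi>. 0 \<le> s \<and> 0 \<le> \<psi> \<and> \<psi> \<le> \<alpha> \<and> x = s * cos \<psi> \<and> y = s * sin \<psi>"
        using polar_near[OF \<phi> t(1)] by blast
      let ?y0 = "V + t *\<^sub>R edir V b'"
      have "ball ?y0 (min \<delta> (\<epsilon> / 2)) \<inter> affine hull F \<subseteq> F"
      proof
        fix y assume y: "y \<in> ball ?y0 (min \<delta> (\<epsilon> / 2)) \<inter> affine hull F"
        then have d: "norm (y - ?y0) < \<delta>" "norm (y - ?y0) < \<epsilon> / 2" by (auto simp: dist_norm norm_minus_commute)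
        have "\<bar>(y - ?y0) \<bullet> u\<bar> \<le> norm (y - ?y0)" "\<bar>(y - ?y0) \<bullet> w\<bar> \<le> norm (y - ?y0)"
          using Cauchy_Schwarz_ineq2[of "y - ?y0" u] Cauchy_Schwarz_ineq2[of "y - ?y0" w] orthonormal_pairD[OF uw] by simp_all
        moreover have "(y - ?y0) \<bullet> u = (y - V) \<bullet> u - t * cos \<phi>" "(y - ?y0) \<bullet> w = (y - V) \<bullet> w - t * sin \<phi>"
          using polar_coords[OF uw, of \<phi>] by (simp_all add: ep inner_simps)
        ultimately obtain s' \<psi> where s': "0 \<le> s'" "0 \<le> \<psi>" "\<psi> \<le> \<alpha>" "(y - V) \<bullet> u = s' * cos \<psi>" "(y - V) \<bullet> w = s' * sin \<psi>"
          using \<delta>(2)[of "(y - V) \<bullet> u" "(y - V) \<bullet> w"] d by auto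
        have yV: "y - V = s' *\<^sub>R polar u w \<psi>"
          using expand[of y] y unfolding s'(4,5) by (simp add: polar_def scaleR_add_right)
        have "norm (y - V) \<le> norm (y - ?y0) + t" using norm_triangle_ineq[of "y - ?y0" "t *\<^sub>R edir V b'"] t e1 by simp
        then have "norm (y - V) < \<epsilon>" using d t by linarith
        moreover have "norm (y - V) = s'" unfolding yV using np s'(1) by simp
        ultimately have "V + s' *\<^sub>R polar u w \<psi> \<in> F" using s' by (intro mem) auto
        then show "y \<in> F" using yV by (metis add.commute diff_add_cancel)
      qed
      then have "?y0 \<in> rel_interior F"
        unfolding mem_rel_interior_ball using yF(1) \<delta> \<epsilon> by (auto intro!: exI[of _ "min \<delta> (\<epsilon> / 2)"])
      then show False using yF by simp
    qed
  qed
  have distinct: "edir V b \<noteq> edir V c"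
  proof
    assume eq: "edir V b = edir V c"
    have bL: "0 < dist V b" "0 < dist V c" using edge_sub_frontier(1)[OF F \<sigma>] edge_sub_frontier(1)[OF F \<tau>] by auto
    define t where "t = min (dist V b) (dist V c) / 2"
    have t: "0 < t" "t < dist V b" "t < dist V c" 
    proof -
      have "t \<le> dist V b / 2" "t \<le> dist V c / 2" by (simp_all add: t_def)
      then show "t < dist V b" "t < dist V c" using bL by linarith+
      show "0 < t" using bL by (simp add: t_def)
    qed
    have "V + t *\<^sub>R edir V b \<in> open_segment V b"
      using closed_segment_edir(2)[OF edge_sub_frontier(1)[OF F \<sigma>]] t by blast
    moreover have "V + t *\<^sub>R edir V b \<in> closed_segment V c"
      unfolding closed_segment_edir(1)[OF edge_sub_frontier(1)[OF F \<tau>]] using t eq by (intro exI[of _ t]) simp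
    ultimately show False using edges_through_open_segment[OF F \<sigma> _ edgesI[OF F \<tau>]] ne by metis
  qed
  have p0: "polar u w 0 = u" by (simp add: polar_def)
  have nor0: "m' = w" if \<sigma>': "closed_segment V b' \<in> face_edges \<F> F" "edge_normal F V b' m'" "edir V b' = polar u w 0" for b' m'
  proof (rule sector_normal[OF F \<sigma>'(1,2) _ _ \<epsilon> \<alpha>r(1)])
    show "norm w = 1" "w \<bullet> edir V b' = 0" using orthonormal_pairD[OF uw] \<sigma>'(3) p0 by auto
    show "V + s *\<^sub>R (cos \<beta> *\<^sub>R edir V b' + sin \<beta> *\<^sub>R w) \<in> F" if "0 \<le> s" "s < \<epsilon>" "0 \<le> \<beta>" "\<beta> \<le> \<alpha>" for s \<beta>
      using mem[OF that] \<sigma>'(3) p0 by (simp add: polar_def)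
  qed
  have nor1: "m' = polar u w (\<alpha> - pi / 2)" if \<sigma>': "closed_segment V b' \<in> face_edges \<F> F" "edge_normal F V b' m'" "edir V b' = polar u w \<alpha>" for b' m'
  proof (rule sector_normal[OF F \<sigma>'(1,2) _ _ \<epsilon> \<alpha>r(1)])
    show "norm (polar u w (\<alpha> - pi / 2)) = 1" by (rule np)
    show "polar u w (\<alpha> - pi / 2) \<bullet> edir V b' = 0" unfolding \<sigma>'(3) polar_inner[OF uw] by simp
    fix s \<beta> assume s: "0 \<le> s" "s < \<epsilon>" "0 \<le> \<beta>" "\<beta> \<le> \<alpha>"
    have "cos \<beta> *\<^sub>R edir V b' + sin \<beta> *\<^sub>R polar u w (\<alpha> - pi / 2) = polar u w (\<alpha> - \<beta>)"
      unfolding \<sigma>'(3) polar_def cos_diff sin_diff by (simp add: algebra_simps)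
    then show "V + s *\<^sub>R (cos \<beta> *\<^sub>R edir V b' + sin \<beta> *\<^sub>R polar u w (\<alpha> - pi / 2)) \<in> F"
      using mem[of s "\<alpha> - \<beta>"] s by simp
  qed
  consider "edir V b = polar u w 0" "edir V c = polar u w \<alpha>" | "edir V c = polar u w 0" "edir V b = polar u w \<alpha>"
    using dir[OF \<sigma>] dir[OF \<tau>] distinct by metis
  then show thesis
  proof cases
    case 1
    then show ?thesis using that[OF \<alpha>(1) uw] nor0[OF \<sigma> m 1(1)] nor1[OF \<tau> n 1(2)] p0 by simp
  next
    case 2
    then show ?thesis using that[OF \<alpha>(1) uw] nor0[OF \<tau> n 2(1)] nor1[OF \<sigma> m 2(2)] p0 by simp
  qed
qed

lemma admissible_bounds:
  assumes "\<alpha> \<in> admissible_angles \<theta>0"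
  shows "\<theta>0 < \<alpha>" "\<alpha> < 2 * pi - \<theta>0" "sin \<theta>0 \<le> \<bar>sin \<alpha>\<bar>"
proof -
  show "\<theta>0 < \<alpha>" "\<alpha> < 2 * pi - \<theta>0" using assms \<theta>0 by (auto simp: admissible_angles_def)
  have *: "sin \<theta>0 \<le> sin \<beta>" if "\<theta>0 < \<beta>" "\<beta> < pi - \<theta>0" for \<beta>
  proof (cases "\<beta> \<le> pi / 2")
    case True
    then show ?thesis using that \<theta>0 by (intro sin_monotone_2pi_le) auto
  next
    case False
    have "sin \<theta>0 \<le> sin (pi - \<beta>)" using that \<theta>0 False by (intro sin_monotone_2pi_le) auto
    then show ?thesis by simp
  qed
  consider "\<theta>0 < \<alpha>" "\<alpha> < pi - \<theta>0" | "\<theta>0 < \<alpha> - pi" "\<alpha> - pi < pi - \<theta>0"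
    using assms by (auto simp: admissible_angles_def)
  then show "sin \<theta>0 \<le> \<bar>sin \<alpha>\<bar>"
  proof cases
    case 1 then show ?thesis using *[of \<alpha>] by linarith
  next
    case 2 then show ?thesis using *[of "\<alpha> - pi"] by (simp add: sin_diff)
  qed
qed

lemma cap_polar:
  assumes "x \<in> cap a b m"
  obtains s \<phi> where "0 \<le> s" "0 \<le> \<phi>" "\<phi> \<le> base_angle" "x - a = s *\<^sub>R polar (edir a b) m \<phi>"
proof -
  obtain t h where th: "x = a + t *\<^sub>R edir a b + h *\<^sub>R m" "0 \<le> t" "0 \<le> h" "h \<le> slope_bound * t"
    using assms by (rule capE) (rule that)
  show thesis
  proof (cases "t = 0")
    case True
    then show ?thesis using that[of 0 0] th base_angle by simp
  next
    case False
    then have t: "t > 0" using th by simp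
    define \<phi> where "\<phi> = arctan (h / t)"
    have b: "base_angle < pi / 2" "- (pi / 2) < base_angle" using base_angle \<theta>0 by linarith+
    have "h / t \<le> slope_bound" using th t by (simp add: divide_le_eq)
    then have "\<phi> \<le> arctan slope_bound" unfolding \<phi>_def by (simp add: arctan_le_iff)
    also have "arctan slope_bound = base_angle" unfolding slope_bound_def using b by (simp add: arctan_tan)
    finally have \<phi>: "0 \<le> \<phi>" "\<phi> \<le> base_angle" using th t by (simp_all add: \<phi>_def)
    have c: "cos \<phi> > 0" unfolding \<phi>_def by (simp add: cos_arctan add_pos_nonneg)
    have tn: "sin \<phi> / cos \<phi> = h / t" using tan_arctan[of "h / t"] by (simp add: \<phi>_def tan_def)
    have "(t / cos \<phi>) *\<^sub>R polar (edir a b) m \<phi> = t *\<^sub>R edir a b + (t * (sin \<phi> / cos \<phi>)) *\<^sub>R m"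
      using c by (simp add: polar_def scaleR_add_right)
    also have "\<dots> = x - a" unfolding tn using t by (simp add: th(1))
    finally show ?thesis using that[of "t / cos \<phi>" \<phi>] \<phi> c t by simp
  qed
qed

text \<open>The angle between the edges, measured inside the face, exceeds \<theta>0 and stays below
  \<open>2 * pi - \<theta>0\<close>. Each cap uses up at most \<theta>0 / 3 of it, so directions
  into the two caps enclose at least \<theta>0 / 3, whichever way round it is measured.\<close>

lemma adjacent_caps:
  assumes F: "F \<in> \<F>"
    and \<sigma>: "closed_segment V b \<in> face_edges \<F> F" and m: "edge_normal F V b m"
    and \<tau>: "closed_segment V c \<in> face_edges \<F> F" and n: "edge_normal F V c n"
    and ne: "closed_segment V b \<noteq> closed_segment V c"
    and x: "x \<in> cap V b m" and z: "z \<in> cap V c n"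
  shows "sin (\<theta>0 / 3) * dist x V \<le> dist x z"
proof -
  obtain \<alpha> u w where \<alpha>: "\<alpha> \<in> admissible_angles \<theta>0" and uw: "orthonormal_pair u w"
    and cases: "(edir V b = u \<and> m = w \<and> edir V c = polar u w \<alpha> \<and> n = polar u w (\<alpha> - pi / 2)) \<or>
     (edir V c = u \<and> n = w \<and> edir V b = polar u w \<alpha> \<and> m = polar u w (\<alpha> - pi / 2))"
    using face_sector[OF F \<sigma> m \<tau> n ne] by blast
  obtain s \<phi> where s: "0 \<le> s" "0 \<le> \<phi>" "\<phi> \<le> base_angle" "x - V = s *\<^sub>R polar (edir V b) m \<phi>" by (rule cap_polar[OF x])
  obtain s' \<psi> where s': "0 \<le> s'" "0 \<le> \<psi>" "\<psi> \<le> base_angle" "z - V = s' *\<^sub>R polar (edir V c) n \<psi>" by (rule cap_polar[OF z])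
  have pp: "polar (polar u w \<alpha>) (polar u w (\<alpha> - pi / 2)) \<eta> = polar u w (\<alpha> - \<eta>)" for \<eta>
    unfolding polar_def cos_diff sin_diff by (simp add: algebra_simps)
  have "polar (edir V b) m \<phi> \<bullet> polar (edir V c) n \<psi> = cos (\<alpha> - \<phi> - \<psi>)
      \<and> norm (polar (edir V b) m \<phi>) = 1 \<and> norm (polar (edir V c) n \<psi>) = 1"
    using cases
  proof (elim disjE conjE)
    assume "edir V b = u" "m = w" "edir V c = polar u w \<alpha>" "n = polar u w (\<alpha> - pi / 2)"
    moreover have "\<phi> - (\<alpha> - \<psi>) = - (\<alpha> - \<phi> - \<psi>)" by simp
    then have "cos (\<phi> - (\<alpha> - \<psi>)) = cos (\<alpha> - \<phi> - \<psi>)" by (simp only: cos_minus)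
    ultimately show ?thesis using pp polar_inner[OF uw] norm_polar[OF uw] by simp
  next
    assume "edir V c = u" "n = w" "edir V b = polar u w \<alpha>" "m = polar u w (\<alpha> - pi / 2)"
    then show ?thesis using pp polar_inner[OF uw] norm_polar[OF uw] by simp
  qed
  moreover have "cos (\<alpha> - \<phi> - \<psi>) \<le> cos (\<theta>0 / 3)"
    using s(2,3) s'(2,3) admissible_bounds[OF \<alpha>] base_angle \<theta>0 by (intro cos_le_cos_off) linarith+
  ultimately have "(x - V) \<bullet> (z - V) \<le> cos (\<theta>0 / 3) * (norm (x - V) * norm (z - V))"
    unfolding s(4) s'(4) using s(1) s'(1) mult_left_mono[of "cos (\<alpha> - \<phi> - \<psi>)" "cos (\<theta>0 / 3)" "s * s'"]
    by (simp add: mult_ac)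
  then have "sin (\<theta>0 / 3) * norm (x - V) \<le> norm ((x - V) - (z - V))"
    using \<theta>0 by (intro norm_diff_ge_angle) auto
  then show ?thesis by (simp add: dist_norm)
qed

end

text \<open>The infimum formula of McShane on an arbitrary set. It only supplies values along paths
  in the boundary, so differentiability does not matter here.\<close>

lemma lipschitz_extension_real:
  fixes f :: "'a::metric_space \<Rightarrow> real"
  assumes f: "L-lipschitz_on S f"
  obtains g where "L-lipschitz_on UNIV g" "\<And>x. x \<in> S \<Longrightarrow> g x = f x"
proof (cases "S = {}")
  case True
  have "L-lipschitz_on UNIV (\<lambda>_::'a. 0::real)" using f by (auto simp: lipschitz_on_def)
  then show thesis using that True by blast
next
  case False
  have L: "0 \<le> L" using f by (simp add: lipschitz_on_def)
  have fl: "f y - L * dist x y \<le> f x" if "x \<in> S" "y \<in> S" for x y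
    using lipschitz_onD[OF f that] by (simp add: dist_real_def abs_le_iff)
  define g where "g = (\<lambda>x. INF y\<in>S. f y + L * dist x y)"
  have bdd: "bdd_below ((\<lambda>y. f y + L * dist x y) ` S)" for x
  proof -
    obtain y0 where y0: "y0 \<in> S" using False by blast
    show ?thesis
    proof (rule bdd_belowI2)
      fix y assume y: "y \<in> S"
      have "f y0 - L * dist y y0 \<le> f y" by (rule fl[OF y y0])
      moreover have "L * dist y y0 \<le> L * (dist x y + dist x y0)"
        using L dist_triangle3[of y y0 x] by (intro mult_left_mono) auto
      ultimately show "f y0 - L * dist x y0 \<le> f y + L * dist x y" by (simp add: distrib_left)
    qed
  qed
  have le: "g x - L * dist x z \<le> g z" for x z
    unfolding g_def
  proof (rule cINF_greatest[OF False])
    fix y assume y: "y \<in> S"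
    have "(INF y\<in>S. f y + L * dist x y) \<le> f y + L * dist x y" by (rule cINF_lower[OF bdd y])
    moreover have "L * dist x y \<le> L * (dist x z + dist z y)" using L dist_triangle by (intro mult_left_mono) auto
    ultimately show "(INF y\<in>S. f y + L * dist x y) - L * dist x z \<le> f y + L * dist z y" by (simp add: distrib_left)
  qed
  show thesis
  proof (rule that)
    show "L-lipschitz_on UNIV g"
    proof (rule lipschitz_onI)
      show "dist (g x) (g y) \<le> L * dist x y" for x y
        using le[of x y] le[of y x] by (simp add: dist_real_def abs_le_iff dist_commute)
    qed (rule L)
    fix x assume x: "x \<in> S"
    show "g x = f x"
    proof (rule antisym)
      have "g x \<le> f x + L * dist x x" unfolding g_def by (rule cINF_lower[OF bdd x])
      then show "g x \<le> f x" by simp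
      show "f x \<le> g x" unfolding g_def
      proof (rule cINF_greatest[OF False])
        fix y assume "y \<in> S"
        then show "f x \<le> f y + L * dist x y" using fl[of y x] x by (simp add: dist_commute)
      qed
    qed
  qed
qed

section \<open>Lipschitz bounds for the interpolation within a face and across faces\<close>

context poly_setting_finite
begin

text \<open>\<open>6 * K\<close> stems from nonadjacent edges, where values differ by at most
  \<open>2 * M\<close> at distance at least \<open>r0 / (3 * K)\<close>; the other term stems from
  adjacent edges, where both points are compared with the common vertex.\<close>

definition planar_const :: real where "planar_const = 6 * K + 4 / sin (\<theta>0 / 3)"

lemma sin_third_pos: "0 < sin (\<theta>0 / 3)"
  using \<theta>0 by (intro sin_gt_zero) auto

lemma planar_const: "6 * K \<le> planar_const" "4 / sin (\<theta>0 / 3) \<le> planar_const" "0 < planar_const"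
  using sin_third_pos K2 by (simp_all add: planar_const_def add_pos_pos)

lemma edge_interp_bound:
  assumes F: "F \<in> \<F>" and \<sigma>: "closed_segment a b \<in> face_edges \<F> F" and m: "edge_normal F a b m"
    and W: "\<forall>v\<in>vertices \<F>. \<bar>W v\<bar> \<le> M" and x: "x \<in> cap a b m"
  shows "\<bar>edge_interp W a b x\<bar> \<le> M"
proof -
  obtain t h where th: "x = a + t *\<^sub>R edir a b + h *\<^sub>R m" "0 \<le> t" "t \<le> dist a b"
    using x by (rule capE) (rule that)
  have ab: "a \<noteq> b" by (rule edge_sub_frontier(1)[OF F \<sigma>])
  define r where "r = t / dist a b"
  have r: "0 \<le> r" "r \<le> 1" using th ab by (simp_all add: r_def)
  have "edge_interp W a b x = W a + r * (W b - W a)"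
    unfolding th(1) r_def by (rule edge_interp_point[OF ab edge_normalD(2)[OF F \<sigma> m]])
  then have "edge_interp W a b x = (1 - r) * W a + r * W b" by (simp add: algebra_simps)
  then have "\<bar>edge_interp W a b x\<bar> \<le> (1 - r) * \<bar>W a\<bar> + r * \<bar>W b\<bar>"
    using abs_triangle_ineq[of "(1 - r) * W a" "r * W b"] r by (simp add: abs_mult)
  also have "\<dots> \<le> (1 - r) * M + r * M"
    using r W endpoint_is_vertex[OF F \<sigma>] by (intro add_mono mult_left_mono) auto
  finally show ?thesis by (simp add: algebra_simps)
qed

lemma vertex_diff_bound:
  fixes W :: "real^3 \<Rightarrow> real"
  assumes "\<forall>v\<in>vertices \<F>. \<bar>W v\<bar> \<le> M" "v \<in> vertices \<F>" "w \<in> vertices \<F>"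
  shows "\<bar>W v - W w\<bar> \<le> 2 * M"
  using bspec[OF assms(1,2)] bspec[OF assms(1,3)] abs_triangle_ineq4[of "W v" "W w"] by linarith

text \<open>Both values are compared with the one at \<open>V\<close>. The angle bound, used with
  the two points in either order, controls both distances to \<open>V\<close> by the distance of the
  points.\<close>

lemma adjacent_interp:
  assumes F: "F \<in> \<F>"
    and \<sigma>: "closed_segment V b \<in> face_edges \<F> F" and m: "edge_normal F V b m"
    and \<tau>: "closed_segment V c \<in> face_edges \<F> F" and n: "edge_normal F V c n"
    and ne: "closed_segment V b \<noteq> closed_segment V c"
    and W: "\<forall>v\<in>vertices \<F>. \<bar>W v\<bar> \<le> M"
    and x: "x \<in> cap V b m" and z: "z \<in> cap V c n"
  shows "\<bar>edge_interp W V b x - edge_interp W V c z\<bar> \<le> planar_const * M / r0 * dist x z"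
proof -
  note VB = edge_sub_frontier(1,2)[OF F \<sigma>] and VC = edge_sub_frontier(1,2)[OF F \<tau>]
  have M: "0 \<le> M" using bspec[OF W endpoint_is_vertex(1)[OF F \<sigma>]] by linarith
  have bx: "\<bar>edge_interp W V b x - edge_interp W V b V\<bar> \<le> 2 * M / r0 * dist x V"
    using vertex_diff_bound[OF W] endpoint_is_vertex[OF F \<sigma>] r0 VB by (intro edge_interp_lipschitz) auto
  have bz: "\<bar>edge_interp W V c z - edge_interp W V c V\<bar> \<le> 2 * M / r0 * dist z V"
    using vertex_diff_bound[OF W] endpoint_is_vertex[OF F \<tau>] r0 VC by (intro edge_interp_lipschitz) auto
  have "sin (\<theta>0 / 3) * dist x V \<le> dist x z" by (rule adjacent_caps[OF F \<sigma> m \<tau> n ne x z])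
  moreover have "sin (\<theta>0 / 3) * dist z V \<le> dist x z"
    using adjacent_caps[OF F \<tau> n \<sigma> m ne[symmetric] z x] by (simp add: dist_commute)
  ultimately have d: "dist x V + dist z V \<le> 2 / sin (\<theta>0 / 3) * dist x z"
    using sin_third_pos by (simp add: field_simps)
  have "\<bar>edge_interp W V b x - edge_interp W V c z\<bar> \<le> 2 * M / r0 * dist x V + 2 * M / r0 * dist z V"
    using bx bz edge_interp_ends(1)[OF VB(1)] edge_interp_ends(1)[OF VC(1)] by (auto simp: abs_le_iff)
  also have "\<dots> = 2 * M / r0 * (dist x V + dist z V)" by (simp only: distrib_left)
  also have "\<dots> \<le> 2 * M / r0 * (2 / sin (\<theta>0 / 3) * dist x z)" using d M r0 by (intro mult_left_mono) auto
  also have "\<dots> = 4 / sin (\<theta>0 / 3) * (M / r0 * dist x z)" by simp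
  also have "\<dots> \<le> planar_const * (M / r0 * dist x z)" using planar_const M r0 by (intro mult_right_mono) auto
  finally show ?thesis by simp
qed

lemma face_interp_lipschitz:
  assumes F: "F \<in> \<F>"
    and \<sigma>: "closed_segment a b \<in> face_edges \<F> F" and m: "edge_normal F a b m"
    and \<tau>: "closed_segment c d \<in> face_edges \<F> F" and n: "edge_normal F c d n"
    and W: "\<forall>v\<in>vertices \<F>. \<bar>W v\<bar> \<le> M"
    and x: "x \<in> cap a b m" and z: "z \<in> cap c d n"
  shows "\<bar>edge_interp W a b x - edge_interp W c d z\<bar> \<le> planar_const * M / r0 * dist x z"
proof -
  note AB = edge_sub_frontier(1,2)[OF F \<sigma>] and CD = edge_sub_frontier(1,2)[OF F \<tau>]
  have M: "0 \<le> M" using bspec[OF W endpoint_is_vertex(1)[OF F \<sigma>]] by linarith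
  have \<sigma>': "closed_segment b a \<in> face_edges \<F> F" using \<sigma> by (simp add: closed_segment_commute)
  have \<tau>': "closed_segment d c \<in> face_edges \<F> F" using \<tau> by (simp add: closed_segment_commute)
  have m': "edge_normal F b a m" by (rule edge_normal_commute[OF AB(1) m])
  have n': "edge_normal F d c n" by (rule edge_normal_commute[OF CD(1) n])
  have x': "x \<in> cap b a m" using x cap_commute[OF AB(1)] by simp
  have z': "z \<in> cap d c n" using z cap_commute[OF CD(1)] by simp
  have ci: "edge_interp W b a = edge_interp W a b" "edge_interp W d c = edge_interp W c d"
    using edge_interp_commute[OF AB(1)] edge_interp_commute[OF CD(1)] by simp_all
  show ?thesis
  proof (cases "closed_segment a b = closed_segment c d")
    case True
    then have "{a, b} = {c, d}" by (simp add: closed_segment_eq)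
    then have eq: "edge_interp W c d = edge_interp W a b" using ci by (auto simp: doubleton_eq_iff)
    have "\<bar>edge_interp W a b x - edge_interp W a b z\<bar> \<le> 2 * M / r0 * dist x z"
      using vertex_diff_bound[OF W] endpoint_is_vertex[OF F \<sigma>] r0 AB by (intro edge_interp_lipschitz) auto
    also have "\<dots> \<le> planar_const * M / r0 * dist x z"
      using planar_const K2 M r0 by (intro mult_right_mono divide_right_mono) auto
    finally show ?thesis by (simp only: eq)
  next
    case ne: False
    show ?thesis
    proof (cases "{a, b} \<inter> {c, d} = {}")
      case True
      have "r0 / (3 * K) \<le> dist x z" by (rule nonadjacent_caps[OF F \<sigma> m \<tau> n True x z])
      then have "6 * K * M / r0 * (r0 / (3 * K)) \<le> 6 * K * M / r0 * dist x z"
        using M K2 r0 by (intro mult_left_mono) auto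
      then have "2 * M \<le> 6 * K * M / r0 * dist x z" using K2 r0 by (simp add: field_simps)
      also have "\<dots> \<le> planar_const * M / r0 * dist x z"
        using planar_const M r0 by (intro mult_right_mono divide_right_mono) auto
      finally show ?thesis
        using edge_interp_bound[OF F \<sigma> m W x] edge_interp_bound[OF F \<tau> n W z] by linarith
    next
      case False
      then consider "a = c" | "a = d" | "b = c" | "b = d" by blast
      then show ?thesis
      proof cases
        case 1 then show ?thesis using adjacent_interp[OF F \<sigma> m _ _ _ W x, of d n] \<tau> n z ne by simp
      next
        case 2 then show ?thesis using adjacent_interp[OF F \<sigma> m _ _ _ W x, of c n] \<tau>' n' z' ne ci
          by (simp add: closed_segment_commute)
      next
        case 3 then show ?thesis using adjacent_interp[OF F \<sigma>' m' _ _ _ W x', of d n] \<tau> n z ne ci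
          by (simp add: closed_segment_commute)
      next
        case 4 then show ?thesis using adjacent_interp[OF F \<sigma>' m' _ _ _ W x', of c n] \<tau>' n' z' ne ci
          by (simp add: closed_segment_commute)
      qed
    qed
  qed
qed

text \<open>A path between two faces may cross a face outside its caps, so the interpolation is
  extended beyond them with the same constant. That overlapping caps give one value is the Lipschitz
  estimate at distance 0.\<close>

lemma face_extension:
  assumes F: "F \<in> \<F>" and W: "\<forall>v\<in>vertices \<F>. \<bar>W v\<bar> \<le> M" and M: "0 \<le> M"
  shows "\<exists>u. (planar_const * M / r0)-lipschitz_on UNIV u \<and>
    (\<forall>a b m x. closed_segment a b \<in> face_edges \<F> F \<and> edge_normal F a b m \<and> x \<in> cap a b m \<longrightarrow> u x = edge_interp W a b x)"
proof -
  define S where "S = {x. \<exists>a b m. closed_segment a b \<in> face_edges \<F> F \<and> edge_normal F a b m \<and> x \<in> cap a b m}"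
  define f where "f = (\<lambda>x. SOME r. \<exists>a b m. closed_segment a b \<in> face_edges \<F> F \<and> edge_normal F a b m \<and> x \<in> cap a b m \<and> r = edge_interp W a b x)"
  have f: "f x = edge_interp W a b x" if x: "closed_segment a b \<in> face_edges \<F> F" "edge_normal F a b m" "x \<in> cap a b m" for a b m x
    unfolding f_def
  proof (rule some_equality)
    show "\<exists>a' b' m. closed_segment a' b' \<in> face_edges \<F> F \<and> edge_normal F a' b' m \<and> x \<in> cap a' b' m \<and> edge_interp W a b x = edge_interp W a' b' x"
      using x by blast
    fix r assume "\<exists>a b m. closed_segment a b \<in> face_edges \<F> F \<and> edge_normal F a b m \<and> x \<in> cap a b m \<and> r = edge_interp W a b x"
    then obtain a' b' m' where x': "closed_segment a' b' \<in> face_edges \<F> F" "edge_normal F a' b' m'" "x \<in> cap a' b' m'"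
      "r = edge_interp W a' b' x" by blast
    show "r = edge_interp W a b x"
      using face_interp_lipschitz[OF F x'(1,2) x(1,2) W x'(3) x(3)] x'(4) by simp
  qed
  have "(planar_const * M / r0)-lipschitz_on S f"
  proof (rule lipschitz_onI)
    fix x z assume "x \<in> S" "z \<in> S"
    then obtain a b m c d n where xz: "closed_segment a b \<in> face_edges \<F> F" "edge_normal F a b m" "x \<in> cap a b m"
      "closed_segment c d \<in> face_edges \<F> F" "edge_normal F c d n" "z \<in> cap c d n" unfolding S_def by blast
    show "dist (f x) (f z) \<le> planar_const * M / r0 * dist x z"
      using face_interp_lipschitz[OF F xz(1,2,4,5) W xz(3,6)] f[OF xz(1-3)] f[OF xz(4-6)] by (simp add: dist_real_def)
  qed (use planar_const M r0 in simp)
  then obtain u where "(planar_const * M / r0)-lipschitz_on UNIV u" "\<And>x. x \<in> S \<Longrightarrow> u x = f x"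
    by (rule lipschitz_extension_real) blast
  moreover have "x \<in> S" if "closed_segment a b \<in> face_edges \<F> F \<and> edge_normal F a b m \<and> x \<in> cap a b m" for a b m x
    using that unfolding S_def by blast
  ultimately have "u x = edge_interp W a b x"
    if "closed_segment a b \<in> face_edges \<F> F \<and> edge_normal F a b m \<and> x \<in> cap a b m" for a b m x
    using f[of a b m x] that by simp
  then show ?thesis using \<open>(planar_const * M / r0)-lipschitz_on UNIV u\<close> by blast
qed

text \<open>The extensions of different faces agree where the faces meet, because such points lie on
  edges and there the value is the interpolation. Glued together they are Lipschitz along a path in
  the boundary, at the cost of the factor \<open>K\<close>. Points at least \<open>r0 / K\<close>
  apart are covered by the bound \<open>M\<close>.\<close>

lemma frontier_interp_lipschitz:
  assumes F: "F \<in> \<F>" and \<sigma>: "closed_segment a b \<in> face_edges \<F> F" and m: "edge_normal F a b m"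
    and G: "G \<in> \<F>" and \<tau>: "closed_segment c d \<in> face_edges \<F> G" and n: "edge_normal G c d n"
    and W: "\<forall>v\<in>vertices \<F>. \<bar>W v\<bar> \<le> M"
    and x: "x \<in> cap a b m" and z: "z \<in> cap c d n"
  shows "\<bar>edge_interp W a b x - edge_interp W c d z\<bar> \<le> K * planar_const * M / r0 * dist x z"
proof (cases "dist x z < r0 / K")
  case True
  have M: "0 \<le> M" using bspec[OF W endpoint_is_vertex(1)[OF F \<sigma>]] by linarith
  define L where "L = planar_const * M / r0"
  have L: "0 \<le> L" using planar_const M r0 by (simp add: L_def)
  have xF: "x \<in> F" using cap_subset_face[OF F \<sigma> m] x by blast
  have zG: "z \<in> G" using cap_subset_face[OF G \<tau> n] z by blast
  obtain \<gamma> where \<gamma>: "(K * dist x z)-lipschitz_on {0..1::real} \<gamma>" "\<gamma> ` {0..1} \<subseteq> frontier D" "\<gamma> 0 = x" "\<gamma> 1 = z"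
    using frontier_path[OF _ _ True] xF zG face_subset(1)[OF F] face_subset(1)[OF G] by blast
  have "\<forall>H\<in>\<F>. \<exists>u. L-lipschitz_on UNIV u \<and>
    (\<forall>a b m x. closed_segment a b \<in> face_edges \<F> H \<and> edge_normal H a b m \<and> x \<in> cap a b m \<longrightarrow> u x = edge_interp W a b x)"
    using face_extension[OF _ W M] unfolding L_def by blast
  then obtain u where u: "\<And>H. H \<in> \<F> \<Longrightarrow> L-lipschitz_on UNIV (u H)"
    "\<And>H a b m x. H \<in> \<F> \<Longrightarrow> closed_segment a b \<in> face_edges \<F> H \<Longrightarrow> edge_normal H a b m \<Longrightarrow> x \<in> cap a b m \<Longrightarrow> u H x = edge_interp W a b x"
    by (metis (no_types, lifting))
  have edge_value: "\<exists>a b. closed_segment a b \<in> face_edges \<F> H \<and> y \<in> closed_segment a b \<and> u H y = edge_interp W a b y"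
    if H: "H \<in> \<F>" "y \<in> rel_frontier H" for H y
  proof -
    obtain \<rho> where \<rho>: "\<rho> \<in> face_edges \<F> H" "y \<in> \<rho>" using rel_frontier_edge[OF H] .
    obtain p q where pq: "p \<noteq> q" "\<rho> = closed_segment p q" by (rule face_edgeE[OF H(1) \<rho>(1)]) (rule that)
    obtain k where k: "edge_normal H p q k" using edge_normal_exists[OF H(1)] \<rho>(1) pq(2) by blast
    have "y \<in> cap p q k" using segment_subset_cap[OF pq(1)] \<rho>(2) pq(2) by blast
    then show ?thesis using u(2)[OF H(1) _ k] \<rho> pq(2) by blast
  qed
  have agree: "u H y = u H' y" if H: "H \<in> \<F>" "H' \<in> \<F>" "y \<in> H" "y \<in> H'" for H H' y
  proof (cases "H = H'")
    case False
    have "y \<in> rel_frontier H" "y \<in> rel_frontier H'" using face_Int_subset[OF H(1,2) False] H by auto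
    then show ?thesis using edge_value[OF H(1)] edge_value[OF H(2)] edge_interp_agree[OF H(1) _ H(2)] by metis
  qed simp
  define val where "val = (\<lambda>y. u (SOME H. H \<in> \<F> \<and> y \<in> H) y)"
  have val: "val y = u H y" if H: "H \<in> \<F>" "y \<in> H" for H y
    unfolding val_def using someI[of "\<lambda>H. H \<in> \<F> \<and> y \<in> H" H] H by (intro agree) auto
  have \<gamma>c: "continuous_on {0..1} \<gamma>" using \<gamma>(1) by (rule lipschitz_on_continuous_on)
  have "(L * (K * dist x z))-lipschitz_on {0..1} (\<lambda>t. val (\<gamma> t))"
  proof (rule lipschitz_on_closed_Union[where I = \<F> and U = "\<lambda>H. {t \<in> {0..1}. \<gamma> t \<in> H}"])
    show "finite \<F>" by (rule poly(3))
    show "0 \<le> L * (K * dist x z)" using L K2 by simp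
    show "{0..1} \<subseteq> (\<Union>H\<in>\<F>. {t \<in> {0..1}. \<gamma> t \<in> H})" 
    proof
      fix t :: real assume t: "t \<in> {0..1}"
      then have "\<gamma> t \<in> \<Union>\<F>" using \<gamma>(2) poly(4) by blast
      then show "t \<in> (\<Union>H\<in>\<F>. {t \<in> {0..1}. \<gamma> t \<in> H})" using t by blast
    qed
    fix H assume H: "H \<in> \<F>"
    show "closed {t \<in> {0..1}. \<gamma> t \<in> H}"
      using continuous_closed_preimage[OF \<gamma>c _ face_closed[OF H]] by (simp add: vimage_def Int_def conj_commute)
    show "(L * (K * dist x z))-lipschitz_on {t \<in> {0..1}. \<gamma> t \<in> H} (\<lambda>t. val (\<gamma> t))"
    proof (rule lipschitz_onI)
      fix s t assume st: "s \<in> {t \<in> {0..1}. \<gamma> t \<in> H}" "t \<in> {t \<in> {0..1}. \<gamma> t \<in> H}"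
      have "dist (val (\<gamma> s)) (val (\<gamma> t)) = dist (u H (\<gamma> s)) (u H (\<gamma> t))" using val[OF H] st by simp
      also have "\<dots> \<le> L * dist (\<gamma> s) (\<gamma> t)" by (rule lipschitz_onD[OF u(1)[OF H]]) auto
      also have "\<dots> \<le> L * (K * dist x z * dist s t)" using lipschitz_onD[OF \<gamma>(1)] st L by (intro mult_left_mono) auto
      finally show "dist (val (\<gamma> s)) (val (\<gamma> t)) \<le> L * (K * dist x z) * dist s t" by (simp add: mult_ac)
    qed (use L K2 in simp)
  qed
  from lipschitz_onD[OF this, of 0 1] have "\<bar>val x - val z\<bar> \<le> L * (K * dist x z)"
    using \<gamma>(3,4) by (simp add: dist_real_def)
  moreover have "val x = edge_interp W a b x" using val[OF F xF] u(2)[OF F \<sigma> m x] by simp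
  moreover have "val z = edge_interp W c d z" using val[OF G zG] u(2)[OF G \<tau> n z] by simp
  ultimately show ?thesis by (simp add: L_def mult_ac)
next
  case False
  have M: "0 \<le> M" using bspec[OF W endpoint_is_vertex(1)[OF F \<sigma>]] by linarith
  have "2 * M = 2 * K * M / r0 * (r0 / K)" using K2 r0 by simp
  also have "\<dots> \<le> 2 * K * M / r0 * dist x z" using False M K2 r0 by (intro mult_left_mono) auto
  also have "\<dots> \<le> K * planar_const * M / r0 * dist x z"
    using planar_const K2 M r0 by (intro mult_right_mono divide_right_mono) auto
  finally show ?thesis
    using edge_interp_bound[OF F \<sigma> m W x] edge_interp_bound[OF G \<tau> n W z] by linarith
qed

end

subsection \<open>Conical structure at a vertex\<close>

context poly_setting
begin

text \<open>The edge is at least \<open>r0\<close> long and the first component of its direction is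
  at least \<open>1 / K\<close> in absolute value, so the edge covers the range
  \<open>\<bar>a\<bar> < r0 / K\<close> on its side; there \<open>g\<close> is linear.\<close>

lemma edge_chart_value:
  assumes F: "F \<in> \<F>" and ch: "face_chart F r0 M0 V E1 E2 g" and \<sigma>: "closed_segment V b \<in> face_edges \<F> F"
    and a: "\<bar>a\<bar> < r0 / K" "0 \<le> a * (edir V b \<bullet> E1)" and ne: "edir V b \<bullet> E1 \<noteq> 0"
  shows "g a = a * ((edir V b \<bullet> E2) / (edir V b \<bullet> E1))"
proof -
  note es = edge_sub_frontier[OF F \<sigma>]
  note co = chart_coords[OF ch]
  define e where "e = edir V b"
  have e1: "norm e = 1" using edir(1)[OF es(1)] by (simp add: e_def)
  have sl: "\<bar>e \<bullet> E2\<bar> \<le> M0 * \<bar>e \<bullet> E1\<bar>" "e = (e \<bullet> E1) *\<^sub>R E1 + (e \<bullet> E2) *\<^sub>R E2"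
    using chart_slope[OF F ch, of V "dist V b" e] es r0 M0 by (auto simp: e_def)
  have "norm e \<le> \<bar>e \<bullet> E1\<bar> + \<bar>e \<bullet> E2\<bar>"
  proof -
    have "norm ((e \<bullet> E1) *\<^sub>R E1 + (e \<bullet> E2) *\<^sub>R E2) \<le> \<bar>e \<bullet> E1\<bar> + \<bar>e \<bullet> E2\<bar>"
      using norm_triangle_ineq[of "(e \<bullet> E1) *\<^sub>R E1" "(e \<bullet> E2) *\<^sub>R E2"] ch
      by (simp add: face_chart_def orthonormal_pair_def)
    then show ?thesis using sl(2) by simp
  qed
  also have "\<dots> \<le> (1 + M0) * \<bar>e \<bullet> E1\<bar>" using sl(1) by (simp add: distrib_right)
  also have "\<dots> \<le> K * \<bar>e \<bullet> E1\<bar>" using K by (intro mult_right_mono) auto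
  finally have eK: "1 \<le> K * \<bar>e \<bullet> E1\<bar>" using e1 by simp
  define s where "s = a / (e \<bullet> E1)"
  have ne': "e \<bullet> E1 \<noteq> 0" using ne by (simp add: e_def)
  have s0: "0 \<le> s" using a(2) ne' by (simp add: s_def e_def zero_le_divide_iff zero_le_mult_iff)
  have "s = \<bar>a\<bar> / \<bar>e \<bullet> E1\<bar>" unfolding abs_divide[symmetric] s_def[symmetric] using s0 by simp
  also have "\<dots> \<le> \<bar>a\<bar> * K"
    using mult_left_mono[OF eK, of "\<bar>a\<bar>"] ne' by (simp add: divide_le_eq mult_ac)
  also have "\<dots> < r0" using a(1) K2 by (simp add: less_divide_eq)
  finally have sr: "s < r0" .
  have sE: "s * (e \<bullet> E1) = a" using ne' by (simp add: s_def)
  have "V + s *\<^sub>R e \<in> rel_frontier F" using es(2,4) s0 sr by (simp add: e_def)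
  moreover have "(V + s *\<^sub>R e - V) \<bullet> E1 = a" "(V + s *\<^sub>R e - V) \<bullet> E2 = s * (e \<bullet> E2)" using sE by simp_all
  moreover have "\<bar>s * (e \<bullet> E2)\<bar> \<le> s * 1" "\<bar>s * (e \<bullet> E1)\<bar> \<le> s * 1"
    unfolding abs_mult using s0 co(4,5)[of e] e1 by (simp_all add: mult_left_le)
  moreover have "r0 \<le> 2 * M0 * r0" using M0 r0 by simp
  ultimately have "g a = s * (e \<bullet> E2)"
    using chart_frontier(1)[OF F ch, of "V + s *\<^sub>R e"] sr sE by simp
  then show ?thesis by (simp add: s_def e_def)
qed

text \<open>Two edges leave \<open>V\<close> on opposite sides of the chart, so near 0 the profile
  \<open>g\<close> is linear on each side, hence positively homogeneous, and its epigraph is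
  conical.\<close>

lemma face_cone:
  assumes F: "F \<in> \<F>" and V: "V \<in> vertices \<F>" "V \<in> F" and x: "x \<in> F" "norm (x - V) < r0 / K"
    and t: "0 \<le> t" "norm (t *\<^sub>R (x - V)) < r0 / K"
  shows "V + t *\<^sub>R (x - V) \<in> F"
proof -
  obtain b where \<sigma>: "closed_segment V b \<in> face_edges \<F> F" using vertex_is_endpoint[OF F V] .
  have "V \<in> rel_frontier F" using edge_sub_frontier(4)[OF F \<sigma>, of 0] by simp
  then obtain E1 E2 g where ch: "face_chart F r0 M0 V E1 E2 g" using face_chart_exists[OF F] by blast
  note co = chart_coords[OF ch]
  obtain c where \<tau>: "closed_segment V c \<in> face_edges \<F> F" and ne: "edir V b \<bullet> E1 \<noteq> 0"
    and opp: "(edir V c \<bullet> E1) * (edir V b \<bullet> E1) < 0"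
    by (rule edge_opposite_side[OF F \<sigma> ch]) (rule that)
  have inF: "\<And>a b. \<bar>a\<bar> < r0 \<Longrightarrow> \<bar>b\<bar> < 2 * M0 * r0 \<Longrightarrow> V + a *\<^sub>R E1 + b *\<^sub>R E2 \<in> F \<longleftrightarrow> g a \<le> b"
    using ch unfolding face_chart_def by blast
  have hom: "g (t * a) = t * g a" if a: "\<bar>a\<bar> < r0 / K" "\<bar>t * a\<bar> < r0 / K" for a
  proof (cases "0 \<le> a * (edir V b \<bullet> E1)")
    case True
    then have "0 \<le> t * a * (edir V b \<bullet> E1)" using t(1) by (simp add: mult.assoc)
    then show ?thesis using edge_chart_value[OF F ch \<sigma> a(1) True ne] edge_chart_value[OF F ch \<sigma> a(2) _ ne] by simp
  next
    case False
    have ne': "edir V c \<bullet> E1 \<noteq> 0" using opp by auto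
    have ac: "0 \<le> a * (edir V c \<bullet> E1)"
      using False opp by (auto simp: zero_le_mult_iff mult_less_0_iff not_le)
    then have "0 \<le> t * a * (edir V c \<bullet> E1)" using t(1) by (simp add: mult.assoc)
    then show ?thesis using edge_chart_value[OF F ch \<tau> a(1) ac ne'] edge_chart_value[OF F ch \<tau> a(2) _ ne'] by simp
  qed
  define a where "a = (x - V) \<bullet> E1"
  define b where "b = (x - V) \<bullet> E2"
  have "x \<in> affine hull F" using x(1) hull_subset[of F affine] by blast
  then have xv: "x = V + a *\<^sub>R E1 + b *\<^sub>R E2" unfolding a_def b_def by (rule co(1))
  have rK: "r0 / K \<le> r0" "r0 \<le> 2 * M0 * r0" using r0 K2 M0 by (simp_all add: field_simps)
  have ab: "\<bar>a\<bar> < r0 / K" "\<bar>b\<bar> < r0 / K" using co(4,5)[of "x - V"] x(2) by (simp_all add: a_def b_def)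
  have tab: "\<bar>t * a\<bar> < r0 / K" "\<bar>t * b\<bar> < r0 / K"
    using co(4,5)[of "t *\<^sub>R (x - V)"] t(2) by (simp_all add: a_def b_def)
  have "g a \<le> b" using inF[of a b] x(1) xv ab rK by simp
  then have "g (t * a) \<le> t * b" using hom[OF ab(1) tab(1)] t(1) by (simp add: mult_left_mono)
  then have "V + (t * a) *\<^sub>R E1 + (t * b) *\<^sub>R E2 \<in> F" using inF[of "t * a" "t * b"] tab rK by simp
  moreover have "V + t *\<^sub>R (x - V) = V + (t * a) *\<^sub>R E1 + (t * b) *\<^sub>R E2"
    by (subst xv) (simp add: algebra_simps)
  ultimately show ?thesis by (simp only:)
qed

lemma vertex_in_frontier:
  assumes "V \<in> vertices \<F>"
  obtains F where "F \<in> \<F>" "V \<in> F"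
proof -
  obtain \<sigma> \<tau> where \<sigma>: "\<sigma> \<in> edges \<F>" "\<sigma> \<inter> \<tau> = {V}" using assms unfolding vertices_def by blast
  then obtain F where F: "F \<in> \<F>" "\<sigma> \<in> face_edges \<F> F" by (auto simp: edges_def)
  have "V \<in> F" using \<sigma>(2) F(2) unfolding face_edges_def by blast
  then show thesis using that F(1) by blast
qed

text \<open>Near a vertex the boundary is a cone: tiny cones lie in the faces through the vertex, these are
  themselves conical, and a graph has only one point over each base point.\<close>

lemma frontier_cone:
  assumes V: "V \<in> vertices \<F>" and x: "x \<in> frontier D" "K * (K * dist x V) < r0" and s: "0 \<le> s" "s \<le> 1"
  shows "V + s *\<^sub>R (x - V) \<in> frontier D"
proof -
  obtain F0 where F0: "F0 \<in> \<F>" "V \<in> F0" using vertex_in_frontier[OF V] .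
  have VD: "V \<in> frontier D" using F0 face_subset(1) by blast
  obtain \<nu> where \<nu>: "graph_direction (frontier D) r0 (r0 / K) M0 V \<nu>" using graph_direction_exists[OF VD] .
  then have n1: "norm \<nu> = 1"
    and lift: "\<And>h. h \<bullet> \<nu> = 0 \<Longrightarrow> norm h < r0 / K \<Longrightarrow> \<exists>c. \<bar>c\<bar> \<le> M0 * norm h \<and> V + h + c *\<^sub>R \<nu> \<in> frontier D"
    unfolding graph_direction_def by auto
  have \<nu>\<nu>: "\<nu> \<bullet> \<nu> = 1" using n1 by (simp add: dot_square_norm)
  \<comment> \<open>Yields a radius \<epsilon> that excludes the faces not containing
    \<open>V\<close>. It is not controlled by \<open>r0\<close> and \<open>K\<close>, so it must not
    enter the radius of the cone and is used for a shrunken copy only.\<close>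
  have "closed (\<Union>{F \<in> \<F>. V \<notin> F})" using poly(3) face_closed by (intro closed_Union) auto
  then have "open (- \<Union>{F \<in> \<F>. V \<notin> F})" by (simp add: open_Compl)
  moreover have "V \<in> - \<Union>{F \<in> \<F>. V \<notin> F}" by auto
  ultimately obtain \<epsilon> where \<epsilon>: "\<epsilon> > 0" "ball V \<epsilon> \<subseteq> - \<Union>{F \<in> \<F>. V \<notin> F}" using open_contains_ball by blast
  define y where "y = x - V"
  define h where "h = y - (y \<bullet> \<nu>) *\<^sub>R \<nu>"
  have h\<nu>: "h \<bullet> \<nu> = 0" using \<nu>\<nu> by (simp add: h_def inner_simps)
  have hy: "norm h \<le> norm y" unfolding h_def by (rule norm_orthogonal_part_le(1)[OF n1])
  have KKy: "K * (K * norm y) < r0" using x(2) by (simp add: y_def dist_norm)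
  then have Ky: "K * norm y < r0 / K" using K2 by (simp add: less_divide_eq mult.commute)
  have KKh: "K * norm h < r0 / K" using Ky mult_left_mono[OF hy, of K] K2 by linarith
  have "1 * norm y \<le> K * norm y" using K2 by (intro mult_right_mono) auto
  then have yK: "norm y < r0 / K" using Ky by simp
  have rK: "r0 / K \<le> r0" using r0 K2 by (simp add: field_simps)
  \<comment> \<open>The base point of \<open>x\<close> is shrunk by \<open>t\<close> until its lift
    lies in the \<epsilon>-ball, hence in a face through \<open>V\<close>. That face is conical up
    to \<open>r0 / K\<close>, so the lift can be enlarged again by \<open>1 / t\<close>; it then
    lies over the base point of \<open>x\<close> and coincides with \<open>x\<close>.\<close>
  define t where "t = min 1 (\<epsilon> / (2 * (K * norm h + 1)))"
  have Kh0: "0 \<le> K * norm h" using K2 by simp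
  have t: "0 < t" "t \<le> 1" using \<epsilon> Kh0 by (auto simp: t_def)
  have tK: "t * (K * norm h) < \<epsilon>"
  proof -
    have "t * (K * norm h) \<le> \<epsilon> / (2 * (K * norm h + 1)) * (K * norm h)" using Kh0 by (intro mult_right_mono) (auto simp: t_def)
    also have "\<dots> = \<epsilon> * (K * norm h / (2 * (K * norm h + 1)))" by simp
    also have "\<dots> < \<epsilon> * 1" using \<epsilon> Kh0 by (intro mult_strict_left_mono) (auto simp: divide_less_eq)
    finally show ?thesis by simp
  qed
  have th: "norm (t *\<^sub>R h) \<le> norm h" using t mult_right_mono[of t 1 "norm h"] by simp
  have "1 * norm h \<le> K * norm h" using K2 by (intro mult_right_mono) auto
  then have "norm (t *\<^sub>R h) < r0 / K" using th KKh by linarith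
  then obtain c where c: "\<bar>c\<bar> \<le> M0 * norm (t *\<^sub>R h)" "V + t *\<^sub>R h + c *\<^sub>R \<nu> \<in> frontier D"
    using lift[of "t *\<^sub>R h"] h\<nu> by auto
  define w where "w = t *\<^sub>R h + c *\<^sub>R \<nu>"
  have "norm w \<le> norm (t *\<^sub>R h) + \<bar>c\<bar>" unfolding w_def using norm_triangle_ineq[of "t *\<^sub>R h" "c *\<^sub>R \<nu>"] n1 by simp
  also have "\<dots> \<le> (1 + M0) * norm (t *\<^sub>R h)" using c(1) by (simp add: distrib_right)
  also have "\<dots> \<le> K * norm (t *\<^sub>R h)" using K by (intro mult_right_mono) auto
  finally have wn: "norm w \<le> t * (K * norm h)" using t by (simp add: mult_ac)
  have wD: "V + w \<in> frontier D" using c(2) by (simp add: w_def add.assoc)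
  have "V + w \<in> ball V \<epsilon>" using wn tK by (simp add: dist_norm)
  then obtain F where F: "F \<in> \<F>" "V \<in> F" "V + w \<in> F" using wD \<epsilon>(2) poly(4) by blast
  have wK: "norm w < r0 / K" using wn KKh t Kh0 mult_right_mono[of t 1 "K * norm h"] by linarith
  have "norm ((1 / t) *\<^sub>R w) \<le> K * norm h" using wn t by (simp add: divide_le_eq mult.commute)
  then have wtK: "norm ((1 / t) *\<^sub>R w) < r0 / K" using KKh by linarith
  have Vw: "V + (1 / t) *\<^sub>R w \<in> F"
    using face_cone[OF F(1) V F(2,3), of "1 / t"] wK wtK t by simp
  have "V + (1 / t) *\<^sub>R w = x"
  proof (rule graph_direction_unique(2)[OF \<nu>])
    show "V + (1 / t) *\<^sub>R w \<in> frontier D" using Vw face_subset(1)[OF F(1)] by blast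
    show "dist V (V + (1 / t) *\<^sub>R w) < r0" using wtK rK by (simp add: dist_norm)
    show "x \<in> frontier D" by (rule x(1))
    show "dist V x < r0" using yK rK by (simp add: y_def dist_norm norm_minus_commute)
    show "V + (1 / t) *\<^sub>R w - x = (c / t - y \<bullet> \<nu>) *\<^sub>R \<nu>"
      using t by (simp add: w_def h_def y_def scaleR_add_right algebra_simps)
  qed
  then have xF: "x \<in> F" using Vw by simp
  have "norm (s *\<^sub>R y) \<le> norm y" using s mult_right_mono[of s 1 "norm y"] by simp
  then have "V + s *\<^sub>R (x - V) \<in> F" using face_cone[OF F(1) V F(2) xF _ s(1)] yK by (simp add: y_def)
  then show ?thesis using face_subset(1)[OF F(1)] by blast
qed

text \<open>\<open>S\<close> stands for the boundary of the other polyhedron: closeness from both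
  sides, and halving towards \<open>V'\<close> within the radius of
  \<open>frontier_cone\<close>.\<close>

definition near_cone :: "(real^3) set \<Rightarrow> real^3 \<Rightarrow> real \<Rightarrow> bool" where
  "near_cone S V' d \<longleftrightarrow> (\<forall>x\<in>frontier D. \<exists>y\<in>S. dist x y \<le> d) \<and> (\<forall>y\<in>S. \<exists>x\<in>frontier D. dist x y \<le> d) \<and>
     (\<forall>y\<in>S. K * (K * dist y V') < r0 \<longrightarrow> V' + (1/2) *\<^sub>R (y - V') \<in> S)"

text \<open>The midpoint of the moved vertex \<open>V'\<close> and a point of the moved boundary lies on the moved
  boundary, hence close to the plane of the face; so does \<open>V'\<close>.\<close>

lemma vertex_plane_bound:
  assumes F: "F \<in> \<F>" and \<sigma>: "closed_segment V b \<in> face_edges \<F> F" and m: "edge_normal F V b m"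
    and near: "near_cone S V' d"
    and small: "192 * K ^ 4 * d \<le> r0" "192 * K ^ 4 * dist V V' \<le> r0" and d0: "0 \<le> d"
    and N: "norm N = 1" "N \<bullet> edir V b = 0" "N \<bullet> m = 0"
  shows "\<bar>N \<bullet> (V' - V)\<bar> \<le> 3 * d"
proof -
  have S1: "\<And>x. x \<in> frontier D \<Longrightarrow> \<exists>y\<in>S. dist x y \<le> d"
    and S2: "\<And>y. y \<in> S \<Longrightarrow> \<exists>x\<in>frontier D. dist x y \<le> d"
    and S3: "\<And>y. y \<in> S \<Longrightarrow> K * (K * dist y V') < r0 \<Longrightarrow> V' + (1/2) *\<^sub>R (y - V') \<in> S"
    using near unfolding near_cone_def by blast+
  note es = edge_sub_frontier[OF F \<sigma>]
  note ed = edge_normalD[OF F \<sigma> m]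
  define e where "e = edir V b"
  have e1: "norm e = 1" using edir(1)[OF es(1)] by (simp add: e_def)
  have em: "e \<bullet> m = 0" using ed(2) by (simp add: e_def inner_commute)
  \<comment> \<open>\<eta> is the distance from \<open>V\<close> along the edge, small enough for
    points within \<open>6 * \<eta>\<close> to be in conical range. \<zeta> is the height above the
    edge and also the radius of a disc about \<open>y\<close> contained in \<open>F\<close>, for
    which \<open>\<zeta> + M0 * (2 * \<zeta>) \<le> \<eta>\<close> suffices.\<close>
  define \<eta> where "\<eta> = r0 / (8 * K\<^sup>2)"
  define \<zeta> where "\<zeta> = \<eta> / (3 * K)"
  have Ksq: "K\<^sup>2 \<ge> 4" using K2 power_mono[of 2 K 2] by simp
  have \<eta>: "0 < \<eta>" "\<eta> \<le> r0 / 32" "8 * K\<^sup>2 * \<eta> = r0"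
  proof -
    show "0 < \<eta>" "8 * K\<^sup>2 * \<eta> = r0" using r0 K2 by (simp_all add: \<eta>_def)
    have "r0 / (8 * K\<^sup>2) \<le> r0 / (8 * 4)" using r0 Ksq by (intro divide_left_mono) auto
    then show "\<eta> \<le> r0 / 32" by (simp add: \<eta>_def)
  qed
  have \<zeta>: "0 < \<zeta>" "3 * K * \<zeta> = \<eta>" using \<eta> K2 by (simp_all add: \<zeta>_def)
  have "1 * \<zeta> \<le> K * \<zeta>" using K2 \<zeta> by (intro mult_right_mono) auto
  then have \<zeta>\<eta>: "3 * \<zeta> \<le> \<eta>" using \<zeta>(2) by simp
  have M\<zeta>: "\<zeta> + M0 * (2 * \<zeta>) \<le> \<eta>"
  proof -
    have "(1 + 2 * M0) * \<zeta> \<le> (3 * K) * \<zeta>" using K K2 \<zeta> by (intro mult_right_mono) auto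
    then show ?thesis using \<zeta>(2) by (simp add: distrib_right)
  qed
  define y where "y = V + \<eta> *\<^sub>R e + \<zeta> *\<^sub>R m"
  have inF: "V + (\<eta> + u) *\<^sub>R e + h *\<^sub>R m \<in> F" if "0 \<le> h" "\<bar>u\<bar> + M0 * h \<le> \<eta>" for u h
  proof -
    have "\<eta> < dist V b" "edge_radius V b \<eta> = \<eta>" using \<eta> es(2) r0 by (auto simp: edge_radius_def)
    then show ?thesis using ed(5)[of \<eta> h u] \<eta> that by (simp add: e_def)
  qed
  have "0 \<le> M0 * \<zeta>" using M0 \<zeta> by simp
  then have "M0 * \<zeta> \<le> \<eta>" using M\<zeta> \<zeta> by linarith
  then have yF: "y \<in> F" using inF[of \<zeta> 0] \<zeta> by (simp add: y_def)
  have Ny: "N \<bullet> (y - V) = 0" using N by (simp add: y_def inner_simps e_def)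
  have yV: "norm (y - V) \<le> 2 * \<eta>"
  proof -
    have "norm (y - V) \<le> \<eta> + \<zeta>"
      using norm_triangle_ineq[of "\<eta> *\<^sub>R e" "\<zeta> *\<^sub>R m"] e1 ed(1) \<eta> \<zeta> by (simp add: y_def)
    then show ?thesis using \<zeta>\<eta> \<zeta> by linarith
  qed
  have K3: "K * (K * (6 * \<eta>)) < r0"
  proof -
    have "K * (K * (6 * \<eta>)) = (3/4) * (8 * K\<^sup>2 * \<eta>)" by (simp add: power2_eq_square)
    then show ?thesis using \<eta>(3) r0 by simp
  qed
  \<comment> \<open>\<open>y\<close> is the midpoint of \<open>V\<close> and \<open>x\<close>, while
    \<open>p\<close> below is the midpoint of \<open>V'\<close> and a point \<open>x1\<close> of
    \<open>S\<close> near \<open>x\<close>. So \<open>p\<close> is near \<open>y\<close>, and the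
    boundary point \<open>q\<close> near \<open>p\<close> is so close to \<open>y\<close> that it
    lies in the plane of \<open>F\<close>.\<close>
  define x where "x = V + 2 *\<^sub>R (y - V)"
  have \<eta>K: "4 * \<eta> < r0 / K"
  proof -
    have "K * (4 * \<eta>) \<le> K * (K * (4 * \<eta>))" using K2 \<eta> by (intro mult_left_mono) auto
    also have "\<dots> \<le> K * (K * (6 * \<eta>))" using K2 \<eta> by (intro mult_left_mono) auto
    finally have "K * (4 * \<eta>) < r0" using K3 by (rule le_less_trans)
    then show ?thesis using K2 by (simp add: less_divide_eq mult.commute)
  qed
  have xF: "x \<in> F" unfolding x_def
    using yV \<eta>K \<eta> endpoint_is_vertex(1)[OF F \<sigma>] es(5)[of 0] yF by (intro face_cone[OF F]) auto
  obtain x1 where x1: "x1 \<in> S" "dist x x1 \<le> d" using S1 xF face_subset(1)[OF F] by blast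
  have K1: "1 \<le> K ^ 4" using K2 by (intro one_le_power) auto
  have K4: "K ^ 4 = K * (K * (K * K))" by (simp add: eval_nat_numeral)
  have dsm: "d \<le> \<zeta> / (8 * K)" "dist V V' \<le> \<zeta> / (8 * K)"
  proof -
    \<comment> \<open>Origin of the constant: \<open>192 * K ^ 4\<close> is the product of
      \<open>8 * K\<close>, \<open>3 * K\<close> and \<open>8 * K\<^sup>2\<close>, so the hypotheses
      say that both distances are at most \<open>\<zeta> / (8 * K)\<close>.\<close>
    have eq: "192 * K ^ 4 * (\<zeta> / (8 * K)) = r0"
      using \<eta>(3) K2 by (simp add: \<zeta>_def K4 power2_eq_square)
    have p: "0 < 192 * K ^ 4" using K2 by simp
    show "d \<le> \<zeta> / (8 * K)" using small(1) eq p by (metis mult_le_cancel_left_pos)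
    show "dist V V' \<le> \<zeta> / (8 * K)" using small(2) eq p by (metis mult_le_cancel_left_pos)
  qed
  have \<zeta>8: "\<zeta> / (8 * K) \<le> \<zeta> / 16" using \<zeta> K2 by (intro divide_left_mono) auto
  have "dist x1 V' \<le> dist x x1 + norm (x - V) + dist V V'"
    using dist_triangle[of x1 V' x] dist_triangle[of x V' V]
    unfolding dist_commute[of x1 x] dist_norm[of x V, symmetric] by linarith
  also have "norm (x - V) \<le> 4 * \<eta>" using yV by (simp add: x_def)
  finally have "dist x1 V' \<le> 6 * \<eta>" using x1(2) dsm \<zeta>8 \<zeta>\<eta> \<zeta> by linarith
  then have "K * (K * dist x1 V') \<le> K * (K * (6 * \<eta>))" using K2 by (intro mult_left_mono) auto
  then have "K * (K * dist x1 V') < r0" using K3 by linarith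
  then have mS: "V' + (1/2) *\<^sub>R (x1 - V') \<in> S" by (rule S3[OF x1(1)])
  define p where "p = V' + (1/2) *\<^sub>R (x1 - V')"
  obtain q where q: "q \<in> frontier D" "dist q p \<le> d" using S2[OF mS] by (auto simp: p_def)
  have "2 *\<^sub>R (p - y) = (V' - V) + (x1 - x)"
    by (simp add: p_def x_def scaleR_right_distrib scaleR_right_diff_distrib scaleR_2)
  then have "p - y = (1/2) *\<^sub>R ((V' - V) + (x1 - x))"
    by (metis scaleR_half_double scaleR_2 scaleR_right_distrib)
  then have "norm (p - y) \<le> (1/2) * (dist V V' + d)"
  proof -
    assume eq: "p - y = (1/2) *\<^sub>R ((V' - V) + (x1 - x))"
    have n: "norm (p - y) = (1/2) * norm ((V' - V) + (x1 - x))" unfolding eq by simp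
    have "norm ((V' - V) + (x1 - x)) \<le> norm (V' - V) + norm (x1 - x)" by (rule norm_triangle_ineq)
    also have "\<dots> = dist V V' + dist x x1" by (metis dist_commute dist_norm)
    also have "\<dots> \<le> dist V V' + d" using x1(2) by simp
    finally show ?thesis unfolding n by simp
  qed
  then have "dist y q \<le> d + (1/2) * (dist V V' + d)"
    using dist_triangle[of y q p] q(2) unfolding dist_commute[of y p] dist_commute[of p q] dist_norm[of p y] by linarith
  also have "\<dots> \<le> 2 * (\<zeta> / (8 * K))"
  proof -
    have "x + 1 / 2 * (y + x) \<le> 2 * q" if "x \<le> q" "y \<le> q" for x y q :: real
      using that by (simp add: field_simps)
    then show ?thesis using dsm by blast
  qed
  finally have "K * dist y q \<le> K * (2 * (\<zeta> / (8 * K)))" using K2 by (intro mult_left_mono) auto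
  also have "\<dots> = \<zeta> / 4" using K2 by simp
  finally have yq: "K * dist y q < \<zeta>" using \<zeta> by simp
  have "N \<bullet> (q - y) = 0"
  proof (rule frontier_flat[OF _ _ _ _ q(1) yq])
    show "y \<in> frontier D" using yF face_subset(1)[OF F] by blast
    show "N \<noteq> 0" using N(1) by auto
    show "\<zeta> \<le> r0" using \<zeta>\<eta> \<eta> \<zeta> r0 by linarith
    fix z assume z: "dist y z < \<zeta>" "N \<bullet> (z - y) = 0"
    define u where "u = (z - y) \<bullet> e"
    define v where "v = (z - y) \<bullet> m"
    have "z - y = u *\<^sub>R e + v *\<^sub>R m"
      using orthonormal3_expand[of e m N "z - y"] e1 ed(1) N em z(2)
      by (simp add: u_def v_def inner_commute e_def)
    then have zz: "z = V + (\<eta> + u) *\<^sub>R e + (\<zeta> + v) *\<^sub>R m" by (simp add: y_def algebra_simps)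
    have "\<bar>u\<bar> < \<zeta>" "\<bar>v\<bar> < \<zeta>"
      using Cauchy_Schwarz_ineq2[of "z - y" e] Cauchy_Schwarz_ineq2[of "z - y" m] e1 ed(1) z(1)
      by (simp_all add: u_def v_def dist_norm norm_minus_commute)
    moreover from this have "M0 * (\<zeta> + v) \<le> M0 * (2 * \<zeta>)" using M0 by (intro mult_left_mono) auto
    ultimately have "z \<in> F" unfolding zz using M\<zeta> by (intro inF) auto
    then show "z \<in> frontier D" using face_subset(1)[OF F] by blast
  qed
  moreover have "N \<bullet> (p - V) = N \<bullet> (p - q) + N \<bullet> (q - y) + N \<bullet> (y - V)" by (simp add: inner_simps)
  moreover have "\<bar>N \<bullet> (p - q)\<bar> \<le> d" using Cauchy_Schwarz_ineq2[of N "p - q"] N(1) q(2) by (simp add: dist_norm norm_minus_commute)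
  ultimately have 1: "\<bar>N \<bullet> (p - V)\<bar> \<le> d" using Ny by simp
  have "N \<bullet> (x1 - V) = N \<bullet> (x1 - x) + 2 * (N \<bullet> (y - V))" by (simp add: x_def inner_simps)
  moreover have "\<bar>N \<bullet> (x1 - x)\<bar> \<le> d" using Cauchy_Schwarz_ineq2[of N "x1 - x"] N(1) x1(2) by (simp add: dist_norm norm_minus_commute)
  ultimately have 2: "\<bar>N \<bullet> (x1 - V)\<bar> \<le> d" using Ny by simp
  \<comment> \<open>The midpoint relation solved for \<open>V'\<close>: the error \<open>d\<close>
    of \<open>p\<close> counts twice and that of \<open>x1\<close> once, which gives 3.\<close>
  have "N \<bullet> (V' - V) = 2 * (N \<bullet> (p - V)) - N \<bullet> (x1 - V)" by (simp add: p_def inner_simps field_simps)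
  then show ?thesis using 1 2 by linarith
qed

text \<open>Directions strictly inside the wedge lead into the interior of \<open>D\<close>, but
  \<open>m\<close> leads along a face, hence along the boundary. So \<open>m\<close> is one of the
  two bounding directions, whichever face is considered.\<close>

lemma dihedral_edge_normal:
  assumes F: "F \<in> \<F>" and \<sigma>: "closed_segment a b \<in> face_edges \<F> F" and m: "edge_normal F a b m"
    and p: "p \<in> open_segment a b" and uw: "orthonormal_pair u w" "u \<bullet> edir a b = 0" "w \<bullet> edir a b = 0"
    and \<alpha>: "0 < \<alpha>" "\<alpha> < 2 * pi" and \<epsilon>: "\<epsilon> > 0" and k: "k \<noteq> 0"
    and wedge: "D \<inter> ball p \<epsilon> = {p + s *\<^sub>R (k *\<^sub>R edir a b) + t *\<^sub>R polar u w \<phi> |s t \<phi>. 0 \<le> t \<and> 0 \<le> \<phi> \<and> \<phi> \<le> \<alpha>} \<inter> ball p \<epsilon>"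
  shows "m = polar u w 0 \<or> m = polar u w \<alpha>"
proof -
  note es = edge_sub_frontier[OF F \<sigma>]
  note ed = edge_normalD[OF F \<sigma> m]
  define e where "e = edir a b"
  have e1: "norm e = 1" using edir(1)[OF es(1)] by (simp add: e_def)
  have ee: "e \<bullet> e = 1" using e1 by (simp add: dot_square_norm)
  note o = orthonormal_pairD[OF uw(1)]
  have ue: "u \<bullet> e = 0" "w \<bullet> e = 0" using uw by (simp_all add: e_def)
  have expand: "z = (z \<bullet> u) *\<^sub>R u + (z \<bullet> w) *\<^sub>R w + (z \<bullet> e) *\<^sub>R e" for z
    by (rule orthonormal3_expand) (use o e1 ue in auto)
  obtain t0 where t0: "0 < t0" "t0 < dist a b" "p = a + t0 *\<^sub>R e"
    using p closed_segment_edir(2)[OF es(1)] by (auto simp: e_def)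
  have me: "m \<bullet> e = 0" using ed(2) by (simp add: e_def)
  have mexp: "m = (m \<bullet> u) *\<^sub>R u + (m \<bullet> w) *\<^sub>R w" using expand[of m] me by simp
  have "(m \<bullet> u)\<^sup>2 + (m \<bullet> w)\<^sup>2 = 1"
  proof -
    have "m \<bullet> m = ((m \<bullet> u) *\<^sub>R u + (m \<bullet> w) *\<^sub>R w) \<bullet> m" using arg_cong[OF mexp, of "\<lambda>z. z \<bullet> m"] .
    also have "\<dots> = (m \<bullet> u)\<^sup>2 + (m \<bullet> w)\<^sup>2" by (simp add: inner_simps power2_eq_square inner_commute)
    finally show ?thesis using ed(1) by (simp add: dot_square_norm)
  qed
  then obtain \<psi> where \<psi>: "0 \<le> \<psi>" "\<psi> < 2 * pi" "m \<bullet> u = cos \<psi>" "m \<bullet> w = sin \<psi>"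
    using sincos_total_2pi by metis
  have mp: "m = polar u w \<psi>" using mexp by (simp add: polar_def \<psi>)
  define h where "h = min (\<epsilon> / 2) (edge_radius a b t0 / M0)"
  have h: "0 < h" "h \<le> \<epsilon> / 2" "M0 * h \<le> edge_radius a b t0"
  proof -
    show "0 < h" using \<epsilon> ed(4)[OF t0(1,2)] M0 by (simp add: h_def)
    show "h \<le> \<epsilon> / 2" unfolding h_def by (rule min.cobounded1)
    have "M0 * h \<le> M0 * (edge_radius a b t0 / M0)" using M0 by (intro mult_left_mono) (auto simp: h_def)
    then show "M0 * h \<le> edge_radius a b t0" using M0 by simp
  qed
  have "p + h *\<^sub>R m \<in> F" using ed(5)[OF t0(1,2), of h 0] h t0(3) by (simp add: e_def)
  then have fr: "p + h *\<^sub>R m \<in> frontier D" using face_subset(1)[OF F] by blast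
  then have "p + h *\<^sub>R m \<in> D \<inter> ball p \<epsilon>"
    using poly(1) frontier_subset_closed h ed(1) \<epsilon> by (auto simp: dist_norm)
  then obtain s t \<phi> where st: "p + h *\<^sub>R m = p + s *\<^sub>R (k *\<^sub>R e) + t *\<^sub>R polar u w \<phi>" "0 \<le> t" "0 \<le> \<phi>" "\<phi> \<le> \<alpha>"
    unfolding wedge e_def by blast
  have hm: "h *\<^sub>R m = (s * k) *\<^sub>R e + t *\<^sub>R polar u w \<phi>" using st(1) by (simp add: add.assoc)
  have pe: "polar u w \<phi> \<bullet> e = 0" for \<phi> using ue by (simp add: polar_def inner_simps)
  have "s * k = 0" using arg_cong[OF hm, of "\<lambda>z. z \<bullet> e"] me pe ee by (simp add: inner_simps)
  then have hm: "h *\<^sub>R m = t *\<^sub>R polar u w \<phi>" using hm by simp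
  then have "norm (h *\<^sub>R m) = norm (t *\<^sub>R polar u w \<phi>)" by simp
  then have "h = t" using h st(2) ed(1) norm_polar[OF uw(1)] by simp
  then have "polar u w \<psi> = polar u w \<phi>" using hm h mp by simp
  then have \<psi>\<phi>: "\<psi> = \<phi>" using polar_unique[OF uw(1)] \<psi> st \<alpha> by auto
  show ?thesis
  proof (rule ccontr)
    assume "\<not> (m = polar u w 0 \<or> m = polar u w \<alpha>)"
    then have r: "0 < \<psi>" "\<psi> < \<alpha>" using mp \<psi>\<phi> st(3,4) by (auto simp: less_le)
    obtain \<delta> where \<delta>: "\<delta> > 0" "\<And>x y. \<bar>x - h * cos \<psi>\<bar> < \<delta> \<Longrightarrow> \<bar>y - h * sin \<psi>\<bar> < \<delta> \<Longrightarrow>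
        \<exists>s \<phi>. 0 \<le> s \<and> 0 \<le> \<phi> \<and> \<phi> \<le> \<alpha> \<and> x = s * cos \<phi> \<and> y = s * sin \<phi>"
      using polar_near[OF r h(1)] by blast
    have "ball (p + h *\<^sub>R m) (min \<delta> (\<epsilon> / 2)) \<subseteq> D"
    proof
      fix z assume z: "z \<in> ball (p + h *\<^sub>R m) (min \<delta> (\<epsilon> / 2))"
      define v where "v = z - (p + h *\<^sub>R m)"
      have nv: "norm v < \<delta>" "norm v < \<epsilon> / 2" using z by (auto simp: v_def dist_norm norm_minus_commute)
      have zp: "z - p = v + h *\<^sub>R m" by (simp add: v_def)
      have "\<bar>v \<bullet> u\<bar> \<le> norm v" "\<bar>v \<bullet> w\<bar> \<le> norm v"
        using Cauchy_Schwarz_ineq2[of v u] Cauchy_Schwarz_ineq2[of v w] o by simp_all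
      moreover have "(z - p) \<bullet> u - h * cos \<psi> = v \<bullet> u" "(z - p) \<bullet> w - h * sin \<psi> = v \<bullet> w"
        unfolding zp using \<psi> by (simp_all add: inner_simps)
      ultimately obtain s \<phi> where s: "0 \<le> s" "0 \<le> \<phi>" "\<phi> \<le> \<alpha>" "(z - p) \<bullet> u = s * cos \<phi>" "(z - p) \<bullet> w = s * sin \<phi>"
        using \<delta>(2)[of "(z - p) \<bullet> u" "(z - p) \<bullet> w"] nv by auto
      define c where "c = (z - p) \<bullet> e"
      have zc: "z - p = s *\<^sub>R polar u w \<phi> + c *\<^sub>R e"
        using expand[of "z - p"] unfolding s(4,5) by (simp add: polar_def scaleR_add_right c_def)
      have "z = p + (c / k) *\<^sub>R (k *\<^sub>R e) + s *\<^sub>R polar u w \<phi>"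
        using k zc by (simp add: algebra_simps)
      moreover have "z \<in> ball p \<epsilon>"
        using norm_triangle_ineq[of v "h *\<^sub>R m"] nv h ed(1) zp by (simp add: dist_norm norm_minus_commute[of p z])
      ultimately have "z \<in> {p + s *\<^sub>R (k *\<^sub>R e) + t *\<^sub>R polar u w \<phi> |s t \<phi>. 0 \<le> t \<and> 0 \<le> \<phi> \<and> \<phi> \<le> \<alpha>} \<inter> ball p \<epsilon>"
        using s(1-3) by blast
      then show "z \<in> D" using wedge unfolding e_def[symmetric] by blast
    qed
    then have "p + h *\<^sub>R m \<in> interior D"
      using \<delta>(1) \<epsilon> by (auto simp: mem_interior intro!: exI[of _ "min \<delta> (\<epsilon> / 2)"])
    then show False using fr by (simp add: frontier_def)
  qed
qed

end

subsection \<open>Displacement of the vertices\<close>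

lemma hausdorff_dist_attained:
  fixes A B :: "'a::euclidean_space set"
  assumes A: "compact A" "A \<noteq> {}" and B: "compact B" "B \<noteq> {}"
  shows "x \<in> A \<Longrightarrow> \<exists>y\<in>B. dist x y \<le> hausdorff_dist A B" "y \<in> B \<Longrightarrow> \<exists>x\<in>A. dist x y \<le> hausdorff_dist A B"
proof -
  have *: "\<exists>y\<in>B. dist x y \<le> (SUP x\<in>A. infdist x B)" if A: "compact A" and B: "compact B" "B \<noteq> {}" and x: "x \<in> A" for A B :: "'a set" and x
  proof -
    obtain y where y: "y \<in> B" "infdist x B = dist x y"
      using infdist_attains_inf[OF compact_imp_closed[OF B(1)] B(2)] by metis
    have "compact ((\<lambda>x. infdist x B) ` A)"
      by (rule compact_continuous_image[OF continuous_on_infdist[OF continuous_on_id] A])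
    then have "bdd_above ((\<lambda>x. infdist x B) ` A)" by (intro bounded_imp_bdd_above compact_imp_bounded)
    then have "infdist x B \<le> (SUP x\<in>A. infdist x B)" using x by (intro cSUP_upper)
    then show ?thesis using y by auto
  qed
  show "\<exists>y\<in>B. dist x y \<le> hausdorff_dist A B" if "x \<in> A"
    using *[OF A(1) B that] by (auto simp: hausdorff_dist_def intro: le_max_iff_disj[THEN iffD2])
  show "\<exists>x\<in>A. dist x y \<le> hausdorff_dist A B" if "y \<in> B"
    using *[OF B(1) A that] by (auto simp: hausdorff_dist_def dist_commute intro: le_max_iff_disj[THEN iffD2])
qed

lemma midpoint_edir:
  assumes "a \<noteq> b"
  shows "midpoint a b = a + (dist a b / 2) *\<^sub>R edir a b"
proof -
  have "(dist a b / 2) *\<^sub>R edir a b + (dist a b / 2) *\<^sub>R edir a b = dist a b *\<^sub>R edir a b"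
    unfolding scaleR_left_distrib[symmetric] by simp
  then have "(dist a b / 2) *\<^sub>R edir a b + (dist a b / 2) *\<^sub>R edir a b = b - a"
    by (simp only: edir(3)[OF assms])
  then show ?thesis by (simp add: midpoint_eq_iff algebra_simps)
qed

context poly_setting
begin

lemma frontier_D_nonempty: "frontier D \<noteq> {}"
proof -
  have "D \<noteq> {}" using poly(2) homeomorphic_empty(2)[of "cball 0 1 :: (real^3) set"] by auto
  moreover have "bounded D" using dom poly(6) bounded_subset unfolding ambient_domain_def by blast
  then have "D \<noteq> UNIV" using not_bounded_UNIV by auto
  ultimately show ?thesis using frontier_eq_empty by blast
qed

text \<open>The cylinder of a boundary chart has height \<open>2 * M0 * r0\<close> above its centre, and this part of it
  lies in \<open>\<Omega>\<close>. Hence \<open>M0\<close> is bounded in terms of \<open>M1\<close>.\<close>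

lemma M0_bound: "2 * M0 \<le> M1"
proof -
  obtain P where P: "P \<in> frontier D" using frontier_D_nonempty by blast
  obtain Q :: "real^3 \<Rightarrow> real^3" and g where Q: "orthogonal_transformation Q"
    and g: "lipschitz_profile r0 M0 {z::real^2. \<bar>z$1\<bar> \<le> r0 \<and> \<bar>z$2\<bar> \<le> r0} g"
    and ch: "\<forall>y. \<bar>y$1\<bar> \<le> r0 \<and> \<bar>y$2\<bar> \<le> r0 \<and> \<bar>y$3\<bar> \<le> 2 * M0 * r0 \<longrightarrow>
      (P + Q y \<in> \<Omega> - D \<longleftrightarrow> y$3 > g (vector [y$1, y$2]))"
    using bspec[OF poly(10)[unfolded lipschitz_boundary3_def] frontier_D_complement(2)[OF P]] by blast
  define y :: "real^3" where "y = (2 * M0 * r0) *\<^sub>R axis 3 1"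
  have yc: "y $ 1 = 0" "y $ 2 = 0" "y $ 3 = 2 * M0 * r0" by (simp_all add: y_def axis_def)
  have "vector [0, 0] = (0 :: real^2)" by (simp add: vec_eq_iff forall_2 vector_2)
  then have "g (vector [y $ 1, y $ 2]) = 0" using g yc by (simp add: lipschitz_profile_def)
  then have "P + Q y \<in> \<Omega>" using ch[rule_format, of y] yc r0 M0 by simp
  moreover have "P \<in> \<Omega>" using P poly(1,6) frontier_subset_closed by blast
  moreover have "bounded \<Omega>" "diameter \<Omega> \<le> M1 * r0" using dom by (simp_all add: ambient_domain_def)
  ultimately have "dist P (P + Q y) \<le> M1 * r0" using diameter_bounded_bound by (meson order_trans)
  moreover have "dist P (P + Q y) = 2 * M0 * r0"
    using orthogonal_transformation_norm[OF Q, of y] r0 M0 by (simp add: dist_norm y_def)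
  ultimately show ?thesis using r0 by simp
qed

lemma sin_theta0: "0 < sin \<theta>0" "sin \<theta>0 \<le> 1"
  using \<theta>0 by (auto intro: sin_gt_zero)

text \<open>The planes of both faces at the edge contain its line, and \<open>V'\<close> is within
  \<open>3 * d\<close> of each. They meet at the dihedral angle, whose sine is at least
  \<open>sin \<theta>0\<close> in absolute value, so the distance to their common line is
  controlled. 9 is the sum of 3, from the first plane, and 6, from the second corrected by the
  first.\<close>

lemma vertex_line_bound:
  assumes F: "F \<in> \<F>" and \<sigma>: "closed_segment V b \<in> face_edges \<F> F" and near: "near_cone S V' d"
    and small: "192 * K ^ 4 * d \<le> r0" "192 * K ^ 4 * dist V V' \<le> r0" and d0: "0 \<le> d"
  shows "norm ((V' - V) - ((V' - V) \<bullet> edir V b) *\<^sub>R edir V b) \<le> 9 * d / sin \<theta>0"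
proof -
  note es = edge_sub_frontier[OF F \<sigma>]
  obtain G where G: "G \<in> \<F>" "G \<noteq> F" "closed_segment V b \<in> face_edges \<F> G"
    by (rule face_edgeE[OF F \<sigma>]) (rule that)
  obtain m where m: "edge_normal F V b m" using edge_normal_exists[OF F \<sigma>] .
  obtain n where n: "edge_normal G V b n" using edge_normal_exists[OF G(1,3)] .
  define e where "e = edir V b"
  have e1: "norm e = 1" using edir(1)[OF es(1)] by (simp add: e_def)
  define L where "L = dist V b"
  have L: "L > 0" using es(1) by (simp add: L_def)
  obtain \<alpha> where \<alpha>: "\<alpha> \<in> admissible_angles \<theta>0" "dihedral_angle D (closed_segment V b) \<alpha>"
    using poly(11)[OF edgesI[OF F \<sigma>]] by blast
  then obtain a' b' u w where \<alpha>r: "0 < \<alpha>" "\<alpha> < 2 * pi" and ab': "closed_segment V b = closed_segment a' b'"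
    and uw: "orthonormal_pair u w" "u \<bullet> (b' - a') = 0" "w \<bullet> (b' - a') = 0"
    and wedge: "\<forall>p\<in>open_segment a' b'. \<exists>\<epsilon>>0. D \<inter> ball p \<epsilon> =
           {p + s *\<^sub>R (b' - a') + t *\<^sub>R polar u w \<phi> |s t \<phi>. 0 \<le> t \<and> 0 \<le> \<phi> \<and> \<phi> \<le> \<alpha>} \<inter> ball p \<epsilon>"
    unfolding dihedral_angle_def polar_def by blast
  have "{V, b} = {a', b'}" using ab' by (simp add: closed_segment_eq)
  then have "a' = V \<and> b' = b \<or> a' = b \<and> b' = V" by (auto simp: doubleton_eq_iff)
  then obtain k where k: "b' - a' = k *\<^sub>R e" "k \<noteq> 0" and os: "open_segment a' b' = open_segment V b"
  proof (elim disjE conjE)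
    assume "a' = V" "b' = b"
    then show ?thesis using that[of L] edir(3)[OF es(1)] L by (simp add: L_def e_def)
  next
    assume "a' = b" "b' = V"
    then show ?thesis using that[of "- L"] edir(3)[OF es(1)] L
      by (simp add: L_def e_def open_segment_commute)
  qed
  have ue: "u \<bullet> e = 0" "w \<bullet> e = 0" using uw(2,3) k by simp_all
  define p where "p = V + (L / 2) *\<^sub>R e"
  have p: "p \<in> open_segment V b"
    unfolding closed_segment_edir(2)[OF es(1)] p_def e_def using L by (intro exI[of _ "L / 2"]) (simp add: L_def)
  then obtain \<epsilon> where \<epsilon>: "\<epsilon> > 0" "D \<inter> ball p \<epsilon> =
           {p + s *\<^sub>R (k *\<^sub>R edir V b) + t *\<^sub>R polar u w \<phi> |s t \<phi>. 0 \<le> t \<and> 0 \<le> \<phi> \<and> \<phi> \<le> \<alpha>} \<inter> ball p \<epsilon>"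
    using wedge os unfolding k(1) e_def by blast
  have mD: "m = polar u w 0 \<or> m = polar u w \<alpha>"
    using dihedral_edge_normal[OF F \<sigma> m p uw(1) ue[unfolded e_def] \<alpha>r \<epsilon>(1) k(2) \<epsilon>(2)] .
  have nD: "n = polar u w 0 \<or> n = polar u w \<alpha>"
    using dihedral_edge_normal[OF G(1,3) n p uw(1) ue[unfolded e_def] \<alpha>r \<epsilon>(1) k(2) \<epsilon>(2)] .
  \<comment> \<open>The two faces occupy different sides of the wedge: with equal normals their
    relative interiors would meet.\<close>
  have mn: "m \<noteq> n"
  proof
    assume eq: "m = n"
    have hL: "0 < L / 2" "L / 2 < dist V b" using L by (simp_all add: L_def)
    define r where "r = edge_radius V b (L / 2) / M0"
    have r: "0 < r" "\<bar>0\<bar> + M0 * r \<le> edge_radius V b (L / 2)"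
      using edge_normalD(4)[OF F \<sigma> m hL] M0 by (simp_all add: r_def)
    have "V + (L / 2) *\<^sub>R edir V b + 0 *\<^sub>R edir V b + r *\<^sub>R m \<in> rel_interior F"
      by (rule half_discD(3)[OF edge_normalD(3)[OF F \<sigma> m hL] r])
    moreover have "V + (L / 2) *\<^sub>R edir V b + 0 *\<^sub>R edir V b + r *\<^sub>R n \<in> rel_interior G"
      by (rule half_discD(3)[OF edge_normalD(3)[OF G(1,3) n hL] r])
    ultimately show False using eq poly(8)[OF F G(1) G(2)[symmetric]] by blast
  qed
  \<comment> \<open>Turning the inner normal of a face by a right angle in the plane orthogonal to
    the edge gives a normal of the plane of that face.\<close>
  have bound: "\<bar>polar u w (\<phi> + pi / 2) \<bullet> (V' - V)\<bar> \<le> 3 * d"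
    if H: "H \<in> \<F>" "closed_segment V b \<in> face_edges \<F> H" "edge_normal H V b q" "q = polar u w \<phi>" for H q \<phi>
  proof (rule vertex_plane_bound[OF H(1-3) near small d0])
    show "norm (polar u w (\<phi> + pi / 2)) = 1" by (rule norm_polar[OF uw(1)])
    show "polar u w (\<phi> + pi / 2) \<bullet> edir V b = 0" using ue by (simp add: polar_def inner_simps e_def)
    show "polar u w (\<phi> + pi / 2) \<bullet> q = 0" unfolding H(4) polar_inner[OF uw(1)] by simp
  qed
  define v where "v = V' - V"
  have "\<bar>polar u w (0 + pi / 2) \<bullet> v\<bar> \<le> 3 * d \<and> \<bar>polar u w (\<alpha> + pi / 2) \<bullet> v\<bar> \<le> 3 * d"
    using bound[OF F \<sigma> m] bound[OF G(1,3) n] mD nD mn unfolding v_def by metis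
  then have b1: "\<bar>v \<bullet> w\<bar> \<le> 3 * d" and b2: "\<bar>cos \<alpha> * (v \<bullet> w) - sin \<alpha> * (v \<bullet> u)\<bar> \<le> 3 * d"
    by (simp_all add: polar_def inner_simps cos_add sin_add inner_commute)
  have "\<bar>cos \<alpha> * (v \<bullet> w)\<bar> \<le> 1 * (3 * d)" unfolding abs_mult using b1 by (intro mult_mono) auto
  then have "\<bar>sin \<alpha> * (v \<bullet> u)\<bar> \<le> 6 * d" using b2 by (simp add: abs_le_iff)
  moreover have "sin \<theta>0 * \<bar>v \<bullet> u\<bar> \<le> \<bar>sin \<alpha>\<bar> * \<bar>v \<bullet> u\<bar>"
    using admissible_bounds(3)[OF \<alpha>(1)] by (intro mult_right_mono) auto
  ultimately have b3: "sin \<theta>0 * \<bar>v \<bullet> u\<bar> \<le> 6 * d" by (simp add: abs_mult)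
  have "sin \<theta>0 * \<bar>v \<bullet> w\<bar> \<le> 1 * (3 * d)" using b1 sin_theta0 by (intro mult_mono) auto
  then have b4: "sin \<theta>0 * (\<bar>v \<bullet> u\<bar> + \<bar>v \<bullet> w\<bar>) \<le> 9 * d" using b3 by (simp add: distrib_left)
  note o = orthonormal_pairD[OF uw(1)]
  have "v - (v \<bullet> e) *\<^sub>R e = (v \<bullet> u) *\<^sub>R u + (v \<bullet> w) *\<^sub>R w"
  proof -
    define cu cw ce where "cu = v \<bullet> u" "cw = v \<bullet> w" "ce = v \<bullet> e"
    have "v = cu *\<^sub>R u + cw *\<^sub>R w + ce *\<^sub>R e"
      unfolding cu_cw_ce_def by (rule orthonormal3_expand) (use o e1 ue in auto)
    then show ?thesis unfolding cu_cw_ce_def[symmetric] by simp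
  qed
  then have "norm (v - (v \<bullet> e) *\<^sub>R e) \<le> \<bar>v \<bullet> u\<bar> + \<bar>v \<bullet> w\<bar>"
    using norm_triangle_ineq[of "(v \<bullet> u) *\<^sub>R u" "(v \<bullet> w) *\<^sub>R w"] o by simp
  also have "\<dots> \<le> 9 * d / sin \<theta>0" using b4 sin_theta0 by (simp add: le_divide_eq mult.commute)
  finally show ?thesis by (simp add: v_def e_def)
qed

text \<open>A face at \<open>V\<close> has two edges there, and \<open>V'\<close> is near the lines
  of both. As these enclose an angle with sine at least \<open>sin \<theta>0\<close> in absolute
  value, the component of the displacement along one line is controlled by the distance to the
  other. The total is \<open>3 * B / sin \<theta>0\<close> with
  \<open>B = 9 * d / sin \<theta>0\<close>.\<close>

lemma vertex_displacement_bound: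
  assumes V: "V \<in> vertices \<F>" and near: "near_cone S V' d"
    and small: "192 * K ^ 4 * d \<le> r0" "192 * K ^ 4 * dist V V' \<le> r0" and d0: "0 \<le> d"
  shows "dist V V' \<le> 27 / (sin \<theta>0)\<^sup>2 * d"
proof -
  obtain F where F: "F \<in> \<F>" "V \<in> F" using vertex_in_frontier[OF V] .
  obtain b where \<sigma>: "closed_segment V b \<in> face_edges \<F> F" using vertex_is_endpoint[OF F(1) V F(2)] .
  have "V \<in> rel_frontier F" using edge_sub_frontier(4)[OF F(1) \<sigma>, of 0] by simp
  then obtain E1 E2 g where ch: "face_chart F r0 M0 V E1 E2 g" using face_chart_exists[OF F(1)] by blast
  obtain c where \<tau>: "closed_segment V c \<in> face_edges \<F> F" and ne: "closed_segment V c \<noteq> closed_segment V b"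
    by (rule edge_opposite_side[OF F(1) \<sigma> ch]) (rule that)
  obtain m where m: "edge_normal F V b m" using edge_normal_exists[OF F(1) \<sigma>] .
  obtain n where n: "edge_normal F V c n" using edge_normal_exists[OF F(1) \<tau>] .
  obtain \<alpha> u w where \<alpha>: "\<alpha> \<in> admissible_angles \<theta>0" and uw: "orthonormal_pair u w"
    and cs: "(edir V b = u \<and> m = w \<and> edir V c = polar u w \<alpha> \<and> n = polar u w (\<alpha> - pi / 2)) \<or>
     (edir V c = u \<and> n = w \<and> edir V b = polar u w \<alpha> \<and> m = polar u w (\<alpha> - pi / 2))"
    using face_sector[OF F(1) \<sigma> m \<tau> n ne[symmetric]] by blast
  define e f where "e = edir V b" "f = edir V c"
  have nf: "norm e = 1" "norm f = 1"
    using edir(1)[OF edge_sub_frontier(1)[OF F(1) \<sigma>]] edir(1)[OF edge_sub_frontier(1)[OF F(1) \<tau>]] by (simp_all add: e_f_def)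
  have ef: "e \<bullet> f = cos \<alpha>"
    using cs polar_coords[OF uw, of \<alpha>] by (auto simp: e_f_def inner_commute)
  define v where "v = V' - V"
  define B where "B = 9 * d / sin \<theta>0"
  have B0: "0 \<le> B" using d0 sin_theta0 by (simp add: B_def)
  have be: "norm (v - (v \<bullet> e) *\<^sub>R e) \<le> B" unfolding v_def e_f_def B_def by (rule vertex_line_bound[OF F(1) \<sigma> near small d0])
  have bf: "norm (v - (v \<bullet> f) *\<^sub>R f) \<le> B" unfolding v_def e_f_def B_def by (rule vertex_line_bound[OF F(1) \<tau> near small d0])
  define a where "a = v \<bullet> e"
  define r where "r = v - a *\<^sub>R e"
  have rB: "norm r \<le> B" using be by (simp add: r_def a_def)
  \<comment> \<open>Project \<open>v = a *\<^sub>R e + r\<close> orthogonally to \<open>f\<close>: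
    the image of \<open>v\<close> is small by \<open>bf\<close>, that of \<open>r\<close> by
    \<open>be\<close>, so \<open>a\<close> times the part of \<open>e\<close> orthogonal to
    \<open>f\<close>, of norm \<open>\<bar>sin \<alpha>\<bar>\<close>, is small too.\<close>
  have "a *\<^sub>R (e - (e \<bullet> f) *\<^sub>R f) = (v - (v \<bullet> f) *\<^sub>R f) - (r - (r \<bullet> f) *\<^sub>R f)"
    by (simp add: r_def inner_simps algebra_simps)
  then have "norm (a *\<^sub>R (e - (e \<bullet> f) *\<^sub>R f)) \<le> norm (v - (v \<bullet> f) *\<^sub>R f) + norm (r - (r \<bullet> f) *\<^sub>R f)"
    by (simp only: norm_triangle_ineq4)
  also have "\<dots> \<le> B + B" using bf rB norm_orthogonal_part_le(1)[OF nf(2), of r] by simp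
  finally have aB: "\<bar>a\<bar> * norm (e - (e \<bullet> f) *\<^sub>R f) \<le> 2 * B" by simp
  have "(norm (e - (e \<bullet> f) *\<^sub>R f))\<^sup>2 = (sin \<alpha>)\<^sup>2"
  proof -
    have "e \<bullet> e = 1" "f \<bullet> f = 1" using nf by (simp_all add: dot_square_norm)
    then have "(norm (e - (e \<bullet> f) *\<^sub>R f))\<^sup>2 = 1 - (e \<bullet> f)\<^sup>2"
      unfolding power2_norm_eq_inner by (simp add: inner_simps inner_commute power2_eq_square)
    then show ?thesis by (simp add: ef sin_squared_eq)
  qed
  then have "norm (e - (e \<bullet> f) *\<^sub>R f) = \<bar>sin \<alpha>\<bar>" by (metis norm_ge_zero abs_of_nonneg power2_abs power2_eq_imp_eq abs_ge_zero)
  then have "\<bar>a\<bar> * sin \<theta>0 \<le> 2 * B"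
    using aB admissible_bounds(3)[OF \<alpha>] mult_left_mono[of "sin \<theta>0" "\<bar>sin \<alpha>\<bar>" "\<bar>a\<bar>"] by simp
  moreover have "norm v \<le> norm r + \<bar>a\<bar>" using norm_triangle_ineq[of r "a *\<^sub>R e"] nf by (simp add: r_def)
  then have "norm v * sin \<theta>0 \<le> (B + \<bar>a\<bar>) * sin \<theta>0" using rB sin_theta0 by (intro mult_right_mono) auto
  moreover have "B * sin \<theta>0 \<le> B * 1" using B0 sin_theta0 by (intro mult_left_mono) auto
  ultimately have "norm v * sin \<theta>0 \<le> 3 * B" by (simp add: distrib_right)
  then have "norm v \<le> 3 * B / sin \<theta>0" using sin_theta0 by (simp add: le_divide_eq)
  also have "\<dots> = 27 / (sin \<theta>0)\<^sup>2 * d" by (simp add: B_def power2_eq_square)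
  finally show ?thesis by (simp add: v_def dist_norm norm_minus_commute)
qed

text \<open>In the plane of the face only \<open>m\<close> and \<open>- m\<close> are unit normals
  of the edge. The condition for small positive \<open>t\<close> excludes \<open>m\<close>, as small
  steps along \<open>m\<close> stay in the face.\<close>

lemma outer_normal_iff:
  assumes F: "F \<in> \<F>" and \<sigma>: "closed_segment a b \<in> face_edges \<F> F" and m: "edge_normal F a b m"
    and n: "outer_normal F a b n"
  shows "n = - m"
proof -
  note es = edge_sub_frontier[OF F \<sigma>]
  note ed = edge_normalD[OF F \<sigma> m]
  define L where "L = dist a b"
  have L: "L > 0" using es(1) by (simp add: L_def)
  have hL: "0 < L / 2" "L / 2 < dist a b" using L by (simp_all add: L_def)
  have mid: "midpoint a b = a + (L / 2) *\<^sub>R edir a b"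
    unfolding L_def by (rule midpoint_edir[OF es(1)])
  have n1: "norm n = 1" "n \<bullet> edir a b = 0" "midpoint a b + n \<in> affine hull F"
    using n by (auto simp: outer_normal_def edir_def)
  have mh: "midpoint a b \<in> affine hull F" unfolding mid using es(6)[of "L / 2"] L by (simp add: L_def)
  have "n = m \<or> n = - m"
  proof (rule edge_normal_unique[OF F edir(1)[OF es(1)] ed(3)[OF hL] ed(4)[OF hL]])
    show "a + (L / 2) *\<^sub>R edir a b \<in> affine hull F" using mh mid by simp
    show "a + (L / 2) *\<^sub>R edir a b + (- (L / 2)) *\<^sub>R edir a b \<in> affine hull F" using es(6)[of 0] by simp
    show "midpoint a b \<in> affine hull F" by (rule mh)
    show "midpoint a b + 1 *\<^sub>R n \<in> affine hull F" using n1 by simp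
  qed (use L n1 in auto)
  moreover have "n \<noteq> m"
  proof
    assume nm: "n = m"
    have "\<forall>\<^sub>F t in at_right 0. midpoint a b + t *\<^sub>R n \<notin> F" using n by (auto simp: outer_normal_def elim: eventually_mono)
    moreover have "\<forall>\<^sub>F t in at_right 0. t \<in> {0<..<edge_radius a b (L / 2) / M0}"
      using ed(4)[OF hL] M0 by (intro eventually_at_right_real) simp
    ultimately have "\<forall>\<^sub>F t in at_right (0::real). False"
    proof eventually_elim
      case (elim t)
      then have "M0 * t \<le> edge_radius a b (L / 2)" using M0 by (auto simp: less_divide_eq mult.commute)
      then have "a + (L / 2 + 0) *\<^sub>R edir a b + t *\<^sub>R m \<in> F" using elim by (intro ed(5)[OF hL]) auto
      then show False using elim nm mid by simp
    qed
    then show False by simp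
  qed
  ultimately show ?thesis by blast
qed

definition cap_triangle :: "real^3 \<Rightarrow> real^3 \<Rightarrow> real^3 \<Rightarrow> (real^3) set" where
  "cap_triangle a b m = convex hull {a, b, midpoint a b + tri_height r0 \<theta>0 M0 *\<^sub>R m}"

lemma cap_triangle_subset:
  assumes F: "F \<in> \<F>" and \<sigma>: "closed_segment a b \<in> face_edges \<F> F"
  shows "cap_triangle a b m \<subseteq> cap a b m"
proof
  note es = edge_sub_frontier[OF F \<sigma>]
  define L where "L = dist a b"
  fix x assume "x \<in> cap_triangle a b m"
  then obtain p q r where pqr: "0 \<le> p" "0 \<le> q" "0 \<le> r" "p + q + r = 1"
    and x: "x = p *\<^sub>R a + q *\<^sub>R b + r *\<^sub>R (midpoint a b + tri_height r0 \<theta>0 M0 *\<^sub>R m)"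
    unfolding cap_triangle_def convex_hull_3 by blast
  have b: "b = a + L *\<^sub>R edir a b" using edir(2)[OF es(1)] by (simp add: L_def)
  have mid: "midpoint a b = a + (L / 2) *\<^sub>R edir a b"
    unfolding L_def by (rule midpoint_edir[OF es(1)])
  have p: "p = 1 - q - r" using pqr by simp
  define t where "t = q * L + r * (L / 2)"
  define h where "h = slope_bound * (r * (r0 / 2))"
  have "x = a + t *\<^sub>R edir a b + h *\<^sub>R m"
  proof -
    define e where "e = edir a b"
    have be: "b = a + L *\<^sub>R e" using b by (simp add: e_def)
    have "r * tri_height r0 \<theta>0 M0 = h" by (simp add: tri_height_eq h_def)
    then have "x = p *\<^sub>R a + q *\<^sub>R b + r *\<^sub>R (a + (L / 2) *\<^sub>R e) + h *\<^sub>R m"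
      unfolding x mid e_def by (simp add: scaleR_add_right add.assoc)
    then show ?thesis unfolding p t_def e_def[symmetric] by (subst (asm) be) (simp add: algebra_simps)
  qed
  moreover have qL: "0 \<le> q * L" "0 \<le> r * (L / 2)" "0 \<le> p * L" using pqr by (simp_all add: L_def)
  moreover have tL: "L - t = p * L + r * (L / 2)" unfolding p t_def by (simp add: algebra_simps)
  ultimately have "0 \<le> t" "t \<le> L" "0 \<le> h" "x = a + t *\<^sub>R edir a b + h *\<^sub>R m"
    using slope_bound(1) pqr r0 by (simp_all add: t_def h_def)
  moreover
  \<comment> \<open>The lower bound on the length of edges enters here: it makes the sides of the
    triangle no steeper than those of the trapezoid.\<close>
  have rL: "r * (r0 / 2) \<le> r * (L / 2)" using pqr es(2) by (intro mult_left_mono) (simp_all add: L_def)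
  have "h \<le> slope_bound * t" unfolding h_def t_def using slope_bound(1) qL rL by (intro mult_left_mono) linarith+
  moreover have "h \<le> slope_bound * (L - t)" unfolding h_def tL using slope_bound(1) qL rL by (intro mult_left_mono) linarith+
  moreover have "r * (r0 / 2) \<le> 1 * (r0 / 2)" using pqr r0 by (intro mult_right_mono) auto
  then have "h \<le> slope_bound * (r0 / 2)" unfolding h_def using slope_bound(1) by (intro mult_left_mono) auto
  ultimately show "x \<in> cap a b m" unfolding cap_def L_def by blast
qed

end

subsection \<open>The vector field\<close>

context poly_setting_finite
begin

definition lipschitz_const :: real where "lipschitz_const = K * planar_const"

text \<open>The cut-off radius \<open>r0 / 8\<close> keeps the support inside the tube of width
  \<open>r0 / 4\<close>. The index set consists of faces with ordered end points of an edge, so each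
  edge occurs several times; this does no harm, as the interpolations agree.\<close>

lemma vertex_data_extension:
  assumes W: "\<forall>v\<in>vertices \<F>. \<bar>W v\<bar> \<le> M" and M: "0 \<le> M"
  obtains u where "ae_differentiable u" "\<And>x y. \<bar>u x - u y\<bar> \<le> 3 * (lipschitz_const * M / r0) * dist x y"
    "\<And>x. \<bar>u x\<bar> \<le> M" "\<And>v. v \<in> vertices \<F> \<Longrightarrow> u v = W v"
    "\<And>x. u x \<noteq> 0 \<Longrightarrow> infdist x D < r0 / 8"
    "\<And>F a b n x. F \<in> \<F> \<Longrightarrow> closed_segment a b \<in> face_edges \<F> F \<Longrightarrow> outer_normal F a b n \<Longrightarrow>
       x \<in> convex hull {a, b, midpoint a b - tri_height r0 \<theta>0 M0 *\<^sub>R n} \<Longrightarrow> u x = edge_interp W a b x"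
proof -
  define I where "I = {(F, a, b). F \<in> \<F> \<and> closed_segment a b \<in> face_edges \<F> F}"
  define nrm where "nrm = (\<lambda>F a b. SOME m. edge_normal F a b m)"
  have nrm: "edge_normal F a b (nrm F a b)" if "F \<in> \<F>" "closed_segment a b \<in> face_edges \<F> F" for F a b
    unfolding nrm_def using edge_normal_exists[OF that] by (metis someI)
  define T where "T = (\<lambda>(F, a, b). cap_triangle a b (nrm F a b))"
  define f where "f = (\<lambda>(F :: (real^3) set, a, b). edge_interp W a b)"
  have I: "\<exists>F a b. i = (F, a, b) \<and> F \<in> \<F> \<and> closed_segment a b \<in> face_edges \<F> F" if "i \<in> I" for i
    using that by (auto simp: I_def)
  have finI: "finite I"
  proof (rule finite_subset)
    show "I \<subseteq> \<F> \<times> vertices \<F> \<times> vertices \<F>"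
      unfolding I_def using endpoint_is_vertex by auto
    show "finite (\<F> \<times> vertices \<F> \<times> vertices \<F>)" using poly(3) finite_vertices by simp
  qed
  have Tcap: "T (F, a, b) \<subseteq> cap a b (nrm F a b)" if "F \<in> \<F>" "closed_segment a b \<in> face_edges \<F> F" for F a b
    unfolding T_def using cap_triangle_subset[OF that] by simp
  define L where "L = lipschitz_const * M / r0"
  \<comment> \<open>The second bound is the condition \<open>M / (r0 / 8) \<le> 3 * L\<close> on the
    slope of the cut-off.\<close>
  have c2: "2 \<le> lipschitz_const" "8 \<le> 3 * lipschitz_const"
  proof -
    have "2 * (6 * 2) \<le> K * planar_const" using planar_const K2 by (intro mult_mono) auto
    then show "2 \<le> lipschitz_const" "8 \<le> 3 * lipschitz_const" by (simp_all add: lipschitz_const_def)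
  qed
  have L0: "0 \<le> L" using c2 M r0 by (simp add: L_def)
  have L2: "2 * M / r0 \<le> L" unfolding L_def using c2 M r0 by (intro divide_right_mono mult_right_mono) auto
  obtain u where u: "ae_differentiable u" "\<And>x y. \<bar>u x - u y\<bar> \<le> 3 * L * dist x y" "\<And>x. \<bar>u x\<bar> \<le> M"
    "\<And>i x. i \<in> I \<Longrightarrow> x \<in> T i \<Longrightarrow> u x = f i x"
    "\<And>x. u x \<noteq> 0 \<Longrightarrow> \<exists>i\<in>I. infdist x (T i) < r0 / 8"
  proof (rule piecewise_affine_extension[of I T f L M "r0 / 8", OF finI])
    fix i assume "i \<in> I"
    then obtain F a b where i: "i = (F, a, b)" "F \<in> \<F>" "closed_segment a b \<in> face_edges \<F> F" using I by blast
    note es = edge_sub_frontier(1,2)[OF i(2,3)]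
    show "convex (T i) \<and> compact (T i) \<and> T i \<noteq> {}"
      by (simp add: i T_def cap_triangle_def finite_imp_compact_convex_hull)
    show "f i differentiable (at x)" for x
      unfolding i f_def edge_interp_def[abs_def] by (simp add: divide_inverse)
    show "\<bar>f i x - f i y\<bar> \<le> L * dist x y" for x y
    proof -
      have "\<bar>edge_interp W a b x - edge_interp W a b y\<bar> \<le> 2 * M / r0 * dist x y"
        using vertex_diff_bound[OF W] endpoint_is_vertex[OF i(2,3)] r0 es by (intro edge_interp_lipschitz) auto
      also have "\<dots> \<le> L * dist x y" using L2 by (intro mult_right_mono) auto
      finally show ?thesis by (simp add: i f_def)
    qed
    show "\<bar>f i x\<bar> \<le> M" if "x \<in> T i" for x
      using edge_interp_bound[OF i(2,3) nrm[OF i(2,3)] W, of x] Tcap[OF i(2,3)] that by (auto simp: i f_def)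
    fix j assume "j \<in> I"
    then obtain G c d where j: "j = (G, c, d)" "G \<in> \<F>" "closed_segment c d \<in> face_edges \<F> G" using I by blast
    show "\<bar>f i x - f j y\<bar> \<le> L * dist x y" if "x \<in> T i" "y \<in> T j" for x y
      using frontier_interp_lipschitz[OF i(2,3) nrm[OF i(2,3)] j(2,3) nrm[OF j(2,3)] W, of x y]
        Tcap[OF i(2,3)] Tcap[OF j(2,3)] that by (auto simp: i j f_def L_def lipschitz_const_def)
  next
    show "0 \<le> M" "0 \<le> L" by (rule M L0)+
    show "0 < r0 / 8" using r0 by simp
    have "8 * M / r0 \<le> 3 * lipschitz_const * M / r0" using c2 M r0 by (intro divide_right_mono mult_right_mono) auto
    then show "M / (r0 / 8) \<le> 3 * L" by (simp add: L_def mult.commute mult.left_commute)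
  qed blast
  have TD: "T i \<subseteq> D \<and> T i \<noteq> {}" if "i \<in> I" for i
  proof -
    obtain F a b where i: "i = (F, a, b)" "F \<in> \<F>" "closed_segment a b \<in> face_edges \<F> F" using I \<open>i \<in> I\<close> by blast
    then show ?thesis
      using Tcap[OF i(2,3)] cap_subset_face[OF i(2,3) nrm[OF i(2,3)]] face_subset(2)[OF i(2)]
      by (auto simp: T_def cap_triangle_def)
  qed
  show thesis
  proof (rule that)
    show "ae_differentiable u" "\<And>x. \<bar>u x\<bar> \<le> M" by (rule u)+
    show "\<bar>u x - u y\<bar> \<le> 3 * (lipschitz_const * M / r0) * dist x y" for x y using u(2) by (simp add: L_def)
    show "infdist x D < r0 / 8" if "u x \<noteq> 0" for x
    proof -
      obtain i where i: "i \<in> I" "infdist x (T i) < r0 / 8" using u(5)[OF \<open>u x \<noteq> 0\<close>] by blast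
      have "infdist x D \<le> infdist x (T i)" using TD[OF i(1)] by (intro infdist_mono) auto
      then show ?thesis using i by simp
    qed
    show "u v = W v" if v: "v \<in> vertices \<F>" for v
    proof -
      obtain F where F: "F \<in> \<F>" "v \<in> F" using vertex_in_frontier[OF v] .
      obtain b where \<sigma>: "closed_segment v b \<in> face_edges \<F> F" using vertex_is_endpoint[OF F(1) v F(2)] .
      have "v \<in> T (F, v, b)" by (simp add: T_def cap_triangle_def hull_inc)
      moreover have "(F, v, b) \<in> I" using F \<sigma> by (simp add: I_def)
      ultimately have "u v = f (F, v, b) v" using u(4) by blast
      then show ?thesis using edge_interp_ends(1)[OF edge_sub_frontier(1)[OF F(1) \<sigma>]] by (simp add: f_def)
    qed
    fix F a b n x
    assume F: "F \<in> \<F>" "closed_segment a b \<in> face_edges \<F> F" "outer_normal F a b n"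
      and x: "x \<in> convex hull {a, b, midpoint a b - tri_height r0 \<theta>0 M0 *\<^sub>R n}"
    have "n = - nrm F a b" by (rule outer_normal_iff[OF F(1,2) nrm[OF F(1,2)] F(3)])
    then have "x \<in> T (F, a, b)" using x by (simp add: T_def cap_triangle_def)
    moreover have "(F, a, b) \<in> I" using F by (simp add: I_def)
    ultimately show "u x = edge_interp W a b x" using u(4)[of "(F, a, b)" x] by (simp add: f_def)
  qed
qed

text \<open>The three components are extended separately, hence the factors 3 and 9 for components
  and entries. Together with the factor 3 lost in the extension they give
  \<open>3 + 27 * lipschitz_const\<close>, free of \<open>r0\<close> because the Jacobian is
  weighted by it.\<close>

lemma vertex_field:
  fixes Z :: "real^3 \<Rightarrow> real^3"
  assumes Z: "\<forall>v\<in>vertices \<F>. norm (Z v) \<le> M" and M: "0 \<le> M"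
  obtains U J where "U \<in> W1_inf" "continuous_on UNIV U" "weak_jacobian U J" "\<And>v. v \<in> vertices \<F> \<Longrightarrow> U v = Z v"
    "closure {x. U x \<noteq> 0} \<subseteq> closure (tube r0 D)" "\<forall>T\<in>edge_triangles r0 \<theta>0 M0 \<F>. affine_map_on T U"
    "sup_norm U + ereal r0 * sup_norm J \<le> ereal ((3 + 27 * lipschitz_const) * M)"
proof -
  define W where "W = (\<lambda>j v. Z v $ j)"
  \<comment> \<open>All properties of a component are packed into one predicate, so that a single
    choice yields the three component functions.\<close>
  define Q where "Q = (\<lambda>j u. ae_differentiable u \<and>
    (\<forall>x y. \<bar>u x - u y\<bar> \<le> 3 * (lipschitz_const * M / r0) * dist x y) \<and>
    (\<forall>x. \<bar>u x\<bar> \<le> M) \<and> (\<forall>v\<in>vertices \<F>. u v = W j v) \<and> (\<forall>x. u x \<noteq> 0 \<longrightarrow> infdist x D < r0 / 8) \<and>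
    (\<forall>F a b n x. F \<in> \<F> \<and> closed_segment a b \<in> face_edges \<F> F \<and> outer_normal F a b n \<and>
       x \<in> convex hull {a, b, midpoint a b - tri_height r0 \<theta>0 M0 *\<^sub>R n} \<longrightarrow> u x = edge_interp (W j) a b x))"
  have "\<forall>j. \<exists>u. Q j u"
  proof
    fix j
    have Wj: "\<forall>v\<in>vertices \<F>. \<bar>W j v\<bar> \<le> M" using Z component_le_norm_cart order_trans unfolding W_def by blast
    show "\<exists>u. Q j u"
    proof (rule vertex_data_extension[OF Wj M])
      fix u :: "real^3 \<Rightarrow> real"
      assume "ae_differentiable u" "\<And>x y. \<bar>u x - u y\<bar> \<le> 3 * (lipschitz_const * M / r0) * dist x y"
        "\<And>x. \<bar>u x\<bar> \<le> M" "\<And>v. v \<in> vertices \<F> \<Longrightarrow> u v = W j v"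
        "\<And>x. u x \<noteq> 0 \<Longrightarrow> infdist x D < r0 / 8"
        "\<And>F a b n x. F \<in> \<F> \<Longrightarrow> closed_segment a b \<in> face_edges \<F> F \<Longrightarrow> outer_normal F a b n \<Longrightarrow>
           x \<in> convex hull {a, b, midpoint a b - tri_height r0 \<theta>0 M0 *\<^sub>R n} \<Longrightarrow> u x = edge_interp (W j) a b x"
      then have "Q j u" unfolding Q_def by (intro conjI allI ballI impI; (elim conjE)?; simp only:)
      then show "\<exists>u. Q j u" by (rule exI[of "Q j" u])
    qed
  qed
  from choice[OF this] obtain u where u0: "\<forall>j. Q j (u j)" by blast
  have u: "ae_differentiable (u j)" "\<bar>u j x - u j y\<bar> \<le> 3 * (lipschitz_const * M / r0) * dist x y"
      "\<bar>u j x\<bar> \<le> M" "v \<in> vertices \<F> \<Longrightarrow> u j v = W j v" "u j x \<noteq> 0 \<Longrightarrow> infdist x D < r0 / 8"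
      "F \<in> \<F> \<Longrightarrow> closed_segment a b \<in> face_edges \<F> F \<Longrightarrow> outer_normal F a b n \<Longrightarrow>
       x \<in> convex hull {a, b, midpoint a b - tri_height r0 \<theta>0 M0 *\<^sub>R n} \<Longrightarrow> u j x = edge_interp (W j) a b x"
    for j x y v F a b n
    using u0[unfolded Q_def, rule_format, of j] by (elim conjE; metis)+
  define U where "U = (\<lambda>x. \<chi> j. u j x)"
  have Uj: "(\<lambda>x. U x $ j) = u j" for j by (simp add: U_def)
  have W1: "U \<in> W1_inf \<and> (\<exists>J. weak_jacobian U J \<and>
      sup_norm U + ereal r0 * sup_norm J \<le> ereal (3 * M + \<bar>r0\<bar> * (9 * (3 * (lipschitz_const * M / r0)))))"
  proof (rule lipschitz_field_weak_jacobian)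
    show "ae_differentiable (\<lambda>x. U x $ j)" for j unfolding Uj by (rule u(1))
    show "\<bar>U x $ i - U y $ i\<bar> \<le> 3 * (lipschitz_const * M / r0) * dist x y" for i x y
      unfolding U_def by (simp only: vec_lambda_beta) (rule u(2))
    show "\<bar>U x $ i\<bar> \<le> M" for i x by (simp add: U_def u(3))
  qed
  then obtain J where J: "weak_jacobian U J"
    "sup_norm U + ereal r0 * sup_norm J \<le> ereal (3 * M + \<bar>r0\<bar> * (9 * (3 * (lipschitz_const * M / r0))))" by blast
  have eq: "3 * M + \<bar>r0\<bar> * (9 * (3 * (lipschitz_const * M / r0))) = (3 + 27 * lipschitz_const) * M"
    using r0 by (simp add: distrib_right)
  show thesis
  proof (rule that)
    show "U \<in> W1_inf" using W1 by blast
    show "weak_jacobian U J" by (rule J(1))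
    show "sup_norm U + ereal r0 * sup_norm J \<le> ereal ((3 + 27 * lipschitz_const) * M)" using J(2) unfolding eq .
    show "continuous_on UNIV U" unfolding U_def
      using u(1) by (intro continuous_on_vec_lambda) (simp add: ae_differentiable_def)
    show "U v = Z v" if "v \<in> vertices \<F>" for v using u(4)[OF that] by (simp add: U_def W_def vec_eq_iff)
    show "closure {x. U x \<noteq> 0} \<subseteq> closure (tube r0 D)"
    proof (rule closure_mono, rule subsetI)
      fix x assume "x \<in> {x. U x \<noteq> 0}"
      then obtain j where "u j x \<noteq> 0" by (auto simp: U_def vec_eq_iff)
      then have "infdist x D < r0 / 8" by (rule u(5))
      then show "x \<in> tube r0 D" using r0 by (simp add: tube_def)
    qed
    show "\<forall>T\<in>edge_triangles r0 \<theta>0 M0 \<F>. affine_map_on T U"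
    proof
      fix T assume "T \<in> edge_triangles r0 \<theta>0 M0 \<F>"
      then obtain a b n F where T: "T = convex hull {a, b, midpoint a b - tri_height r0 \<theta>0 M0 *\<^sub>R n}"
        and F: "F \<in> \<F>" "closed_segment a b \<in> face_edges \<F> F" "outer_normal F a b n"
        unfolding edge_triangles_def by blast
      have "\<forall>j. \<exists>A. linear A \<and> (\<forall>x. edge_interp (W j) a b x = A x + edge_interp (W j) a b 0)"
        using affine_edge_interp by blast
      from choice[OF this] obtain A where A: "\<And>j. linear (A j)" "\<And>j x. edge_interp (W j) a b x = A j x + edge_interp (W j) a b 0"
        by blast
      show "affine_map_on T U"
        unfolding affine_map_on_def
      proof (intro exI conjI ballI)
        show "linear (\<lambda>x. \<chi> j. A j x)"
          using A(1) by (intro linearI) (simp_all add: vec_eq_iff linear_add linear_scale)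
        show "U x = (\<chi> j. A j x) + (\<chi> j. edge_interp (W j) a b 0)" if "x \<in> T" for x
          using u(6)[OF F that[unfolded T]] A(2)[of _ x] by (simp add: U_def vec_eq_iff)
      qed
    qed
  qed
qed

end

section \<open>Choice of the constants and assembly of the field\<close>

theorem proposition6p2:
  fixes \<delta>0 C4 :: "real \<Rightarrow> real \<Rightarrow> real \<Rightarrow> real"
  assumes "\<And>M0 M1 \<theta>0. M0 \<ge> 1 \<Longrightarrow> M1 > 1 \<Longrightarrow> \<theta>0 \<in> {0<..<pi/2} \<Longrightarrow>
             0 < \<delta>0 M0 M1 \<theta>0 \<and> \<delta>0 M0 M1 \<theta>0 < 1 \<and> 1 < C4 M0 M1 \<theta>0"
  shows "\<forall>\<theta>0\<in>{0<..<pi/2}. \<forall>M1>1. \<exists>Ct>0. \<forall>M0\<ge>1. \<exists>C>0.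
    \<forall>r0>0. \<forall>\<Omega> D0 \<F>0 D1 \<F>1 dH N V0 V1.
      ambient_domain r0 M1 \<Omega> \<longrightarrow>
      (D0, \<F>0) \<in> polyhedral_class \<Omega> r0 M1 \<theta>0 M0 \<longrightarrow>
      (D1, \<F>1) \<in> polyhedral_class \<Omega> r0 M1 \<theta>0 M0 \<longrightarrow>
      dH = hausdorff_dist (frontier D0) (frontier D1) \<longrightarrow>
      dH \<le> \<delta>0 M0 M1 \<theta>0 * r0 \<longrightarrow>
      vertex_correspondence (C4 M0 M1 \<theta>0) dH \<F>0 \<F>1 N V0 V1 \<longrightarrow>
      dH \<le> C * r0 \<longrightarrow>
      (\<exists>U DU. U \<in> W1_inf \<and> continuous_on UNIV U \<and> weak_jacobian U DU \<and>
         (\<forall>i\<in>{1..N}. U (V0 i) = V1 i - V0 i) \<and>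
         closure {x. U x \<noteq> 0} \<subseteq> closure (tube r0 D0) \<and>
         (\<forall>T\<in>edge_triangles r0 \<theta>0 M0 \<F>0. affine_map_on T U) \<and>
         sup_norm U + ereal r0 * sup_norm DU \<le> ereal (Ct * dH))"
proof (intro ballI allI impI)
  fix \<theta>0 M1 :: real assume \<theta>0: "\<theta>0 \<in> {0<..<pi/2}" and M1: "1 < M1"
  \<comment> \<open>Chosen before \<open>M0\<close> is known. That it bounds \<open>1 + M0\<close>
    follows from \<open>M0_bound\<close> once a polyhedron of the class is given.\<close>
  define K where "K = 1 + M1"
  define c where "c = 27 / (sin \<theta>0)\<^sup>2"
  define \<Lambda> where "\<Lambda> = K * (6 * K + 4 / sin (\<theta>0 / 3))"
  have s: "0 < sin \<theta>0" "0 < sin (\<theta>0 / 3)" using \<theta>0 by (auto intro!: sin_gt_zero)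
  have K0: "0 < K" using M1 by (simp add: K_def)
  have c0: "0 < c" using s by (simp add: c_def)
  have \<Lambda>0: "0 < \<Lambda>" using K0 s by (simp add: \<Lambda>_def add_pos_pos)
  show "\<exists>Ct>0. \<forall>M0\<ge>1. \<exists>C>0.
    \<forall>r0>0. \<forall>\<Omega> D0 \<F>0 D1 \<F>1 dH N V0 V1.
      ambient_domain r0 M1 \<Omega> \<longrightarrow>
      (D0, \<F>0) \<in> polyhedral_class \<Omega> r0 M1 \<theta>0 M0 \<longrightarrow>
      (D1, \<F>1) \<in> polyhedral_class \<Omega> r0 M1 \<theta>0 M0 \<longrightarrow>
      dH = hausdorff_dist (frontier D0) (frontier D1) \<longrightarrow>
      dH \<le> \<delta>0 M0 M1 \<theta>0 * r0 \<longrightarrow>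
      vertex_correspondence (C4 M0 M1 \<theta>0) dH \<F>0 \<F>1 N V0 V1 \<longrightarrow>
      dH \<le> C * r0 \<longrightarrow>
      (\<exists>U DU. U \<in> W1_inf \<and> continuous_on UNIV U \<and> weak_jacobian U DU \<and>
         (\<forall>i\<in>{1..N}. U (V0 i) = V1 i - V0 i) \<and>
         closure {x. U x \<noteq> 0} \<subseteq> closure (tube r0 D0) \<and>
         (\<forall>T\<in>edge_triangles r0 \<theta>0 M0 \<F>0. affine_map_on T U) \<and>
         sup_norm U + ereal r0 * sup_norm DU \<le> ereal (Ct * dH))"
  proof (rule exI[of _ "(3 + 27 * \<Lambda>) * c"], intro conjI allI impI)
    show "0 < (3 + 27 * \<Lambda>) * c" using \<Lambda>0 c0 by simp
    fix M0 :: real assume M0: "1 \<le> M0"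
    have C4: "1 < C4 M0 M1 \<theta>0" using assms[OF M0 M1 \<theta>0] by blast
    have p: "0 < 192 * K ^ 4" using K0 by simp
    \<comment> \<open>Makes \<open>C4 * dH\<close>, and with it \<open>dH\<close> and every vertex
      displacement, at most \<open>r0 / (192 * K ^ 4)\<close>. Through \<open>C4\<close> this
      constant depends on \<open>M0\<close>, as is permitted for \<open>C\<close>.\<close>
    define C where "C = 1 / (192 * K ^ 4 * C4 M0 M1 \<theta>0)"
    have C: "0 < C" "192 * K ^ 4 * (C4 M0 M1 \<theta>0 * C) = 1" using p C4 by (simp_all add: C_def)
    show "\<exists>C>0. \<forall>r0>0. \<forall>\<Omega> D0 \<F>0 D1 \<F>1 dH N V0 V1.
      ambient_domain r0 M1 \<Omega> \<longrightarrow>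
      (D0, \<F>0) \<in> polyhedral_class \<Omega> r0 M1 \<theta>0 M0 \<longrightarrow>
      (D1, \<F>1) \<in> polyhedral_class \<Omega> r0 M1 \<theta>0 M0 \<longrightarrow>
      dH = hausdorff_dist (frontier D0) (frontier D1) \<longrightarrow>
      dH \<le> \<delta>0 M0 M1 \<theta>0 * r0 \<longrightarrow>
      vertex_correspondence (C4 M0 M1 \<theta>0) dH \<F>0 \<F>1 N V0 V1 \<longrightarrow>
      dH \<le> C * r0 \<longrightarrow>
      (\<exists>U DU. U \<in> W1_inf \<and> continuous_on UNIV U \<and> weak_jacobian U DU \<and>
         (\<forall>i\<in>{1..N}. U (V0 i) = V1 i - V0 i) \<and>
         closure {x. U x \<noteq> 0} \<subseteq> closure (tube r0 D0) \<and>
         (\<forall>T\<in>edge_triangles r0 \<theta>0 M0 \<F>0. affine_map_on T U) \<and>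
         sup_norm U + ereal r0 * sup_norm DU \<le> ereal ((3 + 27 * \<Lambda>) * c * dH))"
    proof (rule exI[of _ C], intro conjI allI impI)
      show "0 < C" by (rule C(1))
      fix r0 \<Omega> D0 \<F>0 D1 \<F>1 dH N V0 V1
      assume r0: "0 < r0" and dom: "ambient_domain r0 M1 \<Omega>"
        and D0: "(D0, \<F>0) \<in> polyhedral_class \<Omega> r0 M1 \<theta>0 M0"
        and D1: "(D1, \<F>1) \<in> polyhedral_class \<Omega> r0 M1 \<theta>0 M0"
        and dH: "dH = hausdorff_dist (frontier D0) (frontier D1)"
        and vc: "vertex_correspondence (C4 M0 M1 \<theta>0) dH \<F>0 \<F>1 N V0 V1"
        and small: "dH \<le> C * r0"
      \<comment> \<open>The bound on \<open>M0\<close> is a consequence of the class being nonempty,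
        so a provisional instance with \<open>K = 1 + M0\<close> provides it; the instances with the
        final \<open>K\<close> have it among their assumptions.\<close>
      interpret base: poly_setting \<Omega> D0 \<F>0 r0 M1 \<theta>0 M0 "1 + M0"
        by unfold_locales (use r0 M0 \<theta>0 dom D0 in auto)
      have MK: "1 + M0 \<le> K" using base.M0_bound M0 by (simp add: K_def)
      have bij0: "bij_betw V0 {1..N} (vertices \<F>0)" and bij1: "bij_betw V1 {1..N} (vertices \<F>1)"
        and V01: "\<And>i. i \<in> {1..N} \<Longrightarrow> dist (V0 i) (V1 i) \<le> C4 M0 M1 \<theta>0 * dH"
        using vc unfolding vertex_correspondence_def by blast+
      interpret P0: poly_setting_finite \<Omega> D0 \<F>0 r0 M1 \<theta>0 M0 K
        by unfold_locales (use r0 M0 MK \<theta>0 dom D0 bij_betw_finite[OF bij0] in auto)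
      interpret P1: poly_setting_finite \<Omega> D1 \<F>1 r0 M1 \<theta>0 M0 K
        by unfold_locales (use r0 M0 MK \<theta>0 dom D1 bij_betw_finite[OF bij1] in auto)
      note hd = hausdorff_dist_attained[OF P0.compact_frontier_D P0.frontier_D_nonempty P1.compact_frontier_D P1.frontier_D_nonempty,
          folded dH]
      have dH0: "0 \<le> dH" using P0.frontier_D_nonempty hd(1) zero_le_dist by (meson all_not_in_conv order_trans)
      have sm1: "192 * K ^ 4 * (C4 M0 M1 \<theta>0 * dH) \<le> r0"
      proof -
        have "192 * K ^ 4 * (C4 M0 M1 \<theta>0 * dH) \<le> 192 * K ^ 4 * (C4 M0 M1 \<theta>0 * (C * r0))"
          using small p C4 by (intro mult_left_mono) auto
        also have "\<dots> = (192 * K ^ 4 * (C4 M0 M1 \<theta>0 * C)) * r0" by simp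
        finally show ?thesis unfolding C(2) by simp
      qed
      have "1 * dH \<le> C4 M0 M1 \<theta>0 * dH" using C4 dH0 by (intro mult_right_mono) auto
      then have "192 * K ^ 4 * dH \<le> 192 * K ^ 4 * (C4 M0 M1 \<theta>0 * dH)" using p by (intro mult_left_mono) auto
      then have sm0: "192 * K ^ 4 * dH \<le> r0" using sm1 by simp
      \<comment> \<open>The correspondence only makes the displacement small. The bound with the
        constant \<open>c\<close> comes from the conical shape of the first boundary at
        \<open>V0 i\<close> and of the second at \<open>V1 i\<close>.\<close>
      have disp: "dist (V0 i) (V1 i) \<le> c * dH" if i: "i \<in> {1..N}" for i
        unfolding c_def
      proof (rule P0.vertex_displacement_bound[OF _ _ sm0 _ dH0])
        show "V0 i \<in> vertices \<F>0" using bij_betwE[OF bij0] i by blast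
        show "P0.near_cone (frontier D1) (V1 i) dH"
          unfolding P0.near_cone_def
        proof (intro conjI ballI impI)
          show "\<exists>y\<in>frontier D1. dist x y \<le> dH" if "x \<in> frontier D0" for x using hd(1)[OF that] .
          show "\<exists>x\<in>frontier D0. dist x y \<le> dH" if "y \<in> frontier D1" for y using hd(2)[OF that] .
          show "V1 i + (1 / 2) *\<^sub>R (y - V1 i) \<in> frontier D1"
            if "y \<in> frontier D1" "K * (K * dist y (V1 i)) < r0" for y
            using bij_betwE[OF bij1] i that by (intro P1.frontier_cone) auto
        qed
        have "192 * K ^ 4 * dist (V0 i) (V1 i) \<le> 192 * K ^ 4 * (C4 M0 M1 \<theta>0 * dH)"
          using V01[OF i] p by (intro mult_left_mono) auto
        then show "192 * K ^ 4 * dist (V0 i) (V1 i) \<le> r0" using sm1 by simp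
      qed
      \<comment> \<open>The displacement as a function of the vertex instead of its index; its
        values off the vertices do not matter.\<close>
      define Z where "Z = (\<lambda>v. V1 (inv_into {1..N} V0 v) - v)"
      have ZV: "Z (V0 i) = V1 i - V0 i" if "i \<in> {1..N}" for i
        using inv_into_f_f[OF bij_betw_imp_inj_on[OF bij0] that] by (simp add: Z_def)
      have ZM: "\<forall>v\<in>vertices \<F>0. norm (Z v) \<le> c * dH"
      proof
        fix v assume "v \<in> vertices \<F>0"
        then obtain i where i: "i \<in> {1..N}" "v = V0 i" using bij_betw_imp_surj_on[OF bij0] by blast
        then show "norm (Z v) \<le> c * dH" using disp[OF i(1)] ZV[OF i(1)] by (simp add: dist_norm norm_minus_commute)
      qed
      have cd0: "0 \<le> c * dH" using c0 dH0 by simp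
      have \<Lambda>: "P0.lipschitz_const = \<Lambda>" by (simp add: P0.lipschitz_const_def P0.planar_const_def \<Lambda>_def)
      obtain U J where UJ: "U \<in> W1_inf" "continuous_on UNIV U" "weak_jacobian U J"
        "\<And>v. v \<in> vertices \<F>0 \<Longrightarrow> U v = Z v"
        "closure {x. U x \<noteq> 0} \<subseteq> closure (tube r0 D0)" "\<forall>T\<in>edge_triangles r0 \<theta>0 M0 \<F>0. affine_map_on T U"
        "sup_norm U + ereal r0 * sup_norm J \<le> ereal ((3 + 27 * \<Lambda>) * (c * dH))"
        using P0.vertex_field[OF ZM cd0] unfolding \<Lambda> by blast
      have "\<forall>i\<in>{1..N}. U (V0 i) = V1 i - V0 i" using UJ(4) ZV bij_betwE[OF bij0] by simp
      moreover have "sup_norm U + ereal r0 * sup_norm J \<le> ereal ((3 + 27 * \<Lambda>) * c * dH)"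
        using UJ(7) by (simp only: mult.assoc)
      ultimately show "\<exists>U DU. U \<in> W1_inf \<and> continuous_on UNIV U \<and> weak_jacobian U DU \<and>
         (\<forall>i\<in>{1..N}. U (V0 i) = V1 i - V0 i) \<and>
         closure {x. U x \<noteq> 0} \<subseteq> closure (tube r0 D0) \<and>
         (\<forall>T\<in>edge_triangles r0 \<theta>0 M0 \<F>0. affine_map_on T U) \<and>
         sup_norm U + ereal r0 * sup_norm DU \<le> ereal ((3 + 27 * \<Lambda>) * c * dH)"
        using UJ by blast
    qed
  qed
qed

end
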